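(* Suppose $-h^*_{\mathcal K}(-\alpha)<\beta<h^*_{\mathcal K}(\alpha)$, and that problem (P) is convex and finite. Then (P) is KT-admissible with some coefficient $\lambda_0\ge0$. Moreover, (P) is solvable with an optimal solution $(\bar\xi,\bar u_1(\cdot))$ if and only if there exists a 7-tuple $(\lambda;\bar Y,g,\bar X,\bar Z,h,q)$ satisfying both the system $$\left\{\begin{aligned} &dg=-[A^\top g-Q_1\bar X-Q_2h]ds-[C^\top g-S_1\bar Z-S_2q]dW(s),\\ &d\bar Y=[-A^\top\bar Y+Q_2\bar X]ds+[-C^\top\bar Y+S_2\bar Z]dW(s),\\ &d\bar X=[A\bar X+B_1(R^1_{11})^{-1}B_1^\top g+B_2(R^2_{22})^{-1}B_2^\top\bar Y+C\bar Z]ds+\bar ZdW(s),\\ &dh=[Ah+B_2(R^2_{22})^{-1}B_2^\top g+Cq]ds+q\,dW(s),\\ &g(0)=H_1\bar X(0)+H_2h(0),\quad \bar Y(0)=H_2\bar X(0),\\ &\bar X(T)=\mathrm{Proj}_{\mathcal K}[G_1^{-1}(-g(T)+\lambda\alpha)],\quad h(T)=0, \end{aligned}\right.$$ and the KKT conditions $$\lambda\Big(\beta-\mathbb E\big\langle\alpha,\mathrm{Proj}_{\mathcal K}[G_1^{-1}(-g(T)+\lambda\alpha)]\big\rangle\Big)=0,\qquad \lambda\ge0,\qquad \beta\le\mathbb E\big\langle\alpha,\mathrm{Proj}_{\mathcal K}[G_1^{-1}(-g(T)+\lambda\alpha)]\big\rangle .$$ In this case $\lambda$ is a KT-coefficient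 of (P), and an optimal solution of (P) is given by $$(\bar\xi,\bar u_1(\cdot))=\Big(\mathrm{Proj}_{\mathcal K}[G_1^{-1}(-g(T)+\lambda\alpha)],\ (R^1_{11}(\cdot))^{-1}B_1^\top(\cdot)g(\cdot)\Big).$$
   Context: $(\Omega,\mathcal F,\mathbb F,\mathbb P)$ is a complete filtered probability space carrying a standard one-dimensional Brownian motion $W$; $\mathbb F=\{\mathcal F_t\}$ is the natural filtration of $W$ augmented by the null sets; $T>0$ is fixed. $L^2_{\mathcal F_T}(\Omega;\mathbb H)$ (resp. $L^\infty_{\mathcal F_T}$): square-integrable (resp. essentially bounded) $\mathcal F_T$-measurable $\mathbb H$-valued random variables. $L^2_{\mathbb F}(0,T;\mathbb H)$ (resp. $L^\infty_{\mathbb F}(0,T;\mathbb H)$): $\mathbb F$-progressively measurable processes with $\mathbb E\int_0^T|\phi|^2ds<\infty$ (resp. essentially bounded). $L^2_{\mathbb F}(\Omega;C([0,T];\mathbb H))$: $\mathbb F$-adapted continuous processes with $\mathbb E\sup_s|\phi(s)|^2<\infty$. $\mathbb S^n$: symmetric matrices. $\mathcal U_1[0,T]=L^2_{\mathbb F}(0,T;\mathbb R^{m_1})$. Assumptions on coefficients: $A,C\in L^\infty_{\mathbb F}(0,T;\mathbb R^{n\times n})$, $B_i\in L^\infty_{\mathbb F}(0,T;\mathbb R^{n\times m_i})$, $Q_i,S_i\in L^\infty_{\mathbb F}(0,T;\mathbb S^n)$, $H_i\in\mathbb S^n$ ($i=1,2$), $G_1\in L^\infty_{\mathcal F_T}(\Omega;\mathbb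 S^n)$, $R^1_{11}\in L^\infty_{\mathbb F}(0,T;\mathbb S^{m_1})$, $R^2_{22}\in L^\infty_{\mathbb F}(0,T;\mathbb S^{m_2})$; $R^1_{11},R^2_{22}$ are invertible with essentially bounded inverses; $G_1>0$. $\mathcal K\subset\mathbb R^n$ is nonempty, closed, convex; $\alpha\in\mathbb R^n$, $\beta\in\mathbb R$; $h^*_{\mathcal K}(p)=\sup_{x\in\mathcal K}\langle p,x\rangle$; $\mathcal U_{\mathcal K}=L^2_{\mathcal F_T}(\Omega;\mathcal K)$; $\mathcal U(\mathcal K,\alpha,\beta)=\{\xi\in\mathcal U_{\mathcal K}:\langle\alpha,\mathbb E\xi\rangle\ge\beta\}$. $\mathrm{Proj}_{\mathcal K}$ is the projection of $\mathbb R^n$ onto $\mathcal K$ under the norm $|x|^2_{G_1}=\langle G_1^{1/2}x,G_1^{1/2}x\rangle$. State equation: for $(\xi,u_1)\in L^2_{\mathcal F_T}(\Omega;\mathbb R^n)\times\mathcal U_1[0,T]$, $$\left\{\begin{aligned} &dY=[-A^\top Y+Q_2X]ds+[-C^\top Y+S_2Z]dW(s),\\ &dX=[AX+B_1u_1+B_2(R^2_{22})^{-1}B_2^\top Y+CZ]ds+ZdW(s),\\ &Y(0)=H_2X(0),\quad X(T)=\xi. \end{aligned}\right.$$ Standing assumption: this system has a unique solution $(Y,X,Z)\in L^2_{\mathbb F}(\Omega;C([0,T];\mathbb R^n))^2\times L^2_{\mathbb F}(0,T;\mathbb R^n)$ for every such $(\xi,u_1)$. Cost: $$J_1(\xi,u_1)=\tfrac12\mathbb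 E\Big\{\int_0^T[\langle Q_1X,X\rangle+\langle S_1Z,Z\rangle+\langle R^1_{11}u_1,u_1\rangle]ds+\langle G_1\xi,\xi\rangle+\langle H_1X(0),X(0)\rangle\Big\}.$$ Problem (P): minimize $J_1(\xi,u_1)$ over $\mathcal U(\mathcal K,\alpha,\beta)\times\mathcal U_1[0,T]$; its value is $\mu_p$ (the infimum). (P) is finite if $\mu_p>-\infty$; solvable if the infimum is attained; convex if $J_1$ is convex in $(\xi,u_1)$ on the admissible set. With $L(\lambda;\xi,u_1)=J_1(\xi,u_1)+\lambda(\beta-\mathbb E\langle\alpha,\xi\rangle)$ and $K(\lambda)=\inf_{(\xi,u_1)\in\mathcal U_{\mathcal K}\times\mathcal U_1[0,T]}L(\lambda;\xi,u_1)$, a KT-coefficient of (P) is any $\lambda_0\ge0$ with $-\infty<K(\lambda_0)=\mu_p$; (P) is KT-admissible if it has a KT-coefficient. Solutions $(\bar Y,g,\bar X,\bar Z,h,q)$: $\bar Y,g,\bar X,h\in L^2_{\mathbb F}(\Omega;C([0,T];\mathbb R^n))$, $\bar Z,q\in L^2_{\mathbb F}(0,T;\mathbb R^n)$; $\lambda\in\mathbb R$. *)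

theory Defs
  imports "HOL-Probability.Probability"
begin

section \<open>Stochastic processes\<close>

text \<open>Processes are functions \<open>real \<Rightarrow> 'a \<Rightarrow> 'b\<close> (time first). Random variables and processes
  are identified when they agree almost everywhere, so membership in a space such as
  \<open>L\<^sup>2(\<Omega>; V)\<close> requires values in \<open>V\<close> only almost everywhere.\<close>

definition aug_filtration :: "'a measure \<Rightarrow> (real \<Rightarrow> 'a \<Rightarrow> real) \<Rightarrow> real \<Rightarrow> 'a measure" where
  "aug_filtration M W t =
     sigma (space M)
       ((\<Union>s\<in>{0..t}. {W s -` B \<inter> space M | B. B \<in> sets borel}) \<union> null_sets M)"

definition brownian_motion ::
  "'a measure \<Rightarrow> (real \<Rightarrow> 'a measure) \<Rightarrow> (real \<Rightarrow> 'a \<Rightarrow> real) \<Rightarrow> bool" where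
  "brownian_motion M F W \<longleftrightarrow>
     (\<forall>t\<ge>0. W t \<in> borel_measurable M \<and> W t \<in> borel_measurable (F t)) \<and>
     (AE \<omega> in M. W 0 \<omega> = 0) \<and>
     (AE \<omega> in M. continuous_on {0..} (\<lambda>t. W t \<omega>)) \<and>
     (\<forall>s t. 0 \<le> s \<and> s < t \<longrightarrow>
        distributed M lborel (\<lambda>\<omega>. W t \<omega> - W s \<omega>) (normal_density 0 (sqrt (t - s))) \<and>
        prob_space.indep_set M (sets (F s))
          {(\<lambda>\<omega>. W t \<omega> - W s \<omega>) -` B \<inter> space M | B. B \<in> sets borel})"

definition progressive ::
  "(real \<Rightarrow> 'a measure) \<Rightarrow> real \<Rightarrow> (real \<Rightarrow> 'a \<Rightarrow> 'b::topological_space) \<Rightarrow> bool" where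
  "progressive F T \<phi> \<longleftrightarrow>
     (\<forall>t\<in>{0..T}. (\<lambda>(s, \<omega>). \<phi> s \<omega>) \<in> borel_measurable (restrict_space borel {0..t} \<Otimes>\<^sub>M F t))"

definition time_prob :: "'a measure \<Rightarrow> real \<Rightarrow> (real \<times> 'a) measure" where
  "time_prob M T = restrict_space lborel {0..T} \<Otimes>\<^sub>M M"

definition L2_rv ::
  "'a measure \<Rightarrow> 'a measure \<Rightarrow> 'b::euclidean_space set \<Rightarrow> ('a \<Rightarrow> 'b) set" where
  "L2_rv M G V = {\<xi>. \<xi> \<in> borel_measurable G \<and> (AE \<omega> in M. \<xi> \<omega> \<in> V) \<and>
     (\<integral>\<^sup>+\<omega>. ennreal ((norm (\<xi> \<omega>))\<^sup>2) \<partial>M) < \<infinity>}"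

definition Linf_rv ::
  "'a measure \<Rightarrow> 'a measure \<Rightarrow> 'b::euclidean_space set \<Rightarrow> ('a \<Rightarrow> 'b) set" where
  "Linf_rv M G V = {\<xi>. \<xi> \<in> borel_measurable G \<and> (AE \<omega> in M. \<xi> \<omega> \<in> V) \<and>
     (\<exists>c. AE \<omega> in M. norm (\<xi> \<omega>) \<le> c)}"

definition L2_proc ::
  "'a measure \<Rightarrow> (real \<Rightarrow> 'a measure) \<Rightarrow> real \<Rightarrow> (real \<Rightarrow> 'a \<Rightarrow> 'b::euclidean_space) set" where
  "L2_proc M F T = {\<phi>. progressive F T \<phi> \<and>
     (\<integral>\<^sup>+\<omega>. (\<integral>\<^sup>+s\<in>{0..T}. ennreal ((norm (\<phi> s \<omega>))\<^sup>2) \<partial>lborel) \<partial>M) < \<infinity>}"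

definition Linf_proc ::
  "'a measure \<Rightarrow> (real \<Rightarrow> 'a measure) \<Rightarrow> real \<Rightarrow> 'b::euclidean_space set \<Rightarrow>
    (real \<Rightarrow> 'a \<Rightarrow> 'b) set" where
  "Linf_proc M F T V = {\<phi>. progressive F T \<phi> \<and>
     (AE (s, \<omega>) in time_prob M T. \<phi> s \<omega> \<in> V) \<and>
     (\<exists>c. AE (s, \<omega>) in time_prob M T. norm (\<phi> s \<omega>) \<le> c)}"

definition L2_cont ::
  "'a measure \<Rightarrow> (real \<Rightarrow> 'a measure) \<Rightarrow> real \<Rightarrow> (real \<Rightarrow> 'a \<Rightarrow> 'b::euclidean_space) set" where
  "L2_cont M F T = {X.
     (\<forall>t\<in>{0..T}. X t \<in> borel_measurable (F t)) \<and>
     (\<forall>\<omega>\<in>space M. continuous_on {0..T} (\<lambda>t. X t \<omega>)) \<and>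
     (\<integral>\<^sup>+\<omega>. (SUP t\<in>{0..T}. ennreal ((norm (X t \<omega>))\<^sup>2)) \<partial>M) < \<infinity>}"


section \<open>The Ito integral\<close>

text \<open>A simple integrand on \<open>[0,t]\<close> is the step process taking the bounded
  \<open>F (\<tau> i)\<close>-measurable value \<open>\<xi> i\<close> on \<open>(\<tau> i, \<tau> (i+1)]\<close> for \<open>i < n\<close>.\<close>

definition simple_integrand ::
  "'a measure \<Rightarrow> (real \<Rightarrow> 'a measure) \<Rightarrow> real \<Rightarrow> nat \<Rightarrow> (nat \<Rightarrow> real) \<Rightarrow>
    (nat \<Rightarrow> 'a \<Rightarrow> 'b::euclidean_space) \<Rightarrow> bool" where
  "simple_integrand M F t n \<tau> \<xi> \<longleftrightarrow>
     (\<forall>i<n. 0 \<le> \<tau> i \<and> \<tau> i \<le> \<tau> (Suc i) \<and> \<tau> (Suc i) \<le> t \<and>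
        \<xi> i \<in> borel_measurable (F (\<tau> i)) \<and> (\<exists>c. \<forall>\<omega>\<in>space M. norm (\<xi> i \<omega>) \<le> c))"

definition simple_process ::
  "nat \<Rightarrow> (nat \<Rightarrow> real) \<Rightarrow> (nat \<Rightarrow> 'a \<Rightarrow> 'b::euclidean_space) \<Rightarrow> real \<Rightarrow> 'a \<Rightarrow> 'b" where
  "simple_process n \<tau> \<xi> s \<omega> = (\<Sum>i<n. indicator {\<tau> i<..\<tau> (Suc i)} s *\<^sub>R \<xi> i \<omega>)"

definition simple_ito ::
  "(real \<Rightarrow> 'a \<Rightarrow> real) \<Rightarrow> nat \<Rightarrow> (nat \<Rightarrow> real) \<Rightarrow> (nat \<Rightarrow> 'a \<Rightarrow> 'b::euclidean_space) \<Rightarrow> 'a \<Rightarrow> 'b" where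
  "simple_ito W n \<tau> \<xi> \<omega> = (\<Sum>i<n. (W (\<tau> (Suc i)) \<omega> - W (\<tau> i) \<omega>) *\<^sub>R \<xi> i \<omega>)"

text \<open>\<open>has_ito_integral M F W \<phi> t J\<close>: the random variable \<open>J\<close> is (a version of)
  \<open>\<integral>\<^sub>0\<^sup>t \<phi> dW\<close>, the \<open>L\<^sup>2\<close>-limit of integrals of simple integrands converging to \<open>\<phi>\<close>
  in \<open>L\<^sup>2([0,t] \<times> \<Omega>)\<close>.\<close>

definition has_ito_integral ::
  "'a measure \<Rightarrow> (real \<Rightarrow> 'a measure) \<Rightarrow> (real \<Rightarrow> 'a \<Rightarrow> real) \<Rightarrow>
    (real \<Rightarrow> 'a \<Rightarrow> 'b::euclidean_space) \<Rightarrow> real \<Rightarrow> ('a \<Rightarrow> 'b) \<Rightarrow> bool" where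
  "has_ito_integral M F W \<phi> t J \<longleftrightarrow>
     \<phi> \<in> L2_proc M F t \<and> J \<in> borel_measurable M \<and>
     (\<exists>n \<tau> \<xi>. (\<forall>k. simple_integrand M F t (n k) (\<tau> k) (\<xi> k)) \<and>
        (\<lambda>k. \<integral>\<^sup>+\<omega>. (\<integral>\<^sup>+s\<in>{0..t}.
            ennreal ((norm (simple_process (n k) (\<tau> k) (\<xi> k) s \<omega> - \<phi> s \<omega>))\<^sup>2) \<partial>lborel) \<partial>M)
          \<longlonglongrightarrow> 0 \<and>
        (\<lambda>k. \<integral>\<^sup>+\<omega>. ennreal ((norm (simple_ito W (n k) (\<tau> k) (\<xi> k) \<omega> - J \<omega>))\<^sup>2) \<partial>M)
          \<longlonglongrightarrow> 0)"

text \<open>\<open>dX = b ds + \<sigma> dW\<close> on \<open>[0,T]\<close>:\<close>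

definition ito_process ::
  "'a measure \<Rightarrow> (real \<Rightarrow> 'a measure) \<Rightarrow> (real \<Rightarrow> 'a \<Rightarrow> real) \<Rightarrow> real \<Rightarrow>
    (real \<Rightarrow> 'a \<Rightarrow> 'b::euclidean_space) \<Rightarrow> (real \<Rightarrow> 'a \<Rightarrow> 'b) \<Rightarrow> (real \<Rightarrow> 'a \<Rightarrow> 'b) \<Rightarrow> bool" where
  "ito_process M F W T X b \<sigma> \<longleftrightarrow>
     (AE \<omega> in M. set_integrable lborel {0..T} (\<lambda>s. b s \<omega>)) \<and>
     (\<forall>t\<in>{0..T}. has_ito_integral M F W \<sigma> t
        (\<lambda>\<omega>. X t \<omega> - X 0 \<omega> - (LINT s:{0..t}|lborel. b s \<omega>)))"


section \<open>Matrices, support functions and weighted projections\<close>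

definition sym_mats :: "(real^'k^'k) set" where
  "sym_mats = {H. transpose H = H}"

text \<open>The square root of a symmetric positive (semi)definite matrix; it exists and is unique.\<close>

definition mat_sqrt :: "real^'k^'k \<Rightarrow> real^'k^'k" where
  "mat_sqrt G = (SOME R. transpose R = R \<and> (\<forall>x. 0 \<le> (R *v x) \<bullet> x) \<and> R ** R = G)"

definition weighted_norm :: "real^'k^'k \<Rightarrow> real^'k \<Rightarrow> real" where
  "weighted_norm G x = sqrt ((mat_sqrt G *v x) \<bullet> (mat_sqrt G *v x))"

definition weighted_proj :: "real^'k^'k \<Rightarrow> (real^'k) set \<Rightarrow> real^'k \<Rightarrow> real^'k" where
  "weighted_proj G K x = arg_min_on (\<lambda>y. weighted_norm G (x - y)) K"

definition support_fun :: "(real^'k) set \<Rightarrow> real^'k \<Rightarrow> ereal" where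
  "support_fun K p = (SUP x\<in>K. ereal (p \<bullet> x))"


section \<open>The constrained linear-quadratic problem\<close>

text \<open>\<open>pM\<close>, \<open>pW\<close>, \<open>pT\<close> are the probability space, the Brownian motion and the horizon;
  the remaining fields are the data named after the prefix \<open>c\<close>. Indices of \<open>R\<close> are shortened:
  \<open>cR11\<close> is \<open>R\<^sup>1\<close> with index 11, \<open>cR22\<close> is \<open>R\<^sup>2\<close> with index 22.\<close>

record ('a, 'n::finite, 'm1::finite, 'm2::finite) lq_problem =
  pM :: "'a measure"
  pW :: "real \<Rightarrow> 'a \<Rightarrow> real"
  pT :: real
  cA :: "real \<Rightarrow> 'a \<Rightarrow> real^'n^'n"
  cC :: "real \<Rightarrow> 'a \<Rightarrow> real^'n^'n"
  cB1 :: "real \<Rightarrow> 'a \<Rightarrow> real^'m1^'n"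
  cB2 :: "real \<Rightarrow> 'a \<Rightarrow> real^'m2^'n"
  cQ1 :: "real \<Rightarrow> 'a \<Rightarrow> real^'n^'n"
  cQ2 :: "real \<Rightarrow> 'a \<Rightarrow> real^'n^'n"
  cS1 :: "real \<Rightarrow> 'a \<Rightarrow> real^'n^'n"
  cS2 :: "real \<Rightarrow> 'a \<Rightarrow> real^'n^'n"
  cR11 :: "real \<Rightarrow> 'a \<Rightarrow> real^'m1^'m1"
  cR22 :: "real \<Rightarrow> 'a \<Rightarrow> real^'m2^'m2"
  cH1 :: "real^'n^'n"
  cH2 :: "real^'n^'n"
  cG1 :: "'a \<Rightarrow> real^'n^'n"
  cK :: "(real^'n) set"
  calpha :: "real^'n"
  cbeta :: real

definition pF :: "('a, 'n::finite, 'm1::finite, 'm2::finite) lq_problem \<Rightarrow> real \<Rightarrow> 'a measure" where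
  "pF p = aug_filtration (pM p) (pW p)"

definition terminal_space ::
  "('a, 'n::finite, 'm1::finite, 'm2::finite) lq_problem \<Rightarrow> (real^'n) set \<Rightarrow> ('a \<Rightarrow> real^'n) set" where
  "terminal_space p V = L2_rv (pM p) (pF p (pT p)) V"

definition control_space ::
  "('a, 'n::finite, 'm1::finite, 'm2::finite) lq_problem \<Rightarrow> (real \<Rightarrow> 'a \<Rightarrow> real^'m1) set" where
  "control_space p = L2_proc (pM p) (pF p) (pT p)"

definition cont_space ::
  "('a, 'n::finite, 'm1::finite, 'm2::finite) lq_problem \<Rightarrow> (real \<Rightarrow> 'a \<Rightarrow> real^'n) set" where
  "cont_space p = L2_cont (pM p) (pF p) (pT p)"

definition sde ::
  "('a, 'n::finite, 'm1::finite, 'm2::finite) lq_problem \<Rightarrow> (real \<Rightarrow> 'a \<Rightarrow> real^'n) \<Rightarrow>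
    (real \<Rightarrow> 'a \<Rightarrow> real^'n) \<Rightarrow> (real \<Rightarrow> 'a \<Rightarrow> real^'n) \<Rightarrow> bool" where
  "sde p X b \<sigma> \<longleftrightarrow> ito_process (pM p) (pF p) (pW p) (pT p) X b \<sigma>"

definition feedback_matrix ::
  "('a, 'n::finite, 'm1::finite, 'm2::finite) lq_problem \<Rightarrow> real \<Rightarrow> 'a \<Rightarrow> real^'n^'n" where
  "feedback_matrix p s \<omega> = cB2 p s \<omega> ** matrix_inv (cR22 p s \<omega>) ** transpose (cB2 p s \<omega>)"

definition state_solution ::
  "('a, 'n::finite, 'm1::finite, 'm2::finite) lq_problem \<Rightarrow> ('a \<Rightarrow> real^'n) \<Rightarrow>
    (real \<Rightarrow> 'a \<Rightarrow> real^'m1) \<Rightarrow> (real \<Rightarrow> 'a \<Rightarrow> real^'n) \<Rightarrow> (real \<Rightarrow> 'a \<Rightarrow> real^'n) \<Rightarrow>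
    (real \<Rightarrow> 'a \<Rightarrow> real^'n) \<Rightarrow> bool" where
  "state_solution p \<xi> u Y X Z \<longleftrightarrow>
     Y \<in> cont_space p \<and> X \<in> cont_space p \<and> Z \<in> L2_proc (pM p) (pF p) (pT p) \<and>
     sde p Y
       (\<lambda>s \<omega>. - (transpose (cA p s \<omega>) *v Y s \<omega>) + cQ2 p s \<omega> *v X s \<omega>)
       (\<lambda>s \<omega>. - (transpose (cC p s \<omega>) *v Y s \<omega>) + cS2 p s \<omega> *v Z s \<omega>) \<and>
     sde p X
       (\<lambda>s \<omega>. cA p s \<omega> *v X s \<omega> + cB1 p s \<omega> *v u s \<omega> + feedback_matrix p s \<omega> *v Y s \<omega>
          + cC p s \<omega> *v Z s \<omega>)
       Z \<and>
     (AE \<omega> in pM p. Y 0 \<omega> = cH2 p *v X 0 \<omega>) \<and>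
     (AE \<omega> in pM p. X (pT p) \<omega> = \<xi> \<omega>)"

definition state_well_posed :: "('a, 'n::finite, 'm1::finite, 'm2::finite) lq_problem \<Rightarrow> bool" where
  "state_well_posed p \<longleftrightarrow>
     (\<forall>\<xi>\<in>terminal_space p UNIV. \<forall>u\<in>control_space p.
        \<exists>Y X Z. state_solution p \<xi> u Y X Z \<and>
          (\<forall>Y' X' Z'. state_solution p \<xi> u Y' X' Z' \<longrightarrow>
             (AE \<omega> in pM p. \<forall>t\<in>{0..pT p}. Y' t \<omega> = Y t \<omega> \<and> X' t \<omega> = X t \<omega>) \<and>
             (AE (s, \<omega>) in time_prob (pM p) (pT p). Z' s \<omega> = Z s \<omega>)))"

definition standing_assumptions :: "('a, 'n::finite, 'm1::finite, 'm2::finite) lq_problem \<Rightarrow> bool" where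
  "standing_assumptions p \<longleftrightarrow>
     prob_space (pM p) \<and> complete_measure (pM p) \<and>
     brownian_motion (pM p) (pF p) (pW p) \<and> 0 < pT p \<and>
     cA p \<in> Linf_proc (pM p) (pF p) (pT p) UNIV \<and>
     cC p \<in> Linf_proc (pM p) (pF p) (pT p) UNIV \<and>
     cB1 p \<in> Linf_proc (pM p) (pF p) (pT p) UNIV \<and>
     cB2 p \<in> Linf_proc (pM p) (pF p) (pT p) UNIV \<and>
     cQ1 p \<in> Linf_proc (pM p) (pF p) (pT p) sym_mats \<and>
     cQ2 p \<in> Linf_proc (pM p) (pF p) (pT p) sym_mats \<and>
     cS1 p \<in> Linf_proc (pM p) (pF p) (pT p) sym_mats \<and>
     cS2 p \<in> Linf_proc (pM p) (pF p) (pT p) sym_mats \<and>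
     cR11 p \<in> Linf_proc (pM p) (pF p) (pT p) sym_mats \<and>
     cR22 p \<in> Linf_proc (pM p) (pF p) (pT p) sym_mats \<and>
     (AE (s, \<omega>) in time_prob (pM p) (pT p). invertible (cR11 p s \<omega>)) \<and>
     (AE (s, \<omega>) in time_prob (pM p) (pT p). invertible (cR22 p s \<omega>)) \<and>
     (\<exists>c. AE (s, \<omega>) in time_prob (pM p) (pT p). norm (matrix_inv (cR11 p s \<omega>)) \<le> c) \<and>
     (\<exists>c. AE (s, \<omega>) in time_prob (pM p) (pT p). norm (matrix_inv (cR22 p s \<omega>)) \<le> c) \<and>
     cH1 p \<in> sym_mats \<and> cH2 p \<in> sym_mats \<and>
     cG1 p \<in> Linf_rv (pM p) (pF p (pT p)) sym_mats \<and>
     (AE \<omega> in pM p. \<forall>x. x \<noteq> 0 \<longrightarrow> 0 < (cG1 p \<omega> *v x) \<bullet> x) \<and>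
     cK p \<noteq> {} \<and> closed (cK p) \<and> convex (cK p) \<and>
     state_well_posed p"

text \<open>Under \<open>state_well_posed\<close> the cost does not depend on which version of the solution
  of the state equation is chosen.\<close>

definition cost ::
  "('a, 'n::finite, 'm1::finite, 'm2::finite) lq_problem \<Rightarrow> ('a \<Rightarrow> real^'n) \<Rightarrow>
    (real \<Rightarrow> 'a \<Rightarrow> real^'m1) \<Rightarrow> real" where
  "cost p \<xi> u =
     (let (Y, X, Z) = (SOME (Y, X, Z). state_solution p \<xi> u Y X Z) in
      1/2 * (\<integral>\<omega>.
        (LINT s:{0..pT p}|lborel.
           (cQ1 p s \<omega> *v X s \<omega>) \<bullet> X s \<omega> + (cS1 p s \<omega> *v Z s \<omega>) \<bullet> Z s \<omega>
           + (cR11 p s \<omega> *v u s \<omega>) \<bullet> u s \<omega>)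
        + (cG1 p \<omega> *v \<xi> \<omega>) \<bullet> \<xi> \<omega> + (cH1 p *v X 0 \<omega>) \<bullet> X 0 \<omega> \<partial>pM p))"

definition admissible_terminal ::
  "('a, 'n::finite, 'm1::finite, 'm2::finite) lq_problem \<Rightarrow> ('a \<Rightarrow> real^'n) set" where
  "admissible_terminal p =
     {\<xi> \<in> terminal_space p (cK p). cbeta p \<le> calpha p \<bullet> (\<integral>\<omega>. \<xi> \<omega> \<partial>pM p)}"

definition optimal_value :: "('a, 'n::finite, 'm1::finite, 'm2::finite) lq_problem \<Rightarrow> ereal" where
  "optimal_value p = (INF (\<xi>, u) \<in> admissible_terminal p \<times> control_space p. ereal (cost p \<xi> u))"

definition problem_finite :: "('a, 'n::finite, 'm1::finite, 'm2::finite) lq_problem \<Rightarrow> bool" where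
  "problem_finite p \<longleftrightarrow> - \<infinity> < optimal_value p"

definition optimal_pair ::
  "('a, 'n::finite, 'm1::finite, 'm2::finite) lq_problem \<Rightarrow> ('a \<Rightarrow> real^'n) \<Rightarrow>
    (real \<Rightarrow> 'a \<Rightarrow> real^'m1) \<Rightarrow> bool" where
  "optimal_pair p \<xi> u \<longleftrightarrow>
     \<xi> \<in> admissible_terminal p \<and> u \<in> control_space p \<and> ereal (cost p \<xi> u) = optimal_value p"

definition problem_solvable :: "('a, 'n::finite, 'm1::finite, 'm2::finite) lq_problem \<Rightarrow> bool" where
  "problem_solvable p \<longleftrightarrow> (\<exists>\<xi> u. optimal_pair p \<xi> u)"

text \<open>Convexity is spelled out because the function space carrying \<open>(\<xi>, u)\<close> is not an instance
  of \<^class>\<open>real_vector\<close>, as required by \<^const>\<open>convex_on\<close>.\<close>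

definition problem_convex :: "('a, 'n::finite, 'm1::finite, 'm2::finite) lq_problem \<Rightarrow> bool" where
  "problem_convex p \<longleftrightarrow>
     (\<forall>\<xi>\<in>admissible_terminal p. \<forall>u\<in>control_space p.
      \<forall>\<xi>'\<in>admissible_terminal p. \<forall>u'\<in>control_space p. \<forall>\<theta>\<in>{0..1}.
        cost p (\<lambda>\<omega>. \<theta> *\<^sub>R \<xi> \<omega> + (1 - \<theta>) *\<^sub>R \<xi>' \<omega>) (\<lambda>s \<omega>. \<theta> *\<^sub>R u s \<omega> + (1 - \<theta>) *\<^sub>R u' s \<omega>)
          \<le> \<theta> * cost p \<xi> u + (1 - \<theta>) * cost p \<xi>' u')"

definition lagrangian ::
  "('a, 'n::finite, 'm1::finite, 'm2::finite) lq_problem \<Rightarrow> real \<Rightarrow> ('a \<Rightarrow> real^'n) \<Rightarrow>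
    (real \<Rightarrow> 'a \<Rightarrow> real^'m1) \<Rightarrow> real" where
  "lagrangian p l \<xi> u = cost p \<xi> u + l * (cbeta p - (\<integral>\<omega>. calpha p \<bullet> \<xi> \<omega> \<partial>pM p))"

definition dual_function ::
  "('a, 'n::finite, 'm1::finite, 'm2::finite) lq_problem \<Rightarrow> real \<Rightarrow> ereal" where
  "dual_function p l =
     (INF (\<xi>, u) \<in> terminal_space p (cK p) \<times> control_space p. ereal (lagrangian p l \<xi> u))"

definition kt_coefficient ::
  "('a, 'n::finite, 'm1::finite, 'm2::finite) lq_problem \<Rightarrow> real \<Rightarrow> bool" where
  "kt_coefficient p l \<longleftrightarrow>
     0 \<le> l \<and> - \<infinity> < dual_function p l \<and> dual_function p l = optimal_value p"

definition kt_admissible :: "('a, 'n::finite, 'm1::finite, 'm2::finite) lq_problem \<Rightarrow> bool" where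
  "kt_admissible p \<longleftrightarrow> (\<exists>l. kt_coefficient p l)"


section \<open>Optimality system\<close>

definition candidate_terminal ::
  "('a, 'n::finite, 'm1::finite, 'm2::finite) lq_problem \<Rightarrow> real \<Rightarrow> (real \<Rightarrow> 'a \<Rightarrow> real^'n) \<Rightarrow>
    'a \<Rightarrow> real^'n" where
  "candidate_terminal p l g \<omega> =
     weighted_proj (cG1 p \<omega>) (cK p)
       (matrix_inv (cG1 p \<omega>) *v (- g (pT p) \<omega> + l *\<^sub>R calpha p))"

definition candidate_control ::
  "('a, 'n::finite, 'm1::finite, 'm2::finite) lq_problem \<Rightarrow> (real \<Rightarrow> 'a \<Rightarrow> real^'n) \<Rightarrow>
    real \<Rightarrow> 'a \<Rightarrow> real^'m1" where
  "candidate_control p g s \<omega> =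
     matrix_inv (cR11 p s \<omega>) *v (transpose (cB1 p s \<omega>) *v g s \<omega>)"

definition optimality_system ::
  "('a, 'n::finite, 'm1::finite, 'm2::finite) lq_problem \<Rightarrow> real \<Rightarrow> (real \<Rightarrow> 'a \<Rightarrow> real^'n) \<Rightarrow>
    (real \<Rightarrow> 'a \<Rightarrow> real^'n) \<Rightarrow> (real \<Rightarrow> 'a \<Rightarrow> real^'n) \<Rightarrow> (real \<Rightarrow> 'a \<Rightarrow> real^'n) \<Rightarrow>
    (real \<Rightarrow> 'a \<Rightarrow> real^'n) \<Rightarrow> (real \<Rightarrow> 'a \<Rightarrow> real^'n) \<Rightarrow> bool" where
  "optimality_system p l Y g X Z h q \<longleftrightarrow>
     Y \<in> cont_space p \<and> g \<in> cont_space p \<and> X \<in> cont_space p \<and> h \<in> cont_space p \<and>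
     Z \<in> L2_proc (pM p) (pF p) (pT p) \<and> q \<in> L2_proc (pM p) (pF p) (pT p) \<and>
     sde p g
       (\<lambda>s \<omega>. - (transpose (cA p s \<omega>) *v g s \<omega> - cQ1 p s \<omega> *v X s \<omega> - cQ2 p s \<omega> *v h s \<omega>))
       (\<lambda>s \<omega>. - (transpose (cC p s \<omega>) *v g s \<omega> - cS1 p s \<omega> *v Z s \<omega> - cS2 p s \<omega> *v q s \<omega>)) \<and>
     sde p Y
       (\<lambda>s \<omega>. - (transpose (cA p s \<omega>) *v Y s \<omega>) + cQ2 p s \<omega> *v X s \<omega>)
       (\<lambda>s \<omega>. - (transpose (cC p s \<omega>) *v Y s \<omega>) + cS2 p s \<omega> *v Z s \<omega>) \<and>
     sde p X
       (\<lambda>s \<omega>. cA p s \<omega> *v X s \<omega>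
          + (cB1 p s \<omega> ** matrix_inv (cR11 p s \<omega>) ** transpose (cB1 p s \<omega>)) *v g s \<omega>
          + feedback_matrix p s \<omega> *v Y s \<omega> + cC p s \<omega> *v Z s \<omega>)
       Z \<and>
     sde p h
       (\<lambda>s \<omega>. cA p s \<omega> *v h s \<omega> + feedback_matrix p s \<omega> *v g s \<omega> + cC p s \<omega> *v q s \<omega>)
       q \<and>
     (AE \<omega> in pM p. g 0 \<omega> = cH1 p *v X 0 \<omega> + cH2 p *v h 0 \<omega>) \<and>
     (AE \<omega> in pM p. Y 0 \<omega> = cH2 p *v X 0 \<omega>) \<and>
     (AE \<omega> in pM p. X (pT p) \<omega> = candidate_terminal p l g \<omega>) \<and>
     (AE \<omega> in pM p. h (pT p) \<omega> = 0)"

definition kkt_conditions ::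
  "('a, 'n::finite, 'm1::finite, 'm2::finite) lq_problem \<Rightarrow> real \<Rightarrow> (real \<Rightarrow> 'a \<Rightarrow> real^'n) \<Rightarrow> bool" where
  "kkt_conditions p l g \<longleftrightarrow>
     l * (cbeta p - (\<integral>\<omega>. calpha p \<bullet> candidate_terminal p l g \<omega> \<partial>pM p)) = 0 \<and>
     0 \<le> l \<and>
     cbeta p \<le> (\<integral>\<omega>. calpha p \<bullet> candidate_terminal p l g \<omega> \<partial>pM p)"

end

theory Submission
  imports Defs
begin

text \<open>The state equation is linear and the cost quadratic, so along a segment the cost is a
  polynomial of degree two. Its linear part is computed from an adjoint system \<open>(g, h, q)\<close> by taking
  the expectation of Ito's product rule for \<open>\<langle>g, X\<rangle>\<close> and \<open>\<langle>h, Y\<rangle>\<close>; its quadratic part is the cost of the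
  difference of the end points, which convexity forces to be nonnegative, even off the admissible set
  because a Slater point exists. The same Slater point bounds the slopes that define the multiplier.
  Stationarity of the Lagrangian in \<open>u\<close> gives the formula for the control, and its variational
  inequality in \<open>\<xi>\<close>, read pointwise, characterises the weighted projection. Conversely, the optimality
  system together with the complementary slackness makes the candidate a minimiser of the Lagrangian.

  Solvability of the adjoint system is reduced to the well-posedness of the state equation. Only
  square integrability, not boundedness, of the integrands is available, hence the expected product
  rule is proved from orthogonality of Ito integrals to the past and Fubini's theorem.\<close>

section \<open>Square integrable functions\<close>

text \<open>The Ito integral is given as an L2 limit at each time separately, whereas the spaces of
  the problem demand adapted processes all of whose paths are continuous. The forward equation
  behind the adjoint system must be solved in such a space, so continuous versions are constructed:
  Doob's inequality turns L2 errors of integrands into errors uniform in time, and the same estimate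
  drives a Picard iteration. Conditional expectations do not occur; the martingale property is used
  only in the weak form that E<eta, I t - I r> = 0 for square integrable eta known at time r, which
  serves Doob's inequality and the product rule alike. Neither the optimal value nor the dual value
  is assumed to be attained, and among the weight matrices only G1 has a sign. Nonnegativity of the
  second variation is therefore drawn from the convexity of the problem alone, and the invertibility
  of R11 is what turns a stationarity equation into an explicit control.\<close>

definition sq_int :: "'a measure \<Rightarrow> ('a \<Rightarrow> 'b::euclidean_space) \<Rightarrow> bool" where
  "sq_int N f \<longleftrightarrow> f \<in> borel_measurable N \<and> integrable N (\<lambda>x. (norm (f x))\<^sup>2)"

lemma norm_add_sq_le: "(norm (x + y))\<^sup>2 \<le> 2 * (norm x)\<^sup>2 + 2 * (norm y)\<^sup>2"
  for x y :: "'b::real_normed_vector"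
proof -
  have "(norm (x + y))\<^sup>2 \<le> (norm x + norm y)\<^sup>2"
    by (intro power_mono norm_triangle_ineq) auto
  also have "\<dots> \<le> 2 * (norm x)\<^sup>2 + 2 * (norm y)\<^sup>2"
    using sum_squares_bound[of "norm x" "norm y"] by (simp add: power2_sum)
  finally show ?thesis .
qed

lemma norm_diff_sq_le: "(norm (x - y))\<^sup>2 \<le> 2 * (norm x)\<^sup>2 + 2 * (norm y)\<^sup>2"
  for x y :: "'b::real_normed_vector"
  using norm_add_sq_le[of x "-y"] by simp

lemma sq_int_measurable[measurable_dest]: "sq_int N f \<Longrightarrow> f \<in> borel_measurable N"
  and sq_int_integrable: "sq_int N f \<Longrightarrow> integrable N (\<lambda>x. (norm (f x))\<^sup>2)"
  by (auto simp: sq_int_def)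

lemma sq_int_iff_nn_integral:
  assumes "f \<in> borel_measurable N"
  shows "sq_int N f \<longleftrightarrow> (\<integral>\<^sup>+x. ennreal ((norm (f x))\<^sup>2) \<partial>N) < \<infinity>"
  using assms by (auto simp: sq_int_def integrable_iff_bounded)

lemma nn_integral_sq_int:
  "sq_int N f \<Longrightarrow> (\<integral>\<^sup>+x. ennreal ((norm (f x))\<^sup>2) \<partial>N) = ennreal (\<integral>x. (norm (f x))\<^sup>2 \<partial>N)"
  by (intro nn_integral_eq_integral) (auto simp: sq_int_def)

lemma sq_int_bound:
  assumes "sq_int N g" "f \<in> borel_measurable N" "AE x in N. norm (f x) \<le> c * norm (g x)"
  shows "sq_int N f"
  unfolding sq_int_def
proof
  show "integrable N (\<lambda>x. (norm (f x))\<^sup>2)"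
  proof (rule Bochner_Integration.integrable_bound)
    show "integrable N (\<lambda>x. c\<^sup>2 * (norm (g x))\<^sup>2)"
      using sq_int_integrable[OF assms(1)] by simp
    show "AE x in N. norm ((norm (f x))\<^sup>2) \<le> norm (c\<^sup>2 * (norm (g x))\<^sup>2)"
      using assms(3)
    proof eventually_elim
      case (elim x)
      then have "(norm (f x))\<^sup>2 \<le> (c * norm (g x))\<^sup>2" by (intro power_mono) auto
      then show ?case by (simp add: power_mult_distrib)
    qed
  qed (use assms in measurable)
qed (fact assms(2))

lemma sq_int_add:
  assumes "sq_int N f" "sq_int N g" shows "sq_int N (\<lambda>x. f x + g x)"
  unfolding sq_int_def
proof
  note [measurable] = sq_int_measurable[OF assms(1)] sq_int_measurable[OF assms(2)]
  show "(\<lambda>x. f x + g x) \<in> borel_measurable N" by measurable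
  show "integrable N (\<lambda>x. (norm (f x + g x))\<^sup>2)"
  proof (rule Bochner_Integration.integrable_bound)
    show "integrable N (\<lambda>x. 2 * (norm (f x))\<^sup>2 + 2 * (norm (g x))\<^sup>2)"
      using assms by (auto simp: sq_int_def)
    show "AE x in N. norm ((norm (f x + g x))\<^sup>2) \<le> norm (2 * (norm (f x))\<^sup>2 + 2 * (norm (g x))\<^sup>2)"
      using norm_add_sq_le by (auto intro!: AE_I2)
  qed measurable
qed

lemma sq_int_scaleR: "sq_int N f \<Longrightarrow> sq_int N (\<lambda>x. c *\<^sub>R f x)"
  by (auto simp: sq_int_def power_mult_distrib)

lemma sq_int_minus: "sq_int N f \<Longrightarrow> sq_int N (\<lambda>x. - f x)"
  by (auto simp: sq_int_def)

lemma sq_int_diff: "sq_int N f \<Longrightarrow> sq_int N g \<Longrightarrow> sq_int N (\<lambda>x. f x - g x)"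
  using sq_int_add[of N f "\<lambda>x. - g x"] sq_int_minus[of N g] by simp

lemma sq_int_zero: "sq_int N (\<lambda>x. 0)"
  by (auto simp: sq_int_def)

lemma sq_int_inner:
  assumes "sq_int N f" "sq_int N g" shows "integrable N (\<lambda>x. f x \<bullet> g x)"
proof (rule Bochner_Integration.integrable_bound)
  note [measurable] = sq_int_measurable[OF assms(1)] sq_int_measurable[OF assms(2)]
  show "integrable N (\<lambda>x. (norm (f x))\<^sup>2 + (norm (g x))\<^sup>2)"
    using assms by (auto simp: sq_int_def)
  show "(\<lambda>x. f x \<bullet> g x) \<in> borel_measurable N" by measurable
  have "\<bar>a \<bullet> b\<bar> \<le> (norm a)\<^sup>2 + (norm b)\<^sup>2" for a b :: 'b
  proof -
    have "\<bar>a \<bullet> b\<bar> \<le> norm a * norm b" by (rule Cauchy_Schwarz_ineq2)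
    also have "\<dots> \<le> 2 * norm a * norm b" by simp
    also have "\<dots> \<le> (norm a)\<^sup>2 + (norm b)\<^sup>2"
      using sum_squares_bound[of "norm a" "norm b"] by simp
    finally show ?thesis .
  qed
  then show "AE x in N. norm (f x \<bullet> g x) \<le> norm ((norm (f x))\<^sup>2 + (norm (g x))\<^sup>2)"
    by (intro AE_I2) (auto simp: abs_of_nonneg)
qed

lemma sq_int_const: "finite_measure N \<Longrightarrow> sq_int N (\<lambda>x. c)"
  by (auto simp: sq_int_def intro!: finite_measure.integrable_const)

lemma sq_int_integrable_finite:
  fixes f :: "'a \<Rightarrow> 'b::euclidean_space"
  assumes "finite_measure N" "sq_int N f" shows "integrable N f"
proof (rule Bochner_Integration.integrable_bound)
  note [measurable] = sq_int_measurable[OF assms(2)]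
  interpret finite_measure N by fact
  show "integrable N (\<lambda>x. 1 + (norm (f x))\<^sup>2)" using assms by (auto simp: sq_int_def)
  show "f \<in> borel_measurable N" by measurable
  have "a \<le> 1 + a\<^sup>2" for a :: real
    using sum_squares_bound[of a 1] by (simp add: power2_eq_square) (smt (verit) zero_le_square)
  then show "AE x in N. norm (f x) \<le> norm (1 + (norm (f x))\<^sup>2)"
    by (intro AE_I2) (auto simp: abs_of_nonneg)
qed

lemma sq_int_integral_add:
  assumes "sq_int N f" "sq_int N g"
  shows "(\<integral>x. (norm (f x + g x))\<^sup>2 \<partial>N)
    = (\<integral>x. (norm (f x))\<^sup>2 \<partial>N) + 2 * (\<integral>x. f x \<bullet> g x \<partial>N) + (\<integral>x. (norm (g x))\<^sup>2 \<partial>N)"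
proof -
  have "(norm (a + b))\<^sup>2 = (norm a)\<^sup>2 + 2 * (a \<bullet> b) + (norm b)\<^sup>2" for a b :: 'b
    by (simp add: power2_norm_eq_inner inner_add inner_commute)
  then show ?thesis
    using sq_int_inner[OF assms] assms by (simp add: sq_int_def)
qed

lemma sq_int_integral_norm_add_le:
  assumes "sq_int N f" "sq_int N g"
  shows "(\<integral>x. (norm (f x + g x))\<^sup>2 \<partial>N) \<le> 2 * (\<integral>x. (norm (f x))\<^sup>2 \<partial>N) + 2 * (\<integral>x. (norm (g x))\<^sup>2 \<partial>N)"
proof -
  have "(\<integral>x. (norm (f x + g x))\<^sup>2 \<partial>N) \<le> (\<integral>x. 2 * (norm (f x))\<^sup>2 + 2 * (norm (g x))\<^sup>2 \<partial>N)"
    using assms sq_int_add[OF assms] by (intro integral_mono norm_add_sq_le) (auto simp: sq_int_def)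
  also have "\<dots> = 2 * (\<integral>x. (norm (f x))\<^sup>2 \<partial>N) + 2 * (\<integral>x. (norm (g x))\<^sup>2 \<partial>N)"
    using assms by (simp add: sq_int_def)
  finally show ?thesis .
qed

text \<open>Discriminant argument: the polynomial in t given by the integral of |f + t g|^2 has no
  negative value.\<close>

lemma sq_int_Cauchy_Schwarz:
  assumes "sq_int N f" "sq_int N g"
  shows "(\<integral>x. f x \<bullet> g x \<partial>N)\<^sup>2 \<le> (\<integral>x. (norm (f x))\<^sup>2 \<partial>N) * (\<integral>x. (norm (g x))\<^sup>2 \<partial>N)"
proof -
  define a b c where "a = (\<integral>x. (norm (f x))\<^sup>2 \<partial>N)" and "b = (\<integral>x. (norm (g x))\<^sup>2 \<partial>N)"
    and "c = (\<integral>x. f x \<bullet> g x \<partial>N)"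
  have q: "0 \<le> a + 2 * t * c + t\<^sup>2 * b" for t
  proof -
    have "0 \<le> (\<integral>x. (norm (f x + t *\<^sub>R g x))\<^sup>2 \<partial>N)" by simp
    also have "\<dots> = a + 2 * t * c + t\<^sup>2 * b"
      by (subst sq_int_integral_add[OF assms(1) sq_int_scaleR[OF assms(2)]])
        (simp add: a_def b_def c_def power_mult_distrib)
    finally show ?thesis .
  qed
  have b0: "0 \<le> b" by (simp add: b_def)
  show ?thesis
  proof (cases "b = 0")
    case True
    have "c = 0"
    proof (rule ccontr)
      assume "c \<noteq> 0"
      \<comment> \<open>For b = 0 the polynomial is affine, and this t gives it the value
        -1.\<close>
      then show False using q[of "- (a + 1) / (2 * c)"] True by (simp add: field_simps)
    qed
    then show ?thesis using True by (simp add: a_def b_def c_def)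
  next
    case False
    then have "0 < b" using b0 by simp
    \<comment> \<open>The minimiser of the polynomial.\<close>
    then have "c\<^sup>2 \<le> a * b" using q[of "- c / b"] by (simp add: field_simps power2_eq_square)
    then show ?thesis by (simp add: a_def b_def c_def)
  qed
qed

text \<open>Square integrability of all members and of the limit is part of the notion: the Bochner
  integral of a non-integrable function is 0, which would otherwise make the convergence
  meaningless.\<close>

definition l2_lim :: "'a measure \<Rightarrow> (nat \<Rightarrow> 'a \<Rightarrow> 'b::euclidean_space) \<Rightarrow> ('a \<Rightarrow> 'b) \<Rightarrow> bool" where
  "l2_lim N f g \<longleftrightarrow> (\<forall>k. sq_int N (f k)) \<and> sq_int N g \<and>
     (\<lambda>k. \<integral>x. (norm (f k x - g x))\<^sup>2 \<partial>N) \<longlonglongrightarrow> 0"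

lemma l2_lim_inner_const:
  assumes "l2_lim N f g" "sq_int N h"
  shows "(\<lambda>k. \<integral>x. f k x \<bullet> h x \<partial>N) \<longlonglongrightarrow> (\<integral>x. g x \<bullet> h x \<partial>N)"
proof -
  have f: "\<And>k. sq_int N (f k)" and g: "sq_int N g" using assms by (auto simp: l2_lim_def)
  have "(\<lambda>k. ((\<integral>x. f k x \<bullet> h x \<partial>N) - (\<integral>x. g x \<bullet> h x \<partial>N))\<^sup>2) \<longlonglongrightarrow> 0"
  proof (rule tendsto_sandwich[of "\<lambda>_. 0" _ _ "\<lambda>k. (\<integral>x. (norm (f k x - g x))\<^sup>2 \<partial>N) * (\<integral>x. (norm (h x))\<^sup>2 \<partial>N)"])
    have "(\<integral>x. f k x \<bullet> h x \<partial>N) - (\<integral>x. g x \<bullet> h x \<partial>N) = (\<integral>x. (f k x - g x) \<bullet> h x \<partial>N)" for k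
      using sq_int_inner[OF f assms(2)] sq_int_inner[OF g assms(2)] by (simp add: inner_diff)
    then show "\<forall>\<^sub>F k in sequentially. ((\<integral>x. f k x \<bullet> h x \<partial>N) - (\<integral>x. g x \<bullet> h x \<partial>N))\<^sup>2
        \<le> (\<integral>x. (norm (f k x - g x))\<^sup>2 \<partial>N) * (\<integral>x. (norm (h x))\<^sup>2 \<partial>N)"
      using sq_int_Cauchy_Schwarz[OF sq_int_diff[OF f g] assms(2)] by simp
    show "(\<lambda>k. (\<integral>x. (norm (f k x - g x))\<^sup>2 \<partial>N) * (\<integral>x. (norm (h x))\<^sup>2 \<partial>N)) \<longlonglongrightarrow> 0"
      using assms by (intro tendsto_mult_left_zero) (auto simp: l2_lim_def)
  qed auto
  then have "(\<lambda>k. \<bar>(\<integral>x. f k x \<bullet> h x \<partial>N) - (\<integral>x. g x \<bullet> h x \<partial>N)\<bar>) \<longlonglongrightarrow> 0"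
    by (simp only: power_tendsto_0_iff tendsto_rabs_zero_iff zero_less_numeral)
  then show ?thesis by (simp add: LIM_zero_iff tendsto_rabs_zero_iff)
qed

lemma l2_lim_add:
  assumes "l2_lim N f g" "l2_lim N f' g'"
  shows "l2_lim N (\<lambda>k x. f k x + f' k x) (\<lambda>x. g x + g' x)"
proof -
  have *: "\<And>k. sq_int N (f k)" "sq_int N g" "\<And>k. sq_int N (f' k)" "sq_int N g'"
    using assms by (auto simp: l2_lim_def)
  have "(\<lambda>k. \<integral>x. (norm (f k x + f' k x - (g x + g' x)))\<^sup>2 \<partial>N) \<longlonglongrightarrow> 0"
  proof (rule tendsto_sandwich[of "\<lambda>_. 0" _ _ "\<lambda>k. 2 * (\<integral>x. (norm (f k x - g x))\<^sup>2 \<partial>N) + 2 * (\<integral>x. (norm (f' k x - g' x))\<^sup>2 \<partial>N)"])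
    show "\<forall>\<^sub>F k in sequentially. (\<integral>x. (norm (f k x + f' k x - (g x + g' x)))\<^sup>2 \<partial>N)
        \<le> 2 * (\<integral>x. (norm (f k x - g x))\<^sup>2 \<partial>N) + 2 * (\<integral>x. (norm (f' k x - g' x))\<^sup>2 \<partial>N)"
      using sq_int_integral_norm_add_le[OF sq_int_diff[OF *(1,2)] sq_int_diff[OF *(3,4)]]
      by (intro always_eventually allI) (simp add: algebra_simps)
    have "(\<lambda>k. 2 * (\<integral>x. (norm (f k x - g x))\<^sup>2 \<partial>N) + 2 * (\<integral>x. (norm (f' k x - g' x))\<^sup>2 \<partial>N)) \<longlonglongrightarrow> 2 * 0 + 2 * 0"
      using assms by (intro tendsto_intros) (auto simp: l2_lim_def)
    then show "(\<lambda>k. 2 * (\<integral>x. (norm (f k x - g x))\<^sup>2 \<partial>N) + 2 * (\<integral>x. (norm (f' k x - g' x))\<^sup>2 \<partial>N)) \<longlonglongrightarrow> 0"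
      by simp
  qed auto
  with * show ?thesis by (auto simp: l2_lim_def intro!: sq_int_add)
qed

lemma l2_lim_scaleR:
  assumes "l2_lim N f g" shows "l2_lim N (\<lambda>k x. c *\<^sub>R f k x) (\<lambda>x. c *\<^sub>R g x)"
proof -
  have "(\<lambda>k. \<integral>x. (norm (c *\<^sub>R f k x - c *\<^sub>R g x))\<^sup>2 \<partial>N) = (\<lambda>k. c\<^sup>2 * (\<integral>x. (norm (f k x - g x))\<^sup>2 \<partial>N))"
    by (simp add: scaleR_diff_right[symmetric] power_mult_distrib)
  then show ?thesis using assms
    by (auto simp: l2_lim_def intro!: sq_int_scaleR tendsto_mult_right_zero)
qed

lemma l2_lim_diff:
  assumes "l2_lim N f g" "l2_lim N f' g'"
  shows "l2_lim N (\<lambda>k x. f k x - f' k x) (\<lambda>x. g x - g' x)"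
  using l2_lim_add[OF assms(1) l2_lim_scaleR[OF assms(2), of "-1"]] by simp

lemma l2_lim_const: "sq_int N g \<Longrightarrow> l2_lim N (\<lambda>_. g) g"
  by (auto simp: l2_lim_def)

lemma l2_lim_inner:
  assumes "l2_lim N f g" "l2_lim N f' g'"
  shows "(\<lambda>k. \<integral>x. f k x \<bullet> f' k x \<partial>N) \<longlonglongrightarrow> (\<integral>x. g x \<bullet> g' x \<partial>N)"
proof -
  have *: "\<And>k. sq_int N (f k)" "sq_int N g" "\<And>k. sq_int N (f' k)" "sq_int N g'"
    using assms by (auto simp: l2_lim_def)
  \<comment> \<open>The product of the two errors is isolated; the remaining terms contain only one
    converging sequence each and are covered by \<open>l2_lim_inner_const\<close>.\<close>
  have eq: "(\<integral>x. f k x \<bullet> f' k x \<partial>N) = (\<integral>x. (f k x - g x) \<bullet> (f' k x - g' x) \<partial>N)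
     + (\<integral>x. f k x \<bullet> g' x \<partial>N) + (\<integral>x. f' k x \<bullet> g x \<partial>N) - (\<integral>x. g x \<bullet> g' x \<partial>N)" for k
    using sq_int_inner[OF *(1)[of k] *(3)[of k]] sq_int_inner[OF *(1)[of k] *(4)]
      sq_int_inner[OF *(2) *(3)[of k]] sq_int_inner[OF *(2) *(4)]
    by (simp add: inner_diff inner_commute[of "f' k _"])
  have "(\<lambda>k. (\<integral>x. (f k x - g x) \<bullet> (f' k x - g' x) \<partial>N)\<^sup>2) \<longlonglongrightarrow> 0"
  proof (rule tendsto_sandwich[of "\<lambda>_. 0" _ _ "\<lambda>k. (\<integral>x. (norm (f k x - g x))\<^sup>2 \<partial>N) * (\<integral>x. (norm (f' k x - g' x))\<^sup>2 \<partial>N)"])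
    show "\<forall>\<^sub>F k in sequentially. (\<integral>x. (f k x - g x) \<bullet> (f' k x - g' x) \<partial>N)\<^sup>2
        \<le> (\<integral>x. (norm (f k x - g x))\<^sup>2 \<partial>N) * (\<integral>x. (norm (f' k x - g' x))\<^sup>2 \<partial>N)"
      by (intro always_eventually allI sq_int_Cauchy_Schwarz sq_int_diff *)
    have "(\<lambda>k. (\<integral>x. (norm (f k x - g x))\<^sup>2 \<partial>N) * (\<integral>x. (norm (f' k x - g' x))\<^sup>2 \<partial>N)) \<longlonglongrightarrow> 0 * 0"
      using assms by (intro tendsto_mult) (auto simp: l2_lim_def)
    then show "(\<lambda>k. (\<integral>x. (norm (f k x - g x))\<^sup>2 \<partial>N) * (\<integral>x. (norm (f' k x - g' x))\<^sup>2 \<partial>N)) \<longlonglongrightarrow> 0" by simp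
  qed auto
  then have "(\<lambda>k. \<integral>x. (f k x - g x) \<bullet> (f' k x - g' x) \<partial>N) \<longlonglongrightarrow> 0"
    by (simp only: power_tendsto_0_iff zero_less_numeral)
  then have "(\<lambda>k. \<integral>x. f k x \<bullet> f' k x \<partial>N) \<longlonglongrightarrow> 0 + (\<integral>x. g x \<bullet> g' x \<partial>N) + (\<integral>x. g' x \<bullet> g x \<partial>N) - (\<integral>x. g x \<bullet> g' x \<partial>N)"
    unfolding eq by (intro tendsto_intros l2_lim_inner_const assms *)
  then show ?thesis by (simp add: inner_commute[of "g' _"])
qed

lemma sq_int_integral_zero_AE:
  assumes "sq_int N f" "(\<integral>x. (norm (f x))\<^sup>2 \<partial>N) = 0" shows "AE x in N. f x = 0"
proof -
  have "AE x in N. (norm (f x))\<^sup>2 = 0"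
    using assms integral_nonneg_eq_0_iff_AE[of N "\<lambda>x. (norm (f x))\<^sup>2"] by (auto simp: sq_int_def)
  then show ?thesis by eventually_elim simp
qed

text \<open>The limit inherits square integrability because some \<open>f k\<close> lies at finite
  distance from it.\<close>

lemma l2_limI_nn_integral:
  assumes "\<And>k. sq_int N (f k)" "g \<in> borel_measurable N"
    and lim: "(\<lambda>k. \<integral>\<^sup>+x. ennreal ((norm (f k x - g x))\<^sup>2) \<partial>N) \<longlonglongrightarrow> 0"
  shows "l2_lim N f g"
proof -
  have [measurable]: "g \<in> borel_measurable N" by fact
  have [measurable]: "f k \<in> borel_measurable N" for k by (rule sq_int_measurable[OF assms(1)])
  have "eventually (\<lambda>k. (\<integral>\<^sup>+x. ennreal ((norm (f k x - g x))\<^sup>2) \<partial>N) < 1) sequentially"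
    using order_tendstoD(2)[OF lim, of 1] by simp
  then obtain k where "(\<integral>\<^sup>+x. ennreal ((norm (f k x - g x))\<^sup>2) \<partial>N) < 1"
    by (auto simp: eventually_sequentially)
  then have "(\<integral>\<^sup>+x. ennreal ((norm (f k x - g x))\<^sup>2) \<partial>N) < \<infinity>"
    using less_trans[OF _ ennreal_one_less_top] by simp
  then have "sq_int N (\<lambda>x. f k x - g x)" by (subst sq_int_iff_nn_integral) auto
  from sq_int_diff[OF assms(1)[of k] this] have g: "sq_int N g" by simp
  have "(\<lambda>k. ennreal (\<integral>x. (norm (f k x - g x))\<^sup>2 \<partial>N)) \<longlonglongrightarrow> ennreal 0"
    using lim nn_integral_sq_int[OF sq_int_diff[OF assms(1) g]] by simp
  then have "(\<lambda>k. \<integral>x. (norm (f k x - g x))\<^sup>2 \<partial>N) \<longlonglongrightarrow> 0"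
    by (subst (asm) tendsto_ennreal_iff) auto
  with assms(1) g show ?thesis by (auto simp: l2_lim_def)
qed

lemma l2_lim_nn_integral:
  assumes "l2_lim N f g"
  shows "(\<lambda>k. \<integral>\<^sup>+x. ennreal ((norm (f k x - g x))\<^sup>2) \<partial>N) \<longlonglongrightarrow> 0"
proof -
  have *: "\<And>k. sq_int N (f k)" "sq_int N g" using assms by (auto simp: l2_lim_def)
  have "(\<lambda>k. ennreal (\<integral>x. (norm (f k x - g x))\<^sup>2 \<partial>N)) \<longlonglongrightarrow> ennreal 0"
    using assms by (intro tendsto_ennrealI) (auto simp: l2_lim_def)
  then show ?thesis using nn_integral_sq_int[OF sq_int_diff[OF *]] by simp
qed

text \<open>Preimages under f and g differ only inside a null set. Completeness makes the difference
  itself a null set, and G contains all of these. This is how versions of random variables stay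
  adapted.\<close>

lemma measurable_AE_eq:
  assumes "complete_measure M" "null_sets M \<subseteq> sets G" "space G = space M"
    and f: "f \<in> measurable G N" and AE: "AE x in M. f x = g x" and g: "\<And>x. x \<in> space M \<Longrightarrow> g x \<in> space N"
  shows "g \<in> measurable G N"
proof (rule measurableI)
  from AE obtain Z where Z: "Z \<in> null_sets M" "{x\<in>space M. f x \<noteq> g x} \<subseteq> Z" 
    by (auto elim!: AE_E3)
  fix A assume A: "A \<in> sets N"
  have "g -` A \<inter> Z \<inter> space M \<in> null_sets M"
    using complete_measure.complete2[OF assms(1), of _ Z] Z(1)
    by (metis inf.cobounded1 inf.cobounded2 le_infE le_infI1)
  moreover have "Z \<in> sets G" using Z assms(2) by auto
  moreover have "g -` A \<inter> space G = ((f -` A \<inter> space G) - Z) \<union> (g -` A \<inter> Z \<inter> space M)"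
    using Z(2) assms(3) by auto
  ultimately show "g -` A \<inter> space G \<in> sets G"
    using measurable_sets[OF f A] assms(2) by auto
qed (use g assms(3) in auto)

section \<open>Elementary stochastic integrals\<close>

text \<open>These properties of the augmented filtration carry the whole stochastic analysis;
  \<open>brownian_problem\<close> checks them for the filtration of the problem.\<close>

locale brownian = prob_space M for M :: "'a measure" +
  fixes F :: "real \<Rightarrow> 'a measure" and W :: "real \<Rightarrow> 'a \<Rightarrow> real"
  assumes complete: "complete_measure M"
    and space_F: "\<And>t. space (F t) = space M"
    and sets_F_mono: "\<And>s t. s \<le> t \<Longrightarrow> sets (F s) \<subseteq> sets (F t)"
    and sets_F_le: "\<And>t. sets (F t) \<subseteq> sets M"
    and null_sets_F: "\<And>t. null_sets M \<subseteq> sets (F t)"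
    and brownian: "brownian_motion M F W"
begin

lemma measurable_F_mono: "s \<le> t \<Longrightarrow> f \<in> measurable (F s) N \<Longrightarrow> f \<in> measurable (F t) N"
  using sets_F_mono[of s t] by (auto simp: measurable_def space_F)

lemma measurable_F_M: "f \<in> measurable (F s) N \<Longrightarrow> f \<in> measurable M N"
  using sets_F_le[of s] by (auto simp: measurable_def space_F)

lemma measurable_F_AE:
  assumes "f \<in> borel_measurable (F t)" "AE x in M. f x = g x" shows "g \<in> borel_measurable (F t)"
  by (rule measurable_AE_eq[OF complete null_sets_F space_F assms]) auto

lemma measurable_M_AE:
  assumes "f \<in> borel_measurable M" "AE x in M. f x = g x" shows "g \<in> borel_measurable M"
  by (rule measurable_AE_eq[OF complete _ _ assms]) auto

section \<open>The product of time and probability space\<close>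

lemma space_time_prob: "space (time_prob M T) = {0..T} \<times> space M"
  by (simp add: time_prob_def space_pair_measure)

lemma pair_time: "pair_sigma_finite (restrict_space lborel {0..T::real}) M"
  by (intro pair_sigma_finite.intro sigma_finite_measure_restrict_space sigma_finite_lborel
      sigma_finite_measure_axioms) auto

lemma finite_time_prob: "finite_measure (time_prob M T)"
proof (rule finite_measureI)
  have "emeasure (time_prob M T) ({0..T} \<times> space M) = emeasure (restrict_space lborel {0..T}) {0..T} * emeasure M (space M)"
    unfolding time_prob_def
    by (intro emeasure_pair_measure_Times) (auto simp: sets_restrict_space)
  also have "\<dots> \<noteq> \<infinity>" by (simp add: emeasure_restrict_space emeasure_space_1 emeasure_lborel_Icc_eq)
  finally show "emeasure (time_prob M T) (space (time_prob M T)) \<noteq> \<infinity>"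
    by (simp add: space_time_prob)
qed

lemma measurable_time_prob_snd: "f \<in> measurable M N \<Longrightarrow> (\<lambda>(s, w). f w) \<in> measurable (time_prob M T) N"
  unfolding time_prob_def split_def by (rule measurable_compose[OF measurable_snd])

lemma measurable_time_prob_fst: "f \<in> measurable borel N \<Longrightarrow> (\<lambda>(s, w). f s) \<in> measurable (time_prob M T) N"
  unfolding time_prob_def split_def
  by (rule measurable_compose[OF measurable_fst]) (simp add: measurable_restrict_space1)

lemma progressive_measurable:
  assumes "progressive F T \<phi>" "0 \<le> t" "t \<le> T"
  shows "case_prod \<phi> \<in> borel_measurable (time_prob M t)"
proof -
  have "case_prod \<phi> \<in> borel_measurable (restrict_space borel {0..t} \<Otimes>\<^sub>M F t)"
    using assms by (auto simp: progressive_def)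
  moreover have "(\<lambda>x. (fst x, snd x)) \<in> measurable (time_prob M t) (restrict_space borel {0..t} \<Otimes>\<^sub>M F t)"
  proof (rule measurable_Pair)
    show "fst \<in> measurable (time_prob M t) (restrict_space borel {0..t})"
      using measurable_fst[of "restrict_space lborel {0..t}" M]
        measurable_cong_sets[OF refl sets_restrict_space_cong[OF sets_lborel]]
      unfolding time_prob_def by blast
    have "(\<lambda>x. x) \<in> measurable M (F t)"
      using sets_F_le[of t] by (intro measurableI) (auto simp: space_F dest: sets.sets_into_space)
    from measurable_compose[OF measurable_snd this]
    show "snd \<in> measurable (time_prob M t) (F t)" unfolding time_prob_def .
  qed
  ultimately show ?thesis by (auto dest: measurable_compose)
qed

lemma progressive_mono: "progressive F T \<phi> \<Longrightarrow> t \<le> T \<Longrightarrow> progressive F t \<phi>"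
  by (auto simp: progressive_def)

lemma nn_integral_time_prob:
  assumes "f \<in> borel_measurable (time_prob M T)"
  shows "(\<integral>\<^sup>+w. (\<integral>\<^sup>+s\<in>{0..T}. f (s, w) \<partial>lborel) \<partial>M) = (\<integral>\<^sup>+x. f x \<partial>time_prob M T)"
proof -
  interpret pair_sigma_finite "restrict_space lborel {0..T}" M by (rule pair_time)
  show ?thesis using nn_integral_snd[of f] assms
    by (simp add: time_prob_def nn_integral_restrict_space)
qed

lemma nn_integral_time_prob':
  assumes "f \<in> borel_measurable (time_prob M T)"
  shows "(\<integral>\<^sup>+s\<in>{0..T}. (\<integral>\<^sup>+w. f (s, w) \<partial>M) \<partial>lborel) = (\<integral>\<^sup>+x. f x \<partial>time_prob M T)"
  using nn_integral_fst[of f "restrict_space lborel {0..T}"] assms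
    by (simp add: time_prob_def nn_integral_restrict_space)

lemma L2_proc_iff:
  assumes "0 \<le> T"
  shows "\<phi> \<in> L2_proc M F T \<longleftrightarrow> progressive F T \<phi> \<and> sq_int (time_prob M T) (case_prod \<phi>)"
proof -
  have "sq_int (time_prob M T) (case_prod \<phi>) \<longleftrightarrow>
     (\<integral>\<^sup>+w. (\<integral>\<^sup>+s\<in>{0..T}. ennreal ((norm (\<phi> s w))\<^sup>2) \<partial>lborel) \<partial>M) < \<infinity>" if p: "progressive F T \<phi>"
  proof -
    have [measurable]: "case_prod \<phi> \<in> borel_measurable (time_prob M T)"
      using progressive_measurable[OF p assms] by simp
    have "(\<integral>\<^sup>+w. (\<integral>\<^sup>+s\<in>{0..T}. ennreal ((norm (case_prod \<phi> (s, w)))\<^sup>2) \<partial>lborel) \<partial>M) = (\<integral>\<^sup>+x. ennreal ((norm (case_prod \<phi> x))\<^sup>2) \<partial>time_prob M T)"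
      by (rule nn_integral_time_prob) measurable
    then show ?thesis by (subst sq_int_iff_nn_integral) auto
  qed
  then show ?thesis by (auto simp: L2_proc_def)
qed

text \<open>Fubini in both orders. Time appears as a set integral over \<open>lborel\<close> because
  the cost and the drift terms are stated that way.\<close>

lemma
  fixes f :: "real \<Rightarrow> 'a \<Rightarrow> 'b::euclidean_space"
  assumes "integrable (time_prob M T) (case_prod f)"
  shows integral_time_prob: "(\<integral>w. (LINT s:{0..T}|lborel. f s w) \<partial>M) = (\<integral>x. case_prod f x \<partial>time_prob M T)"
    and integrable_time_prob: "integrable M (\<lambda>w. LINT s:{0..T}|lborel. f s w)"
    and AE_set_integrable: "AE w in M. set_integrable lborel {0..T} (\<lambda>s. f s w)"
    and integral_time_prob': "(LINT s:{0..T}|lborel. (\<integral>w. f s w \<partial>M)) = (\<integral>x. case_prod f x \<partial>time_prob M T)"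
    and integrable_time_prob': "set_integrable lborel {0..T} (\<lambda>s. \<integral>w. f s w \<partial>M)"
    and AE_integrable_time: "AE s in lborel. s \<in> {0..T} \<longrightarrow> integrable M (f s)"
proof -
  interpret pair_sigma_finite "restrict_space lborel {0..T}" M by (rule pair_time)
  note i = assms[unfolded time_prob_def]
  show "(\<integral>w. (LINT s:{0..T}|lborel. f s w) \<partial>M) = (\<integral>x. case_prod f x \<partial>time_prob M T)"
    using integral_snd[OF i] by (simp add: time_prob_def set_lebesgue_integral_def integral_restrict_space)
  show "integrable M (\<lambda>w. LINT s:{0..T}|lborel. f s w)"
    using integrable_snd[OF i] by (simp add: set_lebesgue_integral_def integral_restrict_space)
  show "AE w in M. set_integrable lborel {0..T} (\<lambda>s. f s w)"
    using AE_integrable_snd[OF i] by (simp add: set_integrable_def integrable_restrict_space)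
  show "(LINT s:{0..T}|lborel. (\<integral>w. f s w \<partial>M)) = (\<integral>x. case_prod f x \<partial>time_prob M T)"
    using integral_fst[OF i] by (simp add: time_prob_def set_lebesgue_integral_def integral_restrict_space)
  show "set_integrable lborel {0..T} (\<lambda>s. \<integral>w. f s w \<partial>M)"
    using integrable_fst[OF i] by (simp add: set_integrable_def integrable_restrict_space)
  show "AE s in lborel. s \<in> {0..T} \<longrightarrow> integrable M (f s)"
    using AE_integrable_fst[OF i] by (simp add: AE_restrict_space_iff)
qed

section \<open>Moments of Brownian increments\<close>

lemma W_measurable: "0 \<le> t \<Longrightarrow> W t \<in> borel_measurable M"
  and W_adapted: "0 \<le> t \<Longrightarrow> W t \<in> borel_measurable (F t)"
  using brownian by (auto simp: brownian_motion_def)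

lemma increment_adapted: "0 \<le> s \<Longrightarrow> s \<le> t \<Longrightarrow> t \<le> r \<Longrightarrow> (\<lambda>w. W t w - W s w) \<in> borel_measurable (F r)"
  using W_adapted[of t] W_adapted[of s] measurable_F_mono[of s r] measurable_F_mono[of t r]
  by (intro borel_measurable_diff) auto

text \<open>\<open>indep_var\<close> speaks of generated sigma algebras,
  \<open>brownian_motion\<close> of the system of preimages of Borel sets. That system is already a
  sigma algebra, so the two notions match.\<close>

lemma increment_indep:
  assumes "0 \<le> s" "s < t" "X \<in> borel_measurable (F s)"
  shows "indep_var borel X borel (\<lambda>w. W t w - W s w)"
  unfolding indep_var_eq
proof (intro conjI)
  show "X \<in> borel_measurable M" using assms measurable_F_M by auto
  show D: "(\<lambda>w. W t w - W s w) \<in> borel_measurable M"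
    using W_measurable[of t] W_measurable[of s] assms by (intro borel_measurable_diff) auto
  have ind: "indep_set (sets (F s)) {(\<lambda>w. W t w - W s w) -` B \<inter> space M | B. B \<in> sets borel}"
    using brownian assms by (auto simp: brownian_motion_def)
  have "{X -` A \<inter> space M |A. A \<in> sets borel} \<subseteq> sets (F s)"
    using measurable_sets[OF assms(3)] by (auto simp: space_F)
  from sets.sigma_sets_subset[OF this]
  have "sigma_sets (space M) {X -` A \<inter> space M |A. A \<in> sets borel} \<subseteq> sets (F s)" by (simp add: space_F)
  moreover have "sigma_sets (space M) {(\<lambda>w. W t w - W s w) -` B \<inter> space M | B. B \<in> sets borel}
     = {(\<lambda>w. W t w - W s w) -` B \<inter> space M | B. B \<in> sets borel}"
  proof -
    have eq: "sigma_sets UNIV (sets borel) = (sets borel :: real set set)"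
      using sets.sigma_sets_eq[of "borel :: real measure"] by simp
    show ?thesis
      by (rule sigma_sets_vimage_commute[of "\<lambda>w. W t w - W s w" "space M" UNIV "sets borel", unfolded eq, symmetric]) auto
  qed
  ultimately show "indep_set (sigma_sets (space M) {X -` A \<inter> space M |A. A \<in> sets borel})
     (sigma_sets (space M) {(\<lambda>w. W t w - W s w) -` A \<inter> space M |A. A \<in> sets borel})"
    using ind by (simp add: indep_sets2_eq) (meson subset_iff)
qed

lemma increment_distributed:
  assumes "0 \<le> s" "s < t"
  shows "distributed M lborel (\<lambda>w. W t w - W s w) (normal_density 0 (sqrt (t - s)))"
  using brownian assms by (auto simp: brownian_motion_def)

lemma
  assumes "0 \<le> s" "s < t"
  shows increment_integrable: "integrable M (\<lambda>w. (W t w - W s w) ^ k)"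
    and increment_mean: "expectation (\<lambda>w. W t w - W s w) = 0"
    and increment_variance: "expectation (\<lambda>w. (W t w - W s w)\<^sup>2) = t - s"
proof -
  note D = increment_distributed[OF assms]
  have pos: "0 < sqrt (t - s)" using assms by simp
  show "integrable M (\<lambda>w. (W t w - W s w) ^ k)"
    using distributed_integrable[OF D, of "\<lambda>x. x ^ k"] integrable_normal_moment[OF pos, of 0 k] by simp
  show m: "expectation (\<lambda>w. W t w - W s w) = 0"
    by (rule normal_distributed_expectation[OF pos D])
  show "expectation (\<lambda>w. (W t w - W s w)\<^sup>2) = t - s"
    using normal_distributed_variance[OF pos D] m assms by simp
qed

lemma
  assumes "0 \<le> s" "s \<le> t" "X \<in> borel_measurable (F s)" "integrable M X"
  shows integrable_mult_increment: "integrable M (\<lambda>w. X w * (W t w - W s w))"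
    and mult_increment_mean: "expectation (\<lambda>w. X w * (W t w - W s w)) = 0"
    and integrable_mult_increment_sq: "integrable M (\<lambda>w. X w * (W t w - W s w)\<^sup>2)"
    and mult_increment_sq_mean: "expectation (\<lambda>w. X w * (W t w - W s w)\<^sup>2) = (t - s) * expectation X"
proof -
  have "integrable M (\<lambda>w. X w * (W t w - W s w)) \<and> expectation (\<lambda>w. X w * (W t w - W s w)) = 0 \<and>
    integrable M (\<lambda>w. X w * (W t w - W s w)\<^sup>2) \<and> expectation (\<lambda>w. X w * (W t w - W s w)\<^sup>2) = (t - s) * expectation X"
  proof (cases "s = t")
    case False
    then have st: "s < t" using assms by simp
    note I = increment_indep[OF assms(1) st assms(3)]
    have "indep_var borel (id \<circ> X) borel ((\<lambda>x. x\<^sup>2) \<circ> (\<lambda>w. W t w - W s w))"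
      by (rule indep_var_compose[OF I]) auto
    then have I2: "indep_var borel X borel (\<lambda>w. (W t w - W s w)\<^sup>2)" by (simp add: comp_def)
    note int = increment_integrable[OF assms(1) st, of 1, simplified] increment_integrable[OF assms(1) st, of 2]
    show ?thesis
      using indep_var_integrable[OF I assms(4) int(1)] indep_var_lebesgue_integral[OF I assms(4) int(1)]
       indep_var_integrable[OF I2 assms(4) int(2)] indep_var_lebesgue_integral[OF I2 assms(4) int(2)]
       increment_mean[OF assms(1) st] increment_variance[OF assms(1) st] by simp
  qed simp
  then show "integrable M (\<lambda>w. X w * (W t w - W s w))" "expectation (\<lambda>w. X w * (W t w - W s w)) = 0"
    "integrable M (\<lambda>w. X w * (W t w - W s w)\<^sup>2)" "expectation (\<lambda>w. X w * (W t w - W s w)\<^sup>2) = (t - s) * expectation X"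
    by auto
qed

lemma integrable_bounded_M:
  fixes X :: "'a \<Rightarrow> 'b::euclidean_space"
  shows "X \<in> borel_measurable M \<Longrightarrow> (\<And>w. w \<in> space M \<Longrightarrow> norm (X w) \<le> c) \<Longrightarrow> integrable M X"
  by (rule integrable_const_bound[where B=c]) auto

lemma integrable_bounded_mult:
  fixes X Y :: "'a \<Rightarrow> real"
  assumes "X \<in> borel_measurable M" "\<And>w. w \<in> space M \<Longrightarrow> norm (X w) \<le> C" "integrable M Y"
  shows "integrable M (\<lambda>w. X w * Y w)"
proof (rule Bochner_Integration.integrable_bound)
  show "integrable M (\<lambda>w. C * Y w)" using assms(3) by simp
  have "\<bar>X x\<bar> * \<bar>Y x\<bar> \<le> \<bar>C\<bar> * \<bar>Y x\<bar>" if "x \<in> space M" for x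
    using assms(2)[OF that] by (intro mult_right_mono) auto
  then show "AE x in M. norm (X x * Y x) \<le> norm (C * Y x)"
    by (intro AE_I2) (simp add: abs_mult)
qed (use assms in measurable)

lemma integrable_increment: "0 \<le> s \<Longrightarrow> s \<le> t \<Longrightarrow> integrable M (\<lambda>w. W t w - W s w)"
  by (rule integrable_mult_increment[of s t "\<lambda>_. 1", unfolded mult_1]) auto

text \<open>The factor is the length of the overlap of (a,b] and (c,d]. Cutting both increments at
  the common end points leaves the squared increment over the overlap and products over disjoint
  intervals; in each of these the later increment is independent of the rest and has mean
  zero.\<close>

lemma expectation_mult_increments:
  assumes X: "X \<in> borel_measurable (F c)" "\<And>w. w \<in> space M \<Longrightarrow> norm (X w) \<le> C"
    and ord: "0 \<le> a" "a \<le> b" "a \<le> c" "c \<le> d"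
  shows "expectation (\<lambda>w. X w * ((W b w - W a w) * (W d w - W c w))) = max 0 (min b d - c) * expectation X"
proof -
  have XM: "X \<in> borel_measurable M" using X(1) by (rule measurable_F_M)
  have Xint: "integrable M X" using XM X(2) by (rule integrable_bounded_M)
  have iX: "integrable M (\<lambda>w. X w * (W t w - W s w))" if "0 \<le> s" "s \<le> t" for s t
    by (rule integrable_bounded_mult[OF XM X(2) integrable_increment[OF that]])
  have mX: "(\<lambda>w. X w * (W t w - W s w)) \<in> borel_measurable (F r)" if "0 \<le> s" "s \<le> t" "t \<le> r" "c \<le> r" for s t r
    using increment_adapted[OF that(1,2,3)] measurable_F_mono[OF that(4) X(1)] by (rule borel_measurable_times[rotated])
  have off: "integrable M (\<lambda>w. X w * (W t w - W s w) * (W v w - W u w))"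
    "expectation (\<lambda>w. X w * (W t w - W s w) * (W v w - W u w)) = 0"
    if "0 \<le> s" "s \<le> t" "t \<le> u" "c \<le> u" "u \<le> v" for s t u v
    using integrable_mult_increment[OF _ that(5) mX[OF that(1-4)] iX[OF that(1,2)]]
     mult_increment_mean[OF _ that(5) mX[OF that(1-4)] iX[OF that(1,2)]] that by auto
  have diag: "integrable M (\<lambda>w. X w * (W t w - W c w)\<^sup>2)"
    "expectation (\<lambda>w. X w * (W t w - W c w)\<^sup>2) = (t - c) * expectation X" if "c \<le> t" for t
    using integrable_mult_increment_sq[OF _ that X(1) Xint] mult_increment_sq_mean[OF _ that X(1) Xint] ord by auto
  show ?thesis
  proof (cases "b \<le> c")
    case True
    then show ?thesis using off(2)[of a b c d] ord by (simp add: mult.assoc)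
  next
    case False
    show ?thesis
    proof (cases "b \<le> d")
      case True
      have "X w * ((W b w - W a w) * (W d w - W c w)) = X w * (W c w - W a w) * (W d w - W c w)
         + X w * (W b w - W c w)\<^sup>2 + X w * (W b w - W c w) * (W d w - W b w)" for w
        by (simp add: algebra_simps power2_eq_square)
      then show ?thesis using off[of a c c d] off[of c b b d] diag[of b] ord True False by simp
    next
      case F: False
      have "X w * ((W b w - W a w) * (W d w - W c w)) = X w * (W c w - W a w) * (W d w - W c w)
         + X w * (W d w - W c w)\<^sup>2 + X w * (W d w - W c w) * (W b w - W d w)" for w
        by (simp add: algebra_simps power2_eq_square)
      then show ?thesis using off[of a c c d] off[of c d d b] diag[of d] ord F False by simp
    qed
  qed
qed

section \<open>Elementary integrands as lists of weighted intervals\<close>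

definition el_ok :: "real \<Rightarrow> (real \<times> real \<times> ('a \<Rightarrow> 'b::euclidean_space)) list \<Rightarrow> bool" where
  "el_ok t xs \<longleftrightarrow> (\<forall>(a, b, \<xi>)\<in>set xs. 0 \<le> a \<and> a \<le> b \<and> b \<le> t \<and> \<xi> \<in> borel_measurable (F a) \<and>
     (\<exists>c. \<forall>w\<in>space M. norm (\<xi> w) \<le> c))"

text \<open>The intervals of a list may overlap. Sums of integrands are then concatenations, and no
  common refinement of two partitions is ever formed.\<close>

definition el_proc :: "(real \<times> real \<times> ('a \<Rightarrow> 'b::euclidean_space)) list \<Rightarrow> real \<Rightarrow> 'a \<Rightarrow> 'b" where
  "el_proc xs s w = (\<Sum>(a, b, \<xi>)\<leftarrow>xs. indicator {a<..b} s *\<^sub>R \<xi> w)"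

definition el_ito :: "(real \<times> real \<times> ('a \<Rightarrow> 'b::euclidean_space)) list \<Rightarrow> 'a \<Rightarrow> 'b" where
  "el_ito xs w = (\<Sum>(a, b, \<xi>)\<leftarrow>xs. (W b w - W a w) *\<^sub>R \<xi> w)"

definition el_scale :: "real \<Rightarrow> (real \<times> real \<times> ('a \<Rightarrow> 'b::euclidean_space)) list \<Rightarrow> (real \<times> real \<times> ('a \<Rightarrow> 'b)) list" where
  "el_scale c xs = map (\<lambda>(a, b, \<xi>). (a, b, \<lambda>w. c *\<^sub>R \<xi> w)) xs"

text \<open>Cuts an integrand off at time r. An entry that starts after r collapses to an empty
  interval at r, and its value is replaced by 0 since it need not be known at time r.\<close>

definition el_trunc :: "real \<Rightarrow> (real \<times> real \<times> ('a \<Rightarrow> 'b::euclidean_space)) list \<Rightarrow> (real \<times> real \<times> ('a \<Rightarrow> 'b)) list" where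
  "el_trunc r xs = map (\<lambda>(a, b, \<xi>). (min r a, min r b, if a \<le> r then \<xi> else (\<lambda>_. 0))) xs"

lemma el_ok_Nil: "el_ok t []" and el_ok_Cons: "el_ok t (x # xs) \<longleftrightarrow> el_ok t [x] \<and> el_ok t xs"
  and el_ok_append: "el_ok t (xs @ ys) \<longleftrightarrow> el_ok t xs \<and> el_ok t ys"
  and el_proc_Cons: "el_proc (x # xs) s w = el_proc [x] s w + el_proc xs s w"
  and el_ito_Cons: "el_ito (x # xs) w = el_ito [x] w + el_ito xs w"
  and el_proc_append: "el_proc (xs @ ys) s w = el_proc xs s w + el_proc ys s w"
  and el_ito_append: "el_ito (xs @ ys) w = el_ito xs w + el_ito ys w"
  and el_proc_Nil: "el_proc [] s w = 0" and el_ito_Nil: "el_ito [] w = 0"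
  by (auto simp: el_ok_def el_proc_def el_ito_def split_beta)

lemma el_ok_scale: "el_ok t xs \<Longrightarrow> el_ok t (el_scale c xs)"
  by (fastforce simp: el_ok_def el_scale_def intro: mult_left_mono)

lemma el_proc_scale: "el_proc (el_scale c xs) s w = c *\<^sub>R el_proc xs s w"
  by (induction xs) (auto simp: el_proc_def el_scale_def scaleR_add_right)

lemma el_ito_scale: "el_ito (el_scale c xs) w = c *\<^sub>R el_ito xs w"
  by (induction xs) (auto simp: el_ito_def el_scale_def scaleR_add_right)

lemma el_ok_trunc: "el_ok t xs \<Longrightarrow> 0 \<le> r \<Longrightarrow> el_ok r (el_trunc r xs)"
  by (fastforce simp: el_ok_def el_trunc_def min_def split: if_splits)

lemma el_proc_trunc: "s \<le> r \<Longrightarrow> el_proc (el_trunc r xs) s w = el_proc xs s w"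
  by (induction xs) (auto simp: el_proc_def el_trunc_def indicator_def)

lemma el_ok_measurable:
  assumes "el_ok t [(a, b, \<xi>)]"
  shows "\<xi> \<in> borel_measurable (F a)" "\<xi> \<in> borel_measurable M" "0 \<le> a" "a \<le> b" "b \<le> t"
    "\<exists>c\<ge>0. \<forall>w\<in>space M. norm (\<xi> w) \<le> c"
proof -
  show "\<exists>c\<ge>0. \<forall>w\<in>space M. norm (\<xi> w) \<le> c"
    using assms by (auto simp: el_ok_def) (meson max.cobounded1 max.coboundedI2)
qed (use assms measurable_F_M in \<open>auto simp: el_ok_def\<close>)

lemma el_proc_measurable: "el_ok t xs \<Longrightarrow> case_prod (el_proc xs) \<in> borel_measurable (time_prob M T)"
proof (induction xs)
  case (Cons x xs)
  obtain a b \<xi> where x: "x = (a, b, \<xi>)" by (cases x)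
  have ok: "el_ok t [(a, b, \<xi>)]" "el_ok t xs" using Cons.prems el_ok_Cons[of t x xs] x by auto
  have "(\<lambda>z. (\<lambda>(s, w). indicator {a<..b} s) z *\<^sub>R (\<lambda>(s, w). \<xi> w) z) \<in> borel_measurable (time_prob M T)"
    by (intro borel_measurable_scaleR measurable_time_prob_fst measurable_time_prob_snd
        el_ok_measurable[OF ok(1)] borel_measurable_indicator) auto
  moreover have "case_prod (el_proc (x # xs)) = (\<lambda>z. (\<lambda>(s, w). indicator {a<..b} s) z *\<^sub>R (\<lambda>(s, w). \<xi> w) z + case_prod (el_proc xs) z)"
    by (auto simp: el_proc_def x)
  ultimately show ?case using Cons.IH[OF ok(2)] by simp
qed (simp add: el_proc_def case_prod_beta')

lemma el_proc_bounded: "el_ok t xs \<Longrightarrow> \<exists>c. \<forall>s. \<forall>w\<in>space M. norm (el_proc xs s w) \<le> c"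
proof (induction xs)
  case (Cons x xs)
  obtain a b \<xi> where x: "x = (a, b, \<xi>)" by (cases x)
  have ok: "el_ok t [(a, b, \<xi>)]" "el_ok t xs" using Cons.prems el_ok_Cons[of t x xs] x by auto
  obtain c where c: "\<forall>s. \<forall>w\<in>space M. norm (el_proc xs s w) \<le> c" using Cons.IH[OF ok(2)] by auto
  obtain d where d: "d \<ge> 0" "\<forall>w\<in>space M. norm (\<xi> w) \<le> d" using el_ok_measurable(6)[OF ok(1)] by auto
  have "norm (el_proc (x # xs) s w) \<le> d + c" if "w \<in> space M" for s w
  proof -
    have "el_proc (x # xs) s w = indicator {a<..b} s *\<^sub>R \<xi> w + el_proc xs s w" by (simp add: el_proc_def x)
    moreover have "norm (indicator {a<..b} s *\<^sub>R \<xi> w) \<le> d" using d that by (auto simp: indicator_def)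
    moreover have "norm (el_proc xs s w) \<le> c" using c that by auto
    ultimately show ?thesis by (metis norm_triangle_mono)
  qed
  then show ?case by blast
qed (auto simp: el_proc_def)

lemma el_proc_sq_int:
  assumes "el_ok t xs" shows "sq_int (time_prob M T) (case_prod (el_proc xs))"
proof -
  interpret fm: finite_measure "time_prob M T" by (rule finite_time_prob)
  obtain c where c: "\<forall>s. \<forall>w\<in>space M. norm (el_proc xs s w) \<le> c" using el_proc_bounded[OF assms] by auto
  show ?thesis
  proof (rule sq_int_bound[OF sq_int_const[OF finite_time_prob]])
    show "AE x in time_prob M T. norm (case_prod (el_proc xs) x) \<le> c * norm (1::real)"
      using c by (intro AE_I2) (auto simp: space_time_prob)
  qed (rule el_proc_measurable[OF assms])
qed

lemma el_ito_single_sq_int: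
  assumes "el_ok t [(a, b, \<xi>)]" shows "sq_int M (el_ito [(a, b, \<xi>)])"
proof -
  note m = el_ok_measurable[OF assms]
  obtain c where c: "c \<ge> 0" "\<forall>w\<in>space M. norm (\<xi> w) \<le> c" using m(6) by auto
  have Wm: "(\<lambda>w. W b w - W a w) \<in> borel_measurable M"
    using W_measurable m by (intro borel_measurable_diff) auto
  have "integrable M (\<lambda>w. (W b w - W a w)\<^sup>2)"
    by (rule integrable_mult_increment_sq[of a b "\<lambda>_. 1", unfolded mult_1]) (use m in auto)
  then have "sq_int M (\<lambda>w. W b w - W a w)" using Wm by (simp only: sq_int_def real_norm_def power2_abs simp_thms)
  moreover have "el_ito [(a, b, \<xi>)] = (\<lambda>w. (W b w - W a w) *\<^sub>R \<xi> w)" by (auto simp: el_ito_def)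
  moreover have "AE w in M. norm ((W b w - W a w) *\<^sub>R \<xi> w) \<le> c * norm (W b w - W a w)"
    using c by (intro AE_I2) (auto simp: mult.commute[of c] intro!: mult_left_mono)
  ultimately show ?thesis using sq_int_bound[OF _ _ \<open>AE w in M. _\<close>] Wm m(2) by simp
qed

lemma el_ito_sq_int: "el_ok t xs \<Longrightarrow> sq_int M (el_ito xs)"
proof (induction xs)
  case Nil
  have "el_ito [] = (\<lambda>_. 0::'b)" by (auto simp: el_ito_def)
  then show ?case by (simp add: sq_int_zero)
next
  case (Cons x xs)
  then have "sq_int M (el_ito [x])" "sq_int M (el_ito xs)"
    using el_ito_single_sq_int[of t "fst x" "fst (snd x)" "snd (snd x)"] el_ok_Cons[of t x xs] by auto
  from sq_int_add[OF this] show ?case by (simp add: el_ito_Cons[of x xs, abs_def])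
qed

lemma el_isometry_single_ord:
  assumes "el_ok t [(a, b, \<xi>)]" "el_ok t [(c, d, \<eta>)]" "a \<le> c"
  shows "expectation (\<lambda>w. el_ito [(a, b, \<xi>)] w \<bullet> el_ito [(c, d, \<eta>)] w)
    = max 0 (min b d - c) * expectation (\<lambda>w. \<xi> w \<bullet> \<eta> w)"
proof -
  note m = el_ok_measurable[OF assms(1)] el_ok_measurable[OF assms(2)]
  obtain C D where C: "C \<ge> 0" "\<forall>w\<in>space M. norm (\<xi> w) \<le> C" and D: "D \<ge> 0" "\<forall>w\<in>space M. norm (\<eta> w) \<le> D"
    using m(6) m(12) by auto
  have b: "norm (\<xi> w \<bullet> \<eta> w) \<le> C * D" if "w \<in> space M" for w
    using C D that by (intro order_trans[OF Cauchy_Schwarz_ineq2[of "\<xi> w" "\<eta> w", folded real_norm_def]] mult_mono) auto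
  have "(\<lambda>w. \<xi> w \<bullet> \<eta> w) \<in> borel_measurable (F c)"
    using measurable_F_mono[OF assms(3) m(1)] m(7) by (rule borel_measurable_inner)
  from expectation_mult_increments[OF this b m(3,4) assms(3) m(10)]
  show ?thesis by (simp add: el_ito_def mult.commute mult.left_commute inner_commute)
qed

text \<open>Integrating over the sample space first turns the right side into the overlap of the two
  intervals times E<xi, eta>. Symmetry of the inner product reduces the left side to ordered left
  end points.\<close>

lemma el_isometry_single:
  assumes "el_ok t [x]" "el_ok t [y]" "0 \<le> t"
  shows "expectation (\<lambda>w. el_ito [x] w \<bullet> el_ito [y] w)
    = (\<integral>z. case_prod (el_proc [x]) z \<bullet> case_prod (el_proc [y]) z \<partial>time_prob M t)"
proof -
  obtain a b \<xi> c d \<eta> where xy: "x = (a, b, \<xi>)" "y = (c, d, \<eta>)" by (metis surj_pair)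
  note ok = assms(1,2)[unfolded xy]
  note m = el_ok_measurable[OF ok(1)] el_ok_measurable[OF ok(2)]
  define f where "f s w = el_proc [x] s w \<bullet> el_proc [y] s w" for s w
  have "integrable (time_prob M t) (case_prod f)"
    using sq_int_inner[OF el_proc_sq_int[OF assms(1)] el_proc_sq_int[OF assms(2)], of t]
    by (simp add: f_def split_beta')
  then have "(\<integral>x. case_prod f x \<partial>time_prob M t) = (LINT s:{0..t}|lborel. (\<integral>w. f s w \<partial>M))"
    by (rule integral_time_prob'[symmetric])
  also have "\<dots> = (LINT s:{max a c<..min b d}|lborel. expectation (\<lambda>w. \<xi> w \<bullet> \<eta> w))"
    unfolding set_lebesgue_integral_def
  proof (intro Bochner_Integration.integral_cong refl)
    fix s
    have "f s = (\<lambda>w. indicator {max a c<..min b d} s * (\<xi> w \<bullet> \<eta> w))"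
      by (auto simp: f_def xy el_proc_def indicator_def)
    then have "expectation (f s) = indicator {max a c<..min b d} s * expectation (\<lambda>w. \<xi> w \<bullet> \<eta> w)"
      by simp
    then show "indicator {0..t} s *\<^sub>R expectation (f s)
        = indicator {max a c<..min b d} s *\<^sub>R expectation (\<lambda>w. \<xi> w \<bullet> \<eta> w)"
      using m by (auto simp: indicator_def)
  qed
  also have "\<dots> = max 0 (min b d - max a c) * expectation (\<lambda>w. \<xi> w \<bullet> \<eta> w)"
    by (auto simp: set_integral_const max_def)
  also have "\<dots> = expectation (\<lambda>w. el_ito [x] w \<bullet> el_ito [y] w)"
  proof (cases "a \<le> c")
    case True then show ?thesis using el_isometry_single_ord[OF ok] by (simp add: xy max_def)
  next
    case False then show ?thesis using el_isometry_single_ord[OF ok(2,1)]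
      by (simp add: xy max_def min.commute inner_commute)
  qed
  finally show ?thesis by (simp add: f_def split_beta')
qed

text \<open>The isometry is kept in bilinear form because the product rule pairs two different
  integrals.\<close>

lemma el_isometry:
  assumes "el_ok t xs" "el_ok t ys" "0 \<le> t"
  shows "expectation (\<lambda>w. el_ito xs w \<bullet> el_ito ys w)
    = (\<integral>z. case_prod (el_proc xs) z \<bullet> case_prod (el_proc ys) z \<partial>time_prob M t)"
proof -
  have 1: "expectation (\<lambda>w. el_ito [x] w \<bullet> el_ito ys w)
      = (\<integral>z. case_prod (el_proc [x]) z \<bullet> case_prod (el_proc ys) z \<partial>time_prob M t)"
    if "el_ok t [x]" "el_ok t ys" for x ys
    using that(2)
  proof (induction ys)
    case (Cons y ys)
    then have ok: "el_ok t [y]" "el_ok t ys" using el_ok_Cons[of t y ys] by auto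
    show ?case
      using sq_int_inner[OF el_ito_sq_int[OF that(1)] el_ito_sq_int[OF ok(1)]]
        sq_int_inner[OF el_ito_sq_int[OF that(1)] el_ito_sq_int[OF ok(2)]]
        sq_int_inner[OF el_proc_sq_int[OF that(1), of t] el_proc_sq_int[OF ok(1), of t]]
        sq_int_inner[OF el_proc_sq_int[OF that(1), of t] el_proc_sq_int[OF ok(2), of t]]
        el_isometry_single[OF that(1) ok(1) assms(3)] Cons.IH[OF ok(2)]
      by (simp add: el_ito_Cons[of y ys] el_proc_Cons[of y ys] inner_add_right split_beta')
  qed (simp add: el_ito_Nil el_proc_Nil split_beta')
  show ?thesis using assms(1)
  proof (induction xs)
    case (Cons x xs)
    then have ok: "el_ok t [x]" "el_ok t xs" using el_ok_Cons[of t x xs] by auto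
    show ?case
      using sq_int_inner[OF el_ito_sq_int[OF ok(1)] el_ito_sq_int[OF assms(2)]]
        sq_int_inner[OF el_ito_sq_int[OF ok(2)] el_ito_sq_int[OF assms(2)]]
        sq_int_inner[OF el_proc_sq_int[OF ok(1), of t] el_proc_sq_int[OF assms(2), of t]]
        sq_int_inner[OF el_proc_sq_int[OF ok(2), of t] el_proc_sq_int[OF assms(2), of t]]
        1[OF ok(1) assms(2)] Cons.IH[OF ok(2)]
      by (simp add: el_ito_Cons[of x xs] el_proc_Cons[of x xs] inner_add_left split_beta')
  qed (simp add: el_ito_Nil el_proc_Nil split_beta')
qed

lemma el_isometry_norm:
  "el_ok t xs \<Longrightarrow> 0 \<le> t \<Longrightarrow> expectation (\<lambda>w. (norm (el_ito xs w))\<^sup>2) = (\<integral>z. (norm (case_prod (el_proc xs) z))\<^sup>2 \<partial>time_prob M t)"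
  using el_isometry[of t xs xs] by (simp add: power2_norm_eq_inner)

text \<open>Weak martingale property. What an entry contributes after r is an increment that starts
  at max a r, when eta and the value of the entry are both known; independence then gives mean
  zero.\<close>

lemma el_increment_orthogonal:
  assumes "el_ok t xs" "0 \<le> r" "r \<le> t" "\<eta> \<in> borel_measurable (F r)" "sq_int M \<eta>"
  shows "expectation (\<lambda>w. \<eta> w \<bullet> (el_ito (el_trunc t xs) w - el_ito (el_trunc r xs) w)) = 0"
  using assms(1)
proof (induction xs)
  case (Cons x xs)
  then have ok: "el_ok t [x]" "el_ok t xs" using el_ok_Cons[of t x xs] by auto
  obtain a b \<xi> where x: "x = (a, b, \<xi>)" by (cases x)
  note m = el_ok_measurable[OF ok(1)[unfolded x]]
  obtain C where C: "C \<ge> 0" "\<forall>w\<in>space M. norm (\<xi> w) \<le> C" using m(6) by auto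
  have s: "sq_int M \<xi>"
    by (rule sq_int_bound[OF sq_int_const[of M "1::real"] m(2)]) (use C finite_measure_axioms in auto)
  have z: "expectation (\<lambda>w. \<eta> w \<bullet> (el_ito (el_trunc t [x]) w - el_ito (el_trunc r [x]) w)) = 0"
  proof (cases "b \<le> r")
    case True
    then have "min t b = b" "min t a = a" "min r b = b" "min r a = a" using m(3-5) assms(3) by auto
    then show ?thesis using m True assms by (simp add: el_trunc_def x el_ito_def)
  next
    case False
    have mm: "(\<lambda>w. \<eta> w \<bullet> \<xi> w) \<in> borel_measurable (F (max a r))"
      using measurable_F_mono[OF _ m(1)] measurable_F_mono[OF _ assms(4)] by (intro borel_measurable_inner) auto
    have "\<eta> w \<bullet> (el_ito (el_trunc t [x]) w - el_ito (el_trunc r [x]) w) = (\<eta> w \<bullet> \<xi> w) * (W b w - W (max a r) w)" for w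
      using m False assms(3) by (auto simp: el_trunc_def x el_ito_def min_def max_def scaleR_left_diff_distrib[symmetric])
    then show ?thesis
      using mult_increment_mean[OF _ _ mm sq_int_inner[OF assms(5) s], of b] m False assms(2) by simp
  qed
  have tr: "el_trunc u (x # xs) = hd (el_trunc u [x]) # el_trunc u xs" "el_trunc u [x] = [hd (el_trunc u [x])]" for u
    by (simp_all add: el_trunc_def)
  have eq: "el_ito (el_trunc u (x # xs)) w = el_ito (el_trunc u [x]) w + el_ito (el_trunc u xs) w" for u w
    using el_ito_Cons[of "hd (el_trunc u [x])" "el_trunc u xs"] tr[of u] by simp
  have 0: "0 \<le> t" using assms by simp
  have i: "integrable M (\<lambda>w. \<eta> w \<bullet> (el_ito (el_trunc t ys) w - el_ito (el_trunc r ys) w))" if "el_ok t ys" for ys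
    by (intro sq_int_inner[OF assms(5)] sq_int_diff el_ito_sq_int[OF el_ok_trunc[OF that]] 0 assms(2))
  have "\<eta> w \<bullet> (el_ito (el_trunc t (x # xs)) w - el_ito (el_trunc r (x # xs)) w) =
    \<eta> w \<bullet> (el_ito (el_trunc t [x]) w - el_ito (el_trunc r [x]) w) + \<eta> w \<bullet> (el_ito (el_trunc t xs) w - el_ito (el_trunc r xs) w)" for w
    by (simp add: eq inner_diff_right inner_add_right)
  then show ?case using z Cons.IH[OF ok(2)] i[OF ok(1)] i[OF ok(2)] by simp
qed (simp add: el_trunc_def el_ito_def)

lemma el_ito_trunc_full: "el_ok t xs \<Longrightarrow> el_ito (el_trunc t xs) w = el_ito xs w"
  by (induction xs) (auto simp: el_ok_def el_trunc_def el_ito_def)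

end

section \<open>Approximation by step processes\<close>

text \<open>Testing f by Cauchy-Schwarz against the constant v, its own integral, gives |v|^4 on the
  left and |v|^2 as a factor on the right.\<close>

lemma norm_integral_sq_le:
  fixes f :: "'a \<Rightarrow> 'b::euclidean_space"
  assumes "finite_measure N" "sq_int N f"
  shows "(norm (\<integral>x. f x \<partial>N))\<^sup>2 \<le> measure N (space N) * (\<integral>x. (norm (f x))\<^sup>2 \<partial>N)"
proof -
  interpret finite_measure N by fact
  define v where "v = (\<integral>x. f x \<partial>N)"
  have i: "integrable N f" using sq_int_integrable_finite[OF assms] .
  have "(v \<bullet> v)\<^sup>2 = (\<integral>x. f x \<bullet> v \<partial>N)\<^sup>2" using i by (simp add: v_def)
  also have "\<dots> \<le> (\<integral>x. (norm (f x))\<^sup>2 \<partial>N) * (\<integral>x. (norm v)\<^sup>2 \<partial>N)"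
    by (rule sq_int_Cauchy_Schwarz[OF assms(2) sq_int_const[OF assms(1)]])
  also have "\<dots> = (measure N (space N) * (\<integral>x. (norm (f x))\<^sup>2 \<partial>N)) * (v \<bullet> v)"
    by (simp add: power2_norm_eq_inner)
  finally have *: "(v \<bullet> v) * (v \<bullet> v) \<le> (measure N (space N) * (\<integral>x. (norm (f x))\<^sup>2 \<partial>N)) * (v \<bullet> v)"
    by (simp add: power2_eq_square)
  have "v \<bullet> v \<le> measure N (space N) * (\<integral>x. (norm (f x))\<^sup>2 \<partial>N)"
  proof (cases "v = 0")
    case False then show ?thesis using * by (simp add: mult_le_cancel_right)
  qed (simp add: zero_le_mult_iff)
  then show ?thesis by (simp add: power2_norm_eq_inner v_def)
qed

lemma norm_set_integral_sq_le:
  fixes f :: "real \<Rightarrow> 'b::euclidean_space"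
  assumes "a \<le> b" "A \<in> sets lborel" "A \<subseteq> {a..b}" "sq_int (restrict_space lborel {a..b}) f"
  shows "(norm (LINT s:A|lborel. f s))\<^sup>2 \<le> measure lborel A * (LINT s:A|lborel. (norm (f s))\<^sup>2)"
proof -
  have fin: "emeasure lborel A < \<infinity>"
    using emeasure_mono[OF assms(3), of lborel] by (simp add: emeasure_lborel_Icc_eq) (auto simp: le_less_trans)
  have fA: "finite_measure (restrict_space lborel A)"
    using fin assms(2) by (intro finite_measureI) (simp add: emeasure_restrict_space space_restrict_space)
  have m: "(\<lambda>x. indicator {a..b} x *\<^sub>R f x) \<in> borel_measurable lborel"
    using sq_int_measurable[OF assms(4)] by (rule borel_measurable_restrict_space_iff[THEN iffD1, rotated]) simp
  have i: "integrable lborel (\<lambda>x. indicator {a..b} x *\<^sub>R (norm (f x))\<^sup>2)"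
    using assms(4) by (subst integrable_restrict_space[symmetric]) (auto simp: sq_int_def)
  have "sq_int (restrict_space lborel A) f"
    unfolding sq_int_def
  proof
    have "(\<lambda>x. indicator A x *\<^sub>R (indicator {a..b} x *\<^sub>R f x)) \<in> borel_measurable lborel"
      by (rule borel_measurable_scaleR[OF borel_measurable_indicator[OF assms(2)] m])
    also have "(\<lambda>x. indicator A x *\<^sub>R (indicator {a..b} x *\<^sub>R f x)) = (\<lambda>x. indicator A x *\<^sub>R f x)"
      using assms(3) by (intro ext) (auto simp: indicator_def)
    finally show "f \<in> borel_measurable (restrict_space lborel A)"
      by (rule borel_measurable_restrict_space_iff[THEN iffD2, rotated]) (use assms(2) in simp)
    have "integrable lborel (\<lambda>x. indicator A x *\<^sub>R (indicator {a..b} x *\<^sub>R (norm (f x))\<^sup>2))"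
      using i assms(2) by (rule integrable_mult_indicator[rotated])
    also have "(\<lambda>x. indicator A x *\<^sub>R (indicator {a..b} x *\<^sub>R (norm (f x))\<^sup>2)) = (\<lambda>x. indicator A x *\<^sub>R (norm (f x))\<^sup>2)"
      using assms(3) by (intro ext) (auto simp: indicator_def)
    finally show "integrable (restrict_space lborel A) (\<lambda>x. (norm (f x))\<^sup>2)"
      using assms(2) by (subst integrable_restrict_space) auto
  qed
  from norm_integral_sq_le[OF fA this] show ?thesis
    using assms(2) by (simp add: set_lebesgue_integral_def integral_restrict_space measure_restrict_space space_restrict_space)
qed

section \<open>Uniform cells and delayed averages in time\<close>

definition cell :: "real \<Rightarrow> nat \<Rightarrow> nat \<Rightarrow> real set" where
  "cell T n i = {T * real i / real n <.. T * real (Suc i) / real n}"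

definition cell_mean :: "real \<Rightarrow> nat \<Rightarrow> (real \<Rightarrow> 'b::euclidean_space) \<Rightarrow> nat \<Rightarrow> 'b" where
  "cell_mean T n f i = (case i of 0 \<Rightarrow> 0 | Suc j \<Rightarrow> (real n / T) *\<^sub>R (LINT r:cell T n j|lborel. f r))"

text \<open>Averages are delayed by one cell so that the averaged process stays adapted.\<close>

definition delayed_mean :: "real \<Rightarrow> nat \<Rightarrow> (real \<Rightarrow> 'b::euclidean_space) \<Rightarrow> real \<Rightarrow> 'b" where
  "delayed_mean T n f s = (\<Sum>i<n. indicator (cell T n i) s *\<^sub>R cell_mean T n f i)"

lemma cell_unique:
  assumes "0 < T" "0 < n" "s \<in> {0<..T}"
  obtains k where "k < n" "s \<in> cell T n k" "\<And>i. i \<noteq> k \<Longrightarrow> s \<notin> cell T n i"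
proof -
  define x where "x = real n * s / T"
  have x: "0 < x" "x \<le> real n" using assms by (auto simp: x_def field_simps)
  \<comment> \<open>Cells are open on the left, hence the ceiling: the index wanted is the k with k
    < x <= k + 1.\<close>
  define k where "k = nat (\<lceil>x\<rceil> - 1)"
  have c: "1 \<le> \<lceil>x\<rceil>" using x(1) by (simp add: one_le_ceiling)
  have rk: "real k = of_int \<lceil>x\<rceil> - 1" using c by (simp add: k_def)
  have in_cell: "s \<in> cell T n i \<longleftrightarrow> real i < x \<and> x \<le> real i + 1" for i
    using assms by (auto simp: cell_def x_def field_simps)
  have sk: "s \<in> cell T n k" unfolding in_cell rk by linarith
  have "k < n"
  proof -
    have "\<lceil>x\<rceil> \<le> int n" using x(2) by (simp add: ceiling_le_iff)
    then show ?thesis using c unfolding k_def by linarith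
  qed
  moreover have "s \<notin> cell T n i" if "i \<noteq> k" for i
  proof
    assume "s \<in> cell T n i"
    then have "real i < x" "x \<le> real i + 1" using in_cell by auto
    moreover have "real k < x" "x \<le> real k + 1" using sk in_cell by auto
    ultimately have "real i < real k + 1" "real k < real i + 1" by auto
    then show False using that by linarith
  qed
  ultimately show ?thesis using sk that by blast
qed

lemma cell_outside: "0 < T \<Longrightarrow> s \<notin> {0<..T} \<Longrightarrow> i < n \<Longrightarrow> s \<notin> cell T n i"
proof
  assume a: "0 < T" "s \<notin> {0<..T}" "i < n" "s \<in> cell T n i"
  then have "T * real i / real n < s" "s \<le> T * real (Suc i) / real n" by (auto simp: cell_def)
  moreover have "T * real (Suc i) \<le> T * real n" using a by (intro mult_left_mono) auto
  then have "T * real (Suc i) / real n \<le> T" "0 \<le> T * real i / real n"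
    using a by (auto simp: divide_le_eq)
  ultimately show False using a(2) by auto
qed

text \<open>At most one cell contains s, so the sum merely selects a value. Norms, squares and
  bounds can then be taken through the sum.\<close>

lemma cell_sum:
  fixes x :: "nat \<Rightarrow> 'b::real_vector"
  assumes "0 < T" "0 < n"
  shows "(\<Sum>i<n. indicator (cell T n i) s *\<^sub>R x i) = (if s \<in> {0<..T} then x (SOME k. k < n \<and> s \<in> cell T n k) else 0)"
    and "s \<in> {0<..T} \<Longrightarrow> (SOME k. k < n \<and> s \<in> cell T n k) < n"
    and "s \<in> {0<..T} \<Longrightarrow> s \<in> cell T n (SOME k. k < n \<and> s \<in> cell T n k)"
proof -
  define P where "P = (\<lambda>k. k < n \<and> s \<in> cell T n k)"
  have *: "(SOME k. P k) < n \<and> s \<in> cell T n (SOME k. P k) \<and> (\<forall>i. i \<noteq> (SOME k. P k) \<longrightarrow> s \<notin> cell T n i)" if s: "s \<in> {0<..T}"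
  proof -
    obtain k where k: "k < n" "s \<in> cell T n k" "\<And>i. i \<noteq> k \<Longrightarrow> s \<notin> cell T n i"
      using cell_unique[OF assms s] by blast
    then have "(SOME k. P k) = k" unfolding P_def by (intro some_equality) auto
    then show ?thesis using k by simp
  qed
  then show "s \<in> {0<..T} \<Longrightarrow> (SOME k. k < n \<and> s \<in> cell T n k) < n"
    "s \<in> {0<..T} \<Longrightarrow> s \<in> cell T n (SOME k. k < n \<and> s \<in> cell T n k)" by (auto simp: P_def)
  show "(\<Sum>i<n. indicator (cell T n i) s *\<^sub>R x i) = (if s \<in> {0<..T} then x (SOME k. k < n \<and> s \<in> cell T n k) else 0)"
  proof (cases "s \<in> {0<..T}")
    case True
    then have "(\<Sum>i<n. indicator (cell T n i) s *\<^sub>R x i) = (\<Sum>i<n. if i = (SOME k. P k) then x i else 0)"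
      using * by (intro sum.cong) (auto simp: indicator_def)
    also have "\<dots> = x (SOME k. P k)" using *[OF True] by (simp add: sum.delta)
    finally show ?thesis using True by (simp add: P_def)
  next
    case False
    then show ?thesis using cell_outside[OF assms(1) False, of _ n] by (auto simp: indicator_def intro!: sum.neutral)
  qed
qed

lemma cell_sets[measurable]: "cell T n i \<in> sets borel"
  by (simp add: cell_def)

lemma cell_measure: "0 < T \<Longrightarrow> measure lborel (cell T n i) = T / real n"
  by (simp add: cell_def diff_divide_distrib[symmetric] divide_right_mono field_simps)

lemma cell_emeasure: "emeasure lborel (cell T n i) < \<infinity>"
proof -
  have "emeasure lborel (cell T n i) \<le> emeasure lborel {T * real i / real n..T * real (Suc i) / real n}"
    by (rule emeasure_mono) (auto simp: cell_def)
  also have "\<dots> < \<infinity>" by (simp add: emeasure_lborel_Icc_eq)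
  finally show ?thesis .
qed

lemma cell_subset: "0 < T \<Longrightarrow> i < n \<Longrightarrow> cell T n i \<subseteq> {0..T}"
proof
  fix s assume "0 < T" "i < n" "s \<in> cell T n i"
  then have "s \<in> {0<..T}" using cell_outside by blast
  then show "s \<in> {0..T}" by auto
qed

abbreviation time_measure :: "real \<Rightarrow> real measure" where
  "time_measure T \<equiv> restrict_space lborel {0..T}"

lemma time_measure_space: "space (time_measure T) = {0..T}"
  by (simp add: space_restrict_space)

lemma delayed_mean_measurable: "delayed_mean T n f \<in> borel_measurable (time_measure T)"
  unfolding delayed_mean_def by (intro measurable_restrict_space1) measurable

lemma finite_time_measure: "finite_measure (time_measure T)"
  by (intro finite_measureI) (simp add: emeasure_restrict_space space_restrict_space emeasure_lborel_Icc_eq)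

lemma delayed_mean_bounded: "0 < T \<Longrightarrow> 0 < n \<Longrightarrow> norm (delayed_mean T n f s) \<le> (\<Sum>i<n. norm (cell_mean T n f i))"
  unfolding delayed_mean_def
  by (rule order_trans[OF norm_sum], rule sum_mono) (simp add: indicator_def)

lemma delayed_mean_sq_int: "0 < T \<Longrightarrow> 0 < n \<Longrightarrow> sq_int (time_measure T) (delayed_mean T n f)"
  using delayed_mean_bounded[of T n f]
  by (intro sq_int_bound[OF sq_int_const[OF finite_time_measure, of _ "1::real"] delayed_mean_measurable,
      where c = "\<Sum>i<n. norm (cell_mean T n f i)"]) auto

lemma sq_int_time_set_integrable:
  assumes "sq_int (time_measure T) f" "A \<in> sets borel" "A \<subseteq> {0..T}"
  shows "set_integrable lborel A f"
proof -
  have "integrable (time_measure T) f"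
    using sq_int_integrable_finite[OF finite_time_measure assms(1)] .
  then have "set_integrable lborel {0..T} f"
    by (simp add: set_integrable_def integrable_restrict_space)
  then show ?thesis by (rule set_integrable_subset) (use assms in auto)
qed

text \<open>Jensen's inequality on each cell. The delay moves every contribution to the next cell,
  so that the mass of the last cell is lost and none is added. The bound is uniform in n, which
  makes the later density argument work.\<close>

lemma delayed_mean_contraction:
  fixes f :: "real \<Rightarrow> 'b::euclidean_space"
  assumes T: "0 < T" and n: "0 < n" and f: "sq_int (time_measure T) f"
  shows "(\<integral>s. (norm (delayed_mean T n f s))\<^sup>2 \<partial>time_measure T) \<le> (\<integral>s. (norm (f s))\<^sup>2 \<partial>time_measure T)"
proof -
  define g where "g s = (norm (f s))\<^sup>2" for s
  have gi: "set_integrable lborel {0..T} g"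
    using sq_int_integrable[OF f] by (simp add: set_integrable_def integrable_restrict_space g_def)
  have gc: "set_integrable lborel (cell T n i) g" if "i < n" for i
    by (rule set_integrable_subset[OF gi]) (use cell_subset[OF T that] in auto)
  have cm: "(norm (cell_mean T n f i))\<^sup>2 * (T / real n) \<le> (case i of 0 \<Rightarrow> 0 | Suc j \<Rightarrow> (LINT r:cell T n j|lborel. g r))" if "i < n" for i
  proof (cases i)
    case (Suc j)
    then have j: "j < n" using that by simp
    have "(norm (LINT s:cell T n j|lborel. f s))\<^sup>2 \<le> measure lborel (cell T n j) * (LINT s:cell T n j|lborel. (norm (f s))\<^sup>2)"
      by (rule norm_set_integral_sq_le[where a=0 and b=T]) (use cell_subset[OF T j] T f in auto)
    then have b: "(norm (LINT s:cell T n j|lborel. f s))\<^sup>2 \<le> T / real n * (LINT s:cell T n j|lborel. g s)"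
      by (simp add: cell_measure[OF T] g_def)
    have "(norm (cell_mean T n f i))\<^sup>2 * (T / real n) = (real n / T) * (norm (LINT s:cell T n j|lborel. f s))\<^sup>2"
      using T n by (simp add: cell_mean_def Suc power_mult_distrib power2_eq_square)
    also have "\<dots> \<le> (real n / T) * (T / real n * (LINT s:cell T n j|lborel. g s))"
      using T by (intro mult_left_mono b) auto
    also have "\<dots> = (LINT s:cell T n j|lborel. g s)" using T n by simp
    finally show ?thesis by (simp add: Suc)
  qed (simp add: cell_mean_def)
  have sq: "(norm (delayed_mean T n f s))\<^sup>2 = (\<Sum>i<n. indicator (cell T n i) s *\<^sub>R (norm (cell_mean T n f i))\<^sup>2)" for s
    unfolding delayed_mean_def cell_sum(1)[OF T n] by simp
  have ind: "indicator {0..T} s *\<^sub>R (indicator (cell T n i) s *\<^sub>R x) = indicator (cell T n i) s *\<^sub>R x" if "i < n" for i s and x :: real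
    using cell_subset[OF T that] by (auto simp: indicator_def)
  have celli: "integrable lborel (\<lambda>s. indicator (cell T n i) s *\<^sub>R (x::real))" for i x
    using cell_emeasure[of T n i] by (simp add: integrable_indicator_iff)
  have "(\<integral>s. (norm (delayed_mean T n f s))\<^sup>2 \<partial>time_measure T)
      = (\<integral>s. (\<Sum>i<n. indicator (cell T n i) s *\<^sub>R (norm (cell_mean T n f i))\<^sup>2) \<partial>lborel)"
    unfolding sq
    by (subst integral_restrict_space, simp)
      (simp only: scaleR_sum_right, intro Bochner_Integration.integral_cong sum.cong refl ind, simp)
  also have "\<dots> = (\<Sum>i<n. (norm (cell_mean T n f i))\<^sup>2 * (T / real n))"
    by (subst Bochner_Integration.integral_sum[OF celli]) (simp add: cell_measure[OF T] mult.commute)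
  also have "\<dots> \<le> (\<Sum>i<n. (case i of 0 \<Rightarrow> 0 | Suc j \<Rightarrow> (LINT r:cell T n j|lborel. g r)))"
    by (intro sum_mono cm) auto
  \<comment> \<open>The first cell carries the value 0, and cell j + 1 carries the mean over cell j;
    the last cell is never averaged.\<close>
  also have "\<dots> = (\<Sum>j<n - 1. (LINT r:cell T n j|lborel. g r))"
  proof -
    obtain m where "n = Suc m" using n by (cases n) auto
    then show ?thesis by (simp only: sum.lessThan_Suc_shift) simp
  qed
  also have "\<dots> \<le> (\<Sum>j<n. (LINT r:cell T n j|lborel. g r))"
    by (intro sum_mono2) (auto simp: g_def set_lebesgue_integral_def)
  also have "\<dots> = (\<integral>r. (\<Sum>j<n. indicator (cell T n j) r *\<^sub>R g r) \<partial>lborel)"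
    unfolding set_lebesgue_integral_def
    using gc by (subst Bochner_Integration.integral_sum) (auto simp: set_integrable_def)
  also have "\<dots> \<le> (LINT r:{0..T}|lborel. g r)"
    unfolding set_lebesgue_integral_def
  proof (rule integral_mono)
    show "integrable lborel (\<lambda>r. \<Sum>j<n. indicator (cell T n j) r *\<^sub>R g r)"
      using gc by (intro Bochner_Integration.integrable_sum) (simp add: set_integrable_def)
    show "integrable lborel (\<lambda>r. indicator {0..T} r *\<^sub>R g r)" using gi by (simp add: set_integrable_def)
    show "(\<Sum>j<n. indicator (cell T n j) r *\<^sub>R g r) \<le> indicator {0..T} r *\<^sub>R g r" for r
      unfolding cell_sum(1)[OF T n] by (auto simp: indicator_def g_def)
  qed
  also have "\<dots> = (\<integral>s. (norm (f s))\<^sup>2 \<partial>time_measure T)"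
    by (simp add: integral_restrict_space set_lebesgue_integral_def g_def)
  finally show ?thesis .
qed

lemma delayed_mean_add:
  assumes "0 < T" "0 < n" "sq_int (time_measure T) f" "sq_int (time_measure T) g"
  shows "delayed_mean T n (\<lambda>s. f s + g s) s = delayed_mean T n f s + delayed_mean T n g s"
proof -
  have "cell_mean T n (\<lambda>s. f s + g s) i = cell_mean T n f i + cell_mean T n g i" if "i < n" for i
  proof (cases i)
    case (Suc j)
    then have "cell T n j \<subseteq> {0..T}" using cell_subset[OF assms(1)] that by simp
    then show ?thesis using sq_int_time_set_integrable[OF assms(3), of "cell T n j"]
        sq_int_time_set_integrable[OF assms(4), of "cell T n j"]
      by (simp add: cell_mean_def Suc set_integral_add scaleR_add_right)
  qed (simp add: cell_mean_def)
  then show ?thesis by (simp add: delayed_mean_def scaleR_add_right sum.distrib)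
qed

lemma delayed_mean_scaleR_right:
  "delayed_mean T n (\<lambda>s. c *\<^sub>R f s) s = c *\<^sub>R delayed_mean T n f s"
proof -
  have eq: "cell_mean T n (\<lambda>s. c *\<^sub>R f s) i = c *\<^sub>R cell_mean T n f i" for i
    by (cases i) (simp_all add: cell_mean_def mult.commute)
  show ?thesis unfolding delayed_mean_def scaleR_sum_right eq
    by (intro sum.cong refl) (rule scaleR_left_commute)
qed

lemma delayed_mean_scaleR_left:
  fixes f :: "real \<Rightarrow> real"
  assumes "0 < T" "0 < n" "sq_int (time_measure T) f"
  shows "delayed_mean T n (\<lambda>s. f s *\<^sub>R v) s = delayed_mean T n f s *\<^sub>R v"
proof -
  have "cell_mean T n (\<lambda>s. f s *\<^sub>R v) i = cell_mean T n f i *\<^sub>R v" if "i < n" for i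
  proof (cases i)
    case (Suc j)
    then have "cell T n j \<subseteq> {0..T}" using cell_subset[OF assms(1)] that by simp
    then have "integrable lborel (\<lambda>r. indicator (cell T n j) r *\<^sub>R f r)"
      using sq_int_time_set_integrable[OF assms(3), of "cell T n j"] by (simp add: set_integrable_def)
    then have "(\<integral>r. (indicator (cell T n j) r *\<^sub>R f r) *\<^sub>R v \<partial>lborel) = (LINT r:cell T n j|lborel. f r) *\<^sub>R v"
      unfolding set_lebesgue_integral_def by (rule integral_scaleR_left)
    then have "(LINT r:cell T n j|lborel. f r *\<^sub>R v) = (LINT r:cell T n j|lborel. f r) *\<^sub>R v"
      by (simp only: set_lebesgue_integral_def scaleR_scaleR real_scaleR_def)
    then show ?thesis by (simp add: cell_mean_def Suc)
  qed (simp add: cell_mean_def)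
  then show ?thesis unfolding delayed_mean_def scaleR_sum_left
    by (intro sum.cong refl) simp
qed

text \<open>\<open>Suc n\<close> excludes partitions without cells.\<close>

definition mean_converges :: "real \<Rightarrow> (real \<Rightarrow> 'b::euclidean_space) \<Rightarrow> bool" where
  "mean_converges T f \<longleftrightarrow> l2_lim (time_measure T) (\<lambda>n. delayed_mean T (Suc n) f) f"

lemma mean_converges_add:
  assumes "0 < T" "mean_converges T f" "mean_converges T g" shows "mean_converges T (\<lambda>s. f s + g s)"
proof -
  have "sq_int (time_measure T) f" "sq_int (time_measure T) g"
    using assms by (auto simp: mean_converges_def l2_lim_def)
  then have eq: "delayed_mean T (Suc n) (\<lambda>s. f s + g s) = (\<lambda>s. delayed_mean T (Suc n) f s + delayed_mean T (Suc n) g s)" for n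
    using delayed_mean_add[OF assms(1) zero_less_Suc] by (intro ext)
  show ?thesis using l2_lim_add[of "time_measure T"] assms(2,3) unfolding mean_converges_def eq by blast
qed

lemma mean_converges_scaleR: "mean_converges T f \<Longrightarrow> mean_converges T (\<lambda>s. c *\<^sub>R f s)"
  by (auto simp: mean_converges_def delayed_mean_scaleR_right[abs_def] intro!: l2_lim_scaleR)

lemma mean_converges_scaleR_left:
  fixes f :: "real \<Rightarrow> real"
  assumes "0 < T" "mean_converges T f" shows "mean_converges T (\<lambda>s. f s *\<^sub>R v)"
proof -
  have f: "sq_int (time_measure T) f" using assms by (auto simp: mean_converges_def l2_lim_def)
  have sv: "sq_int (time_measure T) (\<lambda>s. g s *\<^sub>R v)" if "sq_int (time_measure T) g" for g :: "real \<Rightarrow> real"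
    using that by (rule sq_int_bound[where c = "norm v"]) (use sq_int_measurable[OF that] in \<open>auto simp: mult.commute\<close>)
  have "(\<lambda>k. norm v ^ 2 * (\<integral>x. (norm (delayed_mean T (Suc k) f x - f x))\<^sup>2 \<partial>time_measure T)) \<longlonglongrightarrow> norm v ^ 2 * 0"
    using assms by (intro tendsto_intros) (auto simp: mean_converges_def l2_lim_def)
  moreover have "(norm (delayed_mean T (Suc k) (\<lambda>s. f s *\<^sub>R v) x - f x *\<^sub>R v))\<^sup>2
      = norm v ^ 2 * (norm (delayed_mean T (Suc k) f x - f x))\<^sup>2" for k x
    unfolding delayed_mean_scaleR_left[OF assms(1) zero_less_Suc f] scaleR_diff_left[symmetric]
    by (simp add: power_mult_distrib mult.commute)
  ultimately have "(\<lambda>k. \<integral>x. (norm (delayed_mean T (Suc k) (\<lambda>s. f s *\<^sub>R v) x - f x *\<^sub>R v))\<^sup>2 \<partial>time_measure T) \<longlonglongrightarrow> 0"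
    by simp
  then show ?thesis
    unfolding mean_converges_def l2_lim_def using sv[OF f] delayed_mean_sq_int[OF assms(1) zero_less_Suc] by auto
qed

text \<open>Averaging is a contraction uniformly in the number of cells, so an approximation of g
  within L2 is also an approximation of its averages.\<close>

lemma mean_converges_closed:
  assumes T: "0 < T" and f: "\<And>k. mean_converges T (f k)" and lim: "l2_lim (time_measure T) f g"
  shows "mean_converges T g"
proof -
  have g: "sq_int (time_measure T) g" and fk: "\<And>k. sq_int (time_measure T) (f k)" using lim by (auto simp: l2_lim_def)
  define e where "e k = (\<integral>x. (norm (f k x - g x))\<^sup>2 \<partial>time_measure T)" for k
  have e: "e \<longlonglongrightarrow> 0" using lim by (simp add: e_def[abs_def] l2_lim_def)
  define d where "d k n = (\<integral>x. (norm (delayed_mean T (Suc n) (f k) x - f k x))\<^sup>2 \<partial>time_measure T)" for k n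
  have d: "d k \<longlonglongrightarrow> 0" for k using f[of k] by (simp add: d_def[abs_def] l2_lim_def mean_converges_def)
  \<comment> \<open>The inequality |x + y|^2 <= 2|x|^2 + 2|y|^2 is used twice: 2 d for the error of
    \<open>f k\<close>, and 2 (e + e) doubled for \<open>f k - g\<close> together with its
    average.\<close>
  have le: "(\<integral>x. (norm (delayed_mean T (Suc n) g x - g x))\<^sup>2 \<partial>time_measure T) \<le> 8 * e k + 2 * d k n" for k n
  proof -
    note s = sq_int_diff[OF fk[of k] g] delayed_mean_sq_int[OF T, of "Suc n"]
    have dm: "delayed_mean T (Suc n) g x = delayed_mean T (Suc n) (f k) x - delayed_mean T (Suc n) (\<lambda>s. f k s - g s) x" for x
      using delayed_mean_add[OF T, of "Suc n" g "\<lambda>s. f k s - g s" x] g s by simp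
    have "(\<integral>x. (norm (delayed_mean T (Suc n) g x - g x))\<^sup>2 \<partial>time_measure T) =
      (\<integral>x. (norm ((delayed_mean T (Suc n) (f k) x - f k x) + ((f k x - g x) - delayed_mean T (Suc n) (\<lambda>s. f k s - g s) x)))\<^sup>2 \<partial>time_measure T)"
      unfolding dm by (intro Bochner_Integration.integral_cong refl arg_cong[where f = "\<lambda>x. (norm x)\<^sup>2"]) (simp add: algebra_simps)
    also have "\<dots> \<le> 2 * d k n + 2 * (\<integral>x. (norm ((f k x - g x) + (- delayed_mean T (Suc n) (\<lambda>s. f k s - g s) x)))\<^sup>2 \<partial>time_measure T)"
      unfolding d_def using s fk
      by (intro order_trans[OF sq_int_integral_norm_add_le]) (auto intro!: sq_int_diff)
    also have "(\<integral>x. (norm ((f k x - g x) + (- delayed_mean T (Suc n) (\<lambda>s. f k s - g s) x)))\<^sup>2 \<partial>time_measure T)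
       \<le> 2 * e k + 2 * (\<integral>x. (norm (- delayed_mean T (Suc n) (\<lambda>s. f k s - g s) x))\<^sup>2 \<partial>time_measure T)"
      unfolding e_def using s by (intro sq_int_integral_norm_add_le sq_int_minus) auto
    also have "(\<integral>x. (norm (- delayed_mean T (Suc n) (\<lambda>s. f k s - g s) x))\<^sup>2 \<partial>time_measure T) \<le> e k"
      unfolding e_def using delayed_mean_contraction[OF T _ s(1), of "Suc n"] by simp
    finally show ?thesis by simp
  qed
  have "(\<lambda>n. \<integral>x. (norm (delayed_mean T (Suc n) g x - g x))\<^sup>2 \<partial>time_measure T) \<longlonglongrightarrow> 0"
  proof (rule LIMSEQ_I)
    fix r :: real assume r: "0 < r"
    \<comment> \<open>The shares exhaust the bound: 8 (r / 16) + 2 (r / 4) = r.\<close>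
    obtain k where k: "norm (e k - 0) < r / 16" using LIMSEQ_D[OF e, of "r / 16"] r by auto
    obtain N where N: "\<forall>n\<ge>N. norm (d k n - 0) < r / 4" using LIMSEQ_D[OF d[of k], of "r / 4"] r by auto
    have "norm ((\<integral>x. (norm (delayed_mean T (Suc n) g x - g x))\<^sup>2 \<partial>time_measure T) - 0) < r" if "n \<ge> N" for n
      using le[of n k] k N[rule_format, OF that] r by (auto simp: abs_less_iff)
    then show "\<exists>no. \<forall>n\<ge>no. norm ((\<integral>x. (norm (delayed_mean T (Suc n) g x - g x))\<^sup>2 \<partial>time_measure T) - 0) < r" by blast
  qed
  then show ?thesis
    unfolding mean_converges_def l2_lim_def using g delayed_mean_sq_int[OF T zero_less_Suc] by auto
qed

lemma l2_lim_dominated: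
  fixes f :: "nat \<Rightarrow> 'a \<Rightarrow> 'b::euclidean_space"
  assumes "\<And>k. f k \<in> borel_measurable N" "sq_int N g" "sq_int N h"
    and "AE x in N. (\<lambda>k. f k x) \<longlonglongrightarrow> g x" "\<And>k. AE x in N. norm (f k x) \<le> norm (h x)"
  shows "l2_lim N f g"
proof -
  have f: "sq_int N (f k)" for k
    using sq_int_bound[OF assms(3) assms(1)[of k], of 1] assms(5)[of k] by simp
  have "(\<lambda>k. \<integral>x. (norm (f k x - g x))\<^sup>2 \<partial>N) \<longlonglongrightarrow> (\<integral>x. 0 \<partial>N)"
  proof (rule integral_dominated_convergence[where w = "\<lambda>x. 2 * (norm (h x))\<^sup>2 + 2 * (norm (g x))\<^sup>2"])
    show "integrable N (\<lambda>x. 2 * (norm (h x))\<^sup>2 + 2 * (norm (g x))\<^sup>2)" using assms by (auto simp: sq_int_def)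
    show "AE x in N. (\<lambda>k. (norm (f k x - g x))\<^sup>2) \<longlonglongrightarrow> 0"
      using assms(4)
    proof eventually_elim
      case (elim x)
      then have "(\<lambda>k. (norm (f k x - g x))\<^sup>2) \<longlonglongrightarrow> (norm (g x - g x))\<^sup>2" by (intro tendsto_intros)
      then show ?case by simp
    qed
    show "AE x in N. norm ((norm (f k x - g x))\<^sup>2) \<le> 2 * (norm (h x))\<^sup>2 + 2 * (norm (g x))\<^sup>2" for k
      using assms(5)[of k]
    proof eventually_elim
      case (elim x)
      have "(norm (f k x))\<^sup>2 \<le> (norm (h x))\<^sup>2" using elim by (intro power_mono) auto
      then have "(norm (f k x - g x))\<^sup>2 \<le> 2 * (norm (h x))\<^sup>2 + 2 * (norm (g x))\<^sup>2"
        using norm_diff_sq_le[of "f k x" "g x"] by linarith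
      then show ?case by (simp only: real_norm_def abs_power2)
    qed
    show "(\<lambda>x. (norm (f k x - g x))\<^sup>2) \<in> borel_measurable N" for k
      using assms(1)[of k] sq_int_measurable[OF assms(2)] by measurable
  qed simp
  then show ?thesis using f assms(2) by (simp add: l2_lim_def)
qed

text \<open>The mean used at s is taken over the preceding cell, which lies within two cell widths
  to the left of s. The condition T / n < s keeps s out of the first cell, where the value is
  0.\<close>

lemma delayed_mean_locally_const:
  assumes T: "0 < T" and n: "0 < n" and s: "s \<le> T" "T / real n < s"
    and c: "\<And>r. s - 2 * T / real n \<le> r \<Longrightarrow> r \<le> s \<Longrightarrow> f r = c"
  shows "delayed_mean T n f s = c"
proof -
  have s0: "s \<in> {0<..T}" using s T n by (auto intro: less_trans[rotated])
  define k where "k = (SOME k. k < n \<and> s \<in> cell T n k)"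
  have k: "k < n" "s \<in> cell T n k" using cell_sum(2,3)[OF T n s0] by (auto simp: k_def)
  have "k \<noteq> 0"
  proof
    assume "k = 0"
    then show False using k(2) s by (simp add: cell_def)
  qed
  then obtain j where j: "k = Suc j" by (cases k) auto
  have b: "s - 2 * T / real n \<le> r" "r \<le> s" if "r \<in> cell T n j" for r
    using that k(2) T n by (simp_all add: cell_def j) (simp add: field_simps)
  have "cell_mean T n f k = (real n / T) *\<^sub>R (LINT r:cell T n j|lborel. c)"
    unfolding cell_mean_def j nat.case
    by (intro arg_cong[where f = "\<lambda>x. (real n / T) *\<^sub>R x"] set_lebesgue_integral_cong) (auto intro!: c b)
  also have "(LINT r:cell T n j|lborel. c) = (T / real n) *\<^sub>R c"
    using set_integral_const[of "cell T n j" lborel c] cell_emeasure[of T n j] by (simp add: cell_measure[OF T])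
  also have "(real n / T) *\<^sub>R (T / real n) *\<^sub>R c = c" using T n by simp
  finally show ?thesis using s0 by (simp add: delayed_mean_def cell_sum(1)[OF T n] k_def)
qed

lemma norm_set_integral_le:
  fixes f :: "real \<Rightarrow> 'b::euclidean_space"
  assumes "A \<in> sets lborel" "emeasure lborel A < \<infinity>" "\<And>r. r \<in> A \<Longrightarrow> norm (f r) \<le> c" "0 \<le> c"
  shows "norm (LINT r:A|lborel. f r) \<le> c * measure lborel A"
proof (cases "set_integrable lborel A f")
  case True
  have "norm (LINT r:A|lborel. f r) \<le> (\<integral>r. norm (indicator A r *\<^sub>R f r) \<partial>lborel)"
    unfolding set_lebesgue_integral_def by (rule integral_norm_bound)
  also have "\<dots> \<le> (\<integral>r. indicator A r *\<^sub>R c \<partial>lborel)"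
  proof (rule integral_mono)
    show "integrable lborel (\<lambda>r. norm (indicator A r *\<^sub>R f r))" using True by (simp only: set_integrable_def integrable_norm)
    show "integrable lborel (\<lambda>r. indicator A r *\<^sub>R c)" using assms(1,2) by (simp add: integrable_indicator_iff)
  qed (use assms(3) in \<open>auto simp: indicator_def\<close>)
  also have "\<dots> = c * measure lborel A" using assms(1) by (simp add: mult.commute)
  finally show ?thesis .
next
  case False
  \<comment> \<open>The integral of a non-integrable function is 0 by convention.\<close>
  then show ?thesis using assms(4) by (simp add: set_lebesgue_integral_def set_integrable_def not_integrable_integral_eq)
qed

lemma norm_cell_mean_le:
  assumes "0 < T" "0 < n" "\<And>r. r \<in> {0..T} \<Longrightarrow> norm (f r) \<le> c" "0 \<le> c" "i < n"
  shows "norm (cell_mean T n f i) \<le> c"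
proof (cases i)
  case (Suc j)
  then have j: "j < n" using assms by simp
  have "norm (LINT r:cell T n j|lborel. f r) \<le> c * measure lborel (cell T n j)"
    using assms cell_subset[OF assms(1) j] by (intro norm_set_integral_le cell_emeasure) auto
  then have "real n / T * norm (LINT r:cell T n j|lborel. f r) \<le> real n / T * (c * (T / real n))"
    using assms by (intro mult_left_mono) (auto simp: cell_measure)
  then show ?thesis using assms by (simp add: cell_mean_def Suc)
qed (simp add: cell_mean_def assms)

lemma norm_delayed_mean_le:
  assumes "0 < T" "0 < n" "\<And>r. r \<in> {0..T} \<Longrightarrow> norm (f r) \<le> c" "0 \<le> c"
  shows "norm (delayed_mean T n f s) \<le> c"
  using norm_cell_mean_le[OF assms] cell_sum(2)[OF assms(1,2)] assms(4)
  by (auto simp: delayed_mean_def cell_sum(1)[OF assms(1,2)])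

text \<open>Away from 0 and a the averaging window eventually lies where f is constant, so the
  averages are eventually exact there; dominated convergence does the rest.\<close>

lemma mean_converges_eventually_const:
  fixes f :: "real \<Rightarrow> real"
  assumes T: "0 < T" and f: "f \<in> borel_measurable borel" "\<And>s. \<bar>f s\<bar> \<le> 1"
    and c: "\<And>s. s \<noteq> a \<Longrightarrow> \<exists>e>0. \<forall>r. \<bar>r - s\<bar> < e \<longrightarrow> f r = f s"
  shows "mean_converges T f"
  unfolding mean_converges_def
proof (rule l2_lim_dominated[where h = "\<lambda>_. 1::real"])
  show "sq_int (time_measure T) f"
    using f by (intro sq_int_bound[OF sq_int_const[OF finite_time_measure, of _ "1::real"], where c = 1] measurable_restrict_space1) auto
  show "sq_int (time_measure T) (\<lambda>_. 1::real)" by (rule sq_int_const[OF finite_time_measure])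
  show "delayed_mean T (Suc k) f \<in> borel_measurable (time_measure T)" for k by (rule delayed_mean_measurable)
  have "AE s in lborel. s \<noteq> 0 \<and> s \<noteq> a" using AE_lborel_singleton[of 0] AE_lborel_singleton[of a] by eventually_elim auto
  then have "AE s in lborel. s \<in> {0..T} \<longrightarrow> (\<lambda>k. delayed_mean T (Suc k) f s) \<longlonglongrightarrow> f s"
  proof (rule AE_mp, intro AE_I2 impI)
    fix s assume elim: "s \<noteq> 0 \<and> s \<noteq> a" "s \<in> {0..T}"
    obtain e where e: "e > 0" "\<forall>r. \<bar>r - s\<bar> < e \<longrightarrow> f r = f s" using c elim by blast
    have lim: "(\<lambda>k. C * T / real (Suc k)) \<longlonglongrightarrow> 0" for C
      using tendsto_mult[OF tendsto_const[of "C * T"] LIMSEQ_inverse_real_of_nat] by (simp add: divide_inverse)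
    have s0: "0 < s" using elim by auto
    have "\<forall>\<^sub>F k in sequentially. 2 * T / real (Suc k) < e" using order_tendstoD(2)[OF lim[of 2] e(1)] .
    moreover have "\<forall>\<^sub>F k in sequentially. 1 * T / real (Suc k) < s" using order_tendstoD(2)[OF lim[of 1] s0] .
    ultimately have "\<forall>\<^sub>F k in sequentially. delayed_mean T (Suc k) f s = f s"
    proof eventually_elim
      case e2: (elim k)
      show ?case
      proof (rule delayed_mean_locally_const[OF T])
        fix r assume "s - 2 * T / real (Suc k) \<le> r" "r \<le> s"
        then show "f r = f s" by (intro e(2)[rule_format]) (use e2(1) in auto)
      qed (use elim e2 in auto)
    qed
    then show "(\<lambda>k. delayed_mean T (Suc k) f s) \<longlonglongrightarrow> f s" by (rule tendsto_eventually)
  qed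
  then show "AE s in time_measure T. (\<lambda>k. delayed_mean T (Suc k) f s) \<longlonglongrightarrow> f s"
    by (simp add: AE_restrict_space_iff)
  show "AE s in time_measure T. norm (delayed_mean T (Suc k) f s) \<le> norm (1::real)" for k
  proof (rule AE_I2)
    fix s
    show "norm (delayed_mean T (Suc k) f s) \<le> norm (1::real)"
      using norm_delayed_mean_le[OF T zero_less_Suc, of f 1] f by simp
  qed
qed

text \<open>Dynkin induction from half-lines: complements follow by linearity, disjoint unions by
  dominated convergence and closedness. This takes the place of a differentiation theorem for
  averages.\<close>

lemma mean_converges_indicator:
  assumes T: "0 < T" and "A \<in> sets borel"
  shows "mean_converges T (indicator A :: real \<Rightarrow> real)"
proof -
  have "Int_stable (range (\<lambda>a::real. {..a}))" by (auto simp: Int_stable_def)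
  moreover have "range (\<lambda>a::real. {..a}) \<subseteq> Pow UNIV" by simp
  moreover have "A \<in> sigma_sets UNIV (range (\<lambda>a::real. {..a}))"
    using assms by (simp add: borel_eq_atMost[where 'a=real])
  ultimately show ?thesis
  proof (induction rule: sigma_sets_induct_disjoint)
    case (basic B)
    then obtain a where B: "B = {..a}" by auto
    show ?case unfolding B
    proof (rule mean_converges_eventually_const[OF T, where a = a])
      fix s assume "s \<noteq> a"
      then show "\<exists>e>0. \<forall>r. \<bar>r - s\<bar> < e \<longrightarrow> (indicator {..a} r :: real) = indicator {..a} s"
        by (intro exI[of _ "\<bar>s - a\<bar>"]) (auto simp: indicator_def)
    qed (auto simp: indicator_def)
  next
    case empty
    have "mean_converges T (\<lambda>s. 0 *\<^sub>R (1::real))"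
      by (rule mean_converges_scaleR[OF mean_converges_eventually_const[OF T]]) (auto intro: exI[of _ 1])
    moreover have "(\<lambda>s. 0 *\<^sub>R (1::real)) = (indicator {} :: real \<Rightarrow> real)" by (simp add: fun_eq_iff)
    ultimately show ?case by (simp only:)
  next
    case (compl B)
    have "mean_converges T (\<lambda>s::real. 1::real)"
      by (rule mean_converges_eventually_const[OF T]) (auto intro: exI[of _ 1])
    note mean_converges_add[OF T this mean_converges_scaleR[OF compl(2), of "-1"]]
    moreover have "(\<lambda>s. 1 + (-1) *\<^sub>R indicator B s) = (indicator (UNIV - B) :: real \<Rightarrow> real)"
      by (auto simp: fun_eq_iff indicator_def)
    ultimately show ?case by (simp only:)
  next
    case (union B)
    have "sigma_sets UNIV (range (\<lambda>a::real. {..a})) = sets borel" by (simp add: borel_eq_atMost[where 'a=real])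
    then have B: "B i \<in> sets borel" for i using union(2) by blast
    define f where "f k s = (\<Sum>i<k. indicator (B i) s :: real)" for k s
    have f: "mean_converges T (f k)" for k
    proof (induction k)
      case 0
      have "mean_converges T (\<lambda>s. 0 *\<^sub>R (indicator (B 0) s::real))" by (rule mean_converges_scaleR[OF union(3)])
      then show ?case by (simp add: f_def[abs_def])
    next
      case (Suc k)
      from mean_converges_add[OF T this union(3)] show ?case by (simp add: f_def[abs_def])
    qed
    have fU: "f k s = indicator (\<Union>i<k. B i) s" for k s
      unfolding f_def using union(1) by (subst indicator_UN_disjoint) (auto simp: disjoint_family_on_def)
    show ?case
    proof (rule mean_converges_closed[OF T f l2_lim_dominated[where h = "\<lambda>_. 1::real"]])
      show "f k \<in> borel_measurable (time_measure T)" for k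
        unfolding f_def[abs_def] using B by (intro measurable_restrict_space1 borel_measurable_sum borel_measurable_indicator) (simp add: sets_lborel)
      show "sq_int (time_measure T) (indicator (\<Union>i. B i) :: real \<Rightarrow> real)"
        using B by (intro sq_int_bound[OF sq_int_const[OF finite_time_measure, of _ "1::real"], where c = 1] measurable_restrict_space1)
          (auto simp: indicator_def)
      show "sq_int (time_measure T) (\<lambda>_. 1::real)" by (rule sq_int_const[OF finite_time_measure])
      show "AE s in time_measure T. (\<lambda>k. f k s) \<longlonglongrightarrow> indicator (\<Union>i. B i) s"
        unfolding fU by (intro AE_I2 LIMSEQ_indicator_UN)
      show "AE x in time_measure T. norm (f k x) \<le> norm (1::real)" for k
        unfolding fU by (auto simp: indicator_def)
    qed
  qed
qed

lemma mean_converges_sum: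
  assumes "0 < T" "finite I" "I \<noteq> {}" "\<And>i. i \<in> I \<Longrightarrow> mean_converges T (f i)"
  shows "mean_converges T (\<lambda>s. \<Sum>i\<in>I. f i s)"
  using assms(2-4)
  by (induction I rule: finite_ne_induct) (auto intro!: mean_converges_add[OF assms(1)])

text \<open>Simple functions dominated by 2|f| reduce the claim to indicators.\<close>

lemma mean_converges_sq_int:
  fixes f :: "real \<Rightarrow> 'b::euclidean_space"
  assumes T: "0 < T" and f: "sq_int (time_measure T) f"
  shows "mean_converges T f"
proof -
  obtain F where F: "\<And>i. simple_function (time_measure T) (F i)"
    "\<And>x. x \<in> space (time_measure T) \<Longrightarrow> (\<lambda>i. F i x) \<longlonglongrightarrow> f x"
    "\<And>i x. x \<in> space (time_measure T) \<Longrightarrow> dist (F i x) 0 \<le> 2 * dist (f x) 0"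
    using borel_measurable_implies_sequence_metric[OF sq_int_measurable[OF f], of 0] by blast
  show ?thesis
  proof (rule mean_converges_closed[OF T])
    fix k :: nat
    have fin: "finite (F k ` space (time_measure T))" using F(1)[of k] by (simp add: simple_function_def)
    define A where "A y = F k -` {y} \<inter> {0..T}" for y
    have A: "A y \<in> sets borel" for y
    proof -
      have "A y \<in> sets (time_measure T)"
        using simple_functionD(2)[OF F(1)[of k], of "{y}"] by (simp add: A_def time_measure_space)
      then show ?thesis by (simp add: sets_restrict_space_iff)
    qed
    have m: "mean_converges T (\<lambda>s. \<Sum>y\<in>F k ` {0..T}. indicator (A y) s *\<^sub>R y)"
      using fin T by (intro mean_converges_sum T mean_converges_scaleR_left mean_converges_indicator A) (auto simp: time_measure_space)
    then show "mean_converges T (\<lambda>s. \<Sum>y\<in>F k ` {0..T}. indicator (F k -` {y} \<inter> {0..T}) s *\<^sub>R y)" by (simp add: A_def)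
  next
    let ?G = "\<lambda>k s. \<Sum>y\<in>F k ` {0..T}. indicator (F k -` {y} \<inter> {0..T}) s *\<^sub>R y"
    have eq: "?G k s = F k s" if "s \<in> {0..T}" for k s
      by (rule simple_function_indicator_representation_banach[OF F(1)[of k], of s, unfolded time_measure_space, OF that, symmetric])
    show "l2_lim (time_measure T) ?G f"
    proof (rule l2_lim_dominated[where h = "\<lambda>s. 2 *\<^sub>R f s"])
      show "sq_int (time_measure T) (\<lambda>s. 2 *\<^sub>R f s)" by (rule sq_int_scaleR[OF f])
      have "F k \<in> borel_measurable (time_measure T)" for k by (rule borel_measurable_simple_function[OF F(1)])
      then show "?G k \<in> borel_measurable (time_measure T)" for k
        by (subst measurable_cong[of _ _ "F k"]) (use eq in \<open>simp_all add: time_measure_space\<close>)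
      show "AE s in time_measure T. (\<lambda>k. ?G k s) \<longlonglongrightarrow> f s"
        using F(2) eq by (intro AE_I2) (simp add: time_measure_space)
      show "AE s in time_measure T. norm (?G k s) \<le> norm (2 *\<^sub>R f s)" for k
        using F(3) eq by (intro AE_I2) (simp add: time_measure_space)
    qed (rule f)
  qed
qed

lemma sq_int_integral_norm_triangle:
  assumes "sq_int N f" "sq_int N g" "sq_int N h"
  shows "(\<integral>x. (norm (f x - h x))\<^sup>2 \<partial>N) \<le> 2 * (\<integral>x. (norm (f x - g x))\<^sup>2 \<partial>N) + 2 * (\<integral>x. (norm (g x - h x))\<^sup>2 \<partial>N)"
  using sq_int_integral_norm_add_le[OF sq_int_diff[OF assms(1,2)] sq_int_diff[OF assms(2,3)]] by simp

section \<open>Step processes approximating progressive integrands\<close>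

context brownian
begin

definition simple_el :: "nat \<Rightarrow> (nat \<Rightarrow> real) \<Rightarrow> (nat \<Rightarrow> 'a \<Rightarrow> 'b::euclidean_space) \<Rightarrow> (real \<times> real \<times> ('a \<Rightarrow> 'b)) list" where
  "simple_el n \<tau> \<xi> = map (\<lambda>i. (\<tau> i, \<tau> (Suc i), \<xi> i)) [0..<n]"

lemma el_proc_simple: "el_proc (simple_el n \<tau> \<xi>) = simple_process n \<tau> \<xi>"
  and el_ito_simple: "el_ito (simple_el n \<tau> \<xi>) = simple_ito W n \<tau> \<xi>"
  by (auto simp: fun_eq_iff el_proc_def el_ito_def simple_el_def simple_process_def simple_ito_def comp_def
      interv_sum_list_conv_sum_set_nat atLeast0LessThan)

lemma el_ok_simple: "simple_integrand M F t n \<tau> \<xi> \<Longrightarrow> el_ok t (simple_el n \<tau> \<xi>)"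
  by (auto simp: el_ok_def simple_el_def simple_integrand_def)

lemma path_measurable:
  assumes "case_prod \<phi> \<in> borel_measurable (time_prob M t)" "w \<in> space M"
  shows "(\<lambda>s. \<phi> s w) \<in> borel_measurable (time_measure t)"
  using measurable_compose[OF measurable_Pair2'[of w M "time_measure t"] assms(1)[unfolded time_prob_def]] assms(2)
  by simp

text \<open>Progressive measurability enters here: joint measurability on [0,u] with respect to
  \<open>F u\<close> lets time be integrated out without leaving \<open>F u\<close>.\<close>

lemma progressive_integral_adapted:
  fixes \<phi> :: "real \<Rightarrow> 'a \<Rightarrow> 'b::euclidean_space"
  assumes "progressive F t \<phi>" and u: "0 \<le> u" "u \<le> t" and A: "A \<in> sets borel" "A \<subseteq> {0..u}"
  shows "(\<lambda>w. LINT s:A|lborel. \<phi> s w) \<in> borel_measurable (F u)"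
proof -
  have "case_prod \<phi> \<in> borel_measurable (restrict_space borel {0..u} \<Otimes>\<^sub>M F u)"
    using assms by (auto simp: progressive_def)
  moreover have "sets (restrict_space borel {0..u} \<Otimes>\<^sub>M F u) = sets (time_measure u \<Otimes>\<^sub>M F u)"
    by (intro sets_pair_measure_cong sets_restrict_space_cong) auto
  ultimately have "case_prod \<phi> \<in> borel_measurable (time_measure u \<Otimes>\<^sub>M F u)"
    using measurable_cong_sets by blast
  then have [measurable]: "(\<lambda>(w, s). \<phi> s w) \<in> borel_measurable (F u \<Otimes>\<^sub>M time_measure u)"
    using measurable_pair_swap[of "case_prod \<phi>"] by simp
  have [measurable]: "indicator A \<in> borel_measurable (time_measure u)"
    by (intro measurable_restrict_space1 borel_measurable_indicator) (simp add: A)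
  have "(\<lambda>(w, s). indicator A s *\<^sub>R \<phi> s w) \<in> borel_measurable (F u \<Otimes>\<^sub>M time_measure u)"
    by measurable
  then have "(\<lambda>w. \<integral>s. indicator A s *\<^sub>R \<phi> s w \<partial>time_measure u) \<in> borel_measurable (F u)"
    by (intro sigma_finite_measure.borel_measurable_lebesgue_integral
        finite_measure.axioms(1)[OF finite_time_measure]) simp
  moreover have "(\<integral>s. indicator A s *\<^sub>R \<phi> s w \<partial>time_measure u) = (LINT s:A|lborel. \<phi> s w)" for w
    unfolding set_lebesgue_integral_def using A
    by (subst integral_restrict_space, simp) (auto intro!: Bochner_Integration.integral_cong simp: indicator_def)
  ultimately show ?thesis by simp
qed

text \<open>Along each path the delayed averages converge in L2 of time. The bound c dominates the
  pathwise errors by (2c)^2 t, so their expectations converge as well.\<close>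

lemma simple_approx_bounded:
  fixes \<phi> :: "real \<Rightarrow> 'a \<Rightarrow> 'b::euclidean_space"
  assumes t: "0 < t" and p: "progressive F t \<phi>"
    and b: "\<And>s \<omega>. s \<in> {0..t} \<Longrightarrow> \<omega> \<in> space M \<Longrightarrow> norm (\<phi> s \<omega>) \<le> c" and c: "0 \<le> c"
  defines "\<tau> \<equiv> \<lambda>n i. t * real i / real (Suc n)"
    and "\<xi> \<equiv> \<lambda>n i \<omega>. cell_mean t (Suc n) (\<lambda>r. \<phi> r \<omega>) i"
  shows "simple_integrand M F t (Suc n) (\<tau> n) (\<xi> n)"
    and "l2_lim (time_prob M t) (\<lambda>n. case_prod (simple_process (Suc n) (\<tau> n) (\<xi> n))) (case_prod \<phi>)"
proof -
  have simple: "simple_integrand M F t (Suc n) (\<tau> n) (\<xi> n)" for n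
    unfolding simple_integrand_def
  proof (intro allI impI conjI)
    fix i assume i: "i < Suc n"
    show "0 \<le> \<tau> n i" "\<tau> n i \<le> \<tau> n (Suc i)" "\<tau> n (Suc i) \<le> t"
    proof -
      have "t * real (Suc i) \<le> t * real (Suc n)" using i t by (intro mult_left_mono) auto
      then show "\<tau> n (Suc i) \<le> t" using t by (simp add: \<tau>_def divide_le_eq)
      show "0 \<le> \<tau> n i" "\<tau> n i \<le> \<tau> n (Suc i)" using t by (auto simp: \<tau>_def intro!: divide_right_mono mult_left_mono)
    qed
    have "norm (\<xi> n i \<omega>) \<le> c" if "\<omega> \<in> space M" for \<omega>
      unfolding \<xi>_def by (rule norm_cell_mean_le[OF t]) (use b that c i in auto)
    then show "\<exists>c. \<forall>\<omega>\<in>space M. norm (\<xi> n i \<omega>) \<le> c" by blast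
    show "\<xi> n i \<in> borel_measurable (F (\<tau> n i))"
    proof (cases i)
      case 0 then show ?thesis by (simp add: \<xi>_def cell_mean_def)
    next
      case (Suc j)
      define u where "u = \<tau> n i"
      have "t * real i \<le> t * real (Suc n)" using i t by (intro mult_left_mono) auto
      then have u: "0 \<le> u" "u \<le> t" using t by (auto simp: u_def \<tau>_def divide_le_eq)
      \<comment> \<open>The value on a cell is a mean over the preceding cell, which ends exactly at
        the time when the value must be known.\<close>
      have sub: "cell t (Suc n) j \<subseteq> {0..u}"
      proof
        fix x assume "x \<in> cell t (Suc n) j"
        moreover have "0 \<le> t * real j / real (Suc n)" using t by simp
        ultimately show "x \<in> {0..u}" by (simp add: cell_def u_def \<tau>_def Suc)
      qed
      have m: "(\<lambda>\<omega>. LINT s:cell t (Suc n) j|lborel. \<phi> s \<omega>) \<in> borel_measurable (F u)"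
        by (rule progressive_integral_adapted[OF p u _ sub]) simp
      have "\<xi> n i = (\<lambda>\<omega>. (real (Suc n) / t) *\<^sub>R (LINT s:cell t (Suc n) j|lborel. \<phi> s \<omega>))"
        by (simp add: \<xi>_def cell_mean_def Suc)
      then show ?thesis unfolding u_def[symmetric] using m by (simp only: borel_measurable_const_scaleR)
    qed
  qed
  then show "simple_integrand M F t (Suc n) (\<tau> n) (\<xi> n)" .
  have sp: "simple_process (Suc n) (\<tau> n) (\<xi> n) s \<omega> = delayed_mean t (Suc n) (\<lambda>r. \<phi> r \<omega>) s" for n s \<omega>
    by (simp add: simple_process_def delayed_mean_def cell_def \<tau>_def \<xi>_def)
  have s1: "sq_int (time_prob M t) (case_prod (simple_process (Suc n) (\<tau> n) (\<xi> n)))" for n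
    using el_proc_sq_int[OF el_ok_simple[OF simple]] by (simp add: el_proc_simple)
  have pm: "case_prod \<phi> \<in> borel_measurable (time_prob M t)" using progressive_measurable[OF p] t by simp
  have s2: "sq_int (time_prob M t) (case_prod \<phi>)"
    by (rule sq_int_bound[OF sq_int_const[OF finite_time_prob, of _ "1::real"] pm, where c = c])
      (use b in \<open>auto intro!: AE_I2 simp: space_time_prob\<close>)
  define e where "e n \<omega> = (LINT s:{0..t}|lborel. (norm (simple_process (Suc n) (\<tau> n) (\<xi> n) s \<omega> - \<phi> s \<omega>))\<^sup>2)" for n \<omega>
  have int: "integrable (time_prob M t) (case_prod (\<lambda>s \<omega>. (norm (simple_process (Suc n) (\<tau> n) (\<xi> n) s \<omega> - \<phi> s \<omega>))\<^sup>2))" for n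
    using sq_int_integrable[OF sq_int_diff[OF s1 s2]] by (simp add: split_beta')
  have "(\<lambda>n. expectation (e n)) \<longlonglongrightarrow> (\<integral>\<omega>. 0 \<partial>M)"
  proof (rule integral_dominated_convergence[where w = "\<lambda>_. (2 * c)\<^sup>2 * t"])
    show "e n \<in> borel_measurable M" for n
      unfolding e_def[abs_def] using integrable_time_prob[OF int] by blast
    show "AE \<omega> in M. (\<lambda>n. e n \<omega>) \<longlonglongrightarrow> 0"
    proof (rule AE_I2)
      fix \<omega> assume w: "\<omega> \<in> space M"
      have "sq_int (time_measure t) (\<lambda>s. \<phi> s \<omega>)"
        by (rule sq_int_bound[OF sq_int_const[OF finite_time_measure, of _ "1::real"] path_measurable[OF pm w], where c = c])
          (use b w in \<open>auto intro!: AE_I2 simp: time_measure_space\<close>)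
      from mean_converges_sq_int[OF t this] show "(\<lambda>n. e n \<omega>) \<longlonglongrightarrow> 0"
        unfolding e_def sp mean_converges_def l2_lim_def
        by (simp add: set_lebesgue_integral_def integral_restrict_space)
    qed
    show "AE \<omega> in M. norm (e n \<omega>) \<le> (2 * c)\<^sup>2 * t" for n
    proof (rule AE_I2)
      fix \<omega> assume w: "\<omega> \<in> space M"
      have dm: "norm (delayed_mean t (Suc n) (\<lambda>r. \<phi> r \<omega>) s) \<le> c" for s
        by (rule norm_delayed_mean_le[OF t zero_less_Suc _ c]) (rule b[OF _ w])
      have "norm (simple_process (Suc n) (\<tau> n) (\<xi> n) s \<omega> - \<phi> s \<omega>) \<le> 2 * c" if "s \<in> {0..t}" for s
        using norm_triangle_ineq4[of "simple_process (Suc n) (\<tau> n) (\<xi> n) s \<omega>" "\<phi> s \<omega>"] b[OF that w]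
          dm[of s] by (simp add: sp)
      then have "norm ((norm (simple_process (Suc n) (\<tau> n) (\<xi> n) s \<omega> - \<phi> s \<omega>))\<^sup>2) \<le> (2 * c)\<^sup>2" if "s \<in> {0..t}" for s
        unfolding real_norm_def abs_power2 using that by (intro power_mono) auto
      then have "norm (e n \<omega>) \<le> (2 * c)\<^sup>2 * measure lborel {0..t}"
        unfolding e_def by (intro norm_set_integral_le) (simp_all add: emeasure_lborel_Icc_eq)
      then show "norm (e n \<omega>) \<le> (2 * c)\<^sup>2 * t" using t by simp
    qed
  qed auto
  moreover have "expectation (e n) = (\<integral>z. (norm (case_prod (simple_process (Suc n) (\<tau> n) (\<xi> n)) z - case_prod \<phi> z))\<^sup>2 \<partial>time_prob M t)" for n
    unfolding e_def[abs_def] integral_time_prob[OF int] by (simp add: split_beta')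
  ultimately show "l2_lim (time_prob M t) (\<lambda>n. case_prod (simple_process (Suc n) (\<tau> n) (\<xi> n))) (case_prod \<phi>)"
    using s1 s2 by (simp add: l2_lim_def)
qed

text \<open>Through the isometry, a time interval of length zero makes Ito integrals start at
  0.\<close>

lemma integral_time_prob_0:
  fixes f :: "real \<times> 'a \<Rightarrow> real"
  shows "(\<integral>z. f z \<partial>time_prob M 0) = 0"
proof -
  have "emeasure (time_prob M 0) (space (time_prob M 0)) = 0"
    unfolding time_prob_def space_pair_measure
    by (subst emeasure_pair_measure_Times) (auto simp: space_restrict_space emeasure_restrict_space sets_restrict_space_iff)
  then have "AE z in time_prob M 0. f z = 0"
    by (intro AE_I[where N = "space (time_prob M 0)"]) auto
  then show ?thesis by (rule integral_eq_zero_AE)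
qed

lemma progressive_If:
  assumes "progressive F t \<phi>" "A \<in> sets borel"
  shows "progressive F t (\<lambda>s w. if \<phi> s w \<in> A then \<phi> s w else 0)"
  unfolding progressive_def
proof
  fix u assume "u \<in> {0..t}"
  then have "(\<lambda>z. \<phi> (fst z) (snd z)) \<in> borel_measurable (restrict_space borel {0..u} \<Otimes>\<^sub>M F u)"
    using assms by (simp add: progressive_def split_beta')
  from measurable_compose[OF this, of "\<lambda>x. if x \<in> A then x else 0" borel] assms(2)
  show "(\<lambda>(s, w). if \<phi> s w \<in> A then \<phi> s w else 0) \<in> borel_measurable (restrict_space borel {0..u} \<Otimes>\<^sub>M F u)"
    by (simp add: split_beta')
qed

lemma simple_approx_ex:
  fixes \<phi> :: "real \<Rightarrow> 'a \<Rightarrow> 'b::euclidean_space"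
  assumes t: "0 \<le> t" and \<phi>: "\<phi> \<in> L2_proc M F t" and e: "0 < e"
  shows "\<exists>n \<tau> \<xi>. simple_integrand M F t n \<tau> \<xi> \<and>
    (\<integral>z. (norm (case_prod (simple_process n \<tau> \<xi>) z - case_prod \<phi> z))\<^sup>2 \<partial>time_prob M t) < e"
proof (cases "t = 0")
  case True
  have "simple_integrand M F t 0 (\<lambda>_. 0) (\<lambda>_ _. 0::'b)" by (simp add: simple_integrand_def)
  then show ?thesis using True e by (auto simp: integral_time_prob_0 intro!: exI)
next
  case False
  then have t0: "0 < t" using t by simp
  have p: "progressive F t \<phi>" and s: "sq_int (time_prob M t) (case_prod \<phi>)" using \<phi> L2_proc_iff[OF t] by auto
  \<comment> \<open>Values outside the ball of radius N are replaced by 0; a pointwise measurable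
    operation keeps the process progressive.\<close>
  define \<phi>N where "\<phi>N N s w = (if \<phi> s w \<in> cball 0 (real N) then \<phi> s w else 0)" for N s w
  have pN: "progressive F t (\<phi>N N)" for N unfolding \<phi>N_def by (rule progressive_If[OF p]) simp
  have "l2_lim (time_prob M t) (\<lambda>N. case_prod (\<phi>N N)) (case_prod \<phi>)"
  proof (rule l2_lim_dominated[OF _ s s])
    show "case_prod (\<phi>N k) \<in> borel_measurable (time_prob M t)" for k
      using progressive_measurable[OF pN t] by simp
    show "AE x in time_prob M t. (\<lambda>k. case_prod (\<phi>N k) x) \<longlonglongrightarrow> case_prod \<phi> x"
    proof (rule AE_I2)
      fix x
      obtain N where N: "norm (case_prod \<phi> x) \<le> real N" using real_arch_simple by blast
      have "\<forall>\<^sub>F k in sequentially. case_prod (\<phi>N k) x = case_prod \<phi> x"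
        using eventually_ge_at_top[of N] by eventually_elim (use N in \<open>auto simp: \<phi>N_def split_beta'\<close>)
      then show "(\<lambda>k. case_prod (\<phi>N k) x) \<longlonglongrightarrow> case_prod \<phi> x" by (rule tendsto_eventually)
    qed
    show "AE x in time_prob M t. norm (case_prod (\<phi>N k) x) \<le> norm (case_prod \<phi> x)" for k
      by (intro AE_I2) (auto simp: \<phi>N_def split_beta')
  qed
  then have "(\<lambda>N. \<integral>z. (norm (case_prod (\<phi>N N) z - case_prod \<phi> z))\<^sup>2 \<partial>time_prob M t) \<longlonglongrightarrow> 0" and sN: "\<And>N. sq_int (time_prob M t) (case_prod (\<phi>N N))"
    by (auto simp: l2_lim_def)
  from LIMSEQ_D[OF this(1), of "e / 4"] e
  \<comment> \<open>Each of the two errors gets e / 4, as the final triangle estimate doubles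
    both.\<close>
  obtain N where N: "(\<integral>z. (norm (case_prod (\<phi>N N) z - case_prod \<phi> z))\<^sup>2 \<partial>time_prob M t) < e / 4" by auto
  have bN: "norm (\<phi>N N s w) \<le> real N" for s w by (simp add: \<phi>N_def)
  define \<tau> where "\<tau> n i = t * real i / real (Suc n)" for n i :: nat
  define \<xi> where "\<xi> n i w = cell_mean t (Suc n) (\<lambda>r. \<phi>N N r w) i" for n i w
  note A = simple_approx_bounded[OF t0 pN bN of_nat_0_le_iff, folded \<tau>_def \<xi>_def]
  have "(\<lambda>n. \<integral>z. (norm (case_prod (simple_process (Suc n) (\<tau> n) (\<xi> n)) z - case_prod (\<phi>N N) z))\<^sup>2 \<partial>time_prob M t) \<longlonglongrightarrow> 0"
    and sS: "\<And>n. sq_int (time_prob M t) (case_prod (simple_process (Suc n) (\<tau> n) (\<xi> n)))"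
    using A(2) by (auto simp: l2_lim_def)
  from LIMSEQ_D[OF this(1), of "e / 4"] e
  obtain n where n: "(\<integral>z. (norm (case_prod (simple_process (Suc n) (\<tau> n) (\<xi> n)) z - case_prod (\<phi>N N) z))\<^sup>2 \<partial>time_prob M t) < e / 4" by auto
  have "(\<integral>z. (norm (case_prod (simple_process (Suc n) (\<tau> n) (\<xi> n)) z - case_prod \<phi> z))\<^sup>2 \<partial>time_prob M t) < e"
    using sq_int_integral_norm_triangle[OF sS[of n] sN[of N] s] n N by linarith
  then show ?thesis using A(1)[of n] by blast
qed

lemma simple_approx:
  fixes \<phi> :: "real \<Rightarrow> 'a \<Rightarrow> 'b::euclidean_space"
  assumes t: "0 \<le> t" and \<phi>: "\<phi> \<in> L2_proc M F t" and e: "\<And>k. 0 < e k"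
  obtains n \<tau> \<xi> where "\<And>k. simple_integrand M F t (n k) (\<tau> k) (\<xi> k)"
    "\<And>k. (\<integral>z. (norm (case_prod (simple_process (n k) (\<tau> k) (\<xi> k)) z - case_prod \<phi> z))\<^sup>2 \<partial>time_prob M t) < (e k :: real)"
proof -
  have "\<forall>k. \<exists>n \<tau> \<xi>. simple_integrand M F t n \<tau> \<xi> \<and>
    (\<integral>z. (norm (case_prod (simple_process n \<tau> \<xi>) z - case_prod \<phi> z))\<^sup>2 \<partial>time_prob M t) < e k"
    using simple_approx_ex[OF t \<phi> e] by blast
  from choice[OF this] obtain n where "\<forall>k. \<exists>\<tau> \<xi>. simple_integrand M F t (n k) \<tau> \<xi> \<and>
    (\<integral>z. (norm (case_prod (simple_process (n k) \<tau> \<xi>) z - case_prod \<phi> z))\<^sup>2 \<partial>time_prob M t) < e k" ..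
  from choice[OF this] obtain \<tau> where "\<forall>k. \<exists>\<xi>. simple_integrand M F t (n k) (\<tau> k) \<xi> \<and>
    (\<integral>z. (norm (case_prod (simple_process (n k) (\<tau> k) \<xi>) z - case_prod \<phi> z))\<^sup>2 \<partial>time_prob M t) < e k" ..
  from choice[OF this] obtain \<xi> where "\<forall>k. simple_integrand M F t (n k) (\<tau> k) (\<xi> k) \<and>
    (\<integral>z. (norm (case_prod (simple_process (n k) (\<tau> k) (\<xi> k)) z - case_prod \<phi> z))\<^sup>2 \<partial>time_prob M t) < e k" ..
  then show thesis by (intro that[of n \<tau> \<xi>]) blast+
qed

section \<open>The Ito integral\<close>

text \<open>Passes from partitions to lists of entries and from nonnegative integrals to
  \<open>l2_lim\<close>, so that the calculus of elementary integrals applies.\<close>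

lemma has_ito_elementary:
  assumes "has_ito_integral M F W \<phi> t J" "0 \<le> t"
  obtains xs where "\<And>k. el_ok t (xs k)" "l2_lim (time_prob M t) (\<lambda>k. case_prod (el_proc (xs k))) (case_prod \<phi>)"
    "l2_lim M (\<lambda>k. el_ito (xs k)) J"
proof -
  from assms obtain n \<tau> \<xi> where s: "\<And>k. simple_integrand M F t (n k) (\<tau> k) (\<xi> k)"
    and l1: "(\<lambda>k. \<integral>\<^sup>+w. (\<integral>\<^sup>+s\<in>{0..t}. ennreal ((norm (simple_process (n k) (\<tau> k) (\<xi> k) s w - \<phi> s w))\<^sup>2) \<partial>lborel) \<partial>M) \<longlonglongrightarrow> 0"
    and l2: "(\<lambda>k. \<integral>\<^sup>+w. ennreal ((norm (simple_ito W (n k) (\<tau> k) (\<xi> k) w - J w))\<^sup>2) \<partial>M) \<longlonglongrightarrow> 0"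
    and J: "J \<in> borel_measurable M" and \<phi>: "\<phi> \<in> L2_proc M F t"
    unfolding has_ito_integral_def by blast
  define xs where "xs k = simple_el (n k) (\<tau> k) (\<xi> k)" for k
  have ok: "el_ok t (xs k)" for k unfolding xs_def by (rule el_ok_simple[OF s])
  have pm: "case_prod \<phi> \<in> borel_measurable (time_prob M t)"
    using \<phi> L2_proc_iff[OF assms(2)] by (auto simp: sq_int_def)
  have "l2_lim (time_prob M t) (\<lambda>k. case_prod (el_proc (xs k))) (case_prod \<phi>)"
  proof (rule l2_limI_nn_integral[OF el_proc_sq_int[OF ok] pm])
    have [measurable]: "case_prod (el_proc (xs k)) \<in> borel_measurable (time_prob M t)" for k by (rule el_proc_measurable[OF ok])
    note [measurable] = pm
    have "(\<integral>\<^sup>+w. (\<integral>\<^sup>+s\<in>{0..t}. ennreal ((norm (case_prod (el_proc (xs k)) (s, w) - case_prod \<phi> (s, w)))\<^sup>2) \<partial>lborel) \<partial>M) =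
       (\<integral>\<^sup>+z. ennreal ((norm (case_prod (el_proc (xs k)) z - case_prod \<phi> z))\<^sup>2) \<partial>time_prob M t)" for k
      by (rule nn_integral_time_prob) measurable
    then show "(\<lambda>k. \<integral>\<^sup>+z. ennreal ((norm (case_prod (el_proc (xs k)) z - case_prod \<phi> z))\<^sup>2) \<partial>time_prob M t) \<longlonglongrightarrow> 0"
      using l1 by (simp add: xs_def el_proc_simple)
  qed
  moreover have "l2_lim M (\<lambda>k. el_ito (xs k)) J"
    by (rule l2_limI_nn_integral[OF el_ito_sq_int[OF ok] J]) (use l2 in \<open>simp add: xs_def el_ito_simple\<close>)
  ultimately show thesis using that ok by blast
qed

text \<open>The isometry applied to the concatenation of one list with the negative of the other:
  integrands with a common limit have integrals with a common limit.\<close>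

lemma l2_lim_el_ito_transfer:
  assumes "0 \<le> t" "\<And>k. el_ok t (xs k)" "\<And>k. el_ok t (ys k)"
    and "l2_lim (time_prob M t) (\<lambda>k. case_prod (el_proc (xs k))) \<phi>"
    and "l2_lim (time_prob M t) (\<lambda>k. case_prod (el_proc (ys k))) \<phi>"
    and "l2_lim M (\<lambda>k. el_ito (xs k)) J"
  shows "l2_lim M (\<lambda>k. el_ito (ys k)) J"
proof -
  define zs where "zs k = ys k @ el_scale (-1) (xs k)" for k
  have ok: "el_ok t (zs k)" for k using assms(2,3) by (simp add: zs_def el_ok_append el_ok_scale)
  have p: "case_prod (el_proc (zs k)) = (\<lambda>z. case_prod (el_proc (ys k)) z - case_prod (el_proc (xs k)) z)" for k
    by (auto simp: zs_def el_proc_append el_proc_scale)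
  have i: "el_ito (zs k) w = el_ito (ys k) w - el_ito (xs k) w" for k w
    by (auto simp: zs_def el_ito_append el_ito_scale)
  have "l2_lim (time_prob M t) (\<lambda>k. case_prod (el_proc (zs k))) (\<lambda>_. 0)"
    unfolding p using l2_lim_diff[OF assms(5,4)] by simp
  then have "(\<lambda>k. expectation (\<lambda>w. (norm (el_ito (zs k) w))\<^sup>2)) \<longlonglongrightarrow> 0"
    using el_isometry_norm[OF ok assms(1)] by (simp add: l2_lim_def)
  then have "l2_lim M (\<lambda>k. el_ito (zs k)) (\<lambda>_. 0)"
    using el_ito_sq_int[OF ok] by (simp add: l2_lim_def sq_int_zero)
  from l2_lim_add[OF assms(6) this] show ?thesis by (simp add: i)
qed

text \<open>The definition asks for consecutive partition times, which concatenated or truncated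
  lists do not have. A fresh approximation by partitions is taken and the limit J is transferred to
  it.\<close>

lemma has_ito_integralI:
  assumes "0 \<le> t" "\<phi> \<in> L2_proc M F t" "\<And>k. el_ok t (xs k)"
    and "l2_lim (time_prob M t) (\<lambda>k. case_prod (el_proc (xs k))) (case_prod \<phi>)"
    and "l2_lim M (\<lambda>k. el_ito (xs k)) J"
  shows "has_ito_integral M F W \<phi> t J"
proof -
  obtain n \<tau> \<xi> where s: "\<And>k. simple_integrand M F t (n k) (\<tau> k) (\<xi> k)"
    and l: "\<And>k. (\<integral>z. (norm (case_prod (simple_process (n k) (\<tau> k) (\<xi> k)) z - case_prod \<phi> z))\<^sup>2 \<partial>time_prob M t) < 1 / real (Suc k)"
    by (rule simple_approx[OF assms(1,2), of "\<lambda>k. 1 / real (Suc k)"]) auto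
  define ys where "ys k = simple_el (n k) (\<tau> k) (\<xi> k)" for k
  have ok: "el_ok t (ys k)" for k unfolding ys_def by (rule el_ok_simple[OF s])
  have \<phi>: "sq_int (time_prob M t) (case_prod \<phi>)" using assms(2) L2_proc_iff[OF assms(1)] by auto
  have "(\<lambda>k. \<integral>z. (norm (case_prod (el_proc (ys k)) z - case_prod \<phi> z))\<^sup>2 \<partial>time_prob M t) \<longlonglongrightarrow> 0"
  proof (rule tendsto_sandwich[of "\<lambda>_. 0" _ _ "\<lambda>k. 1 / real (Suc k)"])
    show "(\<lambda>k. 1 / real (Suc k)) \<longlonglongrightarrow> 0" using LIMSEQ_inverse_real_of_nat by (simp add: divide_inverse)
  qed (use l in \<open>auto simp: ys_def el_proc_simple less_imp_le\<close>)
  then have L: "l2_lim (time_prob M t) (\<lambda>k. case_prod (el_proc (ys k))) (case_prod \<phi>)"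
    using el_proc_sq_int[OF ok] \<phi> by (simp add: l2_lim_def)
  note LJ = l2_lim_el_ito_transfer[OF assms(1,3) ok assms(4) L assms(5)]
  note [measurable] = sq_int_measurable[OF \<phi>] el_proc_measurable[OF ok]
  have eq: "(\<integral>\<^sup>+w. (\<integral>\<^sup>+s\<in>{0..t}. ennreal ((norm (case_prod (el_proc (ys k)) (s, w) - case_prod \<phi> (s, w)))\<^sup>2) \<partial>lborel) \<partial>M) =
       (\<integral>\<^sup>+z. ennreal ((norm (case_prod (el_proc (ys k)) z - case_prod \<phi> z))\<^sup>2) \<partial>time_prob M t)" for k
    by (rule nn_integral_time_prob) measurable
  show ?thesis unfolding has_ito_integral_def
  proof (intro conjI exI allI)
    show "\<phi> \<in> L2_proc M F t" "J \<in> borel_measurable M" using assms by (auto simp: l2_lim_def sq_int_def)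
    show "simple_integrand M F t (n k) (\<tau> k) (\<xi> k)" for k by (rule s)
    show "(\<lambda>k. \<integral>\<^sup>+w. (\<integral>\<^sup>+s\<in>{0..t}. ennreal ((norm (simple_process (n k) (\<tau> k) (\<xi> k) s w - \<phi> s w))\<^sup>2) \<partial>lborel) \<partial>M) \<longlonglongrightarrow> 0"
      using l2_lim_nn_integral[OF L] eq by (simp add: ys_def el_proc_simple)
    show "(\<lambda>k. \<integral>\<^sup>+w. ennreal ((norm (simple_ito W (n k) (\<tau> k) (\<xi> k) w - J w))\<^sup>2) \<partial>M) \<longlonglongrightarrow> 0"
      using l2_lim_nn_integral[OF LJ] by (simp add: ys_def el_ito_simple)
  qed
qed

lemma has_ito_sq_int: "has_ito_integral M F W \<phi> t J \<Longrightarrow> 0 \<le> t \<Longrightarrow> sq_int M J"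
  using has_ito_elementary[of \<phi> t J] by (metis l2_lim_def)

lemma has_ito_isometry:
  assumes "0 \<le> t" "has_ito_integral M F W \<phi> t J" "has_ito_integral M F W \<psi> t J'"
  shows "expectation (\<lambda>w. J w \<bullet> J' w) = (\<integral>z. case_prod \<phi> z \<bullet> case_prod \<psi> z \<partial>time_prob M t)"
proof -
  obtain xs where x: "\<And>k. el_ok t (xs k)" "l2_lim (time_prob M t) (\<lambda>k. case_prod (el_proc (xs k))) (case_prod \<phi>)"
    "l2_lim M (\<lambda>k. el_ito (xs k)) J" using has_ito_elementary[OF assms(2,1)] by blast
  obtain ys where y: "\<And>k. el_ok t (ys k)" "l2_lim (time_prob M t) (\<lambda>k. case_prod (el_proc (ys k))) (case_prod \<psi>)"
    "l2_lim M (\<lambda>k. el_ito (ys k)) J'" using has_ito_elementary[OF assms(3,1)] by blast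
  have "(\<lambda>k. expectation (\<lambda>w. el_ito (xs k) w \<bullet> el_ito (ys k) w)) \<longlonglongrightarrow> expectation (\<lambda>w. J w \<bullet> J' w)"
    by (rule l2_lim_inner[OF x(3) y(3)])
  moreover have "(\<lambda>k. expectation (\<lambda>w. el_ito (xs k) w \<bullet> el_ito (ys k) w)) \<longlonglongrightarrow> (\<integral>z. case_prod \<phi> z \<bullet> case_prod \<psi> z \<partial>time_prob M t)"
    unfolding el_isometry[OF x(1) y(1) assms(1)] by (rule l2_lim_inner[OF x(2) y(2)])
  ultimately show ?thesis by (rule LIMSEQ_unique)
qed

lemma progressive_add_scaleR:
  fixes \<phi> \<psi> :: "real \<Rightarrow> 'a \<Rightarrow> 'b::euclidean_space"
  assumes "progressive F t \<phi>" "progressive F t \<psi>"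
  shows "progressive F t (\<lambda>s w. \<phi> s w + c *\<^sub>R \<psi> s w)"
  unfolding progressive_def
proof
  fix u assume "u \<in> {0..t}"
  then have "case_prod \<phi> \<in> borel_measurable (restrict_space borel {0..u} \<Otimes>\<^sub>M F u)" "case_prod \<psi> \<in> borel_measurable (restrict_space borel {0..u} \<Otimes>\<^sub>M F u)"
    using assms by (auto simp: progressive_def)
  then have "(\<lambda>z. case_prod \<phi> z + c *\<^sub>R case_prod \<psi> z) \<in> borel_measurable (restrict_space borel {0..u} \<Otimes>\<^sub>M F u)" by measurable
  then show "(\<lambda>(s, w). \<phi> s w + c *\<^sub>R \<psi> s w) \<in> borel_measurable (restrict_space borel {0..u} \<Otimes>\<^sub>M F u)"
    by (simp add: split_beta')
qed

lemma L2_proc_add_scaleR: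
  assumes "0 \<le> t" "\<phi> \<in> L2_proc M F t" "\<psi> \<in> L2_proc M F t"
  shows "(\<lambda>s w. \<phi> s w + c *\<^sub>R \<psi> s w) \<in> L2_proc M F t"
  using assms progressive_add_scaleR sq_int_add[OF _ sq_int_scaleR, of _ "case_prod \<phi>" "case_prod \<psi>" c]
  unfolding L2_proc_iff[OF assms(1)] by (auto simp: split_beta')

lemma has_ito_add_scaleR:
  assumes "0 \<le> t" "has_ito_integral M F W \<phi> t J" "has_ito_integral M F W \<psi> t J'"
  shows "has_ito_integral M F W (\<lambda>s w. \<phi> s w + c *\<^sub>R \<psi> s w) t (\<lambda>w. J w + c *\<^sub>R J' w)"
proof -
  obtain xs where x: "\<And>k. el_ok t (xs k)" "l2_lim (time_prob M t) (\<lambda>k. case_prod (el_proc (xs k))) (case_prod \<phi>)"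
    "l2_lim M (\<lambda>k. el_ito (xs k)) J" using has_ito_elementary[OF assms(2,1)] by blast
  obtain ys where y: "\<And>k. el_ok t (ys k)" "l2_lim (time_prob M t) (\<lambda>k. case_prod (el_proc (ys k))) (case_prod \<psi>)"
    "l2_lim M (\<lambda>k. el_ito (ys k)) J'" using has_ito_elementary[OF assms(3,1)] by blast
  show ?thesis
  proof (rule has_ito_integralI[OF assms(1), where xs = "\<lambda>k. xs k @ el_scale c (ys k)"])
    show "(\<lambda>s w. \<phi> s w + c *\<^sub>R \<psi> s w) \<in> L2_proc M F t"
      using assms by (intro L2_proc_add_scaleR) (auto simp: has_ito_integral_def)
    show "el_ok t (xs k @ el_scale c (ys k))" for k using x(1) y(1) by (simp add: el_ok_append el_ok_scale)
    show "l2_lim (time_prob M t) (\<lambda>k. case_prod (el_proc (xs k @ el_scale c (ys k)))) (\<lambda>(s, w). \<phi> s w + c *\<^sub>R \<psi> s w)"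
      using l2_lim_add[OF x(2) l2_lim_scaleR[OF y(2)], of c] by (simp add: el_proc_append el_proc_scale split_beta')
    show "l2_lim M (\<lambda>k. el_ito (xs k @ el_scale c (ys k))) (\<lambda>w. J w + c *\<^sub>R J' w)"
      using l2_lim_add[OF x(3) l2_lim_scaleR[OF y(3)], of c] by (simp add: el_ito_append[abs_def] el_ito_scale)
  qed
qed

lemma has_ito_AE_eq:
  assumes "has_ito_integral M F W \<phi> t J" "AE w in M. J w = J' w"
  shows "has_ito_integral M F W \<phi> t J'"
proof -
  have "J' \<in> borel_measurable M" using measurable_M_AE assms by (auto simp: has_ito_integral_def)
  moreover have "(\<integral>\<^sup>+w. ennreal ((norm (f w - J' w))\<^sup>2) \<partial>M) = (\<integral>\<^sup>+w. ennreal ((norm (f w - J w))\<^sup>2) \<partial>M)" for f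
    by (rule nn_integral_cong_AE) (use assms(2) in eventually_elim, simp)
  ultimately show ?thesis using assms(1) unfolding has_ito_integral_def by auto
qed

lemma nn_integral_time_prob_mono:
  assumes "f \<in> borel_measurable (time_prob M r)" "f \<in> borel_measurable (time_prob M t)" "r \<le> t"
  shows "(\<integral>\<^sup>+z. f z \<partial>time_prob M r) \<le> (\<integral>\<^sup>+z. f z \<partial>time_prob M t)"
  unfolding nn_integral_time_prob[OF assms(1), symmetric] nn_integral_time_prob[OF assms(2), symmetric]
  using assms(3) by (intro nn_integral_mono) (auto simp: indicator_def)

lemma l2_lim_time_prob_mono:
  assumes "0 \<le> r" "r \<le> t" "progressive F t \<phi>" "\<And>k. el_ok t (xs k)"
    and "l2_lim (time_prob M t) (\<lambda>k. case_prod (el_proc (xs k))) (case_prod \<phi>)"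
  shows "l2_lim (time_prob M r) (\<lambda>k. case_prod (el_proc (xs k))) (case_prod \<phi>)"
proof (rule l2_limI_nn_integral[OF el_proc_sq_int[OF assms(4)]])
  have [measurable]: "case_prod \<phi> \<in> borel_measurable (time_prob M r)" "case_prod \<phi> \<in> borel_measurable (time_prob M t)"
    using progressive_measurable[OF assms(3)] assms(1,2) by auto
  note [measurable] = el_proc_measurable[OF assms(4)]
  show "case_prod \<phi> \<in> borel_measurable (time_prob M r)" by measurable
  have "(\<integral>\<^sup>+z. ennreal ((norm (case_prod (el_proc (xs k)) z - case_prod \<phi> z))\<^sup>2) \<partial>time_prob M r)
     \<le> (\<integral>\<^sup>+z. ennreal ((norm (case_prod (el_proc (xs k)) z - case_prod \<phi> z))\<^sup>2) \<partial>time_prob M t)" for k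
    by (rule nn_integral_time_prob_mono[OF _ _ assms(2)]) measurable
  then show "(\<lambda>k. \<integral>\<^sup>+z. ennreal ((norm (case_prod (el_proc (xs k)) z - case_prod \<phi> z))\<^sup>2) \<partial>time_prob M r) \<longlonglongrightarrow> 0"
    by (intro tendsto_sandwich[OF _ _ tendsto_const l2_lim_nn_integral[OF assms(5)]] always_eventually allI zero_le)
qed

lemma l2_lim_trunc:
  assumes "0 \<le> r" "r \<le> t" "progressive F t \<phi>" "\<And>k. el_ok t (xs k)"
    and "l2_lim (time_prob M t) (\<lambda>k. case_prod (el_proc (xs k))) (case_prod \<phi>)"
  shows "l2_lim (time_prob M r) (\<lambda>k. case_prod (el_proc (el_trunc r (xs k)))) (case_prod \<phi>)"
proof -
  have "(\<integral>z. (norm (case_prod (el_proc (el_trunc r (xs k))) z - case_prod \<phi> z))\<^sup>2 \<partial>time_prob M r)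
    = (\<integral>z. (norm (case_prod (el_proc (xs k)) z - case_prod \<phi> z))\<^sup>2 \<partial>time_prob M r)" for k
    by (intro Bochner_Integration.integral_cong refl) (auto simp: space_time_prob el_proc_trunc)
  then show ?thesis
    using l2_lim_time_prob_mono[OF assms] el_proc_sq_int[OF el_ok_trunc[OF assms(4,1)]] by (simp add: l2_lim_def)
qed

text \<open>J and J' come with unrelated approximations. The approximations of J, truncated at r,
  also converge to J' by the isometry, and for one list the increment is orthogonal to the
  past.\<close>

lemma has_ito_orthogonal:
  assumes "0 \<le> r" "r \<le> t" "has_ito_integral M F W \<phi> t J" "has_ito_integral M F W \<phi> r J'"
    and \<eta>: "\<eta> \<in> borel_measurable (F r)" "sq_int M \<eta>"
  shows "expectation (\<lambda>w. \<eta> w \<bullet> (J w - J' w)) = 0"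
proof -
  have t: "0 \<le> t" using assms by simp
  obtain xs where x: "\<And>k. el_ok t (xs k)" "l2_lim (time_prob M t) (\<lambda>k. case_prod (el_proc (xs k))) (case_prod \<phi>)"
    "l2_lim M (\<lambda>k. el_ito (xs k)) J" using has_ito_elementary[OF assms(3) t] by blast
  obtain ys where y: "\<And>k. el_ok r (ys k)" "l2_lim (time_prob M r) (\<lambda>k. case_prod (el_proc (ys k))) (case_prod \<phi>)"
    "l2_lim M (\<lambda>k. el_ito (ys k)) J'" using has_ito_elementary[OF assms(4,1)] by blast
  have lr: "l2_lim (time_prob M r) (\<lambda>k. case_prod (el_proc (el_trunc r (xs k)))) (case_prod \<phi>)"
    using assms(3) L2_proc_iff[OF t] by (intro l2_lim_trunc[OF assms(1,2) _ x(1,2)]) (auto simp: has_ito_integral_def)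
  have "l2_lim M (\<lambda>k. el_ito (el_trunc r (xs k))) J'"
    by (rule l2_lim_el_ito_transfer[OF assms(1) y(1) el_ok_trunc[OF x(1) assms(1)] y(2) lr y(3)])
  then have "(\<lambda>k. expectation (\<lambda>w. \<eta> w \<bullet> (el_ito (xs k) w - el_ito (el_trunc r (xs k)) w))) \<longlonglongrightarrow> expectation (\<lambda>w. \<eta> w \<bullet> (J w - J' w))"
    by (intro l2_lim_inner[OF l2_lim_const[OF \<eta>(2)]] l2_lim_diff x)
  moreover have "expectation (\<lambda>w. \<eta> w \<bullet> (el_ito (xs k) w - el_ito (el_trunc r (xs k)) w)) = 0" for k
    using el_increment_orthogonal[OF x(1)[of k] assms(1,2) \<eta>] by (simp add: el_ito_trunc_full[OF x(1)])
  ultimately show ?thesis by (simp add: LIMSEQ_const_iff)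
qed

end

section \<open>Doob's inequality and continuous versions\<close>

primrec running_max :: "(nat \<Rightarrow> real) \<Rightarrow> nat \<Rightarrow> real" where
  "running_max s 0 = s 0"
| "running_max s (Suc n) = max (running_max s n) (s (Suc n))"

lemma running_max_ge: "i \<le> n \<Longrightarrow> s i \<le> running_max s n"
  by (induction n) (auto simp: le_Suc_eq)

text \<open>Trajectorial form of Doob's L2 inequality: no probability is involved, and the
  subtracted sum is a discrete stochastic integral that has nonnegative mean when s comes from a
  submartingale.\<close>

lemma running_max_pathwise:
  assumes "\<And>k. 0 \<le> s k"
  shows "(running_max s n)\<^sup>2 \<le> 4 * (s n)\<^sup>2 - 4 * (\<Sum>k<n. running_max s k * (s (Suc k) - s k))"
proof -
  have "(running_max s n)\<^sup>2 / 2 + (\<Sum>k<n. running_max s k * (s (Suc k) - s k)) \<le> running_max s n * s n"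
  proof (induction n)
    case (Suc n)
    define m s' where "m = running_max s n" and "s' = s (Suc n)"
    \<comment> \<open>While the maximum does not move, the induction step is an equality; at a new
      maximum the gap is half this square.\<close>
    have sq: "0 \<le> (s' - m)\<^sup>2" by simp
    have "(max m s')\<^sup>2 / 2 + (m * s' - m\<^sup>2 / 2) \<le> max m s' * s'"
      using sq by (auto simp: max_def power2_eq_square algebra_simps)
    then show ?case using Suc by (simp add: m_def[symmetric] s'_def[symmetric] algebra_simps)
  qed (simp add: power2_eq_square)
  \<comment> \<open>Young's inequality with weight 1/4 leaves a quarter of the squared maximum on
    the left, hence the factor 4.\<close>
  moreover have "running_max s n * s n \<le> (running_max s n)\<^sup>2 / 4 + (s n)\<^sup>2"
    using zero_le_power2[of "running_max s n / 2 - s n"] by (simp add: power2_eq_square algebra_simps)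
  ultimately show ?thesis by simp
qed

text \<open>\<open>sgn x\<close> is a subgradient of the norm at x. It shows that norms of vector
  martingales are submartingales without a conditional Jensen inequality.\<close>

lemma norm_diff_ge_sgn: "sgn x \<bullet> (y - x) \<le> norm y - norm x" for x y :: "'b::real_inner"
proof -
  have "sgn x \<bullet> y \<le> norm (sgn x) * norm y" by (rule norm_cauchy_schwarz)
  also have "\<dots> \<le> norm y" by (simp add: norm_sgn)
  finally have "sgn x \<bullet> y \<le> norm y" .
  moreover have "sgn x \<bullet> x = norm x"
    by (cases "x = 0") (simp_all add: sgn_div_norm power2_norm_eq_inner[symmetric] power2_eq_square)
  ultimately show ?thesis by (simp add: inner_diff_right)
qed

section \<open>Suprema of paths and uniform grids\<close>

definition csup :: "real \<Rightarrow> (real \<Rightarrow> 'a \<Rightarrow> 'b::euclidean_space) \<Rightarrow> 'a \<Rightarrow> ennreal" where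
  "csup T X w = (SUP t\<in>{0..T}. ennreal ((norm (X t w))\<^sup>2))"

definition grid_point :: "real \<Rightarrow> nat \<Rightarrow> nat \<Rightarrow> real" where
  "grid_point T n i = T * real i / real (Suc n)"

lemma grid_point_bounds: "0 \<le> T \<Longrightarrow> i \<le> Suc n \<Longrightarrow> grid_point T n i \<in> {0..T}"
  using mult_left_mono[of "real i" "real (Suc n)" T] by (auto simp: grid_point_def divide_le_eq)

lemma grid_point_mono: "0 \<le> T \<Longrightarrow> i \<le> j \<Longrightarrow> grid_point T n i \<le> grid_point T n j"
  by (auto simp: grid_point_def intro!: divide_right_mono mult_left_mono)

lemma grid_point_last: "grid_point T n (Suc n) = T"
  by (simp add: grid_point_def)

lemma LIMSEQ_abs_le_inverse:
  fixes x :: "nat \<Rightarrow> real"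
  assumes "\<And>n. \<bar>x n - l\<bar> \<le> c / real (Suc n)" shows "x \<longlonglongrightarrow> l"
proof -
  have "(\<lambda>n. c / real (Suc n)) \<longlonglongrightarrow> 0"
    using tendsto_mult[OF tendsto_const[of c] LIMSEQ_inverse_real_of_nat] by (simp add: divide_inverse)
  then have "(\<lambda>n. x n - l) \<longlonglongrightarrow> 0"
  proof (rule Lim_null_comparison[rotated])
    show "\<forall>\<^sub>F n in sequentially. norm (x n - l) \<le> c / real (Suc n)"
      unfolding real_norm_def by (intro always_eventually allI assms)
  qed
  then show ?thesis by (simp only: LIM_zero_iff)
qed

lemma grid_point_approx:
  assumes "t \<in> {0..T}"
  obtains i where "\<And>n. i n \<le> Suc n" "(\<lambda>n. grid_point T n (i n)) \<longlonglongrightarrow> t"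
proof -
  \<comment> \<open>Rounding down moves t by at most one mesh width. For T = 0 the quotient t / T is
    0 and all grid points coincide.\<close>
  define i where "i n = nat \<lfloor>real (Suc n) * (t / T)\<rfloor>" for n
  have le1: "t / T \<le> 1" "0 \<le> t / T" using assms by (auto simp: divide_le_eq_1)
  have i: "i n \<le> Suc n" for n
  proof -
    have "real (Suc n) * (t / T) \<le> real (Suc n) * 1" using le1 by (intro mult_left_mono) auto
    then have "\<lfloor>real (Suc n) * (t / T)\<rfloor> \<le> int (Suc n)" by (simp add: floor_le_iff)
    then show ?thesis by (simp add: i_def)
  qed
  have ri: "real (i n) \<le> real (Suc n) * (t / T)" "real (Suc n) * (t / T) \<le> real (i n) + 1" for n
  proof -
    have "0 \<le> real (Suc n) * (t / T)" using le1 by (intro mult_nonneg_nonneg) auto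
    then have "real (i n) = of_int \<lfloor>real (Suc n) * (t / T)\<rfloor>" by (simp add: i_def)
    then show "real (i n) \<le> real (Suc n) * (t / T)" "real (Suc n) * (t / T) \<le> real (i n) + 1" by linarith+
  qed
  have T0: "0 \<le> T" using assms by auto
  have tT: "T * (t / T) = t" using assms by (cases "T = 0") auto
  have "\<bar>grid_point T n (i n) - t\<bar> \<le> T / real (Suc n)" for n
  proof -
    have "T * real (i n) \<le> T * (real (Suc n) * (t / T))" "T * (real (Suc n) * (t / T)) \<le> T * (real (i n) + 1)"
      by (rule mult_left_mono[OF ri(1) T0], rule mult_left_mono[OF ri(2) T0])
    then have "T * real (i n) \<le> t * real (Suc n)" "t * real (Suc n) \<le> T * real (i n) + T"
      unfolding mult.left_commute[of T "real (Suc n)" "t / T"] tT by (simp_all only: mult.commute[of t] distrib_left mult_1_right)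
    then have "grid_point T n (i n) \<le> t" "t \<le> grid_point T n (i n) + T / real (Suc n)"
      by (simp_all add: grid_point_def divide_le_eq add_divide_distrib[symmetric] le_divide_eq)
    then show ?thesis by simp
  qed
  then have "(\<lambda>n. grid_point T n (i n)) \<longlonglongrightarrow> t" by (rule LIMSEQ_abs_le_inverse)
  then show thesis using that i by blast
qed

lemma continuous_grid_limit:
  assumes "continuous_on {0..T} f" "t \<in> {0..T}" "\<And>n. i n \<le> Suc n" "(\<lambda>n. grid_point T n (i n)) \<longlonglongrightarrow> t"
  shows "(\<lambda>n. f (grid_point T n (i n))) \<longlonglongrightarrow> f t"
proof (rule continuous_on_tendsto_compose[OF assms(1,4,2)], intro always_eventually allI)
  show "grid_point T n (i n) \<in> {0..T}" for n
    by (rule grid_point_bounds[OF _ assms(3)]) (use assms(2) in simp)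
qed

text \<open>Reduces an uncountable supremum to a countable one, which gives its
  measurability.\<close>

lemma csup_eq_grid:
  assumes "continuous_on {0..T} (\<lambda>t. X t w)" "0 \<le> T"
  shows "csup T X w = (SUP n. SUP i\<in>{..Suc n}. ennreal ((norm (X (grid_point T n i) w))\<^sup>2))"
proof (rule antisym)
  show "csup T X w \<le> (SUP n. SUP i\<in>{..Suc n}. ennreal ((norm (X (grid_point T n i) w))\<^sup>2))"
    unfolding csup_def
  proof (rule SUP_least)
    fix t assume t: "t \<in> {0..T}"
    obtain i where i: "\<And>n. i n \<le> Suc n" "(\<lambda>n. grid_point T n (i n)) \<longlonglongrightarrow> t"
      using grid_point_approx[OF t] by blast
    have "(\<lambda>n. X (grid_point T n (i n)) w) \<longlonglongrightarrow> X t w" by (rule continuous_grid_limit[OF assms(1) t i])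
    then have "(\<lambda>n. ennreal ((norm (X (grid_point T n (i n)) w))\<^sup>2)) \<longlonglongrightarrow> ennreal ((norm (X t w))\<^sup>2)"
      by (intro tendsto_intros)
    then show "ennreal ((norm (X t w))\<^sup>2) \<le> (SUP n. SUP i\<in>{..Suc n}. ennreal ((norm (X (grid_point T n i) w))\<^sup>2))"
    proof (rule LIMSEQ_le_const2, intro exI allI impI)
      fix n
      show "ennreal ((norm (X (grid_point T n (i n)) w))\<^sup>2) \<le> (SUP n. SUP i\<in>{..Suc n}. ennreal ((norm (X (grid_point T n i) w))\<^sup>2))"
        by (rule SUP_upper2[of n], simp, rule SUP_upper) (use i(1)[of n] in simp)
    qed
  qed
  show "(SUP n. SUP i\<in>{..Suc n}. ennreal ((norm (X (grid_point T n i) w))\<^sup>2)) \<le> csup T X w"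
    unfolding csup_def using grid_point_bounds[OF assms(2)] by (intro SUP_least SUP_upper) auto
qed

lemma csup_upper: "t \<in> {0..T} \<Longrightarrow> ennreal ((norm (X t w))\<^sup>2) \<le> csup T X w"
  unfolding csup_def by (rule SUP_upper)

lemma csup_add_scaleR_le: "csup T (\<lambda>t w. X t w + c *\<^sub>R Y t w) w \<le> 2 * csup T X w + ennreal (2 * c\<^sup>2) * csup T Y w"
  unfolding csup_def[of T "\<lambda>t w. X t w + c *\<^sub>R Y t w"]
proof (rule SUP_least)
  fix t assume t: "t \<in> {0..T}"
  have "(norm (X t w + c *\<^sub>R Y t w))\<^sup>2 \<le> 2 * (norm (X t w))\<^sup>2 + 2 * c\<^sup>2 * (norm (Y t w))\<^sup>2"
    using norm_add_sq_le[of "X t w" "c *\<^sub>R Y t w"] by (simp add: power_mult_distrib)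
  then have "ennreal ((norm (X t w + c *\<^sub>R Y t w))\<^sup>2) \<le> ennreal (2 * (norm (X t w))\<^sup>2 + 2 * c\<^sup>2 * (norm (Y t w))\<^sup>2)"
    by (rule ennreal_leI)
  also have "\<dots> = 2 * ennreal ((norm (X t w))\<^sup>2) + ennreal (2 * c\<^sup>2) * ennreal ((norm (Y t w))\<^sup>2)"
    by (simp add: ennreal_plus ennreal_mult[symmetric]) (simp add: ennreal_mult)
  also have "\<dots> \<le> 2 * csup T X w + ennreal (2 * c\<^sup>2) * csup T Y w"
    by (intro add_mono mult_left_mono csup_upper t) auto
  finally show "ennreal ((norm (X t w + c *\<^sub>R Y t w))\<^sup>2) \<le> 2 * csup T X w + ennreal (2 * c\<^sup>2) * csup T Y w" .
qed

lemma L2_cont_iff: "X \<in> L2_cont M F T \<longleftrightarrow> (\<forall>t\<in>{0..T}. X t \<in> borel_measurable (F t)) \<and>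
     (\<forall>w\<in>space M. continuous_on {0..T} (\<lambda>t. X t w)) \<and> (\<integral>\<^sup>+w. csup T X w \<partial>M) < \<infinity>"
  by (auto simp: L2_cont_def csup_def)

text \<open>Repeated use of |x + y|^2 <= 2|x|^2 + 2|y|^2 produces the geometric weights. A
  convergent weighted series of squared increments thus bounds every tail by a multiple of
  2^-m.\<close>

lemma norm_sum_weighted_sq_le:
  fixes d :: "nat \<Rightarrow> 'b::real_normed_vector"
  shows "(norm (\<Sum>j<k. d (m + j)))\<^sup>2 \<le> 2 * (1/2)^m * (\<Sum>j<k. 2^(m + j) * (norm (d (m + j)))\<^sup>2)"
proof (induction k arbitrary: m)
  case (Suc k)
  have "(norm (\<Sum>j<Suc k. d (m + j)))\<^sup>2 = (norm (d m + (\<Sum>j<k. d (Suc m + j))))\<^sup>2"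
    by (simp only: sum.lessThan_Suc_shift) simp
  also have "\<dots> \<le> 2 * (norm (d m))\<^sup>2 + 2 * (norm (\<Sum>j<k. d (Suc m + j)))\<^sup>2" by (rule norm_add_sq_le)
  also have "\<dots> \<le> 2 * (norm (d m))\<^sup>2 + 2 * (2 * (1/2)^Suc m * (\<Sum>j<k. 2^(Suc m + j) * (norm (d (Suc m + j)))\<^sup>2))"
    by (intro add_left_mono mult_left_mono Suc) auto
  also have "\<dots> = 2 * (1/2)^m * (2^m * (norm (d m))\<^sup>2 + (\<Sum>j<k. 2^(Suc m + j) * (norm (d (Suc m + j)))\<^sup>2))"
    by (simp add: algebra_simps power_one_over)
  also have "\<dots> = 2 * (1/2)^m * (\<Sum>j<Suc k. 2^(m + j) * (norm (d (m + j)))\<^sup>2)"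
    by (simp only: sum.lessThan_Suc_shift) simp
  finally show ?case .
qed simp

context brownian
begin

text \<open>Expectation of \<open>running_max_pathwise\<close> for the norms of X. The subtracted
  sum has nonnegative mean by the orthogonality hypothesis.\<close>

lemma doob_discrete:
  fixes X :: "nat \<Rightarrow> 'a \<Rightarrow> 'b::euclidean_space"
  assumes X: "\<And>k. k \<le> n \<Longrightarrow> X k \<in> borel_measurable (F (\<tau> k))" "\<And>k. k \<le> n \<Longrightarrow> sq_int M (X k)"
    and \<tau>: "\<And>i j. i \<le> j \<Longrightarrow> j \<le> n \<Longrightarrow> \<tau> i \<le> \<tau> j"
    and orth: "\<And>k \<eta>. k < n \<Longrightarrow> \<eta> \<in> borel_measurable (F (\<tau> k)) \<Longrightarrow> sq_int M \<eta> \<Longrightarrow>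
      expectation (\<lambda>w. \<eta> w \<bullet> (X (Suc k) w - X k w)) = 0"
  shows "sq_int M (\<lambda>w. running_max (\<lambda>k. norm (X k w)) n)"
    and "expectation (\<lambda>w. (running_max (\<lambda>k. norm (X k w)) n)\<^sup>2) \<le> 4 * expectation (\<lambda>w. (norm (X n w))\<^sup>2)"
proof -
  define S where "S k w = running_max (\<lambda>k. norm (X k w)) k" for k w
  have S0: "0 \<le> S k w" for k w
    unfolding S_def using running_max_ge[of 0 k "\<lambda>k. norm (X k w)"] norm_ge_zero[of "X 0 w"] by linarith
  have nX: "sq_int M (\<lambda>w. norm (X k w))" if "k \<le> n" for k
    using X(2)[OF that] by (rule sq_int_bound[where c = 1]) (use sq_int_measurable[OF X(2)[OF that]] in auto)
  have S: "S k \<in> borel_measurable (F (\<tau> k)) \<and> sq_int M (S k)" if "k \<le> n" for k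
    using that
  proof (induction k)
    case 0
    have "S 0 = (\<lambda>w. norm (X 0 w))" by (simp add: S_def fun_eq_iff)
    then show ?case using X(1)[of 0] nX[of 0] by simp
  next
    case (Suc k)
    then have k: "S k \<in> borel_measurable (F (\<tau> k))" "sq_int M (S k)" by auto
    have eq: "S (Suc k) = (\<lambda>w. max (S k w) (norm (X (Suc k) w)))" by (simp add: S_def fun_eq_iff)
    have m: "S (Suc k) \<in> borel_measurable (F (\<tau> (Suc k)))"
      unfolding eq using measurable_F_mono[OF \<tau> k(1), of "Suc k"] X(1)[OF Suc.prems] Suc.prems by (intro borel_measurable_max) auto
    have "sq_int M (S (Suc k))"
      using sq_int_add[OF k(2) nX[OF Suc.prems]]
      by (rule sq_int_bound[where c = 1]) (use measurable_F_M[OF m] S0 in \<open>auto simp: eq max_def\<close>)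
    then show ?case using m by simp
  qed
  then show sq: "sq_int M (\<lambda>w. running_max (\<lambda>k. norm (X k w)) n)" by (simp add: S_def[abs_def])
  have iS: "integrable M (\<lambda>w. S k w * (norm (X (Suc k) w) - norm (X k w)))" if "k < n" for k
    using sq_int_inner[OF _ sq_int_diff[OF nX[of "Suc k"] nX[of k]], of "S k"] S[of k] that by simp
  have pos: "0 \<le> expectation (\<lambda>w. S k w * (norm (X (Suc k) w) - norm (X k w)))" if "k < n" for k
  proof -
    \<comment> \<open>Orthogonality is tested with the running maximum times the subgradient of the
      norm at \<open>X k\<close>, both known at time \<open>\<tau> k\<close>.\<close>
    define \<eta> where "\<eta> w = S k w *\<^sub>R sgn (X k w)" for w
    have m: "\<eta> \<in> borel_measurable (F (\<tau> k))"
      unfolding \<eta>_def[abs_def] sgn_div_norm using S[of k] X(1)[of k] that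
      by (intro borel_measurable_scaleR borel_measurable_inverse borel_measurable_norm) auto
    have s: "sq_int M \<eta>"
      by (rule sq_int_bound[where c = 1 and g = "S k"]) (use S[of k] that measurable_F_M[OF m] in \<open>auto simp: \<eta>_def norm_sgn\<close>)
    have "0 = expectation (\<lambda>w. \<eta> w \<bullet> (X (Suc k) w - X k w))" using orth[OF that m s] by simp
    also have "\<dots> \<le> expectation (\<lambda>w. S k w * (norm (X (Suc k) w) - norm (X k w)))"
    proof (rule integral_mono)
      show "integrable M (\<lambda>w. \<eta> w \<bullet> (X (Suc k) w - X k w))"
        using that by (intro sq_int_inner[OF s] sq_int_diff X) auto
      show "\<eta> w \<bullet> (X (Suc k) w - X k w) \<le> S k w * (norm (X (Suc k) w) - norm (X k w))" for w
        unfolding \<eta>_def inner_scaleR_left by (intro mult_left_mono norm_diff_ge_sgn S0)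
    qed (rule iS[OF that])
    finally show ?thesis .
  qed
  have "expectation (\<lambda>w. (S n w)\<^sup>2) \<le> expectation (\<lambda>w. 4 * (norm (X n w))\<^sup>2 - 4 * (\<Sum>k<n. S k w * (norm (X (Suc k) w) - norm (X k w))))"
  proof (rule integral_mono)
    show "integrable M (\<lambda>w. (S n w)\<^sup>2)" using sq by (simp add: S_def sq_int_def)
    show "integrable M (\<lambda>w. 4 * (norm (X n w))\<^sup>2 - 4 * (\<Sum>k<n. S k w * (norm (X (Suc k) w) - norm (X k w))))"
      using iS sq_int_integrable[OF X(2)[of n]]
      by (intro Bochner_Integration.integrable_diff integrable_mult_right Bochner_Integration.integrable_sum) auto
    show "(S n w)\<^sup>2 \<le> 4 * (norm (X n w))\<^sup>2 - 4 * (\<Sum>k<n. S k w * (norm (X (Suc k) w) - norm (X k w)))" for w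
      unfolding S_def by (rule running_max_pathwise) simp
  qed
  also have "\<dots> = 4 * expectation (\<lambda>w. (norm (X n w))\<^sup>2) - 4 * (\<Sum>k<n. expectation (\<lambda>w. S k w * (norm (X (Suc k) w) - norm (X k w))))"
    using iS sq_int_integrable[OF X(2)[of n]]
    by (subst Bochner_Integration.integral_diff) (auto intro!: Bochner_Integration.integrable_sum Bochner_Integration.integral_sum)
  also have "\<dots> \<le> 4 * expectation (\<lambda>w. (norm (X n w))\<^sup>2)"
    using sum_nonneg[of "{..<n}" "\<lambda>k. expectation (\<lambda>w. S k w * (norm (X (Suc k) w) - norm (X k w)))"] pos by simp
  finally show "expectation (\<lambda>w. (running_max (\<lambda>k. norm (X k w)) n)\<^sup>2) \<le> 4 * expectation (\<lambda>w. (norm (X n w))\<^sup>2)"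
    by (simp add: S_def)
qed

definition adapted_cont :: "real \<Rightarrow> (real \<Rightarrow> 'a \<Rightarrow> 'b::euclidean_space) \<Rightarrow> bool" where
  "adapted_cont T X \<longleftrightarrow> (\<forall>t\<in>{0..T}. X t \<in> borel_measurable (F t)) \<and> (\<forall>w\<in>space M. continuous_on {0..T} (\<lambda>t. X t w))"

lemma L2_cont_eq: "X \<in> L2_cont M F T \<longleftrightarrow> adapted_cont T X \<and> (\<integral>\<^sup>+w. csup T X w \<partial>M) < \<infinity>"
  by (auto simp: L2_cont_iff adapted_cont_def)

lemma csup_measurable:
  assumes "adapted_cont T X" "0 \<le> T" shows "csup T X \<in> borel_measurable M"
proof -
  have "(\<lambda>w. SUP n. SUP i\<in>{..Suc n}. ennreal ((norm (X (grid_point T n i) w))\<^sup>2)) \<in> borel_measurable M"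
  proof (intro borel_measurable_SUP)
    fix n i :: nat assume i: "i \<in> {..Suc n}"
    then have "X (grid_point T n i) \<in> borel_measurable M"
      using assms grid_point_bounds[OF assms(2), of i n]
      by (intro measurable_F_M[of _ "grid_point T n i"]) (simp add: adapted_cont_def)
    then show "(\<lambda>w. ennreal ((norm (X (grid_point T n i) w))\<^sup>2)) \<in> borel_measurable M" by measurable
  qed auto
  then show ?thesis
    by (subst measurable_cong) (use assms in \<open>auto simp: adapted_cont_def intro!: csup_eq_grid\<close>)
qed

text \<open>The discrete inequality is applied on the uniform grids. These are not nested, so the
  maxima need not increase, and Fatou's lemma replaces monotone convergence.\<close>

lemma doob_continuous:
  fixes X :: "real \<Rightarrow> 'a \<Rightarrow> 'b::euclidean_space"
  assumes T: "0 \<le> T" and X: "adapted_cont T X" and sq: "\<And>t. t \<in> {0..T} \<Longrightarrow> sq_int M (X t)"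
    and orth: "\<And>r t \<eta>. 0 \<le> r \<Longrightarrow> r \<le> t \<Longrightarrow> t \<le> T \<Longrightarrow> \<eta> \<in> borel_measurable (F r) \<Longrightarrow> sq_int M \<eta> \<Longrightarrow>
      expectation (\<lambda>\<omega>. \<eta> \<omega> \<bullet> (X t \<omega> - X r \<omega>)) = 0"
  shows "(\<integral>\<^sup>+\<omega>. csup T X \<omega> \<partial>M) \<le> ennreal (4 * expectation (\<lambda>\<omega>. (norm (X T \<omega>))\<^sup>2))"
proof -
  define S where "S n \<omega> = running_max (\<lambda>k. norm (X (grid_point T n k) \<omega>)) (Suc n)" for n \<omega>
  have b: "grid_point T n k \<in> {0..T}" if "k \<le> Suc n" for n k by (rule grid_point_bounds[OF T that])
  have D: "sq_int M (S n)" "expectation (\<lambda>\<omega>. (S n \<omega>)\<^sup>2) \<le> 4 * expectation (\<lambda>\<omega>. (norm (X T \<omega>))\<^sup>2)" for n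
  proof -
    have 1: "X (grid_point T n k) \<in> borel_measurable (F (grid_point T n k))" "sq_int M (X (grid_point T n k))" if "k \<le> Suc n" for k
      using X b[OF that] sq[OF b[OF that]] by (auto simp: adapted_cont_def)
    have 2: "grid_point T n i \<le> grid_point T n j" if "i \<le> j" "j \<le> Suc n" for i j
      by (rule grid_point_mono[OF T that(1)])
    have 3: "expectation (\<lambda>\<omega>. \<eta> \<omega> \<bullet> (X (grid_point T n (Suc k)) \<omega> - X (grid_point T n k) \<omega>)) = 0"
      if "k < Suc n" "\<eta> \<in> borel_measurable (F (grid_point T n k))" "sq_int M \<eta>" for k \<eta>
    proof (rule orth[OF _ _ _ that(2,3)])
      show "0 \<le> grid_point T n k" using b[of k n] that(1) by simp
      show "grid_point T n k \<le> grid_point T n (Suc k)" by (rule grid_point_mono[OF T]) simp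
      show "grid_point T n (Suc k) \<le> T" using b[of "Suc k" n] that(1) by simp
    qed
    note * = 1(1) 1(2) 2 3
    note d = doob_discrete[of "Suc n" "\<lambda>k. X (grid_point T n k)" "grid_point T n", OF *, unfolded grid_point_last]
    show "sq_int M (S n)" unfolding S_def[abs_def] by (rule d(1))
    show "expectation (\<lambda>\<omega>. (S n \<omega>)\<^sup>2) \<le> 4 * expectation (\<lambda>\<omega>. (norm (X T \<omega>))\<^sup>2)"
      unfolding S_def by (rule d(2))
  qed
  have "(\<integral>\<^sup>+\<omega>. csup T X \<omega> \<partial>M) \<le> (\<integral>\<^sup>+\<omega>. liminf (\<lambda>n. ennreal ((S n \<omega>)\<^sup>2)) \<partial>M)"
  proof (rule nn_integral_mono)
    fix \<omega> assume w: "\<omega> \<in> space M"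
    show "csup T X \<omega> \<le> liminf (\<lambda>n. ennreal ((S n \<omega>)\<^sup>2))"
      unfolding csup_def
    proof (rule SUP_least)
      fix t assume t: "t \<in> {0..T}"
      obtain i where i: "\<And>n. i n \<le> Suc n" "(\<lambda>n. grid_point T n (i n)) \<longlonglongrightarrow> t"
        using grid_point_approx[OF t] by blast
      have "(\<lambda>n. X (grid_point T n (i n)) \<omega>) \<longlonglongrightarrow> X t \<omega>"
        using X w by (intro continuous_grid_limit[OF _ t i]) (auto simp: adapted_cont_def)
      then have "(\<lambda>n. ennreal ((norm (X (grid_point T n (i n)) \<omega>))\<^sup>2)) \<longlonglongrightarrow> ennreal ((norm (X t \<omega>))\<^sup>2)"
        by (intro tendsto_intros)
      then have "ennreal ((norm (X t \<omega>))\<^sup>2) = liminf (\<lambda>n. ennreal ((norm (X (grid_point T n (i n)) \<omega>))\<^sup>2))"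
        by (rule lim_imp_Liminf[OF trivial_limit_sequentially, symmetric])
      also have "\<dots> \<le> liminf (\<lambda>n. ennreal ((S n \<omega>)\<^sup>2))"
      proof (intro Liminf_mono always_eventually allI ennreal_leI power_mono)
        show "norm (X (grid_point T n (i n)) \<omega>) \<le> S n \<omega>" for n
          unfolding S_def by (rule running_max_ge[OF i(1)])
      qed simp
      finally show "ennreal ((norm (X t \<omega>))\<^sup>2) \<le> liminf (\<lambda>n. ennreal ((S n \<omega>)\<^sup>2))" .
    qed
  qed
  also have "\<dots> \<le> liminf (\<lambda>n. \<integral>\<^sup>+\<omega>. ennreal ((S n \<omega>)\<^sup>2) \<partial>M)"
    using sq_int_measurable[OF D(1)] by (intro nn_integral_liminf) measurable
  also have "\<dots> \<le> ennreal (4 * expectation (\<lambda>\<omega>. (norm (X T \<omega>))\<^sup>2))"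
  proof (rule order_trans[OF Liminf_le_Limsup Limsup_bounded])
    show "\<forall>\<^sub>F n in sequentially. (\<integral>\<^sup>+\<omega>. ennreal ((S n \<omega>)\<^sup>2) \<partial>M) \<le> ennreal (4 * expectation (\<lambda>\<omega>. (norm (X T \<omega>))\<^sup>2))"
      using nn_integral_sq_int[OF D(1)] D(2) by (intro always_eventually allI) (simp add: ennreal_leI)
  qed simp
  finally show ?thesis .
qed

section \<open>The space of adapted processes with continuous paths\<close>

lemma L2_cont_sq_int: "X \<in> L2_cont M F T \<Longrightarrow> t \<in> {0..T} \<Longrightarrow> sq_int M (X t)"
proof -
  assume X: "X \<in> L2_cont M F T" and t: "t \<in> {0..T}"
  have m: "X t \<in> borel_measurable M" using X t by (intro measurable_F_M[of _ t]) (simp add: L2_cont_def)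
  have "(\<integral>\<^sup>+w. ennreal ((norm (X t w))\<^sup>2) \<partial>M) \<le> (\<integral>\<^sup>+w. csup T X w \<partial>M)"
    by (intro nn_integral_mono csup_upper t)
  also have "\<dots> < \<infinity>" using X by (simp add: L2_cont_eq)
  finally show "sq_int M (X t)" using m by (simp add: sq_int_iff_nn_integral)
qed

lemma adapted_cont_add_scaleR:
  "adapted_cont T X \<Longrightarrow> adapted_cont T Y \<Longrightarrow> adapted_cont T (\<lambda>t w. X t w + c *\<^sub>R Y t w)"
  by (auto simp: adapted_cont_def intro!: continuous_intros borel_measurable_add borel_measurable_scaleR)

lemma L2_cont_add_scaleR:
  assumes "0 \<le> T" "X \<in> L2_cont M F T" "Y \<in> L2_cont M F T"
  shows "(\<lambda>t w. X t w + c *\<^sub>R Y t w) \<in> L2_cont M F T"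
proof -
  have a: "adapted_cont T X" "adapted_cont T Y" using assms by (auto simp: L2_cont_eq)
  note [measurable] = csup_measurable[OF a(1) assms(1)] csup_measurable[OF a(2) assms(1)]
  have "(\<integral>\<^sup>+w. csup T (\<lambda>t w. X t w + c *\<^sub>R Y t w) w \<partial>M) \<le> (\<integral>\<^sup>+w. 2 * csup T X w + ennreal (2 * c\<^sup>2) * csup T Y w \<partial>M)"
    by (intro nn_integral_mono csup_add_scaleR_le)
  also have "\<dots> = 2 * (\<integral>\<^sup>+w. csup T X w \<partial>M) + ennreal (2 * c\<^sup>2) * (\<integral>\<^sup>+w. csup T Y w \<partial>M)"
    by (simp add: nn_integral_add nn_integral_cmult)
  also have "\<dots> < \<infinity>" using assms by (auto simp: L2_cont_eq ennreal_mult_less_top)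
  finally show ?thesis using adapted_cont_add_scaleR[OF a] by (simp add: L2_cont_eq)
qed

text \<open>Rounding time up to a grid and capping it at t uses only variables known at time t;
  continuity of the paths recovers the process in the limit.\<close>

lemma adapted_cont_progressive:
  fixes X :: "real \<Rightarrow> 'a \<Rightarrow> 'b::euclidean_space"
  assumes "adapted_cont T X" shows "progressive F T X"
  unfolding progressive_def
proof
  fix t assume t: "t \<in> {0..T}"
  define Y where "Y n z = X (max 0 (min t (real_of_int \<lceil>real (Suc n) * fst z\<rceil> / real (Suc n)))) (snd z)" for n z
  have "(\<lambda>z. X (fst z) (snd z)) \<in> borel_measurable (restrict_space borel {0..t} \<Otimes>\<^sub>M F t)"
  proof (rule borel_measurable_LIMSEQ_metric[where f = Y])
    fix n
    have m: "(\<lambda>z. X (max 0 (min t (real_of_int i / real (Suc n)))) (snd z)) \<in> borel_measurable (restrict_space borel {0..t} \<Otimes>\<^sub>M F t)" for i :: int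
    proof (rule measurable_compose[OF measurable_snd])
      let ?u = "max 0 (min t (real_of_int i / real (Suc n)))"
      have "?u \<in> {0..T}" "?u \<le> t" using t by auto
      then show "X ?u \<in> borel_measurable (F t)"
        using assms by (intro measurable_F_mono[of ?u t]) (simp_all only: adapted_cont_def)
    qed
    \<comment> \<open>The rounded time takes countably many values, so each of them may be treated
      as fixed.\<close>
    have "(\<lambda>z. \<lceil>real (Suc n) * fst z\<rceil>) \<in> measurable (restrict_space borel {0..t} \<Otimes>\<^sub>M F t) (count_space UNIV)"
      by (rule measurable_compose[OF measurable_fst]) (intro measurable_restrict_space1, measurable)
    from measurable_compose_countable[OF m this]
    show "Y n \<in> borel_measurable (restrict_space borel {0..t} \<Otimes>\<^sub>M F t)" by (simp add: Y_def[abs_def])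
  next
    fix z assume "z \<in> space (restrict_space borel {0..t} \<Otimes>\<^sub>M F t)"
    then have s: "fst z \<in> {0..t}" and w: "snd z \<in> space M" by (auto simp: space_pair_measure space_restrict_space space_F)
    define u where "u n = max 0 (min t (real_of_int \<lceil>real (Suc n) * fst z\<rceil> / real (Suc n)))" for n
    have "\<bar>u n - fst z\<bar> \<le> 1 / real (Suc n)" for n
    proof -
      define x where "x = fst z"
      define N where "N = real (Suc n)"
      have N: "0 < N" by (simp add: N_def)
      have "N * x \<le> real_of_int \<lceil>N * x\<rceil>" "real_of_int \<lceil>N * x\<rceil> \<le> N * x + 1" by linarith+
      then have "N * x / N \<le> real_of_int \<lceil>N * x\<rceil> / N" "real_of_int \<lceil>N * x\<rceil> / N \<le> (N * x + 1) / N"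
        using N by (intro divide_right_mono; simp)+
      then have "x \<le> real_of_int \<lceil>N * x\<rceil> / N" "real_of_int \<lceil>N * x\<rceil> / N \<le> x + 1 / N"
        using N by (simp_all add: add_divide_distrib)
      then have "fst z \<le> real_of_int \<lceil>real (Suc n) * fst z\<rceil> / real (Suc n)" "real_of_int \<lceil>real (Suc n) * fst z\<rceil> / real (Suc n) \<le> fst z + 1 / real (Suc n)"
        by (simp_all only: x_def N_def)
      then show ?thesis using s unfolding u_def by (auto simp: max_def min_def)
    qed
    then have "u \<longlonglongrightarrow> fst z" by (rule LIMSEQ_abs_le_inverse)
    moreover have "continuous_on {0..T} (\<lambda>t. X t (snd z))" using assms w by (auto simp: adapted_cont_def)
    moreover have "u n \<in> {0..T}" for n using t by (auto simp: u_def)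
    ultimately have "(\<lambda>n. X (u n) (snd z)) \<longlonglongrightarrow> X (fst z) (snd z)"
      using continuous_on_tendsto_compose[of "{0..T}" "\<lambda>t. X t (snd z)" u "fst z"] s t by auto
    then show "(\<lambda>n. Y n z) \<longlonglongrightarrow> X (fst z) (snd z)" by (simp add: Y_def u_def)
  qed
  then show "(\<lambda>(s, \<omega>). X s \<omega>) \<in> borel_measurable (restrict_space borel {0..t} \<Otimes>\<^sub>M F t)"
    by (simp add: split_beta')
qed

lemma L2_cont_L2_proc:
  assumes "0 \<le> T" "X \<in> L2_cont M F T" shows "X \<in> L2_proc M F T"
proof -
  have a: "adapted_cont T X" using assms by (auto simp: L2_cont_eq)
  have "(\<integral>\<^sup>+w. (\<integral>\<^sup>+s\<in>{0..T}. ennreal ((norm (X s w))\<^sup>2) \<partial>lborel) \<partial>M) \<le> (\<integral>\<^sup>+w. (\<integral>\<^sup>+s\<in>{0..T}. csup T X w \<partial>lborel) \<partial>M)"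
    by (intro nn_integral_mono) (auto simp: indicator_def csup_upper)
  also have "\<dots> = (\<integral>\<^sup>+w. csup T X w * ennreal T \<partial>M)"
    using assms(1) by (subst nn_integral_cmult_indicator) (auto simp: emeasure_lborel_Icc_eq)
  also have "\<dots> = (\<integral>\<^sup>+w. csup T X w \<partial>M) * ennreal T"
    by (rule nn_integral_multc[OF csup_measurable[OF a assms(1)]])
  also have "\<dots> < \<infinity>" using assms by (auto simp: L2_cont_eq ennreal_mult_less_top)
  finally show ?thesis using adapted_cont_progressive[OF a] by (simp add: L2_proc_def)
qed

text \<open>Squared increments of size 4^-k survive the weights 2^k, so the weighted series
  converges almost surely and forces uniform convergence of the paths.\<close>

lemma L2_cont_complete:
  fixes V :: "nat \<Rightarrow> real \<Rightarrow> 'a \<Rightarrow> 'b::euclidean_space"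
  assumes T: "0 \<le> T" and V: "\<And>k. adapted_cont T (V k)" and V0: "V 0 \<in> L2_cont M F T"
    and S: "\<And>k. (\<integral>\<^sup>+\<omega>. csup T (\<lambda>t \<omega>. V (Suc k) t \<omega> - V k t \<omega>) \<omega> \<partial>M) \<le> ennreal (c * (1/4)^k)" and c: "0 \<le> c"
  obtains X where "X \<in> L2_cont M F T" "(\<lambda>k. \<integral>\<^sup>+\<omega>. csup T (\<lambda>t \<omega>. V k t \<omega> - X t \<omega>) \<omega> \<partial>M) \<longlonglongrightarrow> 0"
    "AE \<omega> in M. \<forall>t\<in>{0..T}. (\<lambda>k. V k t \<omega>) \<longlonglongrightarrow> X t \<omega>"
proof -
  define D where "D k t \<omega> = V (Suc k) t \<omega> - V k t \<omega>" for k t \<omega>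
  have aD: "adapted_cont T (D k)" for k
    using adapted_cont_add_scaleR[OF V[of "Suc k"] V[of k], of "-1"] by (simp add: D_def[abs_def])
  note [measurable] = csup_measurable[OF aD T]
  \<comment> \<open>Its mean is at most c times the sum of 2^k 4^-k, that is 2 c; where it is finite
    it controls all tails through \<open>norm_sum_weighted_sq_le\<close>.\<close>
  define U where "U \<omega> = (\<Sum>k. ennreal (2^k) * csup T (D k) \<omega>)" for \<omega>
  have [measurable]: "U \<in> borel_measurable M" unfolding U_def[abs_def] by measurable
  have EU: "(\<integral>\<^sup>+\<omega>. U \<omega> \<partial>M) \<le> ennreal (2 * c)"
  proof -
    have "(\<integral>\<^sup>+\<omega>. U \<omega> \<partial>M) = (\<Sum>k. \<integral>\<^sup>+\<omega>. ennreal (2^k) * csup T (D k) \<omega> \<partial>M)"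
      unfolding U_def by (rule nn_integral_suminf) measurable
    also have "\<dots> \<le> (\<Sum>k. ennreal (c * (1/2)^k))"
    proof (rule suminf_le)
      fix k
      have "(\<integral>\<^sup>+\<omega>. ennreal (2^k) * csup T (D k) \<omega> \<partial>M) = ennreal (2^k) * (\<integral>\<^sup>+\<omega>. csup T (D k) \<omega> \<partial>M)"
        by (rule nn_integral_cmult) measurable
      also have "\<dots> \<le> ennreal (2^k) * ennreal (c * (1/4)^k)"
        using S[of k] by (intro mult_left_mono) (auto simp: D_def[abs_def])
      also have "\<dots> = ennreal (2^k * (c * (1/4)^k))" using c by (subst ennreal_mult) auto
      also have "2^k * (c * (1/4)^k) = c * (1/2::real)^k"
        by (simp add: power_divide power_mult_distrib[symmetric] field_simps)
      finally show "(\<integral>\<^sup>+\<omega>. ennreal (2^k) * csup T (D k) \<omega> \<partial>M) \<le> ennreal (c * (1/2)^k)" .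
    qed auto
    also have "\<dots> = ennreal (c * (\<Sum>k. (1/2)^k))"
      using c by (subst suminf_ennreal2) (auto simp: summable_mult suminf_mult summable_geometric)
    also have "\<dots> = ennreal (2 * c)" by (simp add: suminf_geometric mult.commute)
    finally show ?thesis .
  qed
  then have "(\<integral>\<^sup>+\<omega>. U \<omega> \<partial>M) \<noteq> \<infinity>" using ennreal_less_top[of "2 * c"] by (auto simp: top_unique)
  then have AEU: "AE \<omega> in M. U \<omega> \<noteq> \<infinity>" by (intro nn_integral_noteq_infinite) auto
  \<comment> \<open>The value 0 on the exceptional set keeps every path continuous, and adaptedness
    survives because \<open>F t\<close> contains the null sets.\<close>
  define X where "X t \<omega> = (if U \<omega> \<noteq> \<infinity> then lim (\<lambda>k. V k t \<omega>) else 0)" for t \<omega>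
  have bd: "(norm (V (m + k) t \<omega> - V m t \<omega>))\<^sup>2 \<le> 2 * (1/2)^m * enn2real (U \<omega>)" if U: "U \<omega> \<noteq> \<infinity>" and t: "t \<in> {0..T}" for m k t \<omega>
  proof -
    have "V (m + k) t \<omega> - V m t \<omega> = (\<Sum>j<k. D (m + j) t \<omega>)"
      by (induction k) (auto simp: D_def algebra_simps)
    then have "(norm (V (m + k) t \<omega> - V m t \<omega>))\<^sup>2 \<le> 2 * (1/2)^m * (\<Sum>j<k. 2^(m + j) * (norm (D (m + j) t \<omega>))\<^sup>2)"
      using norm_sum_weighted_sq_le[of "\<lambda>j. D j t \<omega>" m k] by simp
    also have "(\<Sum>j<k. 2^(m + j) * (norm (D (m + j) t \<omega>))\<^sup>2) \<le> (\<Sum>j<m + k. 2^j * (norm (D j t \<omega>))\<^sup>2)"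
    proof -
      have "(\<Sum>j<k. 2^(m + j) * (norm (D (m + j) t \<omega>))\<^sup>2) = (\<Sum>j\<in>(+) m ` {..<k}. 2^j * (norm (D j t \<omega>))\<^sup>2)"
        by (subst sum.reindex) (auto simp: inj_on_def)
      also have "\<dots> \<le> (\<Sum>j<m + k. 2^j * (norm (D j t \<omega>))\<^sup>2)" by (intro sum_mono2) auto
      finally show ?thesis .
    qed
    also have "(\<Sum>j<m + k. 2^j * (norm (D j t \<omega>))\<^sup>2) \<le> enn2real (U \<omega>)"
    proof -
      have "ennreal (\<Sum>j<m + k. 2^j * (norm (D j t \<omega>))\<^sup>2) = (\<Sum>j<m + k. ennreal (2^j) * ennreal ((norm (D j t \<omega>))\<^sup>2))"
        by (subst sum_ennreal[symmetric]) (auto simp: ennreal_mult)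
      also have "\<dots> \<le> (\<Sum>j<m + k. ennreal (2^j) * csup T (D j) \<omega>)"
        by (intro sum_mono mult_left_mono csup_upper t) auto
      also have "\<dots> \<le> U \<omega>" unfolding U_def by (intro sum_le_suminf) auto
      finally have "enn2real (ennreal (\<Sum>j<m + k. 2^j * (norm (D j t \<omega>))\<^sup>2)) \<le> enn2real (U \<omega>)"
        using U by (intro enn2real_mono) (auto simp: top.not_eq_extremum)
      then show ?thesis by (simp add: sum_nonneg)
    qed
    finally show ?thesis by (simp add: mult_left_mono)
  qed
  have half: "(\<lambda>m. 2 * (1/2)^m * u) \<longlonglongrightarrow> (0::real)" for u
    using tendsto_mult[OF tendsto_mult[OF tendsto_const[of 2] LIMSEQ_realpow_zero[of "1/2"]] tendsto_const[of u]] by simp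
  have lim: "(\<lambda>k. V k t \<omega>) \<longlonglongrightarrow> X t \<omega>" if U: "U \<omega> \<noteq> \<infinity>" and t: "t \<in> {0..T}" for t \<omega>
  proof -
    have "Cauchy (\<lambda>k. V k t \<omega>)"
      unfolding Cauchy_altdef2
    proof (intro allI impI)
      fix e :: real assume e: "0 < e"
      have "0 < e\<^sup>2" using e by simp
      then have "\<forall>\<^sub>F m in sequentially. 2 * (1/2)^m * enn2real (U \<omega>) < e\<^sup>2"
        using order_tendstoD(2)[OF half] by blast
      then obtain m where m: "2 * (1/2)^m * enn2real (U \<omega>) < e\<^sup>2" by (auto simp: eventually_sequentially)
      have "dist (V n t \<omega>) (V m t \<omega>) < e" if "m \<le> n" for n
      proof -
        obtain k where "n = m + k" using \<open>m \<le> n\<close> le_Suc_ex by blast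
        then have "(norm (V n t \<omega> - V m t \<omega>))\<^sup>2 < e\<^sup>2" using bd[OF U t, of m k] m by simp
        then show ?thesis using e by (simp add: dist_norm power_less_imp_less_base)
      qed
      then show "\<exists>N. \<forall>n\<ge>N. dist (V n t \<omega>) (V N t \<omega>) < e" by blast
    qed
    from Cauchy_convergent[OF this] have "(\<lambda>k. V k t \<omega>) \<longlonglongrightarrow> lim (\<lambda>k. V k t \<omega>)"
      by (simp only: convergent_LIMSEQ_iff)
    then show ?thesis using U by (simp add: X_def)
  qed
  have bdX: "(norm (V m t \<omega> - X t \<omega>))\<^sup>2 \<le> 2 * (1/2)^m * enn2real (U \<omega>)" if U: "U \<omega> \<noteq> \<infinity>" and t: "t \<in> {0..T}" for m t \<omega>
  proof -
    have "(\<lambda>k. V (m + k) t \<omega>) \<longlonglongrightarrow> X t \<omega>" using LIMSEQ_ignore_initial_segment[OF lim[OF U t], of m] by (simp add: add.commute)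
    then have "(\<lambda>k. (norm (V (m + k) t \<omega> - V m t \<omega>))\<^sup>2) \<longlonglongrightarrow> (norm (X t \<omega> - V m t \<omega>))\<^sup>2" by (intro tendsto_intros)
    then have "(norm (X t \<omega> - V m t \<omega>))\<^sup>2 \<le> 2 * (1/2)^m * enn2real (U \<omega>)"
      by (rule LIMSEQ_le_const2) (use bd[OF U t] in blast)
    then show ?thesis by (simp add: norm_minus_commute)
  qed
  have aX: "adapted_cont T X"
    unfolding adapted_cont_def
  proof (intro conjI ballI)
    fix t assume t: "t \<in> {0..T}"
    have "(\<lambda>\<omega>. if U \<omega> \<noteq> \<infinity> then V k t \<omega> else 0) \<in> borel_measurable (F t)" for k
      by (rule measurable_F_AE[where f = "V k t"]) (use V[of k] t AEU in \<open>auto simp: adapted_cont_def\<close>)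
    then show "X t \<in> borel_measurable (F t)"
      by (rule borel_measurable_LIMSEQ_metric) (use lim[OF _ t] in \<open>auto simp: X_def\<close>)
  next
    fix \<omega> assume w: "\<omega> \<in> space M"
    show "continuous_on {0..T} (\<lambda>t. X t \<omega>)"
    proof (cases "U \<omega> = \<infinity>")
      case True then show ?thesis by (simp add: X_def)
    next
      case U: False
      have "uniform_limit {0..T} (\<lambda>k t. V k t \<omega>) (\<lambda>t. X t \<omega>) sequentially"
        unfolding uniform_limit_iff
      proof (intro allI impI)
        fix e :: real assume e: "0 < e"
        then have "\<forall>\<^sub>F m in sequentially. 2 * (1/2)^m * enn2real (U \<omega>) < e\<^sup>2"
          using order_tendstoD(2)[OF half, of "e\<^sup>2"] by simp
        then show "\<forall>\<^sub>F m in sequentially. \<forall>t\<in>{0..T}. dist (V m t \<omega>) (X t \<omega>) < e"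
        proof eventually_elim
          case (elim m)
          show ?case
          proof
            fix t assume "t \<in> {0..T}"
            then have "(norm (V m t \<omega> - X t \<omega>))\<^sup>2 < e\<^sup>2" using bdX[OF U, of t m] elim by simp
            then show "dist (V m t \<omega>) (X t \<omega>) < e" using e by (simp add: dist_norm power_less_imp_less_base)
          qed
        qed
      qed
      then show ?thesis
        by (rule uniform_limit_theorem[rotated]) (use V w in \<open>auto simp: adapted_cont_def\<close>)
    qed
  qed
  have csupX: "(\<integral>\<^sup>+\<omega>. csup T (\<lambda>t \<omega>. V m t \<omega> - X t \<omega>) \<omega> \<partial>M) \<le> ennreal (2 * (1/2)^m * (2 * c))" for m
  proof -
    have "(\<integral>\<^sup>+\<omega>. csup T (\<lambda>t \<omega>. V m t \<omega> - X t \<omega>) \<omega> \<partial>M) \<le> (\<integral>\<^sup>+\<omega>. ennreal (2 * (1/2)^m) * U \<omega> \<partial>M)"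
    proof (rule nn_integral_mono_AE)
      show "AE \<omega> in M. csup T (\<lambda>t \<omega>. V m t \<omega> - X t \<omega>) \<omega> \<le> ennreal (2 * (1/2)^m) * U \<omega>"
        using AEU
      proof eventually_elim
        case U: (elim \<omega>)
        have Ue: "ennreal (enn2real (U \<omega>)) = U \<omega>" using U by (simp add: top.not_eq_extremum)
        show ?case unfolding csup_def
        proof (rule SUP_least)
          fix t assume t: "t \<in> {0..T}"
          have "ennreal ((norm (V m t \<omega> - X t \<omega>))\<^sup>2) \<le> ennreal (2 * (1/2)^m * enn2real (U \<omega>))"
            by (rule ennreal_leI[OF bdX[OF U t]])
          also have "\<dots> = ennreal (2 * (1/2)^m) * U \<omega>" by (subst ennreal_mult) (auto simp: Ue)
          finally show "ennreal ((norm (V m t \<omega> - X t \<omega>))\<^sup>2) \<le> ennreal (2 * (1/2)^m) * U \<omega>" .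
        qed
      qed
    qed
    also have "\<dots> = ennreal (2 * (1/2)^m) * (\<integral>\<^sup>+\<omega>. U \<omega> \<partial>M)" by (rule nn_integral_cmult) measurable
    also have "\<dots> \<le> ennreal (2 * (1/2)^m) * ennreal (2 * c)" by (intro mult_left_mono EU) auto
    also have "\<dots> = ennreal (2 * (1/2)^m * (2 * c))" using c by (subst ennreal_mult) auto
    finally show ?thesis .
  qed
  have "(\<lambda>k. \<integral>\<^sup>+\<omega>. csup T (\<lambda>t \<omega>. V k t \<omega> - X t \<omega>) \<omega> \<partial>M) \<longlonglongrightarrow> 0"
  proof (rule tendsto_sandwich[OF _ _ tendsto_const])
    show "(\<lambda>m. ennreal (2 * (1/2)^m * (2 * c))) \<longlonglongrightarrow> 0" using tendsto_ennrealI[OF half[of "2 * c"]] by simp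
  qed (use csupX in auto)
  moreover have "X \<in> L2_cont M F T"
  proof -
    have "(\<lambda>t \<omega>. V 0 t \<omega> - X t \<omega>) \<in> L2_cont M F T"
      using csupX[of 0] adapted_cont_add_scaleR[OF V[of 0] aX, of "-1"] ennreal_less_top
      by (auto simp: L2_cont_eq intro: le_less_trans)
    from L2_cont_add_scaleR[OF T V0 this, of "-1"] show ?thesis by simp
  qed
  moreover have "AE \<omega> in M. \<forall>t\<in>{0..T}. (\<lambda>k. V k t \<omega>) \<longlonglongrightarrow> X t \<omega>"
    using AEU by eventually_elim (use lim in blast)
  ultimately show thesis using that by blast
qed

section \<open>Continuous versions of Ito integrals\<close>

lemma W_continuous_set:
  obtains Z where "Z \<in> null_sets M" "\<And>w. w \<in> space M - Z \<Longrightarrow> continuous_on {0..} (\<lambda>t. W t w)"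
proof -
  have "AE w in M. continuous_on {0..} (\<lambda>t. W t w)" using brownian by (simp add: brownian_motion_def)
  from AE_E3[OF this] show thesis using that by blast
qed

lemma el_trunc_trunc: "r \<le> t \<Longrightarrow> el_trunc r (el_trunc t xs) = el_trunc r xs"
  by (induction xs) (auto simp: el_trunc_def min_def)

lemma el_trunc_append: "el_trunc t (xs @ ys) = el_trunc t xs @ el_trunc t ys"
  by (simp add: el_trunc_def)

lemma el_ito_trunc_scale: "el_ito (el_trunc t (el_scale c xs)) w = c *\<^sub>R el_ito (el_trunc t xs) w"
  by (induction xs) (auto simp: el_ito_def el_scale_def el_trunc_def scaleR_add_right)

lemma el_ito_trunc_single: "el_ito (el_trunc t [(a, b, \<xi>)]) w = (W (min t b) w - W (min t a) w) *\<^sub>R \<xi> w" if "a \<le> b"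
  using that by (auto simp: el_ito_def el_trunc_def min_def)

lemma el_ito_trunc_Cons: "el_ito (el_trunc t (x # xs)) w = el_ito (el_trunc t [x]) w + el_ito (el_trunc t xs) w"
  by (simp add: el_trunc_def el_ito_def)

lemma el_ito_trunc_adapted: "el_ok T xs \<Longrightarrow> 0 \<le> t \<Longrightarrow> el_ito (el_trunc t xs) \<in> borel_measurable (F t)"
proof (induction xs)
  case Nil
  have "el_ito (el_trunc t []) = (\<lambda>_. 0::'b)" by (simp add: el_trunc_def el_ito_def fun_eq_iff)
  then show ?case by simp
next
  case (Cons x xs)
  obtain a b \<xi> where x: "x = (a, b, \<xi>)" by (cases x)
  have ok: "el_ok T [(a, b, \<xi>)]" "el_ok T xs" using Cons.prems(1) el_ok_Cons[of T x xs] x by auto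
  note m = el_ok_measurable[OF ok(1)]
  have "el_ito (el_trunc t [x]) \<in> borel_measurable (F t)"
  proof (cases "a \<le> t")
    case True
    have "(\<lambda>w. (W (min t b) w - W (min t a) w) *\<^sub>R \<xi> w) \<in> borel_measurable (F t)"
      using m Cons.prems(2) True measurable_F_mono[OF True m(1)]
      by (intro borel_measurable_scaleR increment_adapted) auto
    then show ?thesis unfolding x by (subst measurable_cong[OF el_ito_trunc_single[OF m(4)]]) 
  next
    case False
    then have "el_ito (el_trunc t [x]) = (\<lambda>_. 0)" using m(4) by (auto simp: fun_eq_iff x el_ito_trunc_single min_def)
    then show ?thesis by simp
  qed
  then have "(\<lambda>w. el_ito (el_trunc t [x]) w + el_ito (el_trunc t xs) w) \<in> borel_measurable (F t)"
    using Cons.IH[OF ok(2) Cons.prems(2)] by (rule borel_measurable_add)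
  then show ?case by (subst measurable_cong[OF el_ito_trunc_Cons])
qed

lemma el_ito_trunc_continuous:
  "el_ok T xs \<Longrightarrow> continuous_on {0..} (\<lambda>t. W t w) \<Longrightarrow> continuous_on {0..T} (\<lambda>t. el_ito (el_trunc t xs) w)"
proof (induction xs)
  case Nil then show ?case by (simp add: el_trunc_def el_ito_def)
next
  case (Cons x xs)
  obtain a b \<xi> where x: "x = (a, b, \<xi>)" by (cases x)
  have ok: "el_ok T [(a, b, \<xi>)]" "el_ok T xs" using Cons.prems(1) el_ok_Cons[of T x xs] x by auto
  note m = el_ok_measurable[OF ok(1)]
  have c: "continuous_on {0..T} (\<lambda>t. W (min t c) w)" if "0 \<le> c" for c
    by (rule continuous_on_compose2[OF Cons.prems(2)]) (use that in \<open>auto intro!: continuous_intros\<close>)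
  have "continuous_on {0..T} (\<lambda>t. (W (min t b) w - W (min t a) w) *\<^sub>R \<xi> w)"
    using m by (intro continuous_intros c) auto
  from continuous_on_add[OF this Cons.IH[OF ok(2) Cons.prems(2)]]
  show ?case unfolding x el_ito_trunc_single[OF m(4), symmetric] el_ito_trunc_Cons[symmetric] .
qed

text \<open>Z is a null set outside which the Brownian paths are continuous. The integral is set to
  0 on it since continuity is required of every path.\<close>

definition el_path :: "'a set \<Rightarrow> (real \<times> real \<times> ('a \<Rightarrow> 'b::euclidean_space)) list \<Rightarrow> real \<Rightarrow> 'a \<Rightarrow> 'b" where
  "el_path Z xs t w = (if w \<in> Z then 0 else el_ito (el_trunc t xs) w)"

lemma el_path_AE: "Z \<in> null_sets M \<Longrightarrow> AE w in M. el_ito (el_trunc t xs) w = el_path Z xs t w"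
  by (drule AE_not_in) (auto simp: el_path_def)

text \<open>Doob's inequality followed by the isometry at the final time: the error in the integrand
  bounds the error of the paths uniformly in time.\<close>

lemma el_path_doob:
  assumes T: "0 \<le> T" and ok: "el_ok T xs" and Z: "Z \<in> null_sets M"
    and c: "\<And>w. w \<in> space M - Z \<Longrightarrow> continuous_on {0..} (\<lambda>t. W t w)"
  shows "adapted_cont T (el_path Z xs)"
    and "(\<integral>\<^sup>+w. csup T (el_path Z xs) w \<partial>M) \<le> ennreal (4 * (\<integral>z. (norm (case_prod (el_proc xs) z))\<^sup>2 \<partial>time_prob M T))"
proof -
  have sq: "sq_int M (el_path Z xs t)" if "t \<in> {0..T}" for t
  proof (rule sq_int_bound[where c = 1])
    show "sq_int M (el_ito (el_trunc t xs))" using that by (intro el_ito_sq_int[OF el_ok_trunc[OF ok]]) auto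
    then show "el_path Z xs t \<in> borel_measurable M" using measurable_M_AE[OF _ el_path_AE[OF Z]] sq_int_measurable by blast
  qed (auto simp: el_path_def)
  show a: "adapted_cont T (el_path Z xs)"
    unfolding adapted_cont_def
  proof (intro conjI ballI)
    show "el_path Z xs t \<in> borel_measurable (F t)" if "t \<in> {0..T}" for t
      using that by (intro measurable_F_AE[OF el_ito_trunc_adapted[OF ok] el_path_AE[OF Z]]) auto
    show "continuous_on {0..T} (\<lambda>t. el_path Z xs t w)" if "w \<in> space M" for w
    proof (cases "w \<in> Z")
      case False
      then show ?thesis using el_ito_trunc_continuous[OF ok c[of w]] that by (simp add: el_path_def)
    qed (simp add: el_path_def)
  qed
  have "(\<integral>\<^sup>+w. csup T (el_path Z xs) w \<partial>M) \<le> ennreal (4 * expectation (\<lambda>w. (norm (el_path Z xs T w))\<^sup>2))"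
  proof (rule doob_continuous[OF T a sq])
    fix r t and \<eta> :: "'a \<Rightarrow> 'b" assume r: "0 \<le> r" "r \<le> t" "t \<le> T" and \<eta>: "\<eta> \<in> borel_measurable (F r)" "sq_int M \<eta>"
    have "expectation (\<lambda>w. \<eta> w \<bullet> (el_path Z xs t w - el_path Z xs r w)) =
      expectation (\<lambda>w. \<eta> w \<bullet> (el_ito (el_trunc t xs) w - el_ito (el_trunc r xs) w))"
    proof (rule integral_cong_AE)
      have "el_path Z xs t \<in> borel_measurable M" "el_path Z xs r \<in> borel_measurable M"
        "el_ito (el_trunc t xs) \<in> borel_measurable M" "el_ito (el_trunc r xs) \<in> borel_measurable M"
        using sq[of t] sq[of r] r el_ito_sq_int[OF el_ok_trunc[OF ok, of t]] el_ito_sq_int[OF el_ok_trunc[OF ok, of r]] sq_int_measurable by auto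
      then show "(\<lambda>w. \<eta> w \<bullet> (el_path Z xs t w - el_path Z xs r w)) \<in> borel_measurable M"
       "(\<lambda>w. \<eta> w \<bullet> (el_ito (el_trunc t xs) w - el_ito (el_trunc r xs) w)) \<in> borel_measurable M"
        using sq_int_measurable[OF \<eta>(2)] by measurable
      show "AE w in M. \<eta> w \<bullet> (el_path Z xs t w - el_path Z xs r w) = \<eta> w \<bullet> (el_ito (el_trunc t xs) w - el_ito (el_trunc r xs) w)"
        using AE_not_in[OF Z] by eventually_elim (simp add: el_path_def)
    qed
    also have "\<dots> = 0"
      using el_increment_orthogonal[OF el_ok_trunc[OF ok, of t] r(1,2) \<eta>] r by (simp add: el_trunc_trunc)
    finally show "expectation (\<lambda>w. \<eta> w \<bullet> (el_path Z xs t w - el_path Z xs r w)) = 0" .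
  qed
  also have "expectation (\<lambda>w. (norm (el_path Z xs T w))\<^sup>2) = expectation (\<lambda>w. (norm (el_ito xs w))\<^sup>2)"
  proof (rule integral_cong_AE)
    have "sq_int M (el_path Z xs T)" "sq_int M (el_ito xs)" using sq[of T] T el_ito_sq_int[OF ok] by auto
    then show "(\<lambda>w. (norm (el_path Z xs T w))\<^sup>2) \<in> borel_measurable M" "(\<lambda>w. (norm (el_ito xs w))\<^sup>2) \<in> borel_measurable M"
      using sq_int_measurable by (auto intro!: borel_measurable_power borel_measurable_norm)
    show "AE w in M. (norm (el_path Z xs T w))\<^sup>2 = (norm (el_ito xs w))\<^sup>2"
      using AE_not_in[OF Z] by eventually_elim (simp add: el_path_def el_ito_trunc_full[OF ok])
  qed
  also have "\<dots> = (\<integral>z. (norm (case_prod (el_proc xs) z))\<^sup>2 \<partial>time_prob M T)" by (rule el_isometry_norm[OF ok T])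
  finally show "(\<integral>\<^sup>+w. csup T (el_path Z xs) w \<partial>M) \<le> ennreal (4 * (\<integral>z. (norm (case_prod (el_proc xs) z))\<^sup>2 \<partial>time_prob M T))" .
qed

text \<open>Step processes are chosen with squared error below 4^-k, the rate at which
  \<open>L2_cont_complete\<close> applies. Truncating the same lists identifies the limit process as
  the integral at every time t.\<close>

theorem ito_integral_continuous_version:
  fixes \<phi> :: "real \<Rightarrow> 'a \<Rightarrow> 'b::euclidean_space"
  assumes T: "0 \<le> T" and \<phi>: "\<phi> \<in> L2_proc M F T"
  obtains I where "I \<in> L2_cont M F T" "\<And>t. t \<in> {0..T} \<Longrightarrow> has_ito_integral M F W \<phi> t (I t)"
proof -
  obtain Z where Z: "Z \<in> null_sets M" "\<And>w. w \<in> space M - Z \<Longrightarrow> continuous_on {0..} (\<lambda>t. W t w)"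
    using W_continuous_set by blast
  obtain n \<tau> \<xi> where s: "\<And>k. simple_integrand M F T (n k) (\<tau> k) (\<xi> k)"
    and l: "\<And>k. (\<integral>z. (norm (case_prod (simple_process (n k) (\<tau> k) (\<xi> k)) z - case_prod \<phi> z))\<^sup>2 \<partial>time_prob M T) < (1/4)^k"
    by (rule simple_approx[OF T \<phi>, of "\<lambda>k. (1/4)^k"]) auto
  define xs where "xs k = simple_el (n k) (\<tau> k) (\<xi> k)" for k
  have ok: "el_ok T (xs k)" for k unfolding xs_def by (rule el_ok_simple[OF s])
  have l': "(\<integral>z. (norm (case_prod (el_proc (xs k)) z - case_prod \<phi> z))\<^sup>2 \<partial>time_prob M T) \<le> (1/4)^k" for k
    using less_imp_le[OF l[of k]] by (simp only: xs_def el_proc_simple)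
  have p\<phi>: "progressive F T \<phi>" and s\<phi>: "sq_int (time_prob M T) (case_prod \<phi>)" using \<phi> L2_proc_iff[OF T] by auto
  have L: "l2_lim (time_prob M T) (\<lambda>k. case_prod (el_proc (xs k))) (case_prod \<phi>)"
    unfolding l2_lim_def
  proof (intro conjI allI el_proc_sq_int[OF ok] s\<phi>)
    have "(\<lambda>k. (1/4)^k) \<longlonglongrightarrow> (0::real)" by (rule LIMSEQ_realpow_zero) auto
    then show "(\<lambda>k. \<integral>z. (norm (case_prod (el_proc (xs k)) z - case_prod \<phi> z))\<^sup>2 \<partial>time_prob M T) \<longlonglongrightarrow> 0"
    proof (rule tendsto_sandwich[OF _ _ tendsto_const, rotated 2])
      show "\<forall>\<^sub>F k in sequentially. (\<integral>z. (norm (case_prod (el_proc (xs k)) z - case_prod \<phi> z))\<^sup>2 \<partial>time_prob M T) \<le> (1/4)^k"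
        by (intro always_eventually allI l')
    qed simp
  qed
  define V where "V k = el_path Z (xs k)" for k
  have aV: "adapted_cont T (V k)" for k unfolding V_def by (rule el_path_doob(1)[OF T ok Z])
  have V0: "V 0 \<in> L2_cont M F T"
    using el_path_doob[OF T ok Z, of 0] ennreal_less_top by (auto simp: L2_cont_eq V_def intro: le_less_trans)
  have S: "(\<integral>\<^sup>+w. csup T (\<lambda>t w. V (Suc k) t w - V k t w) w \<partial>M) \<le> ennreal (16 * (1/4)^k)" for k
  proof -
    \<comment> \<open>The difference of two elementary integrals is again elementary, so Doob's
      inequality applies to it directly.\<close>
    define zs where "zs = xs (Suc k) @ el_scale (-1) (xs k)"
    have okz: "el_ok T zs" using ok by (simp add: zs_def el_ok_append el_ok_scale)
    have "(\<lambda>t w. V (Suc k) t w - V k t w) = el_path Z zs"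
      by (auto simp: fun_eq_iff V_def el_path_def zs_def el_trunc_append el_ito_append el_ito_trunc_scale)
    then have "(\<integral>\<^sup>+w. csup T (\<lambda>t w. V (Suc k) t w - V k t w) w \<partial>M) \<le> ennreal (4 * (\<integral>z. (norm (case_prod (el_proc zs) z))\<^sup>2 \<partial>time_prob M T))"
      using el_path_doob(2)[OF T okz Z] by simp
    also have "\<dots> \<le> ennreal (16 * (1/4)^k)"
    proof (rule ennreal_leI)
      have "(\<integral>z. (norm (case_prod (el_proc zs) z))\<^sup>2 \<partial>time_prob M T) =
        (\<integral>z. (norm (case_prod (el_proc (xs (Suc k))) z - case_prod (el_proc (xs k)) z))\<^sup>2 \<partial>time_prob M T)"
        by (intro Bochner_Integration.integral_cong refl) (auto simp: zs_def el_proc_append el_proc_scale)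
      also have "\<dots> \<le> 2 * (\<integral>z. (norm (case_prod (el_proc (xs (Suc k))) z - case_prod \<phi> z))\<^sup>2 \<partial>time_prob M T)
        + 2 * (\<integral>z. (norm (case_prod \<phi> z - case_prod (el_proc (xs k)) z))\<^sup>2 \<partial>time_prob M T)"
        by (rule sq_int_integral_norm_triangle[OF el_proc_sq_int[OF ok] s\<phi> el_proc_sq_int[OF ok]])
      also have "\<dots> \<le> 2 * (1/4)^Suc k + 2 * (1/4)^k"
        unfolding norm_minus_commute[of "case_prod \<phi> _"] by (intro add_mono mult_left_mono l') auto
      \<comment> \<open>The left side is 5/2 times (1/4)^k; after Doob's factor 4 the coarser 4
        gives the constant 16.\<close>
      also have "2 * (1/4)^Suc k + 2 * (1/4)^k \<le> 4 * (1/4::real)^k" by simp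
      finally show "4 * (\<integral>z. (norm (case_prod (el_proc zs) z))\<^sup>2 \<partial>time_prob M T) \<le> 16 * (1/4)^k"
        by linarith
    qed
    finally show ?thesis .
  qed
  obtain X where X: "X \<in> L2_cont M F T" and lim: "(\<lambda>k. \<integral>\<^sup>+w. csup T (\<lambda>t w. V k t w - X t w) w \<partial>M) \<longlonglongrightarrow> 0"
    using L2_cont_complete[OF T aV V0 S zero_le_numeral] by blast
  show thesis
  proof (rule that[OF X])
    fix t assume t: "t \<in> {0..T}"
    then have t': "0 \<le> t" "t \<le> T" by auto
    note okt = el_ok_trunc[OF ok t'(1)]
    have LX: "l2_lim M (\<lambda>k. el_ito (el_trunc t (xs k))) (X t)"
    proof (rule l2_limI_nn_integral[OF el_ito_sq_int[OF okt]])
      show "X t \<in> borel_measurable M" using sq_int_measurable[OF L2_cont_sq_int[OF X t]] .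
      have "(\<integral>\<^sup>+w. ennreal ((norm (el_ito (el_trunc t (xs k)) w - X t w))\<^sup>2) \<partial>M) \<le> (\<integral>\<^sup>+w. csup T (\<lambda>t w. V k t w - X t w) w \<partial>M)" for k
      proof (rule nn_integral_mono_AE)
        show "AE w in M. ennreal ((norm (el_ito (el_trunc t (xs k)) w - X t w))\<^sup>2) \<le> csup T (\<lambda>t w. V k t w - X t w) w"
          using el_path_AE[OF Z(1), of t "xs k"]
          by eventually_elim (use csup_upper[OF t, of "\<lambda>t w. V k t w - X t w"] in \<open>simp add: V_def\<close>)
      qed
      then show "(\<lambda>k. \<integral>\<^sup>+w. ennreal ((norm (el_ito (el_trunc t (xs k)) w - X t w))\<^sup>2) \<partial>M) \<longlonglongrightarrow> 0"
        by (intro tendsto_sandwich[OF _ _ tendsto_const lim] always_eventually allI zero_le)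
    qed
    show "has_ito_integral M F W \<phi> t (X t)"
    proof (rule has_ito_integralI[OF t'(1) _ okt l2_lim_trunc[OF t' p\<phi> ok L] LX])
      show "\<phi> \<in> L2_proc M F t"
        unfolding L2_proc_iff[OF t'(1)] using progressive_mono[OF p\<phi> t'(2)] l2_lim_time_prob_mono[OF t' p\<phi> ok L]
        by (auto simp: l2_lim_def)
    qed
  qed
qed

lemma has_ito_doob:
  fixes I :: "real \<Rightarrow> 'a \<Rightarrow> 'b::euclidean_space"
  assumes T: "0 \<le> T" and I: "I \<in> L2_cont M F T" and h: "\<And>t. t \<in> {0..T} \<Longrightarrow> has_ito_integral M F W \<phi> t (I t)"
  shows "(\<integral>\<^sup>+w. csup T I w \<partial>M) \<le> ennreal (4 * (\<integral>z. (norm (case_prod \<phi> z))\<^sup>2 \<partial>time_prob M T))"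
proof -
  have "(\<integral>\<^sup>+w. csup T I w \<partial>M) \<le> ennreal (4 * expectation (\<lambda>w. (norm (I T w))\<^sup>2))"
  proof (rule doob_continuous[OF T _ L2_cont_sq_int[OF I]])
    show "adapted_cont T I" using I by (simp add: L2_cont_eq)
    fix r t and \<eta> :: "'a \<Rightarrow> 'b" assume r: "0 \<le> r" "r \<le> t" "t \<le> T" and \<eta>: "\<eta> \<in> borel_measurable (F r)" "sq_int M \<eta>"
    show "expectation (\<lambda>w. \<eta> w \<bullet> (I t w - I r w)) = 0"
      using r by (intro has_ito_orthogonal[OF r(1,2) h h \<eta>]) auto
  qed
  also have "expectation (\<lambda>w. (norm (I T w))\<^sup>2) = (\<integral>z. (norm (case_prod \<phi> z))\<^sup>2 \<partial>time_prob M T)"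
    using has_ito_isometry[OF T h[of T] h[of T]] T by (simp add: power2_norm_eq_inner)
  finally show ?thesis .
qed

section \<open>Ito processes and stochastic differential equations\<close>

lemma L2_proc_mono: "\<phi> \<in> L2_proc M F T \<Longrightarrow> 0 \<le> t \<Longrightarrow> t \<le> T \<Longrightarrow> \<phi> \<in> L2_proc M F t"
proof -
  assume \<phi>: "\<phi> \<in> L2_proc M F T" and t: "0 \<le> t" "t \<le> T"
  have "(\<integral>\<^sup>+w. (\<integral>\<^sup>+s\<in>{0..t}. ennreal ((norm (\<phi> s w))\<^sup>2) \<partial>lborel) \<partial>M) \<le> (\<integral>\<^sup>+w. (\<integral>\<^sup>+s\<in>{0..T}. ennreal ((norm (\<phi> s w))\<^sup>2) \<partial>lborel) \<partial>M)"
    using t by (intro nn_integral_mono) (auto simp: indicator_def)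
  also have "\<dots> < \<infinity>" using \<phi> by (simp add: L2_proc_def)
  finally show "\<phi> \<in> L2_proc M F t" using \<phi> progressive_mono[OF _ t(2), of \<phi>] by (auto simp: L2_proc_def)
qed

lemma L2_proc_sq_int: "\<phi> \<in> L2_proc M F T \<Longrightarrow> 0 \<le> T \<Longrightarrow> sq_int (time_prob M T) (case_prod \<phi>)"
  by (simp add: L2_proc_iff)

lemma L2_proc_paths:
  assumes "0 \<le> T" "\<phi> \<in> L2_proc M F T"
  shows "AE w in M. sq_int (time_measure T) (\<lambda>s. \<phi> s w)"
proof -
  note s = L2_proc_sq_int[OF assms(2,1)]
  have "integrable (time_prob M T) (case_prod (\<lambda>s w. (norm (\<phi> s w))\<^sup>2))"
    using sq_int_integrable[OF s] by (simp add: split_beta')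
  from AE_set_integrable[OF this] show ?thesis
    using AE_space
  proof eventually_elim
    case (elim w)
    then show ?case using path_measurable[OF sq_int_measurable[OF s]]
      by (simp add: sq_int_def set_integrable_def integrable_restrict_space)
  qed
qed

lemma L2_proc_set_integrable:
  assumes "0 \<le> T" "\<phi> \<in> L2_proc M F T"
  shows "AE w in M. set_integrable lborel {0..T} (\<lambda>s. \<phi> s w)"
  using L2_proc_paths[OF assms] by eventually_elim (rule sq_int_time_set_integrable, auto)

text \<open>Cauchy-Schwarz in time along each path gives the factor T.\<close>

lemma drift_csup_le:
  fixes b :: "real \<Rightarrow> 'a \<Rightarrow> 'b::euclidean_space"
  assumes T: "0 \<le> T" and b: "b \<in> L2_proc M F T"
    and B: "AE w in M. \<forall>t\<in>{0..T}. B t w = (LINT s:{0..t}|lborel. b s w)"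
  shows "(\<integral>\<^sup>+w. csup T B w \<partial>M) \<le> ennreal (T * (\<integral>z. (norm (case_prod b z))\<^sup>2 \<partial>time_prob M T))"
proof -
  note s = L2_proc_sq_int[OF b T]
  have i: "integrable (time_prob M T) (case_prod (\<lambda>s w. (norm (b s w))\<^sup>2))"
    using sq_int_integrable[OF s] by (simp add: split_beta')
  have "(\<integral>\<^sup>+w. csup T B w \<partial>M) \<le> (\<integral>\<^sup>+w. ennreal (T * (LINT s:{0..T}|lborel. (norm (b s w))\<^sup>2)) \<partial>M)"
  proof (rule nn_integral_mono_AE)
    show "AE w in M. csup T B w \<le> ennreal (T * (LINT s:{0..T}|lborel. (norm (b s w))\<^sup>2))"
      using B L2_proc_paths[OF T b]
    proof eventually_elim
      case (elim w)
      show ?case unfolding csup_def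
      proof (intro SUP_least ennreal_leI)
        fix t assume t: "t \<in> {0..T}"
        have si: "set_integrable lborel {0..T} (\<lambda>s. (norm (b s w))\<^sup>2)"
          using sq_int_integrable[OF elim(2)] by (simp add: set_integrable_def integrable_restrict_space)
        have "(norm (B t w))\<^sup>2 \<le> measure lborel {0..t} * (LINT s:{0..t}|lborel. (norm (b s w))\<^sup>2)"
          unfolding elim(1)[rule_format, OF t]
          by (rule norm_set_integral_sq_le[OF T _ _ elim(2)]) (use t in auto)
        also have "\<dots> \<le> T * (LINT s:{0..T}|lborel. (norm (b s w))\<^sup>2)"
        proof (intro mult_mono)
          show "(LINT s:{0..t}|lborel. (norm (b s w))\<^sup>2) \<le> (LINT s:{0..T}|lborel. (norm (b s w))\<^sup>2)"
            unfolding set_lebesgue_integral_def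
          proof (rule integral_mono)
            show "integrable lborel (\<lambda>s. indicator {0..t} s *\<^sub>R (norm (b s w))\<^sup>2)"
              using set_integrable_subset[OF si, of "{0..t}"] t by (simp add: set_integrable_def)
            show "integrable lborel (\<lambda>s. indicator {0..T} s *\<^sub>R (norm (b s w))\<^sup>2)"
              using si by (simp only: set_integrable_def)
          qed (use t in \<open>auto simp: indicator_def\<close>)
        qed (use t in \<open>auto simp: set_lebesgue_integral_def\<close>)
        finally show "(norm (B t w))\<^sup>2 \<le> T * (LINT s:{0..T}|lborel. (norm (b s w))\<^sup>2)" .
      qed
    qed
  qed
  also have "\<dots> = ennreal (expectation (\<lambda>w. T * (LINT s:{0..T}|lborel. (norm (b s w))\<^sup>2)))"
    using integrable_time_prob[OF i] T
    by (intro nn_integral_eq_integral) (auto simp: set_lebesgue_integral_def intro!: AE_I2 mult_nonneg_nonneg integral_nonneg)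
  also have "expectation (\<lambda>w. T * (LINT s:{0..T}|lborel. (norm (b s w))\<^sup>2)) = T * (\<integral>z. (norm (case_prod b z))\<^sup>2 \<partial>time_prob M T)"
    using integral_time_prob[OF i] by (simp add: split_beta')
  finally show ?thesis .
qed

lemma drift_process:
  fixes b :: "real \<Rightarrow> 'a \<Rightarrow> 'b::euclidean_space"
  assumes T: "0 \<le> T" and b: "b \<in> L2_proc M F T"
  obtains B where "B \<in> L2_cont M F T" "AE \<omega> in M. \<forall>t\<in>{0..T}. B t \<omega> = (LINT s:{0..t}|lborel. b s \<omega>)"
proof -
  obtain Z where Z: "Z \<in> null_sets M" "\<And>\<omega>. \<omega> \<in> space M - Z \<Longrightarrow> set_integrable lborel {0..T} (\<lambda>s. b s \<omega>)"
    using AE_E3[OF L2_proc_set_integrable[OF T b]] by blast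
  \<comment> \<open>Paths on which b is not integrable are set to 0, so that all paths are
    continuous.\<close>
  define B where "B t \<omega> = (if \<omega> \<in> Z then 0 else LINT s:{0..t}|lborel. b s \<omega>)" for t \<omega>
  have AE: "AE \<omega> in M. \<forall>t\<in>{0..T}. B t \<omega> = (LINT s:{0..t}|lborel. b s \<omega>)"
    using AE_not_in[OF Z(1)] by eventually_elim (simp add: B_def)
  have "adapted_cont T B"
    unfolding adapted_cont_def
  proof (intro conjI ballI)
    fix t assume t: "t \<in> {0..T}"
    show "B t \<in> borel_measurable (F t)"
    proof (rule measurable_F_AE)
      show "(\<lambda>\<omega>. LINT s:{0..t}|lborel. b s \<omega>) \<in> borel_measurable (F t)"
        using b t by (intro progressive_integral_adapted[of T]) (auto simp: L2_proc_def)
      show "AE \<omega> in M. (LINT s:{0..t}|lborel. b s \<omega>) = B t \<omega>"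
        using AE by eventually_elim (use t in simp)
    qed
  next
    fix \<omega> assume w: "\<omega> \<in> space M"
    show "continuous_on {0..T} (\<lambda>t. B t \<omega>)"
    proof (cases "\<omega> \<in> Z")
      case False
      then have si: "set_integrable lborel {0..T} (\<lambda>s. b s \<omega>)" using Z w by blast
      have eq: "B t \<omega> = integral {0..t} (\<lambda>s. b s \<omega>)" if "t \<in> {0..T}" for t
        using set_borel_integral_eq_integral(2)[OF set_integrable_subset[OF si, of "{0..t}"]] that False by (simp add: B_def)
      have "continuous_on {0..T} (\<lambda>t. integral {0..t} (\<lambda>s. b s \<omega>))"
        by (rule indefinite_integral_continuous_1[OF set_borel_integral_eq_integral(1)[OF si]])
      then show ?thesis by (subst continuous_on_cong[OF refl eq])
    qed (simp add: B_def)
  qed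
  moreover have "(\<integral>\<^sup>+\<omega>. csup T B \<omega> \<partial>M) < \<infinity>"
    using drift_csup_le[OF T b AE] ennreal_less_top by (auto intro: le_less_trans)
  ultimately show thesis using that AE by (auto simp: L2_cont_eq)
qed

section \<open>Linear combinations and modifications of Ito processes\<close>

lemma ito_processD:
  assumes "ito_process M F W T X b \<sigma>" "t \<in> {0..T}"
  shows "has_ito_integral M F W \<sigma> t (\<lambda>w. X t w - X 0 w - (LINT s:{0..t}|lborel. b s w))"
  using assms by (auto simp: ito_process_def)

lemma ito_process_add_scaleR:
  assumes X: "ito_process M F W T X b \<sigma>" and Y: "ito_process M F W T Y b' \<sigma>'"
  shows "ito_process M F W T (\<lambda>t w. X t w + c *\<^sub>R Y t w) (\<lambda>s w. b s w + c *\<^sub>R b' s w) (\<lambda>s w. \<sigma> s w + c *\<^sub>R \<sigma>' s w)"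
  unfolding ito_process_def
proof (intro conjI ballI)
  have i: "AE w in M. set_integrable lborel {0..T} (\<lambda>s. b s w)" "AE w in M. set_integrable lborel {0..T} (\<lambda>s. b' s w)"
    using X Y by (auto simp: ito_process_def)
  show "AE w in M. set_integrable lborel {0..T} (\<lambda>s. b s w + c *\<^sub>R b' s w)"
    using i by eventually_elim (intro set_integral_add(1) set_integrable_scaleR_right)
  fix t assume t: "t \<in> {0..T}"
  show "has_ito_integral M F W (\<lambda>s w. \<sigma> s w + c *\<^sub>R \<sigma>' s w) t
      (\<lambda>w. X t w + c *\<^sub>R Y t w - (X 0 w + c *\<^sub>R Y 0 w) - (LINT s:{0..t}|lborel. b s w + c *\<^sub>R b' s w))"
  proof (rule has_ito_AE_eq[OF has_ito_add_scaleR[OF _ ito_processD[OF X t] ito_processD[OF Y t]]])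
    show "AE w in M. X t w - X 0 w - (LINT s:{0..t}|lborel. b s w) + c *\<^sub>R (Y t w - Y 0 w - (LINT s:{0..t}|lborel. b' s w))
      = X t w + c *\<^sub>R Y t w - (X 0 w + c *\<^sub>R Y 0 w) - (LINT s:{0..t}|lborel. b s w + c *\<^sub>R b' s w)"
      using i
    proof eventually_elim
      case (elim w)
      have "set_integrable lborel {0..t} (\<lambda>s. b s w)" "set_integrable lborel {0..t} (\<lambda>s. c *\<^sub>R b' s w)"
        using t set_integrable_subset[OF elim(1), of "{0..t}"] set_integrable_subset[OF elim(2), of "{0..t}"] by auto
      then have "(LINT s:{0..t}|lborel. b s w + c *\<^sub>R b' s w) = (LINT s:{0..t}|lborel. b s w) + c *\<^sub>R (LINT s:{0..t}|lborel. b' s w)"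
        by (simp add: set_integral_add(2))
      then show ?case by (simp add: algebra_simps)
    qed
  qed (use t in auto)
qed

lemma ito_process_AE_eq:
  assumes X: "ito_process M F W T X b \<sigma>" and eq: "\<And>t. t \<in> {0..T} \<Longrightarrow> AE w in M. X t w = X' t w" and T: "0 \<le> T"
  shows "ito_process M F W T X' b \<sigma>"
  unfolding ito_process_def
proof (intro conjI ballI)
  show "AE w in M. set_integrable lborel {0..T} (\<lambda>s. b s w)" using X by (simp add: ito_process_def)
  fix t assume t: "t \<in> {0..T}"
  show "has_ito_integral M F W \<sigma> t (\<lambda>w. X' t w - X' 0 w - (LINT s:{0..t}|lborel. b s w))"
  proof (rule has_ito_AE_eq[OF ito_processD[OF X t]])
    have "AE w in M. X 0 w = X' 0 w" using T by (intro eq) auto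
    then show "AE w in M. X t w - X 0 w - (LINT s:{0..t}|lborel. b s w) = X' t w - X' 0 w - (LINT s:{0..t}|lborel. b s w)"
      using eq[OF t] by eventually_elim simp
  qed
qed

text \<open>After exchanging the factors, a null set of the product has null sections for almost
  every path.\<close>

lemma time_prob_AE_paths:
  assumes "AE z in time_prob M T. P (fst z) (snd z)"
  shows "AE w in M. AE s in lborel. s \<in> {0..T} \<longrightarrow> P s w"
proof -
  interpret P: pair_sigma_finite "time_measure T" M by (rule pair_time)
  interpret Q: pair_sigma_finite M "time_measure T" ..
  have "AE z in M \<Otimes>\<^sub>M time_measure T. P (snd z) (fst z)"
  proof -
    have "AE z in distr (M \<Otimes>\<^sub>M time_measure T) (time_measure T \<Otimes>\<^sub>M M) (\<lambda>(x, y). (y, x)). P (fst z) (snd z)"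
      using assms unfolding time_prob_def P.distr_pair_swap[symmetric] .
    from AE_distrD[OF measurable_pair_swap' this] show ?thesis by (simp add: split_beta)
  qed
  from Q.AE_pair[OF this] show ?thesis by (simp add: AE_restrict_space_iff)
qed

text \<open>An optimal control agrees with its closed formula only almost everywhere in time and
  sample; this lets the formula be inserted into the state equation.\<close>

lemma ito_process_drift_AE_eq:
  fixes X :: "real \<Rightarrow> 'a \<Rightarrow> 'b::euclidean_space"
  assumes X: "ito_process M F W T X b \<sigma>" and T: "0 \<le> T"
    and bm: "progressive F T b" "progressive F T b'"
    and eq: "AE z in time_prob M T. b (fst z) (snd z) = b' (fst z) (snd z)"
  shows "ito_process M F W T X b' \<sigma>"
  unfolding ito_process_def
proof (intro conjI ballI)
  note paths = time_prob_AE_paths[OF eq]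
  have pm: "(\<lambda>s. indicator A s *\<^sub>R f s w) \<in> borel_measurable lborel" if "progressive F T f" "w \<in> space M" "A \<in> sets borel" "A \<subseteq> {0..T}"
    for f :: "real \<Rightarrow> 'a \<Rightarrow> 'b" and A w
  proof -
    have "(\<lambda>s. f s w) \<in> borel_measurable (time_measure T)"
      using progressive_measurable[OF that(1) T] that(2) by (intro path_measurable) auto
    then have "(\<lambda>s. indicator {0..T} s *\<^sub>R f s w) \<in> borel_measurable lborel"
      by (rule borel_measurable_restrict_space_iff[THEN iffD1, rotated]) simp
    then have "(\<lambda>s. indicator A s *\<^sub>R (indicator {0..T} s *\<^sub>R f s w)) \<in> borel_measurable lborel"
      by (rule borel_measurable_scaleR[OF borel_measurable_indicator, rotated]) (use that in simp)
    also have "(\<lambda>s. indicator A s *\<^sub>R (indicator {0..T} s *\<^sub>R f s w)) = (\<lambda>s. indicator A s *\<^sub>R f s w)"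
      using that(4) by (intro ext) (auto simp: indicator_def)
    finally show ?thesis .
  qed
  have "AE w in M. set_integrable lborel {0..T} (\<lambda>s. b s w)" using X by (simp add: ito_process_def)
  then show "AE w in M. set_integrable lborel {0..T} (\<lambda>s. b' s w)"
    using paths AE_space
  proof eventually_elim
    case (elim w)
    have "integrable lborel (\<lambda>s. indicator {0..T} s *\<^sub>R b s w) \<longleftrightarrow> integrable lborel (\<lambda>s. indicator {0..T} s *\<^sub>R b' s w)"
    proof (rule integrable_cong_AE)
      show "AE s in lborel. indicator {0..T} s *\<^sub>R b s w = indicator {0..T} s *\<^sub>R b' s w"
        using elim(2) by eventually_elim (auto simp: indicator_def)
    qed (rule pm[OF bm(1) elim(3)] pm[OF bm(2) elim(3)]; simp)+
    then show ?case using elim(1) by (simp add: set_integrable_def)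
  qed
  fix t assume t: "t \<in> {0..T}"
  show "has_ito_integral M F W \<sigma> t (\<lambda>w. X t w - X 0 w - (LINT s:{0..t}|lborel. b' s w))"
  proof (rule has_ito_AE_eq[OF ito_processD[OF X t]])
    show "AE w in M. X t w - X 0 w - (LINT s:{0..t}|lborel. b s w) = X t w - X 0 w - (LINT s:{0..t}|lborel. b' s w)"
      using paths AE_space
    proof eventually_elim
      case (elim w)
      have "(LINT s:{0..t}|lborel. b s w) = (LINT s:{0..t}|lborel. b' s w)"
        unfolding set_lebesgue_integral_def
      proof (rule integral_cong_AE)
        show "AE s in lborel. indicator {0..t} s *\<^sub>R b s w = indicator {0..t} s *\<^sub>R b' s w"
          using elim(1) by eventually_elim (use t in \<open>auto simp: indicator_def\<close>)
      qed (rule pm[OF bm(1) elim(2)] pm[OF bm(2) elim(2)]; use t in simp)+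
      then show ?case by simp
    qed
  qed
qed

text \<open>X is the sum of a drift and an Ito integral. Splitting the square costs a factor 2, the
  drift a factor T, and Doob's inequality a factor 4.\<close>

lemma ito_process_estimate:
  fixes X :: "real \<Rightarrow> 'a \<Rightarrow> 'b::euclidean_space"
  assumes T: "0 \<le> T" and X: "X \<in> L2_cont M F T" "ito_process M F W T X b \<sigma>"
    and X0: "AE w in M. X 0 w = 0" and b: "b \<in> L2_proc M F T"
  shows "(\<integral>\<^sup>+w. csup T X w \<partial>M) \<le> ennreal (2 * T * (\<integral>z. (norm (case_prod b z))\<^sup>2 \<partial>time_prob M T) + 8 * (\<integral>z. (norm (case_prod \<sigma> z))\<^sup>2 \<partial>time_prob M T))"
proof -
  obtain B where B: "B \<in> L2_cont M F T" "AE w in M. \<forall>t\<in>{0..T}. B t w = (LINT s:{0..t}|lborel. b s w)"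
    using drift_process[OF T b] by blast
  define I where "I t w = X t w + (-1) *\<^sub>R B t w" for t w
  have I: "I \<in> L2_cont M F T" unfolding I_def[abs_def] by (rule L2_cont_add_scaleR[OF T X(1) B(1)])
  have hI: "has_ito_integral M F W \<sigma> t (I t)" if t: "t \<in> {0..T}" for t
  proof (rule has_ito_AE_eq[OF ito_processD[OF X(2) t]])
    show "AE w in M. X t w - X 0 w - (LINT s:{0..t}|lborel. b s w) = I t w"
      using B(2) X0 by eventually_elim (use t in \<open>simp add: I_def\<close>)
  qed
  have aBI: "adapted_cont T B" "adapted_cont T I" using B I by (auto simp: L2_cont_eq)
  note [measurable] = csup_measurable[OF aBI(1) T] csup_measurable[OF aBI(2) T]
  have XBI: "X = (\<lambda>t w. B t w + 1 *\<^sub>R I t w)" by (simp add: I_def fun_eq_iff)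
  have "(\<integral>\<^sup>+w. csup T X w \<partial>M) \<le> (\<integral>\<^sup>+w. 2 * csup T B w + ennreal (2 * 1\<^sup>2) * csup T I w \<partial>M)"
    unfolding XBI by (intro nn_integral_mono csup_add_scaleR_le)
  also have "\<dots> = 2 * (\<integral>\<^sup>+w. csup T B w \<partial>M) + 2 * (\<integral>\<^sup>+w. csup T I w \<partial>M)"
    by (simp add: nn_integral_add nn_integral_cmult)
  also have "\<dots> \<le> 2 * ennreal (T * (\<integral>z. (norm (case_prod b z))\<^sup>2 \<partial>time_prob M T)) + 2 * ennreal (4 * (\<integral>z. (norm (case_prod \<sigma> z))\<^sup>2 \<partial>time_prob M T))"
    by (intro add_mono mult_left_mono drift_csup_le[OF T b B(2)] has_ito_doob[OF T I hI]) auto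
  also have "\<dots> = ennreal (2 * (T * (\<integral>z. (norm (case_prod b z))\<^sup>2 \<partial>time_prob M T)) + 2 * (4 * (\<integral>z. (norm (case_prod \<sigma> z))\<^sup>2 \<partial>time_prob M T)))"
    using T by (subst ennreal_plus) (auto simp: ennreal_mult)
  finally show ?thesis by (simp add: mult.assoc)
qed

lemma L2_cont_mono: "X \<in> L2_cont M F T \<Longrightarrow> t \<le> T \<Longrightarrow> X \<in> L2_cont M F t"
proof -
  assume X: "X \<in> L2_cont M F T" and t: "t \<le> T"
  have "(\<integral>\<^sup>+w. csup t X w \<partial>M) \<le> (\<integral>\<^sup>+w. csup T X w \<partial>M)"
    unfolding csup_def using t by (intro nn_integral_mono SUP_subset_mono) auto
  also have "\<dots> < \<infinity>" using X by (simp add: L2_cont_eq)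
  finally show ?thesis using X t unfolding L2_cont_eq adapted_cont_def
    by (auto intro: continuous_on_subset)
qed

lemma ito_process_mono: "ito_process M F W T X b \<sigma> \<Longrightarrow> t \<le> T \<Longrightarrow> ito_process M F W t X b \<sigma>"
  unfolding ito_process_def
  by (auto elim!: eventually_mono intro: set_integrable_subset)

lemma ito_process_exists:
  fixes b \<sigma> :: "real \<Rightarrow> 'a \<Rightarrow> 'b::euclidean_space"
  assumes T: "0 \<le> T" and b: "b \<in> L2_proc M F T" and \<sigma>: "\<sigma> \<in> L2_proc M F T"
    and v: "v \<in> borel_measurable (F 0)" "sq_int M v"
  obtains X where "X \<in> L2_cont M F T" "ito_process M F W T X b \<sigma>" "AE w in M. X 0 w = v w"
proof -
  obtain B where B: "B \<in> L2_cont M F T" "AE w in M. \<forall>t\<in>{0..T}. B t w = (LINT s:{0..t}|lborel. b s w)"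
    using drift_process[OF T b] by blast
  obtain I where I: "I \<in> L2_cont M F T" "\<And>t. t \<in> {0..T} \<Longrightarrow> has_ito_integral M F W \<sigma> t (I t)"
    using ito_integral_continuous_version[OF T \<sigma>] by blast
  have V: "(\<lambda>t w. v w) \<in> L2_cont M F T"
    unfolding L2_cont_eq adapted_cont_def csup_def
    using measurable_F_mono[OF _ v(1)] v(2) T by (auto simp: sq_int_iff_nn_integral[OF sq_int_measurable[OF v(2)]] top.not_eq_extremum[symmetric])
  define X where "X t w = (v w + 1 *\<^sub>R B t w) + 1 *\<^sub>R I t w" for t w
  have X: "X \<in> L2_cont M F T"
    unfolding X_def[abs_def] by (intro L2_cont_add_scaleR T V B I)
  \<comment> \<open>The isometry over an interval of length zero shows that the integral starts at
    0.\<close>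
  have "expectation (\<lambda>w. I 0 w \<bullet> I 0 w) = 0"
    using has_ito_isometry[OF order_refl I(2)[of 0] I(2)[of 0]] T by (simp add: integral_time_prob_0)
  then have I0: "AE w in M. I 0 w = 0"
    using has_ito_sq_int[OF I(2)[of 0] order_refl] T by (intro sq_int_integral_zero_AE) (auto simp: power2_norm_eq_inner)
  have B0: "AE w in M. B 0 w = 0"
    using B(2)
  proof eventually_elim
    case (elim w)
    have "(LINT s:{0..0}|lborel. b s w) = 0"
      unfolding set_lebesgue_integral_def
      by (rule integral_eq_zero_AE) (use AE_lborel_singleton[of 0] in \<open>eventually_elim, auto\<close>)
    then show ?case using elim T by simp
  qed
  have X0: "AE w in M. X 0 w = v w" using I0 B0 by eventually_elim (simp add: X_def)
  have "ito_process M F W T X b \<sigma>"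
    unfolding ito_process_def
  proof (intro conjI ballI L2_proc_set_integrable T b)
    fix t assume t: "t \<in> {0..T}"
    show "has_ito_integral M F W \<sigma> t (\<lambda>w. X t w - X 0 w - (LINT s:{0..t}|lborel. b s w))"
    proof (rule has_ito_AE_eq[OF I(2)[OF t]])
      show "AE w in M. I t w = X t w - X 0 w - (LINT s:{0..t}|lborel. b s w)"
        using X0 B(2) by eventually_elim (use t in \<open>simp add: X_def\<close>)
    qed
  qed
  then show thesis using that X X0 by blast
qed

lemma nn_integral_sq_le_csup: "t \<in> {0..T} \<Longrightarrow> (\<integral>\<^sup>+w. ennreal ((norm (X t w))\<^sup>2) \<partial>M) \<le> (\<integral>\<^sup>+w. csup T X w \<partial>M)"
  by (intro nn_integral_mono csup_upper)

lemma csup_zero_AE: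
  assumes "adapted_cont T X" "0 \<le> T" "(\<integral>\<^sup>+w. csup T X w \<partial>M) = 0"
  shows "AE w in M. \<forall>t\<in>{0..T}. X t w = 0"
proof -
  have "AE w in M. csup T X w = 0"
    using assms(3) nn_integral_0_iff_AE[OF csup_measurable[OF assms(1,2)]] by simp
  then show ?thesis
  proof eventually_elim
    case (elim w)
    show ?case
    proof
      fix t assume "t \<in> {0..T}"
      from csup_upper[OF this, of X w] elim have "ennreal ((norm (X t w))\<^sup>2) = 0" by simp
      then show "X t w = 0" by (simp add: ennreal_eq_0_iff)
    qed
  qed
qed

section \<open>Picard iteration for Lipschitz equations\<close>

lemma nn_integral_power_interval:
  assumes "0 \<le> t" "0 \<le> c"
  shows "(\<integral>\<^sup>+s\<in>{0..t}. ennreal (c * s^k) \<partial>lborel) = ennreal (c * t^Suc k / real (Suc k))"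
proof -
  have "(\<integral>\<^sup>+s\<in>{0..t}. ennreal (c * s^k) \<partial>lborel) = (\<integral>\<^sup>+s. ennreal (c * (s^k * indicator {0..t} s)) \<partial>lborel)"
    by (intro nn_integral_cong) (auto simp: indicator_def)
  also have "\<dots> = ennreal (\<integral>s. c * (s^k * indicator {0..t} s) \<partial>lborel)"
  proof (rule nn_integral_eq_integral)
    have "set_integrable lborel {0..t} (\<lambda>s. s^k)"
      by (rule borel_integrable_atLeastAtMost') (intro continuous_intros)
    then show "integrable lborel (\<lambda>s. c * (s^k * indicator {0..t} s))"
      by (simp add: set_integrable_def mult.commute)
  qed (use assms in \<open>auto simp: indicator_def\<close>)
  also have "(\<integral>s. c * (s^k * indicator {0..t} s) \<partial>lborel) = c * t^Suc k / real (Suc k)"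
    using integral_power[OF assms(1), of k] by simp
  finally show ?thesis .
qed

text \<open>Doob's estimate bounds the uniform distance of two iterates by the L2 distance of their
  predecessors. Iterating in time yields factorial decay and hence convergence on the whole
  interval.\<close>

lemma sde_picard:
  fixes b \<sigma> :: "real \<Rightarrow> 'a \<Rightarrow> 'b \<Rightarrow> 'b::euclidean_space"
  assumes T: "0 \<le> T"
    and b: "\<And>V. V \<in> L2_proc M F T \<Longrightarrow> (\<lambda>s w. b s w (V s w)) \<in> L2_proc M F T"
    and \<sigma>: "\<And>V. V \<in> L2_proc M F T \<Longrightarrow> (\<lambda>s w. \<sigma> s w (V s w)) \<in> L2_proc M F T"
    and lip: "AE z in time_prob M T. \<forall>x y. norm (b (fst z) (snd z) x - b (fst z) (snd z) y) \<le> L * norm (x - y)"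
      "AE z in time_prob M T. \<forall>x y. norm (\<sigma> (fst z) (snd z) x - \<sigma> (fst z) (snd z) y) \<le> L * norm (x - y)"
    and v: "v \<in> borel_measurable (F 0)" "sq_int M v"
  obtains X where "X \<in> L2_cont M F T" "AE w in M. X 0 w = v w"
    "ito_process M F W T X (\<lambda>s w. b s w (X s w)) (\<lambda>s w. \<sigma> s w (X s w))"
proof -
  define step where "step V X \<longleftrightarrow> X \<in> L2_cont M F T \<and> (AE w in M. X 0 w = v w) \<and>
     ito_process M F W T X (\<lambda>s w. b s w (V s w)) (\<lambda>s w. \<sigma> s w (V s w))" for V X
  have ex: "\<exists>X. step V X" if "V \<in> L2_cont M F T" for V
    using ito_process_exists[OF T b[OF L2_cont_L2_proc[OF T that]] \<sigma>[OF L2_cont_L2_proc[OF T that]] v]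
    unfolding step_def by metis
  \<comment> \<open>The constant of \<open>ito_process_estimate\<close> when the differences of
    drift and diffusion are bounded by L times the difference of the arguments.\<close>
  define K where "K = 2 * T * L\<^sup>2 + 8 * L\<^sup>2"
  have K: "0 \<le> K" using T by (simp add: K_def)
  have est: "(\<integral>\<^sup>+w. csup t (\<lambda>s w. X s w - X' s w) w \<partial>M)
      \<le> ennreal K * (\<integral>\<^sup>+z. ennreal ((norm (case_prod V z - case_prod V' z))\<^sup>2) \<partial>time_prob M t)"
    if st: "step V X" "step V' X'" "V \<in> L2_cont M F T" "V' \<in> L2_cont M F T" and t: "t \<in> {0..T}" for V X V' X' t
  proof -
    have t': "0 \<le> t" "t \<le> T" using t by auto
    define bb where "bb s w = b s w (V s w) + (-1) *\<^sub>R b s w (V' s w)" for s w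
    define ss where "ss s w = \<sigma> s w (V s w) + (-1) *\<^sub>R \<sigma> s w (V' s w)" for s w
    define D where "D s w = X s w + (-1) *\<^sub>R X' s w" for s w
    note P = L2_cont_L2_proc[OF T st(3)] L2_cont_L2_proc[OF T st(4)]
    have bb: "bb \<in> L2_proc M F T" "ss \<in> L2_proc M F T"
      unfolding bb_def[abs_def] ss_def[abs_def] by (intro L2_proc_add_scaleR T b \<sigma> P)+
    have D: "D \<in> L2_cont M F T"
      unfolding D_def[abs_def] using st(1,2) by (intro L2_cont_add_scaleR T) (auto simp: step_def)
    have iD: "ito_process M F W T D bb ss"
      unfolding D_def[abs_def] bb_def[abs_def] ss_def[abs_def] using st(1,2) by (intro ito_process_add_scaleR) (auto simp: step_def)
    have "AE w in M. X 0 w = v w" "AE w in M. X' 0 w = v w" using st(1,2) by (auto simp: step_def)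
    then have D0: "AE w in M. D 0 w = 0" by eventually_elim (simp add: D_def)
    have V: "sq_int (time_prob M T) (\<lambda>z. case_prod V z - case_prod V' z)"
      by (intro sq_int_diff L2_proc_sq_int P T)
    have Vt: "sq_int (time_prob M t) (\<lambda>z. case_prod V z - case_prod V' z)"
      by (intro sq_int_diff L2_proc_sq_int[OF L2_proc_mono[OF _ t']] P t'(1))
    \<comment> \<open>The Lipschitz bound is known almost everywhere on [0,T] but used on [0,t]. It
      is first passed to single paths, where restricting time is harmless.\<close>
    have le: "(\<integral>z. (norm (case_prod f z))\<^sup>2 \<partial>time_prob M t) \<le> L\<^sup>2 * (\<integral>z. (norm (case_prod V z - case_prod V' z))\<^sup>2 \<partial>time_prob M t)"
      if f: "f \<in> L2_proc M F T" and fl: "AE z in time_prob M T. norm (case_prod f z) \<le> L * norm (case_prod V z - case_prod V' z)" for f :: "real \<Rightarrow> 'a \<Rightarrow> 'b"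
    proof -
      have "AE w in M. AE s in lborel. s \<in> {0..T} \<longrightarrow> norm (f s w) \<le> L * norm (V s w - V' s w)"
        by (rule time_prob_AE_paths) (use fl in \<open>simp add: split_beta'\<close>)
      then have ae: "AE w in M. AE s in lborel. s \<in> {0..t} \<longrightarrow> norm (f s w) \<le> L * norm (V s w - V' s w)"
        by eventually_elim (erule eventually_mono, use t' in auto)
      have ft: "sq_int (time_prob M t) (case_prod f)" by (intro L2_proc_sq_int[OF L2_proc_mono[OF _ t']] f t'(1))
      note [measurable] = sq_int_measurable[OF ft] sq_int_measurable[OF Vt]
      have "(\<integral>\<^sup>+z. ennreal ((norm (case_prod f z))\<^sup>2) \<partial>time_prob M t) = (\<integral>\<^sup>+w. (\<integral>\<^sup>+s\<in>{0..t}. ennreal ((norm (case_prod f (s, w)))\<^sup>2) \<partial>lborel) \<partial>M)"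
        by (rule nn_integral_time_prob[symmetric]) measurable
      also have "\<dots> \<le> (\<integral>\<^sup>+w. (\<integral>\<^sup>+s\<in>{0..t}. ennreal (L\<^sup>2 * (norm (case_prod V (s, w) - case_prod V' (s, w)))\<^sup>2) \<partial>lborel) \<partial>M)"
      proof (rule nn_integral_mono_AE)
        show "AE w in M. (\<integral>\<^sup>+s\<in>{0..t}. ennreal ((norm (case_prod f (s, w)))\<^sup>2) \<partial>lborel) \<le> (\<integral>\<^sup>+s\<in>{0..t}. ennreal (L\<^sup>2 * (norm (case_prod V (s, w) - case_prod V' (s, w)))\<^sup>2) \<partial>lborel)"
          using ae
        proof eventually_elim
          case (elim w)
          show ?case
          proof (rule nn_integral_mono_AE)
            show "AE s in lborel. ennreal ((norm (case_prod f (s, w)))\<^sup>2) * indicator {0..t} s \<le> ennreal (L\<^sup>2 * (norm (case_prod V (s, w) - case_prod V' (s, w)))\<^sup>2) * indicator {0..t} s"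
              using elim
            proof eventually_elim
              case (elim s)
              have "s \<in> {0..t} \<Longrightarrow> (norm (f s w))\<^sup>2 \<le> (L * norm (V s w - V' s w))\<^sup>2" using elim by (intro power_mono) auto
              then show ?case by (auto simp: indicator_def power_mult_distrib intro!: ennreal_leI)
            qed
          qed
        qed
      qed
      also have "\<dots> = (\<integral>\<^sup>+z. ennreal (L\<^sup>2 * (norm (case_prod V z - case_prod V' z))\<^sup>2) \<partial>time_prob M t)"
        by (rule nn_integral_time_prob) measurable
      also have "\<dots> = ennreal (L\<^sup>2 * (\<integral>z. (norm (case_prod V z - case_prod V' z))\<^sup>2 \<partial>time_prob M t))"
        using sq_int_integrable[OF Vt] by (subst nn_integral_eq_integral) auto
      finally show ?thesis unfolding nn_integral_sq_int[OF ft] by (subst (asm) ennreal_le_iff) auto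
    qed
    define d where "d = (\<integral>z. (norm (case_prod V z - case_prod V' z))\<^sup>2 \<partial>time_prob M t)"
    have d0: "0 \<le> d" by (simp add: d_def)
    have ae: "AE z in time_prob M T. norm (case_prod bb z) \<le> L * norm (case_prod V z - case_prod V' z)"
      "AE z in time_prob M T. norm (case_prod ss z) \<le> L * norm (case_prod V z - case_prod V' z)"
      using lip by (eventually_elim, simp add: bb_def ss_def split_beta')+
    have dd: "(\<integral>z. (norm (case_prod bb z))\<^sup>2 \<partial>time_prob M t) \<le> L\<^sup>2 * d" "(\<integral>z. (norm (case_prod ss z))\<^sup>2 \<partial>time_prob M t) \<le> L\<^sup>2 * d"
      unfolding d_def by (rule le[OF bb(1) ae(1)], rule le[OF bb(2) ae(2)])
    have "(\<integral>\<^sup>+w. csup t D w \<partial>M) \<le> ennreal (2 * t * (\<integral>z. (norm (case_prod bb z))\<^sup>2 \<partial>time_prob M t) + 8 * (\<integral>z. (norm (case_prod ss z))\<^sup>2 \<partial>time_prob M t))"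
      by (rule ito_process_estimate[OF t'(1) L2_cont_mono[OF D t'(2)] ito_process_mono[OF iD t'(2)] D0 L2_proc_mono[OF bb(1) t']])
    also have "\<dots> \<le> ennreal (K * d)"
    proof (rule ennreal_leI)
      have "2 * t * (\<integral>z. (norm (case_prod bb z))\<^sup>2 \<partial>time_prob M t) \<le> 2 * T * (L\<^sup>2 * d)"
        using dd t' by (intro mult_mono) auto
      then show "2 * t * (\<integral>z. (norm (case_prod bb z))\<^sup>2 \<partial>time_prob M t) + 8 * (\<integral>z. (norm (case_prod ss z))\<^sup>2 \<partial>time_prob M t) \<le> K * d"
        using dd(2) by (simp add: K_def algebra_simps)
    qed
    also have "\<dots> = ennreal K * (\<integral>\<^sup>+z. ennreal ((norm (case_prod V z - case_prod V' z))\<^sup>2) \<partial>time_prob M t)"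
      unfolding nn_integral_sq_int[OF Vt] d_def[symmetric] using K d0 by (simp add: ennreal_mult)
    finally show ?thesis by (simp add: D_def[abs_def])
  qed
  have v0: "(\<lambda>t w. v w) \<in> L2_cont M F T"
    unfolding L2_cont_eq adapted_cont_def csup_def
    using measurable_F_mono[OF _ v(1)] v(2) T by (auto simp: sq_int_iff_nn_integral[OF sq_int_measurable[OF v(2)]] top.not_eq_extremum[symmetric])
  \<comment> \<open>Each iterate is a solution, fixed by choice, of the equation with its
    predecessor inserted into the coefficients.\<close>
  define V where "V = rec_nat (\<lambda>t w. v w) (\<lambda>_ V. SOME X. step V X)"
  have V0: "V 0 = (\<lambda>t w. v w)" and VS: "V (Suc k) = (SOME X. step (V k) X)" for k by (simp_all add: V_def)
  have V: "V k \<in> L2_cont M F T \<and> step (V k) (V (Suc k))" for k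
  proof (induction k)
    case 0
    show ?case using someI_ex[OF ex[OF v0]] v0 by (simp add: V0 VS)
  next
    case (Suc k)
    then have "V (Suc k) \<in> L2_cont M F T" by (simp add: step_def)
    then show ?case using someI_ex[OF ex] VS by metis
  qed
  define d where "d k t = (\<integral>\<^sup>+z. ennreal ((norm (case_prod (V (Suc k)) z - case_prod (V k) z))\<^sup>2) \<partial>time_prob M t)" for k t
  have mV: "case_prod (V k) \<in> borel_measurable (time_prob M t)" if "t \<in> {0..T}" for k t
  proof -
    have "V k \<in> L2_proc M F T" using L2_cont_L2_proc[OF T] V by blast
    then have "V k \<in> L2_proc M F t" using that by (intro L2_proc_mono[of _ T t]) auto
    then show ?thesis using that by (intro sq_int_measurable[OF L2_proc_sq_int]) auto
  qed
  have dT: "d 0 T < \<infinity>"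
    using sq_int_diff[OF L2_proc_sq_int[OF L2_cont_L2_proc[OF T] T] L2_proc_sq_int[OF L2_cont_L2_proc[OF T] T], of "V (Suc 0)" "V 0"] V
    unfolding d_def by (subst sq_int_iff_nn_integral[symmetric]) (use mV[of T] T in auto)
  define C where "C = enn2real (d 0 T)"
  have C: "0 \<le> C" "d 0 T = ennreal C" using dT by (auto simp: C_def top.not_eq_extremum)
  \<comment> \<open>The bound is integrated once in each step: the next distance at t is at most K
    times the integral of the previous one over [0,t].\<close>
  have dk: "d k t \<le> ennreal (C * (K * t)^k / fact k)" if t: "t \<in> {0..T}" for k t
    using t
  proof (induction k arbitrary: t)
    case 0
    have tT: "t \<le> T" "T \<in> {0..T}" using 0 T by auto
    note [measurable] = mV[OF 0] mV[OF tT(2)]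
    have "d 0 t \<le> d 0 T"
      unfolding d_def by (rule nn_integral_time_prob_mono[OF _ _ tT(1)]) measurable
    then show ?case using C by simp
  next
    case (Suc k)
    have t': "0 \<le> t" "t \<le> T" using Suc.prems by auto
    have "d (Suc k) t = (\<integral>\<^sup>+s\<in>{0..t}. (\<integral>\<^sup>+w. ennreal ((norm (case_prod (V (Suc (Suc k))) (s, w) - case_prod (V (Suc k)) (s, w)))\<^sup>2) \<partial>M) \<partial>lborel)"
    proof -
      note [measurable] = mV[OF Suc.prems]
      show ?thesis unfolding d_def by (rule nn_integral_time_prob'[symmetric]) measurable
    qed
    also have "\<dots> \<le> (\<integral>\<^sup>+s\<in>{0..t}. ennreal (K * (C * K^k / fact k) * s^k) \<partial>lborel)"
    proof (intro nn_integral_mono)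
      fix s :: real
      show "(\<integral>\<^sup>+w. ennreal ((norm (case_prod (V (Suc (Suc k))) (s, w) - case_prod (V (Suc k)) (s, w)))\<^sup>2) \<partial>M) * indicator {0..t} s
        \<le> ennreal (K * (C * K^k / fact k) * s^k) * indicator {0..t} s"
      proof (cases "s \<in> {0..t}")
        case True
        then have s: "s \<in> {0..T}" "s \<in> {0..s}" "0 \<le> s" using t' by auto
        have "(\<integral>\<^sup>+w. ennreal ((norm (V (Suc (Suc k)) s w - V (Suc k) s w))\<^sup>2) \<partial>M) \<le> (\<integral>\<^sup>+w. csup s (\<lambda>t w. V (Suc (Suc k)) t w - V (Suc k) t w) w \<partial>M)"
          by (rule nn_integral_sq_le_csup[OF s(2), of "\<lambda>t w. V (Suc (Suc k)) t w - V (Suc k) t w"])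
        also have "\<dots> \<le> ennreal K * d k s" unfolding d_def using V by (intro est s) auto
        also have "\<dots> \<le> ennreal K * ennreal (C * (K * s)^k / fact k)" by (intro mult_left_mono Suc.IH s) auto
        also have "\<dots> = ennreal (K * (C * K^k / fact k) * s^k)"
          using K C s by (subst ennreal_mult[symmetric]) (auto simp: power_mult_distrib)
        finally show ?thesis using True by simp
      qed simp
    qed
    also have "\<dots> = ennreal (K * (C * K^k / fact k) * t^Suc k / real (Suc k))"
      using K C by (intro nn_integral_power_interval t') auto
    also have "K * (C * K^k / fact k) * t^Suc k / real (Suc k) = C * (K * t)^Suc k / fact (Suc k)"
      by (simp add: power_mult_distrib mult_ac)
    finally show ?case .
  qed
  \<comment> \<open>Factorials outgrow powers, so a factor 4^-k can be split off, as
    \<open>L2_cont_complete\<close> requires.\<close>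
  obtain c0 where c0: "0 \<le> c0" "\<And>k. (4 * (K * T))^k / fact k \<le> c0"
  proof -
    have "(\<lambda>k. (4 * (K * T))^k / fact k) \<longlonglongrightarrow> 0"
      using summable_LIMSEQ_zero[OF summable_exp_generic[of "4 * (K * T)"]] by (simp add: divide_inverse mult.commute)
    then have "Bseq (\<lambda>k. (4 * (K * T))^k / fact k)" by (intro convergent_imp_Bseq) (auto simp: convergent_def)
    then obtain c where "0 < c" "\<And>k. norm ((4 * (K * T))^k / fact k) \<le> c" by (auto simp: Bseq_def)
    then show thesis using that[of c] by (smt (verit) real_norm_def)
  qed
  have S: "(\<integral>\<^sup>+w. csup T (\<lambda>t w. V (Suc (Suc k)) t w - V (Suc k) t w) w \<partial>M) \<le> ennreal (K * C * c0 * (1/4)^k)" for k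
  proof -
    have "(\<integral>\<^sup>+w. csup T (\<lambda>t w. V (Suc (Suc k)) t w - V (Suc k) t w) w \<partial>M) \<le> ennreal K * d k T"
      unfolding d_def using V T by (intro est) auto
    also have "\<dots> \<le> ennreal K * ennreal (C * (K * T)^k / fact k)"
      using T by (intro mult_left_mono dk) auto
    also have "\<dots> = ennreal (K * C * ((4 * (K * T))^k / fact k) * (1/4)^k)"
      using K C T by (subst ennreal_mult[symmetric]) (auto simp: power_mult_distrib power_divide)
    also have "\<dots> \<le> ennreal (K * C * c0 * (1/4)^k)"
      using K C c0 by (intro ennreal_leI mult_right_mono mult_left_mono) auto
    finally show ?thesis .
  qed
  have aV: "adapted_cont T (V (Suc k))" for k using V[of "Suc k"] by (simp add: L2_cont_eq)
  \<comment> \<open>The sequence starts at \<open>V (Suc 0)\<close>: the estimate compares outputs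
    of the iteration only, and \<open>V 0\<close> is just the constant initial value.\<close>
  obtain X where X: "X \<in> L2_cont M F T" and lim: "(\<lambda>k. \<integral>\<^sup>+w. csup T (\<lambda>t w. V (Suc k) t w - X t w) w \<partial>M) \<longlonglongrightarrow> 0"
    using L2_cont_complete[of T "\<lambda>k. V (Suc k)", OF T aV _ S] V[of "Suc 0"] K C c0 by auto
  \<comment> \<open>One more iteration, started at the limit. X and Y are both limits of the
    iterates, hence equal, which makes X a fixed point.\<close>
  obtain Y where Y: "step X Y" using ex[OF X] by blast
  have YL: "Y \<in> L2_cont M F T" using Y by (simp add: step_def)
  have dVX: "(\<integral>\<^sup>+z. ennreal ((norm (case_prod (V (Suc k)) z - case_prod X z))\<^sup>2) \<partial>time_prob M T) \<le> ennreal T * (\<integral>\<^sup>+w. csup T (\<lambda>t w. V (Suc k) t w - X t w) w \<partial>M)" for k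
  proof -
    have [measurable]: "case_prod (V (Suc k)) \<in> borel_measurable (time_prob M T)" "case_prod X \<in> borel_measurable (time_prob M T)"
      using mV[of T "Suc k"] T sq_int_measurable[OF L2_proc_sq_int[OF L2_cont_L2_proc[OF T X] T]] by auto
    have a: "adapted_cont T (\<lambda>t w. V (Suc k) t w - X t w)"
      using adapted_cont_add_scaleR[OF aV[of k], of X "-1"] X by (simp add: L2_cont_eq)
    have "(\<integral>\<^sup>+z. ennreal ((norm (case_prod (V (Suc k)) z - case_prod X z))\<^sup>2) \<partial>time_prob M T) =
      (\<integral>\<^sup>+w. (\<integral>\<^sup>+s\<in>{0..T}. ennreal ((norm (case_prod (V (Suc k)) (s, w) - case_prod X (s, w)))\<^sup>2) \<partial>lborel) \<partial>M)"
      by (rule nn_integral_time_prob[symmetric]) measurable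
    also have "\<dots> \<le> (\<integral>\<^sup>+w. (\<integral>\<^sup>+s\<in>{0..T}. csup T (\<lambda>t w. V (Suc k) t w - X t w) w \<partial>lborel) \<partial>M)"
      using csup_upper[of _ T "\<lambda>t w. V (Suc k) t w - X t w"] by (intro nn_integral_mono) (auto simp: indicator_def)
    also have "\<dots> = (\<integral>\<^sup>+w. ennreal T * csup T (\<lambda>t w. V (Suc k) t w - X t w) w \<partial>M)"
      using T by (subst nn_integral_cmult_indicator) (auto simp: emeasure_lborel_Icc_eq mult.commute)
    also have "\<dots> = ennreal T * (\<integral>\<^sup>+w. csup T (\<lambda>t w. V (Suc k) t w - X t w) w \<partial>M)"
      by (rule nn_integral_cmult[OF csup_measurable[OF a T]])
    finally show ?thesis .
  qed
  have aXY: "adapted_cont T (\<lambda>t w. X t w - Y t w)"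
    using adapted_cont_add_scaleR[of T X Y "-1"] X YL by (simp add: L2_cont_eq)
  define a where "a k = (\<integral>\<^sup>+w. csup T (\<lambda>t w. V (Suc k) t w - X t w) w \<partial>M)" for k
  have a0: "a \<longlonglongrightarrow> 0" using lim by (simp add: a_def[abs_def])
  have "(\<integral>\<^sup>+w. csup T (\<lambda>t w. X t w - Y t w) w \<partial>M) \<le> 2 * (ennreal K * (ennreal T * a k)) + 2 * a (Suc k)" for k
  proof -
    define P where "P t w = V (Suc (Suc k)) t w - Y t w" for t w
    define Q where "Q t w = V (Suc (Suc k)) t w - X t w" for t w
    have aPQ: "adapted_cont T P" "adapted_cont T Q"
      using adapted_cont_add_scaleR[OF aV[of "Suc k"], of Y "-1"] adapted_cont_add_scaleR[OF aV[of "Suc k"], of X "-1"] X YL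
      by (auto simp: L2_cont_eq P_def[abs_def] Q_def[abs_def])
    note [measurable] = csup_measurable[OF aPQ(1) T] csup_measurable[OF aPQ(2) T]
    have "(\<lambda>t w. X t w - Y t w) = (\<lambda>t w. P t w + (-1) *\<^sub>R Q t w)" by (simp add: P_def Q_def)
    then have "(\<integral>\<^sup>+w. csup T (\<lambda>t w. X t w - Y t w) w \<partial>M) = (\<integral>\<^sup>+w. csup T (\<lambda>t w. P t w + (-1) *\<^sub>R Q t w) w \<partial>M)" by simp
    also have "\<dots> \<le> (\<integral>\<^sup>+w. 2 * csup T P w + ennreal (2 * (-1)\<^sup>2) * csup T Q w \<partial>M)"
      by (intro nn_integral_mono csup_add_scaleR_le)
    also have "\<dots> = 2 * (\<integral>\<^sup>+w. csup T P w \<partial>M) + 2 * (\<integral>\<^sup>+w. csup T Q w \<partial>M)"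
      by (simp add: nn_integral_add nn_integral_cmult)
    also have "(\<integral>\<^sup>+w. csup T Q w \<partial>M) = a (Suc k)" by (simp add: a_def Q_def[abs_def])
    also have "(\<integral>\<^sup>+w. csup T P w \<partial>M) \<le> ennreal K * (\<integral>\<^sup>+z. ennreal ((norm (case_prod (V (Suc k)) z - case_prod X z))\<^sup>2) \<partial>time_prob M T)"
      unfolding P_def[abs_def] using V T by (intro est Y X) auto
    also have "\<dots> \<le> ennreal K * (ennreal T * a k)" unfolding a_def by (intro mult_left_mono dVX) auto
    finally show ?thesis by (simp add: add_right_mono mult_left_mono)
  qed
  moreover have "(\<lambda>k. 2 * (ennreal K * (ennreal T * a k)) + 2 * a (Suc k)) \<longlonglongrightarrow> 2 * (ennreal K * (ennreal T * 0)) + 2 * 0"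
    by (intro tendsto_add ennreal_tendsto_cmult LIMSEQ_Suc a0) auto
  ultimately have "(\<integral>\<^sup>+w. csup T (\<lambda>t w. X t w - Y t w) w \<partial>M) \<le> 2 * (ennreal K * (ennreal T * 0)) + 2 * 0"
    by (intro LIMSEQ_le_const) auto
  then have "AE w in M. \<forall>t\<in>{0..T}. X t w - Y t w = 0"
    by (intro csup_zero_AE[OF aXY T]) simp
  then have XY: "AE w in M. \<forall>t\<in>{0..T}. X t w = Y t w" by simp
  show thesis
  proof (rule that[OF X])
    have "AE w in M. Y 0 w = v w" using Y by (simp add: step_def)
    then show "AE w in M. X 0 w = v w" using XY by eventually_elim (use T in simp)
    show "ito_process M F W T X (\<lambda>s w. b s w (X s w)) (\<lambda>s w. \<sigma> s w (X s w))"
    proof (rule ito_process_AE_eq[OF _ _ T])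
      show "ito_process M F W T Y (\<lambda>s w. b s w (X s w)) (\<lambda>s w. \<sigma> s w (X s w))" using Y by (simp add: step_def)
      show "AE w in M. Y t w = X t w" if "t \<in> {0..T}" for t
        using XY by eventually_elim (use that in simp)
    qed
  qed
qed

end

section \<open>The expected product rule\<close>

text \<open>Integration by parts for two indefinite integrals: the square [0,T] x [0,T] is cut along
  the diagonal, and Fubini is applied to each triangle.\<close>

lemma integral_product_triangle:
  fixes f g :: "real \<Rightarrow> 'b::euclidean_space"
  assumes f: "integrable (time_measure T) f" and g: "integrable (time_measure T) g"
  shows "(\<integral>s. f s \<bullet> (LINT r:{0..s}|lborel. g r) \<partial>time_measure T) + (\<integral>s. (LINT r:{0..s}|lborel. f r) \<bullet> g s \<partial>time_measure T)
    = (\<integral>s. f s \<partial>time_measure T) \<bullet> (\<integral>s. g s \<partial>time_measure T)"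
proof -
  let ?N = "time_measure T"
  interpret N: finite_measure ?N by (rule finite_time_measure)
  interpret P: pair_sigma_finite ?N ?N ..
  have [measurable]: "f \<in> borel_measurable ?N" "g \<in> borel_measurable ?N" using f g by auto
  have id: "(\<lambda>x. x) \<in> borel_measurable ?N" by (intro measurable_restrict_space1) simp
  have fst_m: "fst \<in> borel_measurable (?N \<Otimes>\<^sub>M ?N)" and snd_m: "snd \<in> borel_measurable (?N \<Otimes>\<^sub>M ?N)"
    by (rule measurable_compose[OF measurable_fst id], rule measurable_compose[OF measurable_snd id])
  define h where "h z = f (fst z) \<bullet> g (snd z)" for z
  have int: "integrable (?N \<Otimes>\<^sub>M ?N) h"
  proof (rule Bochner_Integration.integrable_bound)
    show "integrable (?N \<Otimes>\<^sub>M ?N) (\<lambda>z. norm (f (fst z)) * norm (g (snd z)))"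
    proof (rule P.Fubini_integrable)
      show "(\<lambda>z. norm (f (fst z)) * norm (g (snd z))) \<in> borel_measurable (?N \<Otimes>\<^sub>M ?N)" by measurable
      show "integrable ?N (\<lambda>x. \<integral>y. norm (norm (f (fst (x, y))) * norm (g (snd (x, y)))) \<partial>?N)"
        using f by (simp add: abs_mult)
    qed (use g in simp)
    show "h \<in> borel_measurable (?N \<Otimes>\<^sub>M ?N)" unfolding h_def[abs_def] by measurable
    show "AE z in ?N \<Otimes>\<^sub>M ?N. norm (h z) \<le> norm (norm (f (fst z)) * norm (g (snd z)))"
      by (intro AE_I2) (simp add: h_def Cauchy_Schwarz_ineq2)
  qed
  define A where "A = {z \<in> space (?N \<Otimes>\<^sub>M ?N). snd z \<le> fst z}"
  define B where "B = {z \<in> space (?N \<Otimes>\<^sub>M ?N). fst z < snd z}"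
  have AB: "A \<in> sets (?N \<Otimes>\<^sub>M ?N)" "B \<in> sets (?N \<Otimes>\<^sub>M ?N)"
    unfolding A_def B_def using fst_m snd_m by (auto intro!: borel_measurable_le borel_measurable_less)
  have iA: "integrable (?N \<Otimes>\<^sub>M ?N) (\<lambda>z. indicator A z *\<^sub>R h z)" and iB: "integrable (?N \<Otimes>\<^sub>M ?N) (\<lambda>z. indicator B z *\<^sub>R h z)"
    by (intro integrable_mult_indicator AB int)+
  have sf: "set_integrable lborel S f" and sg: "set_integrable lborel S g" if "S \<in> sets borel" "S \<subseteq> {0..T}" for S
  proof -
    have "set_integrable lborel {0..T} f" "set_integrable lborel {0..T} g"
      using f g by (simp_all add: set_integrable_def integrable_restrict_space)
    then show "set_integrable lborel S f" "set_integrable lborel S g"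
      using that by - (rule set_integrable_subset; simp)+
  qed
  have "(\<integral>z. indicator A z *\<^sub>R h z \<partial>(?N \<Otimes>\<^sub>M ?N)) = (\<integral>s. (\<integral>r. indicator A (s, r) *\<^sub>R h (s, r) \<partial>?N) \<partial>?N)"
    by (rule P.integral_fst'[OF iA, symmetric])
  also have "\<dots> = (\<integral>s. f s \<bullet> (LINT r:{0..s}|lborel. g r) \<partial>?N)"
  proof (rule Bochner_Integration.integral_cong[OF refl])
    fix s assume "s \<in> space ?N"
    then have s: "0 \<le> s" "s \<le> T" by (auto simp: time_measure_space)
    have "(\<integral>r. indicator A (s, r) *\<^sub>R h (s, r) \<partial>?N) = (\<integral>r. f s \<bullet> (indicator {0..s} r *\<^sub>R g r) \<partial>lborel)"
      by (subst integral_restrict_space, simp)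
        (intro Bochner_Integration.integral_cong refl, use s in \<open>auto simp: indicator_def A_def h_def space_pair_measure time_measure_space\<close>)
    also have "\<dots> = f s \<bullet> (LINT r:{0..s}|lborel. g r)"
      unfolding set_lebesgue_integral_def using sg[of "{0..s}"] s by (intro integral_inner_right) (auto simp: set_integrable_def)
    finally show "(\<integral>r. indicator A (s, r) *\<^sub>R h (s, r) \<partial>?N) = f s \<bullet> (LINT r:{0..s}|lborel. g r)" .
  qed
  finally have 1: "(\<integral>z. indicator A z *\<^sub>R h z \<partial>(?N \<Otimes>\<^sub>M ?N)) = (\<integral>s. f s \<bullet> (LINT r:{0..s}|lborel. g r) \<partial>?N)" .
  have "(\<integral>z. indicator B z *\<^sub>R h z \<partial>(?N \<Otimes>\<^sub>M ?N)) = (\<integral>s. (\<integral>r. indicator B (r, s) *\<^sub>R h (r, s) \<partial>?N) \<partial>?N)"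
    using P.integral_snd[of "\<lambda>r s. indicator B (r, s) *\<^sub>R h (r, s)"] iB by (simp add: split_beta')
  also have "\<dots> = (\<integral>s. (LINT r:{0..s}|lborel. f r) \<bullet> g s \<partial>?N)"
  proof (rule Bochner_Integration.integral_cong[OF refl])
    fix s assume "s \<in> space ?N"
    then have s: "0 \<le> s" "s \<le> T" by (auto simp: time_measure_space)
    have "(\<integral>r. indicator B (r, s) *\<^sub>R h (r, s) \<partial>?N) = (\<integral>r. (indicator {0..<s} r *\<^sub>R f r) \<bullet> g s \<partial>lborel)"
      by (subst integral_restrict_space, simp)
        (intro Bochner_Integration.integral_cong refl, use s in \<open>auto simp: indicator_def B_def h_def space_pair_measure time_measure_space\<close>)
    also have "\<dots> = (\<integral>r. (indicator {0..<s} r *\<^sub>R f r) \<partial>lborel) \<bullet> g s"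
    proof (rule integral_inner_left)
      have "{0..<s} \<subseteq> {0..T}" using s by auto
      then show "integrable lborel (\<lambda>r. indicator {0..<s} r *\<^sub>R f r)" using sf[of "{0..<s}"] by (simp add: set_integrable_def)
    qed
    \<comment> \<open>The diagonal contributes a single point, which has measure zero.\<close>
    also have "(\<integral>r. (indicator {0..<s} r *\<^sub>R f r) \<partial>lborel) = (LINT r:{0..s}|lborel. f r)"
      unfolding set_lebesgue_integral_def
    proof (rule integral_cong_AE)
      show "AE r in lborel. indicator {0..<s} r *\<^sub>R f r = indicator {0..s} r *\<^sub>R f r"
        using AE_lborel_singleton[of s] by eventually_elim (auto simp: indicator_def)
      show "(\<lambda>r. indicator {0..<s} r *\<^sub>R f r) \<in> borel_measurable lborel" "(\<lambda>r. indicator {0..s} r *\<^sub>R f r) \<in> borel_measurable lborel"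
        by (rule borel_measurable_integrable[OF sf[unfolded set_integrable_def]]; use s in auto)+
    qed
    finally show "(\<integral>r. indicator B (r, s) *\<^sub>R h (r, s) \<partial>?N) = (LINT r:{0..s}|lborel. f r) \<bullet> g s" .
  qed
  finally have 2: "(\<integral>z. indicator B z *\<^sub>R h z \<partial>(?N \<Otimes>\<^sub>M ?N)) = (\<integral>s. (LINT r:{0..s}|lborel. f r) \<bullet> g s \<partial>?N)" .
  have "(\<integral>z. indicator A z *\<^sub>R h z \<partial>(?N \<Otimes>\<^sub>M ?N)) + (\<integral>z. indicator B z *\<^sub>R h z \<partial>(?N \<Otimes>\<^sub>M ?N))
     = (\<integral>z. indicator A z *\<^sub>R h z + indicator B z *\<^sub>R h z \<partial>(?N \<Otimes>\<^sub>M ?N))"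
    by (rule Bochner_Integration.integral_add[OF iA iB, symmetric])
  also have "\<dots> = (\<integral>z. h z \<partial>(?N \<Otimes>\<^sub>M ?N))"
    by (intro Bochner_Integration.integral_cong refl) (auto simp: A_def B_def indicator_def)
  also have "\<dots> = (\<integral>s. (\<integral>r. f s \<bullet> g r \<partial>?N) \<partial>?N)"
    by (subst P.integral_fst'[OF int, symmetric]) (simp add: h_def)
  also have "\<dots> = (\<integral>s. f s \<partial>?N) \<bullet> (\<integral>r. g r \<partial>?N)"
    using f g by simp
  finally show ?thesis unfolding 1 2 .
qed

context brownian
begin

lemma sq_int_time_const:
  fixes \<eta> :: "'a \<Rightarrow> 'b::euclidean_space"
  assumes "sq_int M \<eta>" "0 \<le> T"
  shows "sq_int (time_prob M T) (\<lambda>z. \<eta> (snd z))"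
proof -
  have m: "(\<lambda>z. \<eta> (snd z)) \<in> borel_measurable (time_prob M T)"
    using measurable_time_prob_snd[OF sq_int_measurable[OF assms(1)], of T] by (simp add: split_beta')
  then have [measurable]: "(\<lambda>z. ennreal ((norm (\<eta> (snd z)))\<^sup>2)) \<in> borel_measurable (time_prob M T)" by measurable
  have "(\<integral>\<^sup>+z. ennreal ((norm (\<eta> (snd z)))\<^sup>2) \<partial>time_prob M T) = (\<integral>\<^sup>+w. (\<integral>\<^sup>+s\<in>{0..T}. ennreal ((norm (\<eta> (snd (s, w))))\<^sup>2) \<partial>lborel) \<partial>M)"
    by (rule nn_integral_time_prob[symmetric]) measurable
  also have "\<dots> = (\<integral>\<^sup>+w. ennreal T * ennreal ((norm (\<eta> w))\<^sup>2) \<partial>M)"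
    using assms(2) by (simp add: nn_integral_multc emeasure_lborel_Icc_eq mult.commute[of _ "indicator _ _"])
  also have "\<dots> = ennreal T * (\<integral>\<^sup>+w. ennreal ((norm (\<eta> w))\<^sup>2) \<partial>M)"
    using sq_int_measurable[OF assms(1)] by (intro nn_integral_cmult) measurable
  also have "\<dots> < \<infinity>" by (simp add: nn_integral_sq_int[OF assms(1)] ennreal_mult_less_top)
  finally show ?thesis by (simp add: sq_int_iff_nn_integral[OF m])
qed

lemma integral_time_inner_const:
  assumes T: "0 \<le> T" and f: "f \<in> L2_proc M F T" and \<eta>: "sq_int M \<eta>"
  shows "(\<integral>z. case_prod f z \<bullet> \<eta> (snd z) \<partial>time_prob M T) = expectation (\<lambda>w. (LINT s:{0..T}|lborel. f s w) \<bullet> \<eta> w)"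
proof -
  have i: "integrable (time_prob M T) (case_prod (\<lambda>s w. f s w \<bullet> \<eta> w))"
    using sq_int_inner[OF L2_proc_sq_int[OF f T] sq_int_time_const[OF \<eta> T]] by (simp add: split_beta')
  have "(\<integral>z. case_prod f z \<bullet> \<eta> (snd z) \<partial>time_prob M T) = expectation (\<lambda>w. LINT s:{0..T}|lborel. f s w \<bullet> \<eta> w)"
    unfolding integral_time_prob[OF i] by (simp add: split_beta')
  also have "\<dots> = expectation (\<lambda>w. (LINT s:{0..T}|lborel. f s w) \<bullet> \<eta> w)"
  proof (rule integral_cong_AE)
    show "(\<lambda>w. LINT s:{0..T}|lborel. f s w \<bullet> \<eta> w) \<in> borel_measurable M" using integrable_time_prob[OF i] by blast
    have "(\<lambda>w. LINT s:{0..T}|lborel. f s w) \<in> borel_measurable M"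
      using f T by (intro measurable_F_M[OF progressive_integral_adapted[of T _ T]]) (auto simp: L2_proc_def)
    then show "(\<lambda>w. (LINT s:{0..T}|lborel. f s w) \<bullet> \<eta> w) \<in> borel_measurable M" using sq_int_measurable[OF \<eta>] by measurable
    show "AE w in M. (LINT s:{0..T}|lborel. f s w \<bullet> \<eta> w) = (LINT s:{0..T}|lborel. f s w) \<bullet> \<eta> w"
      using L2_proc_set_integrable[OF T f]
    proof eventually_elim
      case (elim w)
      have "(\<integral>s. (indicator {0..T} s *\<^sub>R f s w) \<bullet> \<eta> w \<partial>lborel) = (\<integral>s. indicator {0..T} s *\<^sub>R f s w \<partial>lborel) \<bullet> \<eta> w"
        using elim by (intro integral_inner_left) (simp add: set_integrable_def)
      then show ?case by (simp add: set_lebesgue_integral_def)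
    qed
  qed
  finally show ?thesis .
qed

lemma progressive_section:
  assumes "progressive F T f" "s \<in> {0..T}" shows "f s \<in> borel_measurable (F s)"
proof -
  have "case_prod f \<in> borel_measurable (restrict_space borel {0..s} \<Otimes>\<^sub>M F s)" using assms by (auto simp: progressive_def)
  from measurable_compose[OF measurable_Pair1' this, of s] assms(2) show ?thesis by (simp add: space_restrict_space)
qed

text \<open>For almost every s the variable \<open>f s\<close> is square integrable and known at
  time s, hence orthogonal to \<open>I T - I s\<close>. So I may be frozen at its final value inside
  the time integral.\<close>

lemma integral_time_inner_ito:
  fixes f :: "real \<Rightarrow> 'a \<Rightarrow> 'b::euclidean_space"
  assumes T: "0 \<le> T" and f: "f \<in> L2_proc M F T" and I: "I \<in> L2_cont M F T"
    and h: "\<And>t. t \<in> {0..T} \<Longrightarrow> has_ito_integral M F W \<phi> t (I t)"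
  shows "(\<integral>z. case_prod f z \<bullet> case_prod I z \<partial>time_prob M T) = expectation (\<lambda>w. (LINT s:{0..T}|lborel. f s w) \<bullet> I T w)"
proof -
  have IT: "sq_int M (I T)" using L2_cont_sq_int[OF I] T by simp
  note sf = L2_proc_sq_int[OF f T] and sI = L2_proc_sq_int[OF L2_cont_L2_proc[OF T I] T] and sT = sq_int_time_const[OF IT T]
  have i: "integrable (time_prob M T) (case_prod (\<lambda>s w. f s w \<bullet> (I T w - I s w)))"
    using sq_int_inner[OF sf sq_int_diff[OF sT sI]] by (simp add: split_beta')
  have i2: "integrable (time_prob M T) (case_prod (\<lambda>s w. (norm (f s w))\<^sup>2))"
    using sq_int_integrable[OF sf] by (simp add: split_beta')
  have "(\<integral>z. case_prod f z \<bullet> (I T (snd z) - case_prod I z) \<partial>time_prob M T) = (LINT s:{0..T}|lborel. expectation (\<lambda>w. f s w \<bullet> (I T w - I s w)))"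
    unfolding integral_time_prob'[OF i] by (simp add: split_beta')
  also have "\<dots> = 0"
    unfolding set_lebesgue_integral_def
  proof (rule integral_eq_zero_AE)
    show "AE s in lborel. indicator {0..T} s *\<^sub>R expectation (\<lambda>w. f s w \<bullet> (I T w - I s w)) = 0"
      using AE_integrable_time[OF i2]
    proof eventually_elim
      case (elim s)
      show ?case
      proof (cases "s \<in> {0..T}")
        case True
        have m: "f s \<in> borel_measurable (F s)" using f True by (intro progressive_section) (auto simp: L2_proc_def)
        have "sq_int M (f s)" using elim True measurable_F_M[OF m] by (simp add: sq_int_def)
        with m have "expectation (\<lambda>w. f s w \<bullet> (I T w - I s w)) = 0"
          using True T by (intro has_ito_orthogonal[of s T, OF _ _ h h]) auto
        then show ?thesis by simp
      qed simp
    qed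
  qed
  finally have "(\<integral>z. case_prod f z \<bullet> I T (snd z) \<partial>time_prob M T) = (\<integral>z. case_prod f z \<bullet> case_prod I z \<partial>time_prob M T)"
    using sq_int_inner[OF sf sT] sq_int_inner[OF sf sI] by (simp add: inner_diff_right)
  then show ?thesis using integral_time_inner_const[OF T f IT] by simp
qed

lemma integral_time_inner_drift:
  fixes b c :: "real \<Rightarrow> 'a \<Rightarrow> 'b::euclidean_space"
  assumes T: "0 \<le> T" and b: "b \<in> L2_proc M F T" and c: "c \<in> L2_proc M F T"
    and B: "B \<in> L2_cont M F T" "AE w in M. \<forall>t\<in>{0..T}. B t w = (LINT s:{0..t}|lborel. b s w)"
    and C: "C \<in> L2_cont M F T" "AE w in M. \<forall>t\<in>{0..T}. C t w = (LINT s:{0..t}|lborel. c s w)"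
  shows "(\<integral>z. case_prod b z \<bullet> case_prod C z \<partial>time_prob M T) + (\<integral>z. case_prod B z \<bullet> case_prod c z \<partial>time_prob M T)
    = expectation (\<lambda>w. B T w \<bullet> C T w)"
proof -
  note s = L2_proc_sq_int[OF b T] L2_proc_sq_int[OF c T] L2_proc_sq_int[OF L2_cont_L2_proc[OF T B(1)] T] L2_proc_sq_int[OF L2_cont_L2_proc[OF T C(1)] T]
  have i1: "integrable (time_prob M T) (case_prod (\<lambda>s w. b s w \<bullet> C s w))"
    and i2: "integrable (time_prob M T) (case_prod (\<lambda>s w. B s w \<bullet> c s w))"
    using sq_int_inner[OF s(1,4)] sq_int_inner[OF s(3,2)] by (simp_all add: split_beta')
  have "(\<integral>z. case_prod b z \<bullet> case_prod C z \<partial>time_prob M T) + (\<integral>z. case_prod B z \<bullet> case_prod c z \<partial>time_prob M T)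
    = expectation (\<lambda>w. LINT s:{0..T}|lborel. b s w \<bullet> C s w) + expectation (\<lambda>w. LINT s:{0..T}|lborel. B s w \<bullet> c s w)"
    unfolding integral_time_prob[OF i1] integral_time_prob[OF i2] by (simp add: split_beta')
  also have "\<dots> = expectation (\<lambda>w. (LINT s:{0..T}|lborel. b s w \<bullet> C s w) + (LINT s:{0..T}|lborel. B s w \<bullet> c s w))"
    by (rule Bochner_Integration.integral_add[OF integrable_time_prob[OF i1] integrable_time_prob[OF i2], symmetric])
  also have "\<dots> = expectation (\<lambda>w. B T w \<bullet> C T w)"
  proof (rule integral_cong_AE)
    show "(\<lambda>w. (LINT s:{0..T}|lborel. b s w \<bullet> C s w) + (LINT s:{0..T}|lborel. B s w \<bullet> c s w)) \<in> borel_measurable M"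
      using integrable_time_prob[OF i1] integrable_time_prob[OF i2] by (intro borel_measurable_add) blast+
    have "sq_int M (B T)" "sq_int M (C T)" using L2_cont_sq_int[OF B(1)] L2_cont_sq_int[OF C(1)] T by auto
    then show "(\<lambda>w. B T w \<bullet> C T w) \<in> borel_measurable M" using sq_int_measurable by (intro borel_measurable_inner) blast+
    show "AE w in M. (LINT s:{0..T}|lborel. b s w \<bullet> C s w) + (LINT s:{0..T}|lborel. B s w \<bullet> c s w) = B T w \<bullet> C T w"
      using L2_proc_paths[OF T b] L2_proc_paths[OF T c] B(2) C(2)
    proof eventually_elim
      case (elim w)
      have bc: "integrable (time_measure T) (\<lambda>s. b s w)" "integrable (time_measure T) (\<lambda>s. c s w)"
        using elim by (auto intro: sq_int_integrable_finite[OF finite_time_measure])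
      have eq: "(LINT s:{0..T}|lborel. f s) = (\<integral>s. f s \<partial>time_measure T)" for f :: "real \<Rightarrow> 'd::euclidean_space"
        by (simp add: set_lebesgue_integral_def integral_restrict_space)
      have "(LINT s:{0..T}|lborel. b s w \<bullet> C s w) = (\<integral>s. b s w \<bullet> (LINT r:{0..s}|lborel. c r w) \<partial>time_measure T)"
        unfolding eq by (intro Bochner_Integration.integral_cong refl) (use elim in \<open>simp add: time_measure_space\<close>)
      moreover have "(LINT s:{0..T}|lborel. B s w \<bullet> c s w) = (\<integral>s. (LINT r:{0..s}|lborel. b r w) \<bullet> c s w \<partial>time_measure T)"
        unfolding eq by (intro Bochner_Integration.integral_cong refl) (use elim in \<open>simp add: time_measure_space\<close>)
      moreover have "B T w \<bullet> C T w = (\<integral>s. b s w \<partial>time_measure T) \<bullet> (\<integral>s. c s w \<partial>time_measure T)"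
        using elim T by (simp add: eq)
      ultimately show ?case using integral_product_triangle[OF bc] by simp
    qed
  qed
  finally show ?thesis .
qed

lemma ito_decomposition:
  fixes X :: "real \<Rightarrow> 'a \<Rightarrow> 'b::euclidean_space"
  assumes T: "0 \<le> T" and X: "X \<in> L2_cont M F T" "ito_process M F W T X b \<sigma>" and b: "b \<in> L2_proc M F T"
  obtains B I where "B \<in> L2_cont M F T" "AE w in M. \<forall>t\<in>{0..T}. B t w = (LINT s:{0..t}|lborel. b s w)"
    "I \<in> L2_cont M F T" "\<And>t. t \<in> {0..T} \<Longrightarrow> has_ito_integral M F W \<sigma> t (I t)"
    "\<And>t w. X t w = X 0 w + B t w + I t w"
proof -
  obtain B where B: "B \<in> L2_cont M F T" "AE w in M. \<forall>t\<in>{0..T}. B t w = (LINT s:{0..t}|lborel. b s w)"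
    using drift_process[OF T b] by blast
  define I where "I t w = (X t w + (-1) *\<^sub>R X 0 w) + (-1) *\<^sub>R B t w" for t w
  have X0: "(\<lambda>t w. X 0 w) \<in> L2_cont M F T"
  proof -
    have m: "X 0 \<in> borel_measurable (F 0)" "sq_int M (X 0)" using X(1) T L2_cont_sq_int[OF X(1)] by (auto simp: L2_cont_def)
    then show ?thesis unfolding L2_cont_eq adapted_cont_def csup_def
      using measurable_F_mono[OF _ m(1)] T by (auto simp: sq_int_iff_nn_integral[OF sq_int_measurable[OF m(2)]] top.not_eq_extremum[symmetric])
  qed
  have I: "I \<in> L2_cont M F T"
    unfolding I_def[abs_def] by (intro L2_cont_add_scaleR T X X0 B)
  have "has_ito_integral M F W \<sigma> t (I t)" if t: "t \<in> {0..T}" for t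
  proof (rule has_ito_AE_eq[OF ito_processD[OF X(2) t]])
    show "AE w in M. X t w - X 0 w - (LINT s:{0..t}|lborel. b s w) = I t w"
      using B(2) by eventually_elim (use t in \<open>simp add: I_def\<close>)
  qed
  then show thesis using that[OF B I] by (simp add: I_def)
qed

text \<open>The integral over an interval of length zero is a version of 0, so orthogonality to the
  past can be used with r = 0.\<close>

lemma has_ito_initial_orthogonal:
  assumes "0 \<le> t" "has_ito_integral M F W \<phi> t J" "\<eta> \<in> borel_measurable (F 0)" "sq_int M \<eta>"
  shows "expectation (\<lambda>w. \<eta> w \<bullet> J w) = 0"
proof -
  have "\<phi> \<in> L2_proc M F t" using assms(2) by (simp add: has_ito_integral_def)
  then have "\<phi> \<in> L2_proc M F 0" by (rule L2_proc_mono[OF _ order_refl assms(1)])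
  then obtain I where I: "\<And>t. t \<in> {0..0} \<Longrightarrow> has_ito_integral M F W \<phi> t (I t)"
    using ito_integral_continuous_version[OF order_refl, of \<phi>] by blast
  then have I0: "has_ito_integral M F W \<phi> 0 (I 0)" by simp
  have "expectation (\<lambda>w. I 0 w \<bullet> I 0 w) = 0"
    using has_ito_isometry[OF order_refl I0 I0] by (simp add: integral_time_prob_0)
  then have "AE w in M. I 0 w = 0"
    using has_ito_sq_int[OF I0] by (intro sq_int_integral_zero_AE) (auto simp: power2_norm_eq_inner)
  then have "has_ito_integral M F W \<phi> 0 (\<lambda>_. 0)" by (rule has_ito_AE_eq[OF I0])
  from has_ito_orthogonal[OF order_refl assms(1,2) this assms(3,4)] show ?thesis by simp
qed

text \<open>Both factors are split into initial value, drift and Ito part, which gives nine pairings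
  at time T. Drift with drift is integration by parts, drift with a martingale or an initial value
  comes from freezing, the two Ito parts give the isometry, and initial values are orthogonal to
  integrals. All products are integrable, so no localisation by stopping times occurs.\<close>

theorem ito_product_expectation:
  fixes X Y :: "real \<Rightarrow> 'a \<Rightarrow> 'b::euclidean_space"
  assumes T: "0 \<le> T" and X: "X \<in> L2_cont M F T" "ito_process M F W T X b \<sigma>" "b \<in> L2_proc M F T"
    and Y: "Y \<in> L2_cont M F T" "ito_process M F W T Y c \<tau>" "c \<in> L2_proc M F T"
  shows "expectation (\<lambda>w. X T w \<bullet> Y T w) - expectation (\<lambda>w. X 0 w \<bullet> Y 0 w)
    = (\<integral>z. case_prod b z \<bullet> case_prod Y z \<partial>time_prob M T) + (\<integral>z. case_prod X z \<bullet> case_prod c z \<partial>time_prob M T)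
      + (\<integral>z. case_prod \<sigma> z \<bullet> case_prod \<tau> z \<partial>time_prob M T)"
proof -
  obtain B I where B: "B \<in> L2_cont M F T" "AE w in M. \<forall>t\<in>{0..T}. B t w = (LINT s:{0..t}|lborel. b s w)"
    and I: "I \<in> L2_cont M F T" "\<And>t. t \<in> {0..T} \<Longrightarrow> has_ito_integral M F W \<sigma> t (I t)"
    and XD: "\<And>t w. X t w = X 0 w + B t w + I t w" by (rule ito_decomposition[OF T X]) blast
  obtain C J where C: "C \<in> L2_cont M F T" "AE w in M. \<forall>t\<in>{0..T}. C t w = (LINT s:{0..t}|lborel. c s w)"
    and J: "J \<in> L2_cont M F T" "\<And>t. t \<in> {0..T} \<Longrightarrow> has_ito_integral M F W \<tau> t (J t)"
    and YD: "\<And>t w. Y t w = Y 0 w + C t w + J t w" by (rule ito_decomposition[OF T Y]) blast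
  have T0: "0 \<in> {0..T}" "T \<in> {0..T}" using T by auto
  have x: "X 0 \<in> borel_measurable (F 0)" "sq_int M (X 0)" and y: "Y 0 \<in> borel_measurable (F 0)" "sq_int M (Y 0)"
    using X(1) Y(1) T0 L2_cont_sq_int[OF X(1)] L2_cont_sq_int[OF Y(1)] by (auto simp: L2_cont_def)
  note sT = L2_cont_sq_int[OF B(1) T0(2)] L2_cont_sq_int[OF I(1) T0(2)] L2_cont_sq_int[OF C(1) T0(2)] L2_cont_sq_int[OF J(1) T0(2)]
  have sb: "sq_int (time_prob M T) (case_prod b)" "sq_int (time_prob M T) (case_prod c)"
    by (intro L2_proc_sq_int X Y T)+
  have sp: "sq_int (time_prob M T) (case_prod Z)" if "Z \<in> L2_cont M F T" for Z :: "real \<Rightarrow> 'a \<Rightarrow> 'b"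
    by (intro L2_proc_sq_int L2_cont_L2_proc that T)
  have BT: "AE w in M. (LINT s:{0..T}|lborel. b s w) = B T w" "AE w in M. (LINT s:{0..T}|lborel. c s w) = C T w"
    using B(2) by (rule eventually_mono, use T in simp) (rule eventually_mono[OF C(2)], use T in simp)
  have mb: "(\<lambda>w. LINT s:{0..T}|lborel. b s w) \<in> borel_measurable M" "(\<lambda>w. LINT s:{0..T}|lborel. c s w) \<in> borel_measurable M"
    using X(3) Y(3) T by (auto intro!: measurable_F_M[OF progressive_integral_adapted[of T _ T]] simp: L2_proc_def)
  have rep: "expectation (\<lambda>w. (LINT s:{0..T}|lborel. b s w) \<bullet> \<eta> w) = expectation (\<lambda>w. B T w \<bullet> \<eta> w)"
    "expectation (\<lambda>w. (LINT s:{0..T}|lborel. c s w) \<bullet> \<eta> w) = expectation (\<lambda>w. C T w \<bullet> \<eta> w)" if "sq_int M \<eta>" for \<eta>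
  proof -
    note m = sq_int_measurable[OF that] sq_int_measurable[OF sT(1)] sq_int_measurable[OF sT(3)]
    show "expectation (\<lambda>w. (LINT s:{0..T}|lborel. b s w) \<bullet> \<eta> w) = expectation (\<lambda>w. B T w \<bullet> \<eta> w)"
      by (rule integral_cong_AE[OF borel_measurable_inner[OF mb(1) m(1)] borel_measurable_inner[OF m(2,1)]])
        (use BT(1) in eventually_elim, simp)
    show "expectation (\<lambda>w. (LINT s:{0..T}|lborel. c s w) \<bullet> \<eta> w) = expectation (\<lambda>w. C T w \<bullet> \<eta> w)"
      by (rule integral_cong_AE[OF borel_measurable_inner[OF mb(2) m(1)] borel_measurable_inner[OF m(3,1)]])
        (use BT(2) in eventually_elim, simp)
  qed
  have bx: "(\<integral>z. case_prod b z \<bullet> Y 0 (snd z) \<partial>time_prob M T) = expectation (\<lambda>w. B T w \<bullet> Y 0 w)"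
    and cy: "(\<integral>z. case_prod c z \<bullet> X 0 (snd z) \<partial>time_prob M T) = expectation (\<lambda>w. C T w \<bullet> X 0 w)"
    and bJ: "(\<integral>z. case_prod b z \<bullet> case_prod J z \<partial>time_prob M T) = expectation (\<lambda>w. B T w \<bullet> J T w)"
    and cI: "(\<integral>z. case_prod c z \<bullet> case_prod I z \<partial>time_prob M T) = expectation (\<lambda>w. C T w \<bullet> I T w)"
    using integral_time_inner_const[OF T X(3) y(2)] integral_time_inner_const[OF T Y(3) x(2)]
      integral_time_inner_ito[OF T X(3) J] integral_time_inner_ito[OF T Y(3) I] rep y(2) x(2) sT by auto
  note BC = integral_time_inner_drift[OF T X(3) Y(3) B C]
  have xJ: "expectation (\<lambda>w. X 0 w \<bullet> J T w) = 0" and yI: "expectation (\<lambda>w. Y 0 w \<bullet> I T w) = 0"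
    by (rule has_ito_initial_orthogonal[OF T J(2)[OF T0(2)] x], rule has_ito_initial_orthogonal[OF T I(2)[OF T0(2)] y])
  have IJ: "expectation (\<lambda>w. I T w \<bullet> J T w) = (\<integral>z. case_prod \<sigma> z \<bullet> case_prod \<tau> z \<partial>time_prob M T)"
    by (intro has_ito_isometry T I J T0)
  have "(\<integral>z. case_prod b z \<bullet> case_prod Y z \<partial>time_prob M T) =
    (\<integral>z. case_prod b z \<bullet> Y 0 (snd z) + case_prod b z \<bullet> case_prod C z + case_prod b z \<bullet> case_prod J z \<partial>time_prob M T)"
  proof (intro Bochner_Integration.integral_cong refl)
    fix z :: "real \<times> 'a"
    show "case_prod b z \<bullet> case_prod Y z = case_prod b z \<bullet> Y 0 (snd z) + case_prod b z \<bullet> case_prod C z + case_prod b z \<bullet> case_prod J z"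
      using YD[of "fst z" "snd z"] by (simp add: split_beta inner_add_right)
  qed
  also have "\<dots> = expectation (\<lambda>w. B T w \<bullet> Y 0 w) + (\<integral>z. case_prod b z \<bullet> case_prod C z \<partial>time_prob M T) + expectation (\<lambda>w. B T w \<bullet> J T w)"
    using sq_int_inner[OF sb(1) sq_int_time_const[OF y(2) T]] sq_int_inner[OF sb(1) sp[OF C(1)]] sq_int_inner[OF sb(1) sp[OF J(1)]]
    by (simp only: Bochner_Integration.integral_add Bochner_Integration.integrable_add bx bJ)
  finally have e1: "(\<integral>z. case_prod b z \<bullet> case_prod Y z \<partial>time_prob M T) = expectation (\<lambda>w. B T w \<bullet> Y 0 w) + (\<integral>z. case_prod b z \<bullet> case_prod C z \<partial>time_prob M T) + expectation (\<lambda>w. B T w \<bullet> J T w)" .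
  have "(\<integral>z. case_prod X z \<bullet> case_prod c z \<partial>time_prob M T) =
    (\<integral>z. case_prod c z \<bullet> X 0 (snd z) + case_prod B z \<bullet> case_prod c z + case_prod c z \<bullet> case_prod I z \<partial>time_prob M T)"
  proof (intro Bochner_Integration.integral_cong refl)
    fix z :: "real \<times> 'a"
    show "case_prod X z \<bullet> case_prod c z = case_prod c z \<bullet> X 0 (snd z) + case_prod B z \<bullet> case_prod c z + case_prod c z \<bullet> case_prod I z"
      using XD[of "fst z" "snd z"] by (simp add: split_beta inner_add_left inner_commute[of "c _ _"])
  qed
  also have "\<dots> = expectation (\<lambda>w. C T w \<bullet> X 0 w) + (\<integral>z. case_prod B z \<bullet> case_prod c z \<partial>time_prob M T) + expectation (\<lambda>w. C T w \<bullet> I T w)"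
    using sq_int_inner[OF sb(2) sq_int_time_const[OF x(2) T]] sq_int_inner[OF sp[OF B(1)] sb(2)] sq_int_inner[OF sb(2) sp[OF I(1)]]
    by (simp only: Bochner_Integration.integral_add Bochner_Integration.integrable_add cy cI)
  finally have e2: "(\<integral>z. case_prod X z \<bullet> case_prod c z \<partial>time_prob M T) = expectation (\<lambda>w. C T w \<bullet> X 0 w) + (\<integral>z. case_prod B z \<bullet> case_prod c z \<partial>time_prob M T) + expectation (\<lambda>w. C T w \<bullet> I T w)" .
  have "expectation (\<lambda>w. X T w \<bullet> Y T w) = expectation (\<lambda>w. X 0 w \<bullet> Y 0 w + C T w \<bullet> X 0 w + X 0 w \<bullet> J T w + B T w \<bullet> Y 0 w + B T w \<bullet> C T w + B T w \<bullet> J T w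
     + Y 0 w \<bullet> I T w + C T w \<bullet> I T w + I T w \<bullet> J T w)"
  proof (intro Bochner_Integration.integral_cong refl)
    fix w
    show "X T w \<bullet> Y T w = X 0 w \<bullet> Y 0 w + C T w \<bullet> X 0 w + X 0 w \<bullet> J T w + B T w \<bullet> Y 0 w + B T w \<bullet> C T w + B T w \<bullet> J T w
     + Y 0 w \<bullet> I T w + C T w \<bullet> I T w + I T w \<bullet> J T w"
      unfolding XD[of T w] YD[of T w] by (simp add: inner_add_left inner_add_right inner_commute)
  qed
  also have "\<dots> = expectation (\<lambda>w. X 0 w \<bullet> Y 0 w) + expectation (\<lambda>w. C T w \<bullet> X 0 w) + expectation (\<lambda>w. X 0 w \<bullet> J T w) + expectation (\<lambda>w. B T w \<bullet> Y 0 w) + expectation (\<lambda>w. B T w \<bullet> C T w) + expectation (\<lambda>w. B T w \<bullet> J T w)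
     + expectation (\<lambda>w. Y 0 w \<bullet> I T w) + expectation (\<lambda>w. C T w \<bullet> I T w) + expectation (\<lambda>w. I T w \<bullet> J T w)"
    using sq_int_inner[OF x(2) y(2)] sq_int_inner[OF sT(3) x(2)] sq_int_inner[OF x(2) sT(4)] sq_int_inner[OF sT(1) y(2)] sq_int_inner[OF sT(1,3)]
     sq_int_inner[OF sT(1,4)] sq_int_inner[OF y(2) sT(2)] sq_int_inner[OF sT(3,2)] sq_int_inner[OF sT(2,4)]
    by (simp only: Bochner_Integration.integral_add Bochner_Integration.integrable_add)
  finally show ?thesis unfolding e1 e2 using BC xJ yI IJ by linarith
qed

end

section \<open>Matrices and weighted projections\<close>

lemma inner_matrix_vector_mult: "(A *v x) \<bullet> y = x \<bullet> (transpose A *v y)" for A :: "real^'n^'m"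
  by (metis dot_lmul_matrix inner_commute transpose_matrix_vector)

text \<open>The norm of a matrix is the Frobenius norm; Cauchy-Schwarz is applied row by
  row.\<close>

lemma norm_matrix_vector_mult_le: "norm (A *v x) \<le> norm A * norm x" for A :: "real^'n^'m"
proof (rule power2_le_imp_le)
  have "(norm (A *v x))\<^sup>2 = (\<Sum>i\<in>UNIV. ((A $ i) \<bullet> x)\<^sup>2)"
    by (simp add: norm_vec_def L2_set_def matrix_vector_mult_def inner_vec_def sum_nonneg)
  also have "\<dots> \<le> (\<Sum>i\<in>UNIV. (norm (A $ i) * norm x)\<^sup>2)"
    by (intro sum_mono) (metis Cauchy_Schwarz_ineq2 abs_ge_zero power2_abs power_mono)
  also have "\<dots> = (norm A)\<^sup>2 * (norm x)\<^sup>2"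
    by (simp add: norm_vec_def[of A] L2_set_def sum_nonneg power_mult_distrib sum_distrib_right)
  finally show "(norm (A *v x))\<^sup>2 \<le> (norm A * norm x)\<^sup>2" by (simp add: power_mult_distrib)
qed simp

lemma norm_transpose: "norm (transpose A) = norm A" for A :: "real^'n^'m"
proof -
  have eq: "(norm B)\<^sup>2 = (\<Sum>i\<in>UNIV. \<Sum>j\<in>UNIV. (B $ i $ j)\<^sup>2)" for B :: "real^'k^'l"
    by (simp add: norm_vec_def L2_set_def sum_nonneg)
  have "(norm (transpose A))\<^sup>2 = (norm A)\<^sup>2"
    unfolding eq transpose_def vec_lambda_beta by (rule sum.swap)
  then show ?thesis by simp
qed

lemma matrix_vector_mult_measurable:
  fixes A :: "'a \<Rightarrow> real^'n^'m"
  assumes "A \<in> borel_measurable N" "x \<in> borel_measurable N"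
  shows "(\<lambda>z. A z *v x z) \<in> borel_measurable N"
proof (rule borel_measurable_continuous_Pair[OF assms])
  show "continuous_on UNIV (\<lambda>p. (fst p :: real^'n^'m) *v snd p)"
    unfolding matrix_vector_mult_def by (intro continuous_intros)
qed

lemma transpose_measurable:
  fixes A :: "'a \<Rightarrow> real^'n^'m"
  assumes "A \<in> borel_measurable N" shows "(\<lambda>z. transpose (A z)) \<in> borel_measurable N"
proof (rule borel_measurable_continuous_on[OF _ assms])
  show "continuous_on UNIV (transpose :: real^'n^'m \<Rightarrow> _)"
    unfolding transpose_def[abs_def] by (intro continuous_intros)
qed

lemma matrix_inv_mult_vec:
  fixes R :: "real^'k^'k"
  assumes "invertible R" shows "R *v (matrix_inv R *v x) = x" "matrix_inv R *v (R *v x) = x"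
proof -
  have "R ** matrix_inv R = mat 1 \<and> matrix_inv R ** R = mat 1"
    using assms unfolding invertible_def matrix_inv_def by (rule someI_ex)
  then show "R *v (matrix_inv R *v x) = x" "matrix_inv R *v (R *v x) = x"
    by (simp_all add: matrix_vector_mul_assoc)
qed

lemma inner_matrix_inv_symmetric:
  fixes R :: "real^'k^'k"
  assumes "invertible R" "transpose R = R"
  shows "(matrix_inv R *v x) \<bullet> y = x \<bullet> (matrix_inv R *v y)"
proof -
  have "(matrix_inv R *v x) \<bullet> y = (matrix_inv R *v x) \<bullet> (R *v (matrix_inv R *v y))"
    by (simp add: matrix_inv_mult_vec[OF assms(1)])
  also have "\<dots> = (R *v (matrix_inv R *v x)) \<bullet> (matrix_inv R *v y)"
    using inner_matrix_vector_mult[of R "matrix_inv R *v x" "matrix_inv R *v y"] assms(2) by simp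
  finally show ?thesis by (simp add: matrix_inv_mult_vec[OF assms(1)])
qed

text \<open>On singular matrices \<^const>\<open>matrix_inv\<close> is one fixed arbitrary matrix; elsewhere Cramer's rule applies.\<close>

lemma matrix_inv_vec_measurable:
  fixes R :: "'a \<Rightarrow> real^'k^'k"
  assumes R: "R \<in> borel_measurable N" and y: "y \<in> borel_measurable N"
  shows "(\<lambda>z. matrix_inv (R z) *v y z) \<in> borel_measurable N"
proof -
  define C :: "real^'k^'k" where "C = (SOME A. False)"
  have cd: "continuous_on UNIV (\<lambda>p. det (f p))" if "continuous_on UNIV f" for f :: "'p::topological_space \<Rightarrow> real^'k^'k"
    unfolding det_def by (intro continuous_intros that)
  have eq: "matrix_inv (R z) *v y z = (if det (R z) = 0 then C *v y z
      else (\<chi> k. det (\<chi> i j. if j = k then y z $ i else R z $ i $ j) / det (R z)))" for z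
  proof (cases "det (R z) = 0")
    case True
    then have ni: "\<not> invertible (R z)" by (simp add: invertible_det_nz)
    then have "(\<lambda>A'. R z ** A' = mat 1 \<and> A' ** R z = mat 1) = (\<lambda>_. False)"
      unfolding invertible_def by auto
    then have "matrix_inv (R z) = C" by (simp only: matrix_inv_def C_def)
    then show ?thesis using True by simp
  next
    case False
    then have "invertible (R z)" by (simp add: invertible_det_nz)
    from cramer[OF False, THEN iffD1, OF matrix_inv_mult_vec(1)[OF this, of "y z"]] False
    show ?thesis by simp
  qed
  have dm: "(\<lambda>z. det (\<chi> i j. if j = k then y z $ i else R z $ i $ j)) \<in> borel_measurable N" for k
  proof (rule borel_measurable_continuous_Pair[OF y R])
    have "continuous_on UNIV (\<lambda>p :: (real^'k) \<times> (real^'k^'k). (if j = k then fst p $ i else snd p $ i $ j))" for i j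
      by (cases "j = k") (auto intro!: continuous_intros)
    then show "continuous_on UNIV (\<lambda>p :: (real^'k) \<times> (real^'k^'k). det (\<chi> i j. if j = k then fst p $ i else snd p $ i $ j))"
      by (intro cd continuous_on_vec_lambda)
  qed
  have dR: "(\<lambda>z. det (R z)) \<in> borel_measurable N"
    by (rule borel_measurable_continuous_on[OF cd R]) (rule continuous_on_id)
  have cm: "(\<lambda>z. \<chi> k. det (\<chi> i j. if j = k then y z $ i else R z $ i $ j) / det (R z)) \<in> borel_measurable N"
    using dm dR by (subst borel_measurable_euclidean_space)
      (auto simp: Basis_vec_def inner_axis intro!: borel_measurable_divide)
  have "{z \<in> space N. det (R z) = 0} \<in> sets N" using dR by measurable
  then show ?thesis unfolding eq
    by (intro measurable_If cm matrix_vector_mult_measurable y) auto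
qed

text \<open>m is the minimum of the quadratic form on the compact unit sphere, extended by
  homogeneity.\<close>

lemma posdef_coercive:
  fixes G :: "real^'k^'k"
  assumes "\<And>x. x \<noteq> 0 \<Longrightarrow> 0 < (G *v x) \<bullet> x"
  obtains m where "0 < m" "\<And>x. m * (norm x)\<^sup>2 \<le> (G *v x) \<bullet> x"
proof -
  have "continuous_on (sphere 0 1) (\<lambda>x. (G *v x) \<bullet> x)" by (intro continuous_intros matrix_vector_mult_linear_continuous_on)
  moreover have "axis undefined 1 \<in> sphere (0::real^'k) 1" by (simp add: norm_axis_1)
  ultimately obtain u where u: "u \<in> sphere 0 1" "\<And>x. x \<in> sphere 0 1 \<Longrightarrow> (G *v u) \<bullet> u \<le> (G *v x) \<bullet> x"
    using continuous_attains_inf[OF compact_sphere[of 0 1], of "\<lambda>x. (G *v x) \<bullet> x"] by blast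
  show thesis
  proof (rule that[of "(G *v u) \<bullet> u"])
    show "0 < (G *v u) \<bullet> u" using u(1) by (intro assms) auto
    show "((G *v u) \<bullet> u) * (norm x)\<^sup>2 \<le> (G *v x) \<bullet> x" for x
    proof (cases "x = 0")
      case False
      have "x /\<^sub>R norm x \<in> sphere 0 1" using False by simp
      from u(2)[OF this] have "(G *v u) \<bullet> u \<le> ((G *v x) \<bullet> x) / (norm x)\<^sup>2"
        by (simp add: matrix_vector_mult_scaleR divide_inverse power2_eq_square mult_ac)
      then show ?thesis using False by (simp add: le_divide_eq)
    qed simp
  qed
qed

text \<open>With \<open>S = 1 - G / c\<close> of norm below 1, a fixed point of \<open>Y = (S + Y\<^sup>2) / 2\<close> satisfies
  \<open>(1 - Y)\<^sup>2 = 1 - S\<close>.\<close>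

lemma mat_sqrt_exists:
  fixes G :: "real^'k^'k"
  assumes sym: "transpose G = G" and pos: "\<And>x. x \<noteq> 0 \<Longrightarrow> 0 < (G *v x) \<bullet> x"
  shows "\<exists>R. transpose R = R \<and> (\<forall>x. 0 \<le> (R *v x) \<bullet> x) \<and> R ** R = G"
proof -
  obtain m where m: "0 < m" "\<And>x. m * (norm x)\<^sup>2 \<le> (G *v x) \<bullet> x" using posdef_coercive[OF pos] by blast
  \<comment> \<open>Chosen so that m <= c and |G|^2 <= m c. Then |S x|^2 <= (1 - 2 m / c + m / c)
    |x|^2, which explains r below.\<close>
  define c where "c = (norm G)\<^sup>2 / m + m"
  have c: "m \<le> c" "0 < c" using m(1) by (auto simp: c_def add_nonneg_pos)
  have cG: "(norm G)\<^sup>2 \<le> m * c" using m(1) by (simp add: c_def field_simps)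
  define r where "r = sqrt (1 - m / c)"
  have r: "0 \<le> r" "r < 1" using m(1) c by (auto simp: r_def)
  \<comment> \<open>S is taken as a bounded operator because its operator norm is below 1, whereas
    its Frobenius norm need not be.\<close>
  define S where "S = Blinfun (\<lambda>x. x - (1 / c) *\<^sub>R (G *v x))"
  have S: "blinfun_apply S x = x - (1 / c) *\<^sub>R (G *v x)" for x
    unfolding S_def
    by (subst bounded_linear_Blinfun_apply)
      (auto intro!: linearI simp: algebra_simps simp flip: linear_conv_bounded_linear)
  have "norm (blinfun_apply S x) \<le> r * norm x" for x
  proof (rule power2_le_imp_le)
    have "(norm (G *v x))\<^sup>2 \<le> (norm G * norm x)\<^sup>2" by (intro power_mono norm_matrix_vector_mult_le) simp
    also have "\<dots> \<le> m * c * (norm x)\<^sup>2" using cG by (simp add: power_mult_distrib mult_right_mono)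
    finally have g: "(norm (G *v x))\<^sup>2 \<le> m * c * (norm x)\<^sup>2" .
    have "(norm (blinfun_apply S x))\<^sup>2 = (norm x)\<^sup>2 - (2 / c) * ((G *v x) \<bullet> x) + (norm (G *v x))\<^sup>2 / c\<^sup>2"
      unfolding S power2_norm_eq_inner by (simp add: inner_diff_left inner_diff_right inner_commute power2_eq_square)
    also have "\<dots> \<le> (norm x)\<^sup>2 - (2 / c) * (m * (norm x)\<^sup>2) + (m * c * (norm x)\<^sup>2) / c\<^sup>2"
      using c by (intro add_mono diff_mono order_refl mult_left_mono m divide_right_mono g) auto
    also have "\<dots> = (1 - m / c) * (norm x)\<^sup>2" using c by (simp add: field_simps power2_eq_square)
    also have "\<dots> = (r * norm x)\<^sup>2" using c by (simp add: r_def power_mult_distrib)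
    finally show "(norm (blinfun_apply S x))\<^sup>2 \<le> (r * norm x)\<^sup>2" .
  qed (use r in simp)
  then have nS: "norm S \<le> r" by (intro norm_blinfun_bound r) (simp add: mult.commute)
  \<comment> \<open>The ball of radius r is mapped into itself since (r + r^2) / 2 <= r, and the map
    contracts by r on it. Symmetry is closed under the map and under limits, so the fixed point is
    symmetric.\<close>
  define D where "D = {Y :: (real^'k) \<Rightarrow>\<^sub>L (real^'k). norm Y \<le> r \<and> (\<forall>x y. blinfun_apply Y x \<bullet> y = x \<bullet> blinfun_apply Y y)}"
  define f where "f Y = (1/2) *\<^sub>R (S + (Y o\<^sub>L Y))" for Y
  have symS: "blinfun_apply S x \<bullet> y = x \<bullet> blinfun_apply S y" for x y
    using inner_matrix_vector_mult[of G x y] sym by (simp add: S inner_diff_left inner_diff_right)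
  have cD: "closed D"
    unfolding D_def
    by (intro closed_Collect_conj closed_Collect_le closed_Collect_all closed_Collect_eq continuous_intros)
  have nYY: "norm (Y o\<^sub>L Z) \<le> norm Y * norm Z" for Y Z :: "(real^'k) \<Rightarrow>\<^sub>L (real^'k)"
    by (rule norm_blinfun_compose)
  have "\<exists>!Y\<in>D. f Y = Y"
  proof (rule Banach_fix[OF complete_eq_closed[THEN iffD2, OF cD] _ r])
    show "D \<noteq> {}" using r by (auto simp: D_def intro!: exI[of _ 0])
    show "f ` D \<subseteq> D"
    proof (rule image_subsetI)
      fix Y assume Y: "Y \<in> D"
      have "norm (f Y) \<le> (1/2) * (norm S + norm (Y o\<^sub>L Y))"
        unfolding f_def by (simp add: norm_triangle_ineq)
      also have "\<dots> \<le> (1/2) * (r + r * 1)"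
        using Y r nS by (intro mult_left_mono add_mono order_trans[OF nYY] mult_mono) (auto simp: D_def)
      finally have "norm (f Y) \<le> r" by simp
      then show "f Y \<in> D"
        using Y symS by (simp add: D_def f_def blinfun.bilinear_simps inner_add_left inner_add_right)
    qed
    show "dist (f Y) (f Z) \<le> r * dist Y Z" if "Y \<in> D" "Z \<in> D" for Y Z
    proof -
      have "f Y - f Z = (1/2) *\<^sub>R ((Y o\<^sub>L (Y - Z)) + ((Y - Z) o\<^sub>L Z))"
        by (rule blinfun_eqI) (simp add: f_def blinfun.bilinear_simps algebra_simps)
      then have "norm (f Y - f Z) \<le> (1/2) * (norm (Y o\<^sub>L (Y - Z)) + norm ((Y - Z) o\<^sub>L Z))"
        by (simp add: norm_triangle_ineq)
      also have "\<dots> \<le> (1/2) * (r * norm (Y - Z) + norm (Y - Z) * r)"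
        using that r by (intro mult_left_mono add_mono order_trans[OF nYY] mult_mono) (auto simp: D_def)
      finally show ?thesis by (simp add: dist_norm mult.commute)
    qed
  qed
  then obtain Y where Y: "Y \<in> D" "f Y = Y" by blast
  have fp: "blinfun_apply S x + blinfun_apply Y (blinfun_apply Y x) = 2 *\<^sub>R blinfun_apply Y x" for x
  proof -
    define w where "w = blinfun_apply S x + blinfun_apply Y (blinfun_apply Y x)"
    have "blinfun_apply (f Y) x = (1/2) *\<^sub>R w"
      by (simp add: f_def w_def blinfun.bilinear_simps)
    then have "2 *\<^sub>R blinfun_apply Y x = w" using Y(2) by simp
    then show ?thesis by (simp add: w_def)
  qed
  \<comment> \<open>The fixed point equation gives (1 - Y)^2 = 1 - S = G / c.\<close>
  define R where "R = matrix (\<lambda>x. sqrt c *\<^sub>R (x - blinfun_apply Y x))"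
  have R: "R *v x = sqrt c *\<^sub>R (x - blinfun_apply Y x)" for x
    unfolding R_def
    by (rule matrix_works) (unfold linear_matrix_vector_mul_eq, intro linearI, auto simp: blinfun.bilinear_simps algebra_simps)
  have symR: "(R *v x) \<bullet> y = x \<bullet> (R *v y)" for x y
    using Y(1) by (simp add: R D_def inner_diff_left inner_diff_right)
  have "transpose R *v x = R *v x" for x
    using inner_matrix_vector_mult[of R _ x] symR by (intro vector_eq_ldot[THEN iffD1]) auto
  then have "transpose R = R" by (simp add: matrix_eq)
  moreover have "0 \<le> (R *v x) \<bullet> x" for x
  proof -
    have "blinfun_apply Y x \<bullet> x \<le> norm (blinfun_apply Y x) * norm x" by (rule norm_cauchy_schwarz)
    also have "\<dots> \<le> (norm Y * norm x) * norm x" by (intro mult_right_mono norm_blinfun) simp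
    also have "\<dots> \<le> (1 * norm x) * norm x" using Y(1) r by (intro mult_right_mono) (auto simp: D_def)
    finally show ?thesis using c by (simp add: R inner_diff_left power2_norm_eq_inner[symmetric] power2_eq_square)
  qed
  moreover have "R ** R = G"
  proof (rule matrix_eq[THEN iffD2, rule_format])
    fix x
    have "(R ** R) *v x = R *v (R *v x)" by (simp add: matrix_vector_mul_assoc)
    also have "\<dots> = c *\<^sub>R (x - 2 *\<^sub>R blinfun_apply Y x + blinfun_apply Y (blinfun_apply Y x))"
      using c by (simp add: R blinfun.bilinear_simps algebra_simps scaleR_2)
    also have "\<dots> = c *\<^sub>R (x - blinfun_apply S x)" unfolding fp[of x, symmetric] by simp
    also have "\<dots> = G *v x" using c by (simp add: S)
    finally show "(R ** R) *v x = G *v x" .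
  qed
  ultimately show ?thesis by blast
qed

lemma posdef_invertible:
  fixes G :: "real^'k^'k"
  assumes "\<And>x. x \<noteq> 0 \<Longrightarrow> 0 < (G *v x) \<bullet> x" shows "invertible G"
proof -
  have "\<forall>x. G *v x = 0 \<longrightarrow> x = 0" using assms by force
  then show ?thesis unfolding invertible_left_inverse matrix_left_invertible_ker .
qed

text \<open>With x the preimage of w under G, the variational inequality on the right characterises
  the minimisers of |x - y| in the G-norm over K. Strict positivity makes the minimiser unique, so
  the choice inside \<open>weighted_proj\<close> is determined.\<close>

lemma weighted_proj_iff:
  fixes G :: "real^'k^'k"
  assumes sym: "transpose G = G" and pos: "\<And>x. x \<noteq> 0 \<Longrightarrow> 0 < (G *v x) \<bullet> x"
    and K: "K \<noteq> {}" "closed K" "convex K"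
  shows "y = weighted_proj G K (matrix_inv G *v w) \<longleftrightarrow> y \<in> K \<and> (\<forall>k\<in>K. 0 \<le> (G *v y - w) \<bullet> (k - y))"
proof -
  define x where "x = matrix_inv G *v w"
  have Gx: "G *v x = w" unfolding x_def by (rule matrix_inv_mult_vec[OF posdef_invertible[OF pos]])
  define R where "R = mat_sqrt G"
  have R: "transpose R = R" "R ** R = G"
    using someI_ex[OF mat_sqrt_exists[OF sym pos]] unfolding R_def mat_sqrt_def by auto
  have RR: "(R *v u) \<bullet> (R *v v) = (G *v u) \<bullet> v" for u v
    using inner_matrix_vector_mult[of R "R *v u" v] R by (simp add: matrix_vector_mul_assoc inner_commute)
  have wn: "weighted_norm G u = sqrt ((G *v u) \<bullet> u)" for u
    by (simp add: weighted_norm_def R_def[symmetric] RR)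
  have symG: "(G *v u) \<bullet> v = (G *v v) \<bullet> u" for u v
    using inner_matrix_vector_mult[of G u v] sym by (simp add: inner_commute)
  have pos0: "0 \<le> (G *v u) \<bullet> u" for u using pos[of u] by (cases "u = 0") auto
  define VI where "VI y \<longleftrightarrow> y \<in> K \<and> (\<forall>k\<in>K. 0 \<le> (G *v y - w) \<bullet> (k - y))" for y
  \<comment> \<open>Expansion of the squared G-norm of x - k around y; the middle term is the
    variational inequality and the last is the strict gain used for uniqueness.\<close>
  have expand: "(G *v (x - k)) \<bullet> (x - k) = (G *v (x - y)) \<bullet> (x - y) + 2 * ((G *v y - w) \<bullet> (k - y)) + (G *v (y - k)) \<bullet> (y - k)" for k y
  proof -
    have "x - k = (x - y) + (y - k)" by simp
    then have "(G *v (x - k)) \<bullet> (x - k) = (G *v (x - y)) \<bullet> (x - y) + 2 * ((G *v (x - y)) \<bullet> (y - k)) + (G *v (y - k)) \<bullet> (y - k)"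
      using symG[of "y - k" "x - y"] by (simp only: matrix_vector_right_distrib inner_add_left inner_add_right)
    moreover have "(G *v (x - y)) \<bullet> (y - k) = (G *v y - w) \<bullet> (k - y)"
      by (simp add: matrix_vector_mult_diff_distrib Gx inner_diff_left inner_diff_right)
    ultimately show ?thesis by simp
  qed
  have min: "is_arg_min (\<lambda>y. weighted_norm G (x - y)) (\<lambda>y. y \<in> K) y" if "VI y" for y
    unfolding is_arg_min_linorder
  proof (intro conjI allI impI)
    show "y \<in> K" using that by (simp add: VI_def)
    fix k assume "k \<in> K"
    then have "0 \<le> (G *v y - w) \<bullet> (k - y)" using that by (simp add: VI_def)
    then have "(G *v (x - y)) \<bullet> (x - y) \<le> (G *v (x - k)) \<bullet> (x - k)"
      using expand[of k y] pos0[of "y - k"] by linarith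
    then show "weighted_norm G (x - y) \<le> weighted_norm G (x - k)" unfolding wn by (rule real_sqrt_le_mono)
  qed
  have uniq: "k = y" if "VI y" "is_arg_min (\<lambda>y. weighted_norm G (x - y)) (\<lambda>y. y \<in> K) k" for y k
  proof (rule ccontr)
    assume "k \<noteq> y"
    then have "0 < (G *v (y - k)) \<bullet> (y - k)" by (intro pos) auto
    moreover have "(G *v (x - k)) \<bullet> (x - k) \<le> (G *v (x - y)) \<bullet> (x - y)"
      using that by (simp add: is_arg_min_linorder VI_def wn)
    moreover have "0 \<le> (G *v y - w) \<bullet> (k - y)" using that by (simp add: is_arg_min_linorder VI_def)
    ultimately show False using expand[of k y] by simp
  qed
  \<comment> \<open>The square root R is an isometry from the G-norm to the Euclidean norm, so
    existence comes from the Euclidean closest point in the closed convex image of K.\<close>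
  have "\<exists>y. VI y"
  proof -
    have lin: "linear ((*v) R)" by simp
    have inj: "inj ((*v) R)"
    proof (rule linear_injective_0[OF lin, THEN iffD2], intro allI impI)
      fix u assume "R *v u = 0"
      then have "(G *v u) \<bullet> u = 0" using RR[of u u] by simp
      then show "u = 0" using pos[of u] by force
    qed
    define C where "C = (*v) R ` K"
    have C: "closed C" "convex C" "C \<noteq> {}"
      unfolding C_def using K closed_injective_linear_image[OF K(2) lin inj] convex_linear_image[OF lin K(3)] by auto
    obtain p where p: "p \<in> C" "\<And>q. q \<in> C \<Longrightarrow> dist (R *v x) p \<le> dist (R *v x) q"
      using closest_point_exists[OF C(1,3), of "R *v x"] by blast
    then obtain y where y: "y \<in> K" "p = R *v y" by (auto simp: C_def)
    have "0 \<le> (G *v y - w) \<bullet> (k - y)" if "k \<in> K" for k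
    proof -
      have "(R *v x - p) \<bullet> (R *v k - p) \<le> 0"
        using any_closest_point_dot[OF C(2,1) p(1), of "R *v k" "R *v x"] p(2) that by (auto simp: C_def)
      then have "(G *v (x - y)) \<bullet> (k - y) \<le> 0"
        using RR[of "x - y" "k - y"] by (simp add: y(2) matrix_vector_mult_diff_distrib)
      then show ?thesis by (simp add: matrix_vector_mult_diff_distrib Gx inner_diff_left)
    qed
    then show ?thesis using y(1) by (auto simp: VI_def)
  qed
  then obtain z where z: "VI z" by blast
  \<comment> \<open>A minimiser exists, so the choice operator inside \<open>arg_min_on\<close>
    really picks one.\<close>
  have "is_arg_min (\<lambda>y. weighted_norm G (x - y)) (\<lambda>y. y \<in> K) (weighted_proj G K x)"
    unfolding weighted_proj_def arg_min_on_def arg_min_def using min[OF z] by (rule someI)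
  then have "weighted_proj G K x = z" by (rule uniq[OF z])
  moreover have "y = z" if "VI y" using uniq[OF z min[OF that]] by simp
  ultimately show ?thesis unfolding x_def[symmetric] VI_def[symmetric] using z by blast
qed

section \<open>Square integrable processes as an inner product space\<close>

context brownian
begin

text \<open>H must preserve measurability for all measures on the product, since progressive
  measurability is a separate statement for every time horizon u and \<open>F u\<close>.\<close>

lemma progressive_comp2:
  assumes "progressive F t f" "progressive F t g"
    and "\<And>(N :: (real \<times> 'a) measure) f g. f \<in> borel_measurable N \<Longrightarrow> g \<in> borel_measurable N \<Longrightarrow> (\<lambda>z. H (f z) (g z)) \<in> borel_measurable N"
  shows "progressive F t (\<lambda>s w. H (f s w) (g s w))"
  unfolding progressive_def
proof
  fix u assume u: "u \<in> {0..t}"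
  have "case_prod f \<in> borel_measurable (restrict_space borel {0..u} \<Otimes>\<^sub>M F u)" "case_prod g \<in> borel_measurable (restrict_space borel {0..u} \<Otimes>\<^sub>M F u)"
    using assms(1,2) u by (auto simp: progressive_def)
  from assms(3)[OF this] show "(\<lambda>(s, w). H (f s w) (g s w)) \<in> borel_measurable (restrict_space borel {0..u} \<Otimes>\<^sub>M F u)"
    by (simp add: split_beta')
qed

lemma progressive_mult_vec:
  fixes A :: "real \<Rightarrow> 'a \<Rightarrow> real^'n^'m"
  shows "progressive F t A \<Longrightarrow> progressive F t x \<Longrightarrow> progressive F t (\<lambda>s w. A s w *v x s w)"
  by (rule progressive_comp2[where H = "(*v)"]) (auto intro: matrix_vector_mult_measurable)

lemma progressive_transpose:
  fixes A :: "real \<Rightarrow> 'a \<Rightarrow> real^'n^'m"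
  shows "progressive F t A \<Longrightarrow> progressive F t (\<lambda>s w. transpose (A s w))"
  by (rule progressive_comp2[where H = "\<lambda>x y. transpose x" and g = A]) (auto intro: transpose_measurable)

lemma progressive_matrix_inv_mult_vec:
  fixes R :: "real \<Rightarrow> 'a \<Rightarrow> real^'k^'k"
  shows "progressive F t R \<Longrightarrow> progressive F t x \<Longrightarrow> progressive F t (\<lambda>s w. matrix_inv (R s w) *v x s w)"
  by (rule progressive_comp2[where H = "\<lambda>A y. matrix_inv A *v y"]) (auto intro: matrix_inv_vec_measurable)

lemma L2_proc_bound:
  assumes "0 \<le> T" "x \<in> L2_proc M F T" "progressive F T y"
    and "AE z in time_prob M T. norm (case_prod y z) \<le> c * norm (case_prod x z)"
  shows "y \<in> L2_proc M F T"
  using assms sq_int_bound[OF L2_proc_sq_int[OF assms(2,1)] progressive_measurable[OF assms(3,1) order_refl] assms(4)]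
  by (simp add: L2_proc_iff)

lemma L2_proc_mult_vec:
  fixes A :: "real \<Rightarrow> 'a \<Rightarrow> real^'n^'m"
  assumes "0 \<le> T" "A \<in> Linf_proc M F T V" "x \<in> L2_proc M F T"
  shows "(\<lambda>s w. A s w *v x s w) \<in> L2_proc M F T"
proof -
  obtain c where c: "AE z in time_prob M T. norm (case_prod A z) \<le> c"
    using assms(2) by (auto simp: Linf_proc_def split_beta')
  show ?thesis
  proof (rule L2_proc_bound[OF assms(1,3)])
    show "progressive F T (\<lambda>s w. A s w *v x s w)"
      using assms by (intro progressive_mult_vec) (auto simp: Linf_proc_def L2_proc_def)
    show "AE z in time_prob M T. norm (case_prod (\<lambda>s w. A s w *v x s w) z) \<le> c * norm (case_prod x z)"
      using c by eventually_elim
        (auto simp: split_beta' intro: order_trans[OF norm_matrix_vector_mult_le mult_right_mono])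
  qed
qed

lemma Linf_proc_transpose:
  fixes A :: "real \<Rightarrow> 'a \<Rightarrow> real^'n^'m"
  assumes "A \<in> Linf_proc M F T V" shows "(\<lambda>s w. transpose (A s w)) \<in> Linf_proc M F T UNIV"
  using assms progressive_transpose by (auto simp: Linf_proc_def norm_transpose)

lemma L2_proc_matrix_inv_mult_vec:
  fixes R :: "real \<Rightarrow> 'a \<Rightarrow> real^'k^'k"
  assumes "0 \<le> T" "progressive F T R" "x \<in> L2_proc M F T"
    and c: "AE (s, w) in time_prob M T. norm (matrix_inv (R s w)) \<le> c"
  shows "(\<lambda>s w. matrix_inv (R s w) *v x s w) \<in> L2_proc M F T"
proof (rule L2_proc_bound[OF assms(1,3)])
  show "progressive F T (\<lambda>s w. matrix_inv (R s w) *v x s w)"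
    using assms by (intro progressive_matrix_inv_mult_vec) (auto simp: L2_proc_def)
  show "AE z in time_prob M T. norm (case_prod (\<lambda>s w. matrix_inv (R s w) *v x s w) z) \<le> c * norm (case_prod x z)"
    using c by eventually_elim
      (auto simp: split_beta' intro: order_trans[OF norm_matrix_vector_mult_le mult_right_mono])
qed

lemma L2_proc_zero: "0 \<le> T \<Longrightarrow> (\<lambda>s w. 0) \<in> L2_proc M F T"
  by (simp add: L2_proc_def progressive_def split_beta')

lemma L2_proc_add: "0 \<le> T \<Longrightarrow> f \<in> L2_proc M F T \<Longrightarrow> g \<in> L2_proc M F T \<Longrightarrow> (\<lambda>s w. f s w + g s w) \<in> L2_proc M F T"
  using L2_proc_add_scaleR[of T f g 1] by simp

lemma L2_proc_diff: "0 \<le> T \<Longrightarrow> f \<in> L2_proc M F T \<Longrightarrow> g \<in> L2_proc M F T \<Longrightarrow> (\<lambda>s w. f s w - g s w) \<in> L2_proc M F T"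
  using L2_proc_add_scaleR[of T f g "-1"] by simp

lemma L2_proc_minus: "0 \<le> T \<Longrightarrow> f \<in> L2_proc M F T \<Longrightarrow> (\<lambda>s w. - f s w) \<in> L2_proc M F T"
  using L2_proc_diff[OF _ L2_proc_zero, of T f] by simp

lemma L2_proc_scaleR: "0 \<le> T \<Longrightarrow> f \<in> L2_proc M F T \<Longrightarrow> (\<lambda>s w. c *\<^sub>R f s w) \<in> L2_proc M F T"
  using L2_proc_add_scaleR[OF _ L2_proc_zero, of T f c] by simp

definition tip :: "real \<Rightarrow> (real \<Rightarrow> 'a \<Rightarrow> 'b::euclidean_space) \<Rightarrow> (real \<Rightarrow> 'a \<Rightarrow> 'b) \<Rightarrow> real" where
  "tip T f g = (\<integral>z. case_prod f z \<bullet> case_prod g z \<partial>time_prob M T)"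

lemma tip_commute: "tip T f g = tip T g f"
  by (simp add: tip_def inner_commute)

lemma tip_add_scaleR:
  assumes "0 \<le> T" "f \<in> L2_proc M F T" "g \<in> L2_proc M F T" "h \<in> L2_proc M F T"
  shows "tip T (\<lambda>s w. f s w + c *\<^sub>R g s w) h = tip T f h + c * tip T g h"
  using sq_int_inner[OF L2_proc_sq_int[OF assms(2,1)] L2_proc_sq_int[OF assms(4,1)]]
    sq_int_inner[OF L2_proc_sq_int[OF assms(3,1)] L2_proc_sq_int[OF assms(4,1)]]
  by (simp add: tip_def split_beta' inner_add_left)

lemma tip_add:
  assumes "0 \<le> T" "f \<in> L2_proc M F T" "g \<in> L2_proc M F T" "h \<in> L2_proc M F T"
  shows "tip T (\<lambda>s w. f s w + g s w) h = tip T f h + tip T g h"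
    "tip T h (\<lambda>s w. f s w + g s w) = tip T h f + tip T h g"
  using tip_add_scaleR[OF assms, of 1] by (simp_all add: tip_commute[of T h])

lemma tip_diff:
  assumes "0 \<le> T" "f \<in> L2_proc M F T" "g \<in> L2_proc M F T" "h \<in> L2_proc M F T"
  shows "tip T (\<lambda>s w. f s w - g s w) h = tip T f h - tip T g h"
  using tip_add_scaleR[OF assms, of "-1"] by simp

lemma tip_minus: "tip T (\<lambda>s w. - f s w) h = - tip T f h" "tip T h (\<lambda>s w. - f s w) = - tip T h f"
  by (simp_all add: tip_def split_beta')

lemma tip_transpose: "tip T (\<lambda>s w. A s w *v f s w) g = tip T f (\<lambda>s w. transpose (A s w) *v g s w)"
  for A :: "real \<Rightarrow> 'a \<Rightarrow> real^'n^'m"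
  by (simp add: tip_def split_beta' inner_matrix_vector_mult)

lemma tip_cong_AE:
  assumes "0 \<le> T" "f \<in> L2_proc M F T" "f' \<in> L2_proc M F T" "g \<in> L2_proc M F T" "g' \<in> L2_proc M F T"
    and "AE z in time_prob M T. case_prod f z = case_prod f' z" "AE z in time_prob M T. case_prod g z = case_prod g' z"
  shows "tip T f g = tip T f' g'"
  unfolding tip_def
proof (rule integral_cong_AE)
  show "AE z in time_prob M T. case_prod f z \<bullet> case_prod g z = case_prod f' z \<bullet> case_prod g' z"
    using assms(6,7) by eventually_elim simp
qed (rule borel_measurable_inner; rule sq_int_measurable[OF L2_proc_sq_int]; fact)+

lemma tip_symmetric:
  fixes A :: "real \<Rightarrow> 'a \<Rightarrow> real^'n^'n"
  assumes "0 \<le> T" "A \<in> Linf_proc M F T sym_mats" "f \<in> L2_proc M F T" "g \<in> L2_proc M F T"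
  shows "tip T (\<lambda>s w. A s w *v f s w) g = tip T f (\<lambda>s w. A s w *v g s w)"
  unfolding tip_transpose
proof (rule tip_cong_AE[OF assms(1,3,3)])
  show "(\<lambda>s w. transpose (A s w) *v g s w) \<in> L2_proc M F T"
    by (intro L2_proc_mult_vec[OF assms(1) Linf_proc_transpose[OF assms(2)]] assms)
  show "(\<lambda>s w. A s w *v g s w) \<in> L2_proc M F T" by (intro L2_proc_mult_vec[OF assms(1,2)] assms)
  have "AE (s, w) in time_prob M T. A s w \<in> sym_mats" using assms(2) by (simp add: Linf_proc_def)
  then show "AE z in time_prob M T. case_prod (\<lambda>s w. transpose (A s w) *v g s w) z = case_prod (\<lambda>s w. A s w *v g s w) z"
    by eventually_elim (auto simp: sym_mats_def simp del: transpose_matrix_vector)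
qed simp

text \<open>Converts the pathwise uniqueness of the state into equality almost everywhere on the
  product, which is what time integrals see.\<close>

lemma AE_paths_time_prob:
  assumes "0 \<le> T" "case_prod f \<in> borel_measurable (time_prob M T)" "case_prod g \<in> borel_measurable (time_prob M T)"
    and "AE w in M. \<forall>t\<in>{0..T}. f t w = (g t w :: 'b::euclidean_space)"
  shows "AE z in time_prob M T. case_prod f z = case_prod g z"
proof -
  interpret P: pair_sigma_finite "time_measure T" M by (rule pair_time)
  show ?thesis unfolding time_prob_def
  proof (rule P.AE_pair_measure)
    show "{z \<in> space (time_measure T \<Otimes>\<^sub>M M). case_prod f z = case_prod g z} \<in> sets (time_measure T \<Otimes>\<^sub>M M)"
    proof -
      note [measurable] = assms(2,3)[unfolded time_prob_def]
      have "{z \<in> space (time_measure T \<Otimes>\<^sub>M M). norm (case_prod f z - case_prod g z) = 0} \<in> sets (time_measure T \<Otimes>\<^sub>M M)"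
        by measurable
      then show ?thesis by simp
    qed
    show "AE s in time_measure T. AE w in M. case_prod f (s, w) = case_prod g (s, w)"
    proof (rule AE_I2)
      fix s assume "s \<in> space (time_measure T)"
      then show "AE w in M. case_prod f (s, w) = case_prod g (s, w)"
        using assms(4) by (auto simp: time_measure_space elim!: eventually_mono)
    qed
  qed
qed

section \<open>Linear images of Ito processes\<close>

lemma l2_lim_bounded_linear:
  assumes "bounded_linear f" "l2_lim N X Y"
  shows "l2_lim N (\<lambda>k x. f (X k x)) (\<lambda>x. f (Y x))"
proof -
  interpret f: bounded_linear f by fact
  obtain K where K: "\<And>x. norm (f x) \<le> norm x * K" using f.bounded by blast
  have s: "sq_int N (\<lambda>x. f (h x))" if "sq_int N h" for h
    by (rule sq_int_bound[OF that, where c = K])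
      (use K sq_int_measurable[OF that] f.continuous_on[OF continuous_on_id] in
        \<open>auto simp: mult.commute intro: borel_measurable_continuous_on\<close>)
  have *: "\<And>k. sq_int N (X k)" "sq_int N Y" using assms(2) by (auto simp: l2_lim_def)
  have "(\<lambda>k. \<integral>x. (norm (f (X k x) - f (Y x)))\<^sup>2 \<partial>N) \<longlonglongrightarrow> 0"
  proof (rule tendsto_sandwich[of "\<lambda>_. 0" _ _ "\<lambda>k. K\<^sup>2 * (\<integral>x. (norm (X k x - Y x))\<^sup>2 \<partial>N)"])
    have "(\<integral>x. (norm (f (X k x) - f (Y x)))\<^sup>2 \<partial>N) \<le> (\<integral>x. K\<^sup>2 * (norm (X k x - Y x))\<^sup>2 \<partial>N)" for k
    proof (rule integral_mono)
      show "integrable N (\<lambda>x. (norm (f (X k x) - f (Y x)))\<^sup>2)" by (intro sq_int_integrable sq_int_diff s *)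
      show "integrable N (\<lambda>x. K\<^sup>2 * (norm (X k x - Y x))\<^sup>2)" by (intro integrable_mult_right sq_int_integrable sq_int_diff *)
      show "(norm (f (X k x) - f (Y x)))\<^sup>2 \<le> K\<^sup>2 * (norm (X k x - Y x))\<^sup>2" for x
        using power_mono[OF K[of "X k x - Y x"], of 2] by (simp add: f.diff power_mult_distrib mult.commute)
    qed
    then show "\<forall>\<^sub>F k in sequentially. (\<integral>x. (norm (f (X k x) - f (Y x)))\<^sup>2 \<partial>N) \<le> K\<^sup>2 * (\<integral>x. (norm (X k x - Y x))\<^sup>2 \<partial>N)" by simp
    show "(\<lambda>k. K\<^sup>2 * (\<integral>x. (norm (X k x - Y x))\<^sup>2 \<partial>N)) \<longlonglongrightarrow> 0"
      using assms(2) by (intro tendsto_mult_right_zero) (auto simp: l2_lim_def)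
  qed auto
  then show ?thesis using s * by (auto simp: l2_lim_def)
qed

text \<open>Used with \<open>fst\<close> and \<open>snd\<close>, which recover the two components
  from the pair equation solved in \<open>adjoint_exists\<close>.\<close>

lemma has_ito_bounded_linear:
  fixes f :: "'b::euclidean_space \<Rightarrow> 'c::euclidean_space"
  assumes f: "bounded_linear f" and t: "0 \<le> t" and h: "has_ito_integral M F W \<phi> t J"
  shows "has_ito_integral M F W (\<lambda>s w. f (\<phi> s w)) t (\<lambda>w. f (J w))"
proof -
  interpret f: bounded_linear f by fact
  have mf: "(\<lambda>x. f (g x)) \<in> borel_measurable N" if "g \<in> borel_measurable N" for g and N :: "'d measure"
    using that f.continuous_on[OF continuous_on_id] by (rule borel_measurable_continuous_on[rotated])
  obtain xs where x: "\<And>k. el_ok t (xs k)" "l2_lim (time_prob M t) (\<lambda>k. case_prod (el_proc (xs k))) (case_prod \<phi>)"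
    "l2_lim M (\<lambda>k. el_ito (xs k)) J" using has_ito_elementary[OF h t] by blast
  define ys where "ys k = map (\<lambda>(a, b, \<xi>). (a, b, \<lambda>w. f (\<xi> w))) (xs k)" for k
  have yp: "el_proc (ys k) s w = f (el_proc (xs k) s w)" and yi: "el_ito (ys k) w = f (el_ito (xs k) w)" for k s w
  proof -
    have "el_proc (map (\<lambda>(a, b, \<xi>). (a, b, \<lambda>w. f (\<xi> w))) zs) s w = f (el_proc zs s w) \<and>
      el_ito (map (\<lambda>(a, b, \<xi>). (a, b, \<lambda>w. f (\<xi> w))) zs) w = f (el_ito zs w)" for zs
      by (induction zs) (auto simp: el_proc_def el_ito_def f.zero f.add f.scaleR)
    then show "el_proc (ys k) s w = f (el_proc (xs k) s w)" "el_ito (ys k) w = f (el_ito (xs k) w)" by (simp_all add: ys_def)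
  qed
  show ?thesis
  proof (rule has_ito_integralI[OF t, where xs = ys])
    show "el_ok t (ys k)" for k
      unfolding el_ok_def ys_def
    proof (clarsimp, intro conjI)
      fix a b \<xi> assume "(a, b, \<xi>) \<in> set (xs k)"
      then have *: "0 \<le> a" "a \<le> b" "b \<le> t" "\<xi> \<in> borel_measurable (F a)" "\<exists>c. \<forall>w\<in>space M. norm (\<xi> w) \<le> c"
        using x(1)[of k] by (auto simp: el_ok_def)
      then show "0 \<le> a" "a \<le> b" "b \<le> t" by auto
      show "(\<lambda>w. f (\<xi> w)) \<in> borel_measurable (F a)" using *(4) by (rule mf)
      obtain K where K: "0 < K" "\<And>x. norm (f x) \<le> norm x * K" using f.pos_bounded by blast
      obtain c where "\<forall>w\<in>space M. norm (\<xi> w) \<le> c" using *(5) by blast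
      then have "\<forall>w\<in>space M. norm (f (\<xi> w)) \<le> c * K"
        using K by (meson less_imp_le mult_right_mono order_trans)
      then show "\<exists>c. \<forall>w\<in>space M. norm (f (\<xi> w)) \<le> c" by blast
    qed
    show l: "l2_lim (time_prob M t) (\<lambda>k. case_prod (el_proc (ys k))) (\<lambda>(s, w). f (\<phi> s w))"
      using l2_lim_bounded_linear[OF f x(2)] by (simp add: yp split_beta')
    show "l2_lim M (\<lambda>k. el_ito (ys k)) (\<lambda>w. f (J w))"
      using l2_lim_bounded_linear[OF f x(3)] by (simp add: yi[abs_def])
    have "progressive F t \<phi>" using h L2_proc_iff[OF t] by (auto simp: has_ito_integral_def)
    then have "progressive F t (\<lambda>s w. f (\<phi> s w))"
      by (rule progressive_comp2[where H = "\<lambda>x y. f x" and g = \<phi>]) (auto intro: mf simp: \<open>progressive F t \<phi>\<close>)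
    then show "(\<lambda>s w. f (\<phi> s w)) \<in> L2_proc M F t" using l by (simp add: L2_proc_iff[OF t] l2_lim_def)
  qed
qed

lemma ito_process_bounded_linear:
  fixes f :: "'b::euclidean_space \<Rightarrow> 'c::euclidean_space"
  assumes f: "bounded_linear f" and X: "ito_process M F W T X b \<sigma>"
  shows "ito_process M F W T (\<lambda>t w. f (X t w)) (\<lambda>s w. f (b s w)) (\<lambda>s w. f (\<sigma> s w))"
  unfolding ito_process_def
proof (intro conjI ballI)
  interpret f: bounded_linear f by fact
  have i: "AE w in M. set_integrable lborel {0..T} (\<lambda>s. b s w)" using X by (simp add: ito_process_def)
  have fi: "set_integrable lborel S (\<lambda>s. f (g s))" "(LINT s:S|lborel. f (g s)) = f (LINT s:S|lborel. g s)"
    if "set_integrable lborel S g" for g and S :: "real set"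
    using integrable_bounded_linear[OF f that[unfolded set_integrable_def]] integral_bounded_linear[OF f that[unfolded set_integrable_def]]
    by (simp_all add: set_integrable_def set_lebesgue_integral_def f.scaleR)
  show "AE w in M. set_integrable lborel {0..T} (\<lambda>s. f (b s w))" using i by eventually_elim (rule fi(1))
  fix t assume t: "t \<in> {0..T}"
  show "has_ito_integral M F W (\<lambda>s w. f (\<sigma> s w)) t (\<lambda>w. f (X t w) - f (X 0 w) - (LINT s:{0..t}|lborel. f (b s w)))"
  proof (rule has_ito_AE_eq[OF has_ito_bounded_linear[OF f _ ito_processD[OF X t]]])
    show "AE w in M. f (X t w - X 0 w - (LINT s:{0..t}|lborel. b s w)) = f (X t w) - f (X 0 w) - (LINT s:{0..t}|lborel. f (b s w))"
      using i
    proof eventually_elim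
      case (elim w)
      have "set_integrable lborel {0..t} (\<lambda>s. b s w)" by (rule set_integrable_subset[OF elim]) (use t in auto)
      then show ?case by (simp add: fi(2) f.diff)
    qed
  qed (use t in auto)
qed

lemma L2_cont_bounded_linear:
  fixes f :: "'b::euclidean_space \<Rightarrow> 'c::euclidean_space"
  assumes f: "bounded_linear f" and T: "0 \<le> T" and X: "X \<in> L2_cont M F T"
  shows "(\<lambda>t w. f (X t w)) \<in> L2_cont M F T"
proof -
  interpret f: bounded_linear f by fact
  obtain K where K: "0 < K" "\<And>x. norm (f x) \<le> norm x * K" using f.pos_bounded by blast
  have aX: "adapted_cont T X" using X by (simp add: L2_cont_eq)
  have "(\<integral>\<^sup>+w. csup T (\<lambda>t w. f (X t w)) w \<partial>M) \<le> (\<integral>\<^sup>+w. ennreal (K\<^sup>2) * csup T X w \<partial>M)"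
  proof (rule nn_integral_mono)
    fix w
    show "csup T (\<lambda>t w. f (X t w)) w \<le> ennreal (K\<^sup>2) * csup T X w"
      unfolding csup_def[of T "\<lambda>t w. f (X t w)"]
    proof (rule SUP_least)
      fix t assume t: "t \<in> {0..T}"
      have "(norm (f (X t w)))\<^sup>2 \<le> K\<^sup>2 * (norm (X t w))\<^sup>2"
        using power_mono[OF K(2)[of "X t w"], of 2] by (simp add: power_mult_distrib mult.commute)
      then have "ennreal ((norm (f (X t w)))\<^sup>2) \<le> ennreal (K\<^sup>2) * ennreal ((norm (X t w))\<^sup>2)"
        by (simp add: ennreal_mult[symmetric] ennreal_leI)
      also have "\<dots> \<le> ennreal (K\<^sup>2) * csup T X w" by (intro mult_left_mono csup_upper t) auto
      finally show "ennreal ((norm (f (X t w)))\<^sup>2) \<le> ennreal (K\<^sup>2) * csup T X w" .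
    qed
  qed
  also have "\<dots> = ennreal (K\<^sup>2) * (\<integral>\<^sup>+w. csup T X w \<partial>M)" by (rule nn_integral_cmult[OF csup_measurable[OF aX T]])
  also have "\<dots> < \<infinity>" using X by (simp add: L2_cont_eq ennreal_mult_less_top)
  finally show ?thesis using aX f.continuous_on[OF continuous_on_id]
    by (auto simp: L2_cont_eq adapted_cont_def intro: borel_measurable_continuous_on f.continuous_on)
qed

end

section \<open>The linear-quadratic problem\<close>

lemma sets_aug_filtration:
  "sets (aug_filtration M W t) = sigma_sets (space M) ((\<Union>s\<in>{0..t}. {W s -` B \<inter> space M | B. B \<in> sets borel}) \<union> null_sets M)"
  unfolding aug_filtration_def by (rule sets_measure_of) (auto dest: sets.sets_into_space)

locale lq =
  fixes p :: "('a, 'n::finite, 'm1::finite, 'm2::finite) lq_problem"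
  assumes standing: "standing_assumptions p"
begin

lemma brownian_problem: "brownian (pM p) (pF p) (pW p)"
proof -
  have ps: "prob_space (pM p)" and c: "complete_measure (pM p)" and bm: "brownian_motion (pM p) (pF p) (pW p)"
    using standing by (auto simp: standing_assumptions_def)
  have gen: "(\<Union>s\<in>{0..t}. {pW p s -` B \<inter> space (pM p) | B. B \<in> sets borel}) \<union> null_sets (pM p) \<subseteq> sets (pM p)" for t
  proof -
    have "pW p s -` B \<inter> space (pM p) \<in> sets (pM p)" if "0 \<le> s" "B \<in> sets borel" for s B
      using bm that by (intro measurable_sets[of "pW p s" _ borel]) (auto simp: brownian_motion_def)
    then show ?thesis by auto
  qed
  interpret prob_space "pM p" by fact
  show ?thesis
  proof (intro brownian.intro brownian_axioms.intro)
    show "prob_space (pM p)" by fact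
    show "complete_measure (pM p)" "brownian_motion (pM p) (pF p) (pW p)" by fact+
    show "space (pF p t) = space (pM p)" for t by (simp add: pF_def aug_filtration_def space_measure_of_conv)
    show "sets (pF p s) \<subseteq> sets (pF p t)" if "s \<le> t" for s t
      unfolding pF_def sets_aug_filtration by (intro sigma_sets_mono' Un_mono UN_mono order_refl) (use that in auto)
    show "sets (pF p t) \<subseteq> sets (pM p)" for t
      unfolding pF_def sets_aug_filtration by (rule sets.sigma_sets_subset[OF gen])
    show "null_sets (pM p) \<subseteq> sets (pF p t)" for t
      unfolding pF_def sets_aug_filtration by (auto intro: sigma_sets.Basic)
  qed
qed

sublocale brownian "pM p" "pF p" "pW p" by (rule brownian_problem)

abbreviation "TT \<equiv> pT p"
abbreviation "PL2 \<equiv> L2_proc (pM p) (pF p) TT"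

lemma T_nonneg: "0 \<le> TT" "0 \<in> {0..TT}" "TT \<in> {0..TT}"
  using standing by (auto simp: standing_assumptions_def)

lemma coefficients:
  "cA p \<in> Linf_proc (pM p) (pF p) TT UNIV" "cC p \<in> Linf_proc (pM p) (pF p) TT UNIV"
  "cB1 p \<in> Linf_proc (pM p) (pF p) TT UNIV" "cB2 p \<in> Linf_proc (pM p) (pF p) TT UNIV"
  "cQ1 p \<in> Linf_proc (pM p) (pF p) TT sym_mats" "cQ2 p \<in> Linf_proc (pM p) (pF p) TT sym_mats"
  "cS1 p \<in> Linf_proc (pM p) (pF p) TT sym_mats" "cS2 p \<in> Linf_proc (pM p) (pF p) TT sym_mats"
  "cR11 p \<in> Linf_proc (pM p) (pF p) TT sym_mats" "cR22 p \<in> Linf_proc (pM p) (pF p) TT sym_mats"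
  using standing by (auto simp: standing_assumptions_def)

lemma cont_PL2: "X \<in> cont_space p \<Longrightarrow> X \<in> PL2"
  unfolding cont_space_def by (rule L2_cont_L2_proc[OF T_nonneg(1)])

lemma cont_sq_int: "X \<in> cont_space p \<Longrightarrow> t \<in> {0..TT} \<Longrightarrow> sq_int (pM p) (X t)"
  unfolding cont_space_def by (rule L2_cont_sq_int)

lemma R11_inv_PL2: "x \<in> PL2 \<Longrightarrow> (\<lambda>s \<omega>. matrix_inv (cR11 p s \<omega>) *v x s \<omega>) \<in> PL2"
  and R22_inv_PL2: "y \<in> PL2 \<Longrightarrow> (\<lambda>s \<omega>. matrix_inv (cR22 p s \<omega>) *v y s \<omega>) \<in> PL2"
proof -
  obtain c d where cd: "AE (s, \<omega>) in time_prob (pM p) TT. norm (matrix_inv (cR11 p s \<omega>)) \<le> c"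
    "AE (s, \<omega>) in time_prob (pM p) TT. norm (matrix_inv (cR22 p s \<omega>)) \<le> d"
    using standing by (auto simp: standing_assumptions_def)
  have pr: "progressive (pF p) TT (cR11 p)" "progressive (pF p) TT (cR22 p)"
    using coefficients(9,10) by (auto simp: Linf_proc_def)
  show "x \<in> PL2 \<Longrightarrow> (\<lambda>s \<omega>. matrix_inv (cR11 p s \<omega>) *v x s \<omega>) \<in> PL2"
    by (rule L2_proc_matrix_inv_mult_vec[OF T_nonneg(1) pr(1) _ cd(1)])
  show "y \<in> PL2 \<Longrightarrow> (\<lambda>s \<omega>. matrix_inv (cR22 p s \<omega>) *v y s \<omega>) \<in> PL2"
    by (rule L2_proc_matrix_inv_mult_vec[OF T_nonneg(1) pr(2) _ cd(2)])
qed

lemmas mult_PL2 = coefficients[THEN L2_proc_mult_vec[OF T_nonneg(1)]]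
lemmas mult_transpose_PL2 = coefficients[THEN Linf_proc_transpose, THEN L2_proc_mult_vec[OF T_nonneg(1)]]

lemma feedback_mult: "feedback_matrix p s \<omega> *v y = cB2 p s \<omega> *v (matrix_inv (cR22 p s \<omega>) *v (transpose (cB2 p s \<omega>) *v y))"
  by (simp add: feedback_matrix_def matrix_vector_mul_assoc matrix_mul_assoc del: transpose_matrix_vector)

lemma feedback_PL2: "x \<in> PL2 \<Longrightarrow> (\<lambda>s \<omega>. feedback_matrix p s \<omega> *v x s \<omega>) \<in> PL2"
  unfolding feedback_mult by (intro mult_PL2 R22_inv_PL2 mult_transpose_PL2)

lemmas PL2_intros = mult_PL2 mult_transpose_PL2 feedback_PL2 R11_inv_PL2
  L2_proc_add[OF T_nonneg(1)] L2_proc_diff[OF T_nonneg(1)] L2_proc_minus[OF T_nonneg(1)]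
  L2_proc_scaleR[OF T_nonneg(1)] L2_proc_zero[OF T_nonneg(1)]

lemma feedback_symmetric:
  assumes "f \<in> PL2" "g \<in> PL2"
  shows "tip TT (\<lambda>s \<omega>. feedback_matrix p s \<omega> *v f s \<omega>) g = tip TT f (\<lambda>s \<omega>. feedback_matrix p s \<omega> *v g s \<omega>)"
proof -
  let ?f = "\<lambda>s \<omega>. transpose (cB2 p s \<omega>) *v f s \<omega>" and ?g = "\<lambda>s \<omega>. transpose (cB2 p s \<omega>) *v g s \<omega>"
  have fg: "?f \<in> PL2" "?g \<in> PL2" by (intro PL2_intros assms)+
  have "AE (s, \<omega>) in time_prob (pM p) TT. invertible (cR22 p s \<omega>)" "AE (s, \<omega>) in time_prob (pM p) TT. cR22 p s \<omega> \<in> sym_mats"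
    using standing coefficients(10) by (auto simp: standing_assumptions_def Linf_proc_def)
  then have ae: "AE z in time_prob (pM p) TT. (case_prod (\<lambda>s \<omega>. matrix_inv (cR22 p s \<omega>) *v ?f s \<omega>) z) \<bullet> case_prod ?g z
      = case_prod ?f z \<bullet> (case_prod (\<lambda>s \<omega>. matrix_inv (cR22 p s \<omega>) *v ?g s \<omega>) z)"
    by eventually_elim (auto simp: sym_mats_def inner_matrix_inv_symmetric)
  have "tip TT (\<lambda>s \<omega>. feedback_matrix p s \<omega> *v f s \<omega>) g = tip TT (\<lambda>s \<omega>. matrix_inv (cR22 p s \<omega>) *v ?f s \<omega>) ?g"
    unfolding feedback_mult by (rule tip_transpose)
  also have "\<dots> = tip TT ?f (\<lambda>s \<omega>. matrix_inv (cR22 p s \<omega>) *v ?g s \<omega>)"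
    unfolding tip_def
    by (rule integral_cong_AE[OF _ _ ae]; intro borel_measurable_inner sq_int_measurable[OF L2_proc_sq_int[OF _ T_nonneg(1)]] R22_inv_PL2 fg)
  also have "\<dots> = tip TT (\<lambda>s \<omega>. matrix_inv (cR22 p s \<omega>) *v ?g s \<omega>) ?f" by (rule tip_commute)
  also have "\<dots> = tip TT (\<lambda>s \<omega>. feedback_matrix p s \<omega> *v g s \<omega>) f"
    unfolding feedback_mult by (rule tip_transpose[symmetric])
  finally show ?thesis by (simp only: tip_commute)
qed

lemma terminal_space_iff: "\<xi> \<in> terminal_space p V \<longleftrightarrow> \<xi> \<in> borel_measurable (pF p TT) \<and> (AE \<omega> in pM p. \<xi> \<omega> \<in> V) \<and> sq_int (pM p) \<xi>"
  unfolding terminal_space_def L2_rv_def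
  by (auto simp: sq_int_iff_nn_integral[OF measurable_F_M])

lemma terminal_UNIV: "\<xi> \<in> terminal_space p V \<Longrightarrow> \<xi> \<in> terminal_space p UNIV"
  by (simp add: terminal_space_iff)

section \<open>Linearity and uniqueness of the state equation\<close>

lemma sde_add_scaleR:
  assumes "sde p X b \<sigma>" "sde p X' b' \<sigma>'"
    and "\<And>s \<omega>. b'' s \<omega> = b s \<omega> + c *\<^sub>R b' s \<omega>" "\<And>s \<omega>. \<sigma>'' s \<omega> = \<sigma> s \<omega> + c *\<^sub>R \<sigma>' s \<omega>"
  shows "sde p (\<lambda>t \<omega>. X t \<omega> + c *\<^sub>R X' t \<omega>) b'' \<sigma>''"
proof -
  have "b'' = (\<lambda>s \<omega>. b s \<omega> + c *\<^sub>R b' s \<omega>)" "\<sigma>'' = (\<lambda>s \<omega>. \<sigma> s \<omega> + c *\<^sub>R \<sigma>' s \<omega>)" using assms(3,4) by (simp_all add: fun_eq_iff)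
  then show ?thesis using ito_process_add_scaleR[OF assms(1,2)[unfolded sde_def], of c] by (simp add: sde_def)
qed

lemma state_solution_add_scaleR:
  assumes S: "state_solution p \<xi> u Y X Z" and S': "state_solution p \<xi>' u' Y' X' Z'"
  shows "state_solution p (\<lambda>\<omega>. \<xi> \<omega> + c *\<^sub>R \<xi>' \<omega>) (\<lambda>s \<omega>. u s \<omega> + c *\<^sub>R u' s \<omega>)
    (\<lambda>t \<omega>. Y t \<omega> + c *\<^sub>R Y' t \<omega>) (\<lambda>t \<omega>. X t \<omega> + c *\<^sub>R X' t \<omega>) (\<lambda>t \<omega>. Z t \<omega> + c *\<^sub>R Z' t \<omega>)"
proof -
  note s = S[unfolded state_solution_def cont_space_def] S'[unfolded state_solution_def cont_space_def]
  show ?thesis unfolding state_solution_def cont_space_def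
  proof (intro conjI)
    show "sde p (\<lambda>t \<omega>. Y t \<omega> + c *\<^sub>R Y' t \<omega>)
       (\<lambda>s \<omega>. - (transpose (cA p s \<omega>) *v (Y s \<omega> + c *\<^sub>R Y' s \<omega>)) + cQ2 p s \<omega> *v (X s \<omega> + c *\<^sub>R X' s \<omega>))
       (\<lambda>s \<omega>. - (transpose (cC p s \<omega>) *v (Y s \<omega> + c *\<^sub>R Y' s \<omega>)) + cS2 p s \<omega> *v (Z s \<omega> + c *\<^sub>R Z' s \<omega>))"
      by (rule sde_add_scaleR) (use s in \<open>auto simp: algebra_simps\<close>)
    show "sde p (\<lambda>t \<omega>. X t \<omega> + c *\<^sub>R X' t \<omega>)
       (\<lambda>s \<omega>. cA p s \<omega> *v (X s \<omega> + c *\<^sub>R X' s \<omega>) + cB1 p s \<omega> *v (u s \<omega> + c *\<^sub>R u' s \<omega>)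
         + feedback_matrix p s \<omega> *v (Y s \<omega> + c *\<^sub>R Y' s \<omega>) + cC p s \<omega> *v (Z s \<omega> + c *\<^sub>R Z' s \<omega>))
       (\<lambda>t \<omega>. Z t \<omega> + c *\<^sub>R Z' t \<omega>)"
      by (rule sde_add_scaleR) (use s in \<open>auto simp: algebra_simps\<close>)
    have "AE \<omega> in pM p. Y 0 \<omega> = cH2 p *v X 0 \<omega>" "AE \<omega> in pM p. Y' 0 \<omega> = cH2 p *v X' 0 \<omega>" using s by auto
    then show "AE \<omega> in pM p. Y 0 \<omega> + c *\<^sub>R Y' 0 \<omega> = cH2 p *v (X 0 \<omega> + c *\<^sub>R X' 0 \<omega>)"
      by eventually_elim (simp add: algebra_simps)
    have "AE \<omega> in pM p. X TT \<omega> = \<xi> \<omega>" "AE \<omega> in pM p. X' TT \<omega> = \<xi>' \<omega>" using s by auto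
    then show "AE \<omega> in pM p. X TT \<omega> + c *\<^sub>R X' TT \<omega> = \<xi> \<omega> + c *\<^sub>R \<xi>' \<omega>"
      by eventually_elim simp
  qed (use s L2_cont_add_scaleR[OF T_nonneg(1)] L2_proc_add_scaleR[OF T_nonneg(1)] in auto)
qed

lemma state_solution_exists:
  assumes "\<xi> \<in> terminal_space p UNIV" "u \<in> control_space p"
  obtains Y X Z where "state_solution p \<xi> u Y X Z"
  using standing assms unfolding standing_assumptions_def state_well_posed_def by blast

lemma state_solution_unique:
  assumes "\<xi> \<in> terminal_space p UNIV" "u \<in> control_space p"
    and S: "state_solution p \<xi> u Y X Z" "state_solution p \<xi> u Y' X' Z'"
  shows "AE z in time_prob (pM p) TT. case_prod X z = case_prod X' z" "AE z in time_prob (pM p) TT. case_prod Z z = case_prod Z' z"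
    "AE \<omega> in pM p. X 0 \<omega> = X' 0 \<omega>"
proof -
  obtain Y0 X0 Z0 where u: "\<And>Y' X' Z'. state_solution p \<xi> u Y' X' Z' \<Longrightarrow>
             (AE \<omega> in pM p. \<forall>t\<in>{0..TT}. Y' t \<omega> = Y0 t \<omega> \<and> X' t \<omega> = X0 t \<omega>) \<and>
             (AE (s, \<omega>) in time_prob (pM p) TT. Z' s \<omega> = Z0 s \<omega>)"
    using standing assms(1,2) unfolding standing_assumptions_def state_well_posed_def by blast
  note u1 = u[OF S(1)] and u2 = u[OF S(2)]
  have X: "AE \<omega> in pM p. \<forall>t\<in>{0..TT}. X t \<omega> = X' t \<omega>"
    using conjunct1[OF u1] conjunct1[OF u2] by eventually_elim simp
  show "AE \<omega> in pM p. X 0 \<omega> = X' 0 \<omega>" using X by eventually_elim (use T_nonneg in simp)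
  have "X \<in> PL2" "X' \<in> PL2" using S cont_PL2 by (auto simp: state_solution_def)
  then show "AE z in time_prob (pM p) TT. case_prod X z = case_prod X' z"
    by (intro AE_paths_time_prob[OF T_nonneg(1) _ _ X] sq_int_measurable[OF L2_proc_sq_int[OF _ T_nonneg(1)]])
  show "AE z in time_prob (pM p) TT. case_prod Z z = case_prod Z' z"
    using conjunct2[OF u1] conjunct2[OF u2] by eventually_elim auto
qed

section \<open>The cost as a quadratic form\<close>

definition form :: "('a \<Rightarrow> real^'n) \<Rightarrow> (real \<Rightarrow> 'a \<Rightarrow> real^'n) \<Rightarrow> (real \<Rightarrow> 'a \<Rightarrow> real^'n) \<Rightarrow> (real \<Rightarrow> 'a \<Rightarrow> real^'m1)
    \<Rightarrow> ('a \<Rightarrow> real^'n) \<Rightarrow> (real \<Rightarrow> 'a \<Rightarrow> real^'n) \<Rightarrow> (real \<Rightarrow> 'a \<Rightarrow> real^'n) \<Rightarrow> (real \<Rightarrow> 'a \<Rightarrow> real^'m1) \<Rightarrow> real" where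
  "form \<xi> X Z u \<xi>' X' Z' u' = tip TT (\<lambda>s \<omega>. cQ1 p s \<omega> *v X s \<omega>) X' + tip TT (\<lambda>s \<omega>. cS1 p s \<omega> *v Z s \<omega>) Z'
     + tip TT (\<lambda>s \<omega>. cR11 p s \<omega> *v u s \<omega>) u' + expectation (\<lambda>\<omega>. (cG1 p \<omega> *v \<xi> \<omega>) \<bullet> \<xi>' \<omega>)
     + expectation (\<lambda>\<omega>. (cH1 p *v X 0 \<omega>) \<bullet> X' 0 \<omega>)"

lemma G1_sq_int: "sq_int (pM p) \<xi> \<Longrightarrow> sq_int (pM p) (\<lambda>\<omega>. cG1 p \<omega> *v \<xi> \<omega>)"
proof -
  assume s: "sq_int (pM p) \<xi>"
  obtain c where c: "AE \<omega> in pM p. norm (cG1 p \<omega>) \<le> c" and m: "cG1 p \<in> borel_measurable (pF p TT)"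
    using standing by (auto simp: standing_assumptions_def Linf_rv_def)
  show ?thesis
  proof (rule sq_int_bound[OF s])
    show "(\<lambda>\<omega>. cG1 p \<omega> *v \<xi> \<omega>) \<in> borel_measurable (pM p)"
      by (rule matrix_vector_mult_measurable[OF measurable_F_M[OF m] sq_int_measurable[OF s]])
    show "AE \<omega> in pM p. norm (cG1 p \<omega> *v \<xi> \<omega>) \<le> c * norm (\<xi> \<omega>)"
      using c by eventually_elim (auto intro: order_trans[OF norm_matrix_vector_mult_le mult_right_mono])
  qed
qed

lemma mat_sq_int: "sq_int (pM p) x \<Longrightarrow> sq_int (pM p) (\<lambda>\<omega>. H *v x \<omega>)" for H :: "real^'k^'l"
  by (rule sq_int_bound[where c = "norm H"])
    (auto intro: matrix_vector_mult_measurable norm_matrix_vector_mult_le dest: sq_int_measurable)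

lemma H_symmetric: "(cH1 p *v x) \<bullet> y = x \<bullet> (cH1 p *v y)" "(cH2 p *v x) \<bullet> y = x \<bullet> (cH2 p *v y)"
  using standing inner_matrix_vector_mult[of "cH1 p" x y] inner_matrix_vector_mult[of "cH2 p" x y]
  by (auto simp: standing_assumptions_def sym_mats_def)

lemma G1_posdef: "AE \<omega> in pM p. transpose (cG1 p \<omega>) = cG1 p \<omega> \<and> (\<forall>x. x \<noteq> 0 \<longrightarrow> 0 < (cG1 p \<omega> *v x) \<bullet> x)"
  using standing by (auto simp: standing_assumptions_def Linf_rv_def sym_mats_def)

text \<open>\<open>cost\<close> evaluates a solution picked by choice. Uniqueness up to null sets
  makes every solution give the same value, so the polarised expression \<open>form\<close> can be
  used with any of them.\<close>

lemma cost_eq_form: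
  assumes xi: "\<xi> \<in> terminal_space p UNIV" and u: "u \<in> control_space p" and S: "state_solution p \<xi> u Y X Z"
  shows "cost p \<xi> u = form \<xi> X Z u \<xi> X Z u / 2"
proof -
  obtain Y' X' Z' where eps: "(SOME (Y, X, Z). state_solution p \<xi> u Y X Z) = (Y', X', Z')" by (metis surj_pair)
  have "case (SOME (Y, X, Z). state_solution p \<xi> u Y X Z) of (Y, X, Z) \<Rightarrow> state_solution p \<xi> u Y X Z"
    by (rule someI[of _ "(Y, X, Z)"]) (simp add: S)
  then have S': "state_solution p \<xi> u Y' X' Z'" by (simp add: eps)
  have m: "X \<in> PL2" "Z \<in> PL2" "X' \<in> PL2" "Z' \<in> PL2" "u \<in> PL2" "X \<in> cont_space p" "X' \<in> cont_space p"
    using S S' u cont_PL2 by (auto simp: state_solution_def control_space_def)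
  have sx: "sq_int (pM p) \<xi>" using xi by (simp add: terminal_space_iff)
  have s0: "sq_int (pM p) (X' 0)" "sq_int (pM p) (X 0)" using cont_sq_int m T_nonneg by auto
  note U = state_solution_unique[OF xi u S' S]
  define h where "h s \<omega> = (cQ1 p s \<omega> *v X' s \<omega>) \<bullet> X' s \<omega> + (cS1 p s \<omega> *v Z' s \<omega>) \<bullet> Z' s \<omega> + (cR11 p s \<omega> *v u s \<omega>) \<bullet> u s \<omega>" for s \<omega>
  have i: "integrable (time_prob (pM p) TT) (\<lambda>z. case_prod f z \<bullet> case_prod g z)" if "f \<in> PL2" "g \<in> PL2" for f g :: "real \<Rightarrow> 'a \<Rightarrow> 'z::euclidean_space"
    by (intro sq_int_inner L2_proc_sq_int that T_nonneg)
  have hi: "integrable (time_prob (pM p) TT) (case_prod h)"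
    using i[OF mult_PL2(5)[OF m(3)] m(3)] i[OF mult_PL2(7)[OF m(4)] m(4)] i[OF mult_PL2(9)[OF m(5)] m(5)]
    by (simp add: h_def split_beta')
  have hI: "(\<integral>z. case_prod h z \<partial>time_prob (pM p) TT) = tip TT (\<lambda>s \<omega>. cQ1 p s \<omega> *v X' s \<omega>) X' + tip TT (\<lambda>s \<omega>. cS1 p s \<omega> *v Z' s \<omega>) Z' + tip TT (\<lambda>s \<omega>. cR11 p s \<omega> *v u s \<omega>) u"
    using i[OF mult_PL2(5)[OF m(3)] m(3)] i[OF mult_PL2(7)[OF m(4)] m(4)] i[OF mult_PL2(9)[OF m(5)] m(5)]
    by (simp add: h_def tip_def split_beta')
  have "cost p \<xi> u = 1/2 * expectation (\<lambda>\<omega>. (LINT s:{0..TT}|lborel. h s \<omega>) + (cG1 p \<omega> *v \<xi> \<omega>) \<bullet> \<xi> \<omega> + (cH1 p *v X' 0 \<omega>) \<bullet> X' 0 \<omega>)"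
    by (simp add: cost_def eps h_def)
  also have "\<dots> = 1/2 * (expectation (\<lambda>\<omega>. LINT s:{0..TT}|lborel. h s \<omega>) + expectation (\<lambda>\<omega>. (cG1 p \<omega> *v \<xi> \<omega>) \<bullet> \<xi> \<omega>) + expectation (\<lambda>\<omega>. (cH1 p *v X' 0 \<omega>) \<bullet> X' 0 \<omega>))"
    using integrable_time_prob[OF hi] sq_int_inner[OF G1_sq_int[OF sx] sx] sq_int_inner[OF mat_sq_int[OF s0(1)] s0(1), of "cH1 p"]
    by simp
  also have "expectation (\<lambda>\<omega>. LINT s:{0..TT}|lborel. h s \<omega>) = (\<integral>z. case_prod h z \<partial>time_prob (pM p) TT)" by (rule integral_time_prob[OF hi])
  also note hI
  also have "tip TT (\<lambda>s \<omega>. cQ1 p s \<omega> *v X' s \<omega>) X' = tip TT (\<lambda>s \<omega>. cQ1 p s \<omega> *v X s \<omega>) X"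
    by (rule tip_cong_AE[OF T_nonneg(1)]; (intro PL2_intros m)?) (use U(1) in \<open>eventually_elim; auto\<close>)+
  also have "tip TT (\<lambda>s \<omega>. cS1 p s \<omega> *v Z' s \<omega>) Z' = tip TT (\<lambda>s \<omega>. cS1 p s \<omega> *v Z s \<omega>) Z"
    by (rule tip_cong_AE[OF T_nonneg(1)]; (intro PL2_intros m)?) (use U(2) in \<open>eventually_elim; auto\<close>)+
  also have "expectation (\<lambda>\<omega>. (cH1 p *v X' 0 \<omega>) \<bullet> X' 0 \<omega>) = expectation (\<lambda>\<omega>. (cH1 p *v X 0 \<omega>) \<bullet> X 0 \<omega>)"
    by (rule integral_cong_AE; (intro borel_measurable_inner sq_int_measurable mat_sq_int s0)?) (use U(3) in \<open>eventually_elim; simp\<close>)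
  finally show ?thesis by (simp add: form_def)
qed

lemma expectation_add_scaleR:
  assumes "sq_int (pM p) f" "sq_int (pM p) g" "sq_int (pM p) h"
  shows "expectation (\<lambda>\<omega>. (f \<omega> + c *\<^sub>R g \<omega>) \<bullet> h \<omega>) = expectation (\<lambda>\<omega>. f \<omega> \<bullet> h \<omega>) + c * expectation (\<lambda>\<omega>. g \<omega> \<bullet> h \<omega>)"
  using sq_int_inner[OF assms(1,3)] sq_int_inner[OF assms(2,3)] by (simp add: inner_add_left)

lemma form_add_scaleR:
  assumes m: "X \<in> cont_space p" "X' \<in> cont_space p" "X'' \<in> cont_space p" "Z \<in> PL2" "Z' \<in> PL2" "Z'' \<in> PL2" "u \<in> PL2" "u' \<in> PL2" "u'' \<in> PL2"
    and s: "sq_int (pM p) \<xi>" "sq_int (pM p) \<xi>'" "sq_int (pM p) \<xi>''"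
  shows "form (\<lambda>\<omega>. \<xi> \<omega> + c *\<^sub>R \<xi>' \<omega>) (\<lambda>t \<omega>. X t \<omega> + c *\<^sub>R X' t \<omega>) (\<lambda>t \<omega>. Z t \<omega> + c *\<^sub>R Z' t \<omega>) (\<lambda>t \<omega>. u t \<omega> + c *\<^sub>R u' t \<omega>) \<xi>'' X'' Z'' u''
    = form \<xi> X Z u \<xi>'' X'' Z'' u'' + c * form \<xi>' X' Z' u' \<xi>'' X'' Z'' u''"
proof -
  have ts: "tip TT (\<lambda>s \<omega>. A s \<omega> *v (f s \<omega> + c *\<^sub>R g s \<omega>)) h = tip TT (\<lambda>s \<omega>. A s \<omega> *v f s \<omega>) h + c * tip TT (\<lambda>s \<omega>. A s \<omega> *v g s \<omega>) h"
    if "A \<in> Linf_proc (pM p) (pF p) TT sym_mats" "f \<in> PL2" "g \<in> PL2" "h \<in> PL2" for A :: "real \<Rightarrow> 'a \<Rightarrow> real^'k^'k" and f g h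
  proof -
    have "(\<lambda>s \<omega>. A s \<omega> *v (f s \<omega> + c *\<^sub>R g s \<omega>)) = (\<lambda>s \<omega>. A s \<omega> *v f s \<omega> + c *\<^sub>R (A s \<omega> *v g s \<omega>))"
      by (simp add: matrix_vector_right_distrib matrix_vector_mult_scaleR)
    then show ?thesis
      using tip_add_scaleR[OF T_nonneg(1) L2_proc_mult_vec[OF T_nonneg(1) that(1,2)] L2_proc_mult_vec[OF T_nonneg(1) that(1,3)] that(4), of c] by simp
  qed
  have s0: "sq_int (pM p) (X 0)" "sq_int (pM p) (X' 0)" "sq_int (pM p) (X'' 0)" using cont_sq_int m T_nonneg by auto
  have G: "expectation (\<lambda>\<omega>. (cG1 p \<omega> *v (\<xi> \<omega> + c *\<^sub>R \<xi>' \<omega>)) \<bullet> \<xi>'' \<omega>) = expectation (\<lambda>\<omega>. (cG1 p \<omega> *v \<xi> \<omega>) \<bullet> \<xi>'' \<omega>) + c * expectation (\<lambda>\<omega>. (cG1 p \<omega> *v \<xi>' \<omega>) \<bullet> \<xi>'' \<omega>)"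
    using expectation_add_scaleR[OF G1_sq_int[OF s(1)] G1_sq_int[OF s(2)] s(3), of c] by (simp add: matrix_vector_right_distrib matrix_vector_mult_scaleR)
  have H: "expectation (\<lambda>\<omega>. (cH1 p *v (X 0 \<omega> + c *\<^sub>R X' 0 \<omega>)) \<bullet> X'' 0 \<omega>) = expectation (\<lambda>\<omega>. (cH1 p *v X 0 \<omega>) \<bullet> X'' 0 \<omega>) + c * expectation (\<lambda>\<omega>. (cH1 p *v X' 0 \<omega>) \<bullet> X'' 0 \<omega>)"
    using expectation_add_scaleR[OF mat_sq_int[OF s0(1)] mat_sq_int[OF s0(2)] s0(3), of "cH1 p" c "cH1 p"] by (simp add: matrix_vector_right_distrib matrix_vector_mult_scaleR)
  show ?thesis unfolding form_def G H
    by (simp only: ts[OF coefficients(5) cont_PL2[OF m(1)] cont_PL2[OF m(2)] cont_PL2[OF m(3)]] ts[OF coefficients(7) m(4,5,6)] ts[OF coefficients(9) m(7,8,9)])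
      (simp add: algebra_simps)
qed

lemma form_commute:
  assumes m: "X \<in> cont_space p" "X' \<in> cont_space p" "Z \<in> PL2" "Z' \<in> PL2" "u \<in> PL2" "u' \<in> PL2"
    and s: "sq_int (pM p) \<xi>" "sq_int (pM p) \<xi>'"
  shows "form \<xi> X Z u \<xi>' X' Z' u' = form \<xi>' X' Z' u' \<xi> X Z u"
proof -
  have "expectation (\<lambda>\<omega>. (cG1 p \<omega> *v \<xi> \<omega>) \<bullet> \<xi>' \<omega>) = expectation (\<lambda>\<omega>. (cG1 p \<omega> *v \<xi>' \<omega>) \<bullet> \<xi> \<omega>)"
  proof (rule integral_cong_AE)
    show "AE \<omega> in pM p. (cG1 p \<omega> *v \<xi> \<omega>) \<bullet> \<xi>' \<omega> = (cG1 p \<omega> *v \<xi>' \<omega>) \<bullet> \<xi> \<omega>"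
      using G1_posdef by eventually_elim (metis inner_commute inner_matrix_vector_mult)
  qed (intro borel_measurable_inner sq_int_measurable G1_sq_int s)+
  moreover have "expectation (\<lambda>\<omega>. (cH1 p *v X 0 \<omega>) \<bullet> X' 0 \<omega>) = expectation (\<lambda>\<omega>. (cH1 p *v X' 0 \<omega>) \<bullet> X 0 \<omega>)"
    by (intro Bochner_Integration.integral_cong refl) (metis H_symmetric(1) inner_commute)
  ultimately show ?thesis unfolding form_def
    using tip_symmetric[OF T_nonneg(1) coefficients(5) cont_PL2[OF m(1)] cont_PL2[OF m(2)]]
      tip_symmetric[OF T_nonneg(1) coefficients(7) m(3,4)] tip_symmetric[OF T_nonneg(1) coefficients(9) m(5,6)]
    by (simp only: tip_commute)
qed

text \<open>The two mixed terms of the symmetric form agree, which cancels the factor 1/2 in front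
  of the cross term.\<close>

lemma cost_expansion:
  assumes xi: "\<xi> \<in> terminal_space p UNIV" "\<eta> \<in> terminal_space p UNIV" and u: "u \<in> control_space p" "v \<in> control_space p"
    and S: "state_solution p \<xi> u Y X Z" and S': "state_solution p \<eta> v Y' X' Z'"
  shows "cost p (\<lambda>\<omega>. \<xi> \<omega> + c *\<^sub>R \<eta> \<omega>) (\<lambda>s \<omega>. u s \<omega> + c *\<^sub>R v s \<omega>)
    = cost p \<xi> u + c * form \<xi> X Z u \<eta> X' Z' v + c\<^sup>2 * cost p \<eta> v"
proof -
  have x2: "(\<lambda>\<omega>. \<xi> \<omega> + c *\<^sub>R \<eta> \<omega>) \<in> terminal_space p UNIV"
    using xi by (auto simp: terminal_space_iff intro!: sq_int_add sq_int_scaleR borel_measurable_add borel_measurable_scaleR)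
  have u2: "(\<lambda>s \<omega>. u s \<omega> + c *\<^sub>R v s \<omega>) \<in> control_space p"
    using u L2_proc_add_scaleR[OF T_nonneg(1)] by (simp add: control_space_def)
  have m: "X \<in> cont_space p" "X' \<in> cont_space p" "Z \<in> PL2" "Z' \<in> PL2" "u \<in> PL2" "v \<in> PL2"
    using S S' u by (auto simp: state_solution_def control_space_def)
  have m2: "(\<lambda>t \<omega>. X t \<omega> + c *\<^sub>R X' t \<omega>) \<in> cont_space p" "(\<lambda>t \<omega>. Z t \<omega> + c *\<^sub>R Z' t \<omega>) \<in> PL2" "(\<lambda>s \<omega>. u s \<omega> + c *\<^sub>R v s \<omega>) \<in> PL2"
    using m L2_proc_add_scaleR[OF T_nonneg(1)] L2_cont_add_scaleR[OF T_nonneg(1)] by (auto simp: cont_space_def)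
  have s: "sq_int (pM p) \<xi>" "sq_int (pM p) \<eta>" "sq_int (pM p) (\<lambda>\<omega>. \<xi> \<omega> + c *\<^sub>R \<eta> \<omega>)"
    using xi x2 by (auto simp: terminal_space_iff)
  note e1 = form_add_scaleR[OF m(1,2) m2(1) m(3,4) m2(2) m(5,6) m2(3) s, of c]
  note e2 = form_commute[OF m(1) m2(1) m(3) m2(2) m(5) m2(3) s(1,3)] form_commute[OF m(2) m2(1) m(4) m2(2) m(6) m2(3) s(2,3)]
  note e3 = form_add_scaleR[OF m(1,2,1,3,4,3,5,6,5) s(1,2,1), of c] form_add_scaleR[OF m(1,2,2,3,4,4,5,6,6) s(1,2,2), of c]
  note e4 = form_commute[OF m(2,1,4,3,6,5) s(2,1)]
  show ?thesis
    unfolding cost_eq_form[OF x2 u2 state_solution_add_scaleR[OF S S']] cost_eq_form[OF xi(1) u(1) S] cost_eq_form[OF xi(2) u(2) S'] e1 e2 e3 e4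
    by (simp add: field_simps power2_eq_square)
qed

end

section \<open>The adjoint equation and the gradient of the cost\<close>

context brownian
begin

lemma L2_proc_bounded_linear:
  fixes f :: "'b::euclidean_space \<Rightarrow> 'c::euclidean_space"
  assumes T: "0 \<le> T" and f: "bounded_linear f" and x: "x \<in> L2_proc M F T"
  shows "(\<lambda>s \<omega>. f (x s \<omega>)) \<in> L2_proc M F T"
proof -
  interpret f: bounded_linear f by fact
  obtain K where K: "\<And>x. norm (f x) \<le> norm x * K" using f.bounded by blast
  have p: "progressive F T x" using x by (simp add: L2_proc_def)
  show ?thesis
  proof (rule L2_proc_bound[OF T x, where c = K])
    show "progressive F T (\<lambda>s \<omega>. f (x s \<omega>))"
      by (rule progressive_comp2[OF p p, where H = "\<lambda>x y. f x"])
        (rule borel_measurable_continuous_on[OF f.continuous_on[OF continuous_on_id]])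
  qed (use K in \<open>auto simp: mult.commute\<close>)
qed

lemma L2_proc_Pair:
  assumes T: "0 \<le> T" and "f \<in> L2_proc M F T" "g \<in> L2_proc M F T"
  shows "(\<lambda>s \<omega>. (f s \<omega>, g s \<omega>)) \<in> L2_proc M F T"
proof -
  have "bounded_linear (\<lambda>x. (x, 0::'c))" "bounded_linear (\<lambda>x. (0::'b, x))"
    by (intro bounded_linear_Pair bounded_linear_ident bounded_linear_zero)+
  from L2_proc_add[OF T L2_proc_bounded_linear[OF T this(1) assms(2)] L2_proc_bounded_linear[OF T this(2) assms(3)]]
  show ?thesis by simp
qed

end

lemma norm_mult_vec_le: "norm A \<le> a \<Longrightarrow> norm x \<le> b \<Longrightarrow> norm (A *v x) \<le> a * b" for A :: "real^'n^'m"
  by (rule order_trans[OF norm_matrix_vector_mult_le mult_mono]) (auto intro: order_trans[OF norm_ge_zero])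

lemma norm_Pair_add_le: "norm (x, y) \<le> norm x + norm y"
  for x :: "'b::real_normed_vector" and y :: "'c::real_normed_vector"
  using norm_triangle_ineq[of "(x, 0::'c)" "(0::'b, y)"] by (simp add: norm_Pair)

context lq
begin

text \<open>The triple g, h, q solves the state system in the places of Y, X, Z, with control 0 and
  terminal value 0, and with sources \<open>cQ1\<close>, \<open>cS1\<close>, \<open>cH1\<close>
  taken from the cost along the given X and Z.\<close>

definition adjoint :: "(real \<Rightarrow> 'a \<Rightarrow> real^'n) \<Rightarrow> (real \<Rightarrow> 'a \<Rightarrow> real^'n) \<Rightarrow> (real \<Rightarrow> 'a \<Rightarrow> real^'n)
    \<Rightarrow> (real \<Rightarrow> 'a \<Rightarrow> real^'n) \<Rightarrow> (real \<Rightarrow> 'a \<Rightarrow> real^'n) \<Rightarrow> bool" where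
  "adjoint X Z g h q \<longleftrightarrow> g \<in> cont_space p \<and> h \<in> cont_space p \<and> q \<in> PL2 \<and>
     sde p g
       (\<lambda>s \<omega>. - (transpose (cA p s \<omega>) *v g s \<omega> - cQ1 p s \<omega> *v X s \<omega> - cQ2 p s \<omega> *v h s \<omega>))
       (\<lambda>s \<omega>. - (transpose (cC p s \<omega>) *v g s \<omega> - cS1 p s \<omega> *v Z s \<omega> - cS2 p s \<omega> *v q s \<omega>)) \<and>
     sde p h
       (\<lambda>s \<omega>. cA p s \<omega> *v h s \<omega> + feedback_matrix p s \<omega> *v g s \<omega> + cC p s \<omega> *v q s \<omega>)
       q \<and>
     (AE \<omega> in pM p. g 0 \<omega> = cH1 p *v X 0 \<omega> + cH2 p *v h 0 \<omega>) \<and>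
     (AE \<omega> in pM p. h TT \<omega> = 0)"

text \<open>A forward equation with \<open>q = 0\<close> absorbs the inhomogeneities; the well-posed state
  equation then corrects the terminal value.\<close>

lemma adjoint_exists:
  assumes X: "X \<in> cont_space p" and Z: "Z \<in> PL2"
  obtains g h q where "adjoint X Z g h q"
proof -
  \<comment> \<open>The first component stands for g, the second for h.\<close>
  define b :: "real \<Rightarrow> 'a \<Rightarrow> (real^'n) \<times> (real^'n) \<Rightarrow> (real^'n) \<times> (real^'n)" where
    "b s \<omega> x = (- (transpose (cA p s \<omega>) *v fst x) + cQ2 p s \<omega> *v snd x + cQ1 p s \<omega> *v X s \<omega>,
       cA p s \<omega> *v snd x + feedback_matrix p s \<omega> *v fst x)" for s \<omega> x
  define \<sigma> :: "real \<Rightarrow> 'a \<Rightarrow> (real^'n) \<times> (real^'n) \<Rightarrow> (real^'n) \<times> (real^'n)" where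
    "\<sigma> s \<omega> x = (- (transpose (cC p s \<omega>) *v fst x) + cS1 p s \<omega> *v Z s \<omega>, 0)" for s \<omega> x
  define v where "v \<omega> = (cH1 p *v X 0 \<omega>, 0::real^'n)" for \<omega>
  have fs: "(\<lambda>s \<omega>. fst (V s \<omega>)) \<in> PL2" "(\<lambda>s \<omega>. snd (V s \<omega>)) \<in> PL2" if "V \<in> PL2" for V :: "real \<Rightarrow> 'a \<Rightarrow> (real^'n) \<times> (real^'n)"
    using L2_proc_bounded_linear[OF T_nonneg(1) bounded_linear_fst that] L2_proc_bounded_linear[OF T_nonneg(1) bounded_linear_snd that] .
  have bP: "(\<lambda>s \<omega>. b s \<omega> (V s \<omega>)) \<in> PL2" if "V \<in> PL2" for V
    unfolding b_def by (intro L2_proc_Pair T_nonneg PL2_intros fs that cont_PL2 X)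
  have sP: "(\<lambda>s \<omega>. \<sigma> s \<omega> (V s \<omega>)) \<in> PL2" if "V \<in> PL2" for V
    unfolding \<sigma>_def by (intro L2_proc_Pair T_nonneg PL2_intros fs that Z)
  obtain ca cc cb cq cr where bds: "AE z in time_prob (pM p) TT. norm (case_prod (cA p) z) \<le> ca"
    "AE z in time_prob (pM p) TT. norm (case_prod (cC p) z) \<le> cc" "AE z in time_prob (pM p) TT. norm (case_prod (cB2 p) z) \<le> cb"
    "AE z in time_prob (pM p) TT. norm (case_prod (cQ2 p) z) \<le> cq"
    "AE z in time_prob (pM p) TT. norm (matrix_inv (case_prod (cR22 p) z)) \<le> cr"
    using standing by (auto simp: standing_assumptions_def Linf_proc_def split_beta')
  \<comment> \<open>The summands bound the coefficients of b and of sigma; absolute values allow any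
    of them to be dropped, so one L serves both estimates.\<close>
  define L where "L = \<bar>ca\<bar> + \<bar>cq\<bar> + (\<bar>ca\<bar> + \<bar>cb * (cr * cb)\<bar>) + \<bar>cc\<bar>"
  have lipb: "AE z in time_prob (pM p) TT. \<forall>x y. norm (b (fst z) (snd z) x - b (fst z) (snd z) y) \<le> L * norm (x - y)"
    using bds(1,3,4,5)
  proof (eventually_elim, intro allI)
    fix z :: "real \<times> 'a" and x y :: "(real^'n) \<times> (real^'n)" assume 1: "norm (case_prod (cA p) z) \<le> ca" "norm (case_prod (cB2 p) z) \<le> cb" "norm (case_prod (cQ2 p) z) \<le> cq"
      "norm (matrix_inv (case_prod (cR22 p) z)) \<le> cr"
    obtain s \<omega> where z: "z = (s, \<omega>)" by (cases z)
    define d where "d = x - y"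
    have d: "norm (fst d) \<le> norm d" "norm (snd d) \<le> norm d" by (cases d, simp add: norm_fst_le norm_snd_le)+
    have "b s \<omega> x - b s \<omega> y = (- (transpose (cA p s \<omega>) *v fst d) + cQ2 p s \<omega> *v snd d, cA p s \<omega> *v snd d + feedback_matrix p s \<omega> *v fst d)"
      by (simp add: b_def d_def algebra_simps del: transpose_matrix_vector)
    then have "norm (b s \<omega> x - b s \<omega> y) \<le> norm (- (transpose (cA p s \<omega>) *v fst d) + cQ2 p s \<omega> *v snd d) + norm (cA p s \<omega> *v snd d + feedback_matrix p s \<omega> *v fst d)"
      using norm_Pair_add_le by metis
    also have "\<dots> \<le> (norm (transpose (cA p s \<omega>) *v fst d) + norm (cQ2 p s \<omega> *v snd d)) + (norm (cA p s \<omega> *v snd d) + norm (feedback_matrix p s \<omega> *v fst d))"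
      using norm_triangle_ineq[of "- (transpose (cA p s \<omega>) *v fst d)"] by (intro add_mono norm_triangle_ineq) (simp only: norm_minus_cancel)
    also have "\<dots> \<le> (ca * norm d + cq * norm d) + (ca * norm d + cb * (cr * (cb * norm d)))"
      unfolding feedback_mult using 1 d by (intro add_mono norm_mult_vec_le) (simp_all add: z norm_transpose)
    also have "\<dots> = (ca + cq + (ca + cb * (cr * cb))) * norm d" by (simp add: algebra_simps)
    also have "\<dots> \<le> L * norm d" unfolding L_def by (intro mult_right_mono) auto
    finally show "norm (b (fst z) (snd z) x - b (fst z) (snd z) y) \<le> L * norm (x - y)" by (simp add: z d_def)
  qed
  have lips: "AE z in time_prob (pM p) TT. \<forall>x y. norm (\<sigma> (fst z) (snd z) x - \<sigma> (fst z) (snd z) y) \<le> L * norm (x - y)"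
    using bds(2)
  proof (eventually_elim, intro allI)
    fix z :: "real \<times> 'a" and x y :: "(real^'n) \<times> (real^'n)" assume 1: "norm (case_prod (cC p) z) \<le> cc"
    obtain s \<omega> where z: "z = (s, \<omega>)" by (cases z)
    define d where "d = x - y"
    have "\<sigma> s \<omega> x - \<sigma> s \<omega> y = (- (transpose (cC p s \<omega>) *v fst d), 0)"
      by (simp add: \<sigma>_def d_def algebra_simps del: transpose_matrix_vector)
    then have "norm (\<sigma> s \<omega> x - \<sigma> s \<omega> y) = norm (transpose (cC p s \<omega>) *v fst d)" by (simp add: norm_Pair del: transpose_matrix_vector)
    also have "\<dots> \<le> cc * norm d" using 1 by (intro norm_mult_vec_le) (auto simp: z norm_transpose norm_fst_le[of "fst d" "snd d", simplified])
    also have "\<dots> \<le> L * norm d" unfolding L_def by (intro mult_right_mono) auto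
    finally show "norm (\<sigma> (fst z) (snd z) x - \<sigma> (fst z) (snd z) y) \<le> L * norm (x - y)" by (simp add: z d_def)
  qed
  have X0: "X 0 \<in> borel_measurable (pF p 0)" "sq_int (pM p) (X 0)"
    using X cont_sq_int[OF X] T_nonneg by (auto simp: cont_space_def L2_cont_def)
  have v: "v \<in> borel_measurable (pF p 0)" "sq_int (pM p) v"
  proof -
    show m: "v \<in> borel_measurable (pF p 0)"
      unfolding v_def[abs_def] by (intro borel_measurable_Pair matrix_vector_mult_measurable X0) auto
    show "sq_int (pM p) v"
      by (rule sq_int_bound[OF X0(2) measurable_F_M[OF m], where c = "norm (cH1 p)"])
        (simp add: v_def norm_Pair norm_matrix_vector_mult_le)
  qed
  obtain V where V: "V \<in> L2_cont (pM p) (pF p) TT" "AE \<omega> in pM p. V 0 \<omega> = v \<omega>"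
    "ito_process (pM p) (pF p) (pW p) TT V (\<lambda>s \<omega>. b s \<omega> (V s \<omega>)) (\<lambda>s \<omega>. \<sigma> s \<omega> (V s \<omega>))"
    by (rule sde_picard[OF T_nonneg(1) bP sP lipb lips v])
  define g0 where "g0 t \<omega> = fst (V t \<omega>)" for t \<omega>
  define h0 where "h0 t \<omega> = snd (V t \<omega>)" for t \<omega>
  have gh0: "g0 \<in> cont_space p" "h0 \<in> cont_space p"
    unfolding cont_space_def g0_def[abs_def] h0_def[abs_def]
    using L2_cont_bounded_linear[OF bounded_linear_fst T_nonneg(1) V(1)] L2_cont_bounded_linear[OF bounded_linear_snd T_nonneg(1) V(1)] by (simp_all only:)
  have g0: "g0 = (\<lambda>t \<omega>. fst (V t \<omega>))" and h0: "h0 = (\<lambda>t \<omega>. snd (V t \<omega>))" by (simp_all add: g0_def h0_def fun_eq_iff)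
  have ig: "sde p g0 (\<lambda>s \<omega>. - (transpose (cA p s \<omega>) *v g0 s \<omega>) + cQ2 p s \<omega> *v h0 s \<omega> + cQ1 p s \<omega> *v X s \<omega>)
      (\<lambda>s \<omega>. - (transpose (cC p s \<omega>) *v g0 s \<omega>) + cS1 p s \<omega> *v Z s \<omega>)"
    using ito_process_bounded_linear[OF bounded_linear_fst V(3)] by (simp only: sde_def b_def \<sigma>_def g0 h0 fst_conv snd_conv)
  have ih: "sde p h0 (\<lambda>s \<omega>. cA p s \<omega> *v h0 s \<omega> + feedback_matrix p s \<omega> *v g0 s \<omega>) (\<lambda>s \<omega>. 0)"
    using ito_process_bounded_linear[OF bounded_linear_snd V(3)] by (simp only: sde_def b_def \<sigma>_def g0 h0 fst_conv snd_conv)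
  \<comment> \<open>A state solution with control 0 and this terminal value cancels h at the final
    time. Since \<open>h0 0 = 0\<close>, its initial condition \<open>Y1 0 = cH2 p *v X1 0\<close>
    supplies exactly the missing coupling of g with h at time 0.\<close>
  have "(\<lambda>\<omega>. - h0 TT \<omega>) \<in> terminal_space p UNIV"
    using gh0(2) cont_sq_int[OF gh0(2)] T_nonneg by (auto simp: terminal_space_iff cont_space_def L2_cont_def intro!: sq_int_minus)
  moreover have "(\<lambda>s \<omega>. 0) \<in> control_space p" by (simp add: control_space_def PL2_intros)
  ultimately obtain Y1 X1 Z1 where S: "state_solution p (\<lambda>\<omega>. - h0 TT \<omega>) (\<lambda>s \<omega>. 0) Y1 X1 Z1"
    using state_solution_exists by blast
  note s = S[unfolded state_solution_def]
  have "adjoint X Z (\<lambda>t \<omega>. g0 t \<omega> + 1 *\<^sub>R Y1 t \<omega>) (\<lambda>t \<omega>. h0 t \<omega> + 1 *\<^sub>R X1 t \<omega>) Z1"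
    unfolding adjoint_def
  proof (intro conjI)
    show "(\<lambda>t \<omega>. g0 t \<omega> + 1 *\<^sub>R Y1 t \<omega>) \<in> cont_space p" "(\<lambda>t \<omega>. h0 t \<omega> + 1 *\<^sub>R X1 t \<omega>) \<in> cont_space p"
      using gh0 s by (auto simp only: cont_space_def intro!: L2_cont_add_scaleR[OF T_nonneg(1)])
    show "Z1 \<in> PL2" using s by simp
    have sY: "sde p Y1 (\<lambda>s \<omega>. - (transpose (cA p s \<omega>) *v Y1 s \<omega>) + cQ2 p s \<omega> *v X1 s \<omega>)
       (\<lambda>s \<omega>. - (transpose (cC p s \<omega>) *v Y1 s \<omega>) + cS2 p s \<omega> *v Z1 s \<omega>)" using s by simp
    have sX: "sde p X1 (\<lambda>s \<omega>. cA p s \<omega> *v X1 s \<omega> + cB1 p s \<omega> *v 0 + feedback_matrix p s \<omega> *v Y1 s \<omega> + cC p s \<omega> *v Z1 s \<omega>) Z1"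
      using s by simp
    show "sde p (\<lambda>t \<omega>. g0 t \<omega> + 1 *\<^sub>R Y1 t \<omega>)
       (\<lambda>s \<omega>. - (transpose (cA p s \<omega>) *v (g0 s \<omega> + 1 *\<^sub>R Y1 s \<omega>) - cQ1 p s \<omega> *v X s \<omega> - cQ2 p s \<omega> *v (h0 s \<omega> + 1 *\<^sub>R X1 s \<omega>)))
       (\<lambda>s \<omega>. - (transpose (cC p s \<omega>) *v (g0 s \<omega> + 1 *\<^sub>R Y1 s \<omega>) - cS1 p s \<omega> *v Z s \<omega> - cS2 p s \<omega> *v Z1 s \<omega>))"
      by (rule sde_add_scaleR[OF ig sY]) (simp_all add: matrix_vector_right_distrib del: transpose_matrix_vector)
    show "sde p (\<lambda>t \<omega>. h0 t \<omega> + 1 *\<^sub>R X1 t \<omega>)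
       (\<lambda>s \<omega>. cA p s \<omega> *v (h0 s \<omega> + 1 *\<^sub>R X1 s \<omega>) + feedback_matrix p s \<omega> *v (g0 s \<omega> + 1 *\<^sub>R Y1 s \<omega>) + cC p s \<omega> *v Z1 s \<omega>) Z1"
      by (rule sde_add_scaleR[OF ih sX]) (simp_all add: matrix_vector_right_distrib)
    have "AE \<omega> in pM p. Y1 0 \<omega> = cH2 p *v X1 0 \<omega>" "AE \<omega> in pM p. X1 TT \<omega> = - h0 TT \<omega>" using s by auto
    then show "AE \<omega> in pM p. g0 0 \<omega> + 1 *\<^sub>R Y1 0 \<omega> = cH1 p *v X 0 \<omega> + cH2 p *v (h0 0 \<omega> + 1 *\<^sub>R X1 0 \<omega>)"
      "AE \<omega> in pM p. h0 TT \<omega> + 1 *\<^sub>R X1 TT \<omega> = 0"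
      using V(2) by (eventually_elim, simp add: g0_def h0_def v_def)+
  qed
  then show thesis by (rule that)
qed

lemma expectation_cong_AE:
  assumes "sq_int (pM p) f" "sq_int (pM p) f'" "sq_int (pM p) g" "AE \<omega> in pM p. f \<omega> = f' \<omega>"
  shows "expectation (\<lambda>\<omega>. f \<omega> \<bullet> g \<omega>) = expectation (\<lambda>\<omega>. f' \<omega> \<bullet> g \<omega>)" "expectation (\<lambda>\<omega>. g \<omega> \<bullet> f \<omega>) = expectation (\<lambda>\<omega>. g \<omega> \<bullet> f' \<omega>)"
proof -
  show "expectation (\<lambda>\<omega>. f \<omega> \<bullet> g \<omega>) = expectation (\<lambda>\<omega>. f' \<omega> \<bullet> g \<omega>)"
    by (rule integral_cong_AE[OF borel_measurable_inner borel_measurable_inner]; (rule sq_int_measurable; fact)?) (use assms(4) in \<open>eventually_elim; simp\<close>)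
  then show "expectation (\<lambda>\<omega>. g \<omega> \<bullet> f \<omega>) = expectation (\<lambda>\<omega>. g \<omega> \<bullet> f' \<omega>)" by (simp add: inner_commute)
qed

text \<open>The adjoint is designed so that, in the difference of the product rules for <g, X'> and
  <h, Y'>, the pairings with A, C, Q2, S2 and the feedback matrix cancel by transposition and
  symmetry. The dependence on the state variation is thereby traded for pairings with eta and
  v.\<close>

lemma duality:
  assumes A: "adjoint X Z g h q" and X: "X \<in> cont_space p" and Z: "Z \<in> PL2"
    and S: "state_solution p \<eta> v Y' X' Z'" and v: "v \<in> PL2" and \<eta>: "sq_int (pM p) \<eta>"
  shows "tip TT (\<lambda>s \<omega>. cQ1 p s \<omega> *v X s \<omega>) X' + tip TT (\<lambda>s \<omega>. cS1 p s \<omega> *v Z s \<omega>) Z' + expectation (\<lambda>\<omega>. (cH1 p *v X 0 \<omega>) \<bullet> X' 0 \<omega>)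
    = expectation (\<lambda>\<omega>. g TT \<omega> \<bullet> \<eta> \<omega>) - tip TT (\<lambda>s \<omega>. transpose (cB1 p s \<omega>) *v g s \<omega>) v"
proof -
  note a = A[unfolded adjoint_def] and s = S[unfolded state_solution_def]
  have c: "g \<in> cont_space p" "h \<in> cont_space p" "Y' \<in> cont_space p" "X' \<in> cont_space p" using a s by auto
  have m: "g \<in> PL2" "h \<in> PL2" "q \<in> PL2" "Y' \<in> PL2" "X' \<in> PL2" "Z' \<in> PL2" "X \<in> PL2"
    using a s c X cont_PL2 by auto
  have cl: "g \<in> L2_cont (pM p) (pF p) TT" "h \<in> L2_cont (pM p) (pF p) TT" "Y' \<in> L2_cont (pM p) (pF p) TT" "X' \<in> L2_cont (pM p) (pF p) TT"
    using c by (auto simp: cont_space_def)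
  note T = T_nonneg(1)
  let ?AT = "\<lambda>f s \<omega>. transpose (cA p s \<omega>) *v f s \<omega>" and ?A = "\<lambda>f s \<omega>. cA p s \<omega> *v f s \<omega>"
  let ?CT = "\<lambda>f s \<omega>. transpose (cC p s \<omega>) *v f s \<omega>" and ?C = "\<lambda>f s \<omega>. cC p s \<omega> *v f s \<omega>"
  let ?Q1 = "\<lambda>f s \<omega>. cQ1 p s \<omega> *v f s \<omega>" and ?Q2 = "\<lambda>f s \<omega>. cQ2 p s \<omega> *v f s \<omega>"
  let ?S1 = "\<lambda>f s \<omega>. cS1 p s \<omega> *v f s \<omega>" and ?S2 = "\<lambda>f s \<omega>. cS2 p s \<omega> *v f s \<omega>"
  let ?N = "\<lambda>f s \<omega>. feedback_matrix p s \<omega> *v f s \<omega>" and ?B = "\<lambda>f s \<omega>. cB1 p s \<omega> *v f s \<omega>"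
  have P: "?AT g \<in> PL2" "?CT g \<in> PL2" "?Q1 X \<in> PL2" "?Q2 h \<in> PL2" "?S1 Z \<in> PL2" "?S2 q \<in> PL2" "?A X' \<in> PL2" "?B v \<in> PL2" "?N Y' \<in> PL2" "?C Z' \<in> PL2"
    "?A h \<in> PL2" "?N g \<in> PL2" "?C q \<in> PL2" "?AT Y' \<in> PL2" "?Q2 X' \<in> PL2" "?CT Y' \<in> PL2" "?S2 Z' \<in> PL2"
    by (intro PL2_intros m Z v)+
  have bg: "(\<lambda>s \<omega>. - (?AT g s \<omega> - ?Q1 X s \<omega> - ?Q2 h s \<omega>)) \<in> PL2" and bX: "(\<lambda>s \<omega>. ?A X' s \<omega> + ?B v s \<omega> + ?N Y' s \<omega> + ?C Z' s \<omega>) \<in> PL2"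
    and bh: "(\<lambda>s \<omega>. ?A h s \<omega> + ?N g s \<omega> + ?C q s \<omega>) \<in> PL2" and bY: "(\<lambda>s \<omega>. - ?AT Y' s \<omega> + ?Q2 X' s \<omega>) \<in> PL2"
    by (intro L2_proc_add[OF T] L2_proc_diff[OF T] L2_proc_minus[OF T] P)+
  have sg: "ito_process (pM p) (pF p) (pW p) TT g (\<lambda>s \<omega>. - (?AT g s \<omega> - ?Q1 X s \<omega> - ?Q2 h s \<omega>)) (\<lambda>s \<omega>. - (?CT g s \<omega> - ?S1 Z s \<omega> - ?S2 q s \<omega>))"
    and sX: "ito_process (pM p) (pF p) (pW p) TT X' (\<lambda>s \<omega>. ?A X' s \<omega> + ?B v s \<omega> + ?N Y' s \<omega> + ?C Z' s \<omega>) Z'"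
    and sh: "ito_process (pM p) (pF p) (pW p) TT h (\<lambda>s \<omega>. ?A h s \<omega> + ?N g s \<omega> + ?C q s \<omega>) q"
    and sY: "ito_process (pM p) (pF p) (pW p) TT Y' (\<lambda>s \<omega>. - ?AT Y' s \<omega> + ?Q2 X' s \<omega>) (\<lambda>s \<omega>. - ?CT Y' s \<omega> + ?S2 Z' s \<omega>)"
    using a s by (auto simp: sde_def)
  have e1: "expectation (\<lambda>\<omega>. g TT \<omega> \<bullet> X' TT \<omega>) - expectation (\<lambda>\<omega>. g 0 \<omega> \<bullet> X' 0 \<omega>)
     = tip TT (\<lambda>s \<omega>. - (?AT g s \<omega> - ?Q1 X s \<omega> - ?Q2 h s \<omega>)) X' + tip TT g (\<lambda>s \<omega>. ?A X' s \<omega> + ?B v s \<omega> + ?N Y' s \<omega> + ?C Z' s \<omega>)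
       + tip TT (\<lambda>s \<omega>. - (?CT g s \<omega> - ?S1 Z s \<omega> - ?S2 q s \<omega>)) Z'"
    using ito_product_expectation[OF T cl(1) sg bg cl(4) sX bX] by (simp only: tip_def)
  have e2: "expectation (\<lambda>\<omega>. h TT \<omega> \<bullet> Y' TT \<omega>) - expectation (\<lambda>\<omega>. h 0 \<omega> \<bullet> Y' 0 \<omega>)
     = tip TT (\<lambda>s \<omega>. ?A h s \<omega> + ?N g s \<omega> + ?C q s \<omega>) Y' + tip TT h (\<lambda>s \<omega>. - ?AT Y' s \<omega> + ?Q2 X' s \<omega>)
       + tip TT q (\<lambda>s \<omega>. - ?CT Y' s \<omega> + ?S2 Z' s \<omega>)"
    using ito_product_expectation[OF T cl(2) sh bh cl(3) sY bY] by (simp only: tip_def)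
  note ex = tip_add[OF T] tip_diff[OF T] tip_minus L2_proc_add[OF T] L2_proc_diff[OF T] L2_proc_minus[OF T] P m Z v
  have r1: "tip TT (\<lambda>s \<omega>. - (?AT g s \<omega> - ?Q1 X s \<omega> - ?Q2 h s \<omega>)) X' = - (tip TT (?AT g) X' - tip TT (?Q1 X) X' - tip TT (?Q2 h) X')"
    by (simp only: ex)
  have r2: "tip TT g (\<lambda>s \<omega>. ?A X' s \<omega> + ?B v s \<omega> + ?N Y' s \<omega> + ?C Z' s \<omega>) = tip TT g (?A X') + tip TT g (?B v) + tip TT g (?N Y') + tip TT g (?C Z')"
    by (simp only: ex)
  have r3: "tip TT (\<lambda>s \<omega>. - (?CT g s \<omega> - ?S1 Z s \<omega> - ?S2 q s \<omega>)) Z' = - (tip TT (?CT g) Z' - tip TT (?S1 Z) Z' - tip TT (?S2 q) Z')"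
    by (simp only: ex)
  have r4: "tip TT (\<lambda>s \<omega>. ?A h s \<omega> + ?N g s \<omega> + ?C q s \<omega>) Y' = tip TT (?A h) Y' + tip TT (?N g) Y' + tip TT (?C q) Y'"
    by (simp only: ex)
  have r5: "tip TT h (\<lambda>s \<omega>. - ?AT Y' s \<omega> + ?Q2 X' s \<omega>) = - tip TT h (?AT Y') + tip TT h (?Q2 X')"
    by (simp only: ex)
  have r6: "tip TT q (\<lambda>s \<omega>. - ?CT Y' s \<omega> + ?S2 Z' s \<omega>) = - tip TT q (?CT Y') + tip TT q (?S2 Z')"
    by (simp only: ex)
  have t: "tip TT (?AT g) X' = tip TT g (?A X')" "tip TT (?CT g) Z' = tip TT g (?C Z')" "tip TT (?A h) Y' = tip TT h (?AT Y')"
    "tip TT (?C q) Y' = tip TT q (?CT Y')" "tip TT g (?B v) = tip TT (\<lambda>s \<omega>. transpose (cB1 p s \<omega>) *v g s \<omega>) v"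
    using tip_transpose[of TT "cA p" X' g] tip_transpose[of TT "cC p" Z' g] tip_transpose[of TT "cA p" h Y'] tip_transpose[of TT "cC p" q Y'] tip_transpose[of TT "cB1 p" v g]
    by (simp_all only: tip_commute)
  have y: "tip TT (?Q2 h) X' = tip TT h (?Q2 X')" "tip TT (?S2 q) Z' = tip TT q (?S2 Z')" "tip TT (?N g) Y' = tip TT g (?N Y')"
    by (intro tip_symmetric T coefficients m feedback_symmetric)+
  have sq: "sq_int (pM p) (g TT)" "sq_int (pM p) (g 0)" "sq_int (pM p) (h TT)" "sq_int (pM p) (h 0)" "sq_int (pM p) (Y' TT)" "sq_int (pM p) (Y' 0)"
    "sq_int (pM p) (X' TT)" "sq_int (pM p) (X' 0)" "sq_int (pM p) (X 0)"
    by (intro cont_sq_int c X T_nonneg)+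
  have b1: "expectation (\<lambda>\<omega>. g TT \<omega> \<bullet> X' TT \<omega>) = expectation (\<lambda>\<omega>. g TT \<omega> \<bullet> \<eta> \<omega>)"
    using s by (intro expectation_cong_AE(2)[OF sq(7) \<eta> sq(1)]) auto
  have b2: "expectation (\<lambda>\<omega>. h TT \<omega> \<bullet> Y' TT \<omega>) = 0"
    using expectation_cong_AE(1)[OF sq(3) sq_int_zero sq(5)] a by simp
  have b3: "expectation (\<lambda>\<omega>. h 0 \<omega> \<bullet> Y' 0 \<omega>) = expectation (\<lambda>\<omega>. (cH2 p *v h 0 \<omega>) \<bullet> X' 0 \<omega>)"
    using s expectation_cong_AE(2)[OF sq(6) mat_sq_int[OF sq(8), of "cH2 p"] sq(4)] by (simp add: H_symmetric)
  have b4: "expectation (\<lambda>\<omega>. g 0 \<omega> \<bullet> X' 0 \<omega>) = expectation (\<lambda>\<omega>. (cH1 p *v X 0 \<omega>) \<bullet> X' 0 \<omega>) + expectation (\<lambda>\<omega>. (cH2 p *v h 0 \<omega>) \<bullet> X' 0 \<omega>)"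
  proof -
    note hs = mat_sq_int[OF sq(9), of "cH1 p"] mat_sq_int[OF sq(4), of "cH2 p"]
    have "expectation (\<lambda>\<omega>. g 0 \<omega> \<bullet> X' 0 \<omega>) = expectation (\<lambda>\<omega>. (cH1 p *v X 0 \<omega> + cH2 p *v h 0 \<omega>) \<bullet> X' 0 \<omega>)"
      using a by (intro expectation_cong_AE(1)[OF sq(2) sq_int_add[OF hs] sq(8)]) auto
    then show ?thesis using sq_int_inner[OF hs(1) sq(8)] sq_int_inner[OF hs(2) sq(8)] by (simp add: inner_add_left)
  qed
  show ?thesis using e1 e2 unfolding r1 r2 r3 r4 r5 r6 t y b1 b2 b3 b4 by linarith
qed

text \<open>The directional derivative of the cost at (xi, u) along (eta, v) when g is the adjoint
  process of the state of (xi, u).\<close>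

definition grad :: "('a \<Rightarrow> real^'n) \<Rightarrow> (real \<Rightarrow> 'a \<Rightarrow> real^'m1) \<Rightarrow> (real \<Rightarrow> 'a \<Rightarrow> real^'n) \<Rightarrow> ('a \<Rightarrow> real^'n) \<Rightarrow> (real \<Rightarrow> 'a \<Rightarrow> real^'m1) \<Rightarrow> real" where
  "grad \<xi> u g \<eta> v = expectation (\<lambda>\<omega>. (cG1 p \<omega> *v \<xi> \<omega> + g TT \<omega>) \<bullet> \<eta> \<omega>)
     + tip TT (\<lambda>s \<omega>. cR11 p s \<omega> *v u s \<omega> - transpose (cB1 p s \<omega>) *v g s \<omega>) v"

lemma cost_variation:
  assumes xi: "\<xi> \<in> terminal_space p UNIV" "\<eta> \<in> terminal_space p UNIV" and u: "u \<in> control_space p" "v \<in> control_space p"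
    and S: "state_solution p \<xi> u Y X Z" and A: "adjoint X Z g h q"
  shows "cost p (\<lambda>\<omega>. \<xi> \<omega> + c *\<^sub>R \<eta> \<omega>) (\<lambda>s \<omega>. u s \<omega> + c *\<^sub>R v s \<omega>)
    = cost p \<xi> u + c * grad \<xi> u g \<eta> v + c\<^sup>2 * cost p \<eta> v"
proof -
  obtain Y' X' Z' where S': "state_solution p \<eta> v Y' X' Z'" using state_solution_exists[OF xi(2) u(2)] by blast
  have m: "X \<in> cont_space p" "Z \<in> PL2" "u \<in> PL2" "v \<in> PL2" "g \<in> cont_space p"
    using S A u by (auto simp: state_solution_def control_space_def adjoint_def)
  have s: "sq_int (pM p) \<xi>" "sq_int (pM p) \<eta>" "sq_int (pM p) (g TT)"
    using xi cont_sq_int[OF m(5) T_nonneg(3)] by (auto simp: terminal_space_iff)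
  have P: "(\<lambda>s \<omega>. cR11 p s \<omega> *v u s \<omega>) \<in> PL2" "(\<lambda>s \<omega>. transpose (cB1 p s \<omega>) *v g s \<omega>) \<in> PL2"
    by (intro PL2_intros m cont_PL2)+
  have "form \<xi> X Z u \<eta> X' Z' v = grad \<xi> u g \<eta> v"
    unfolding form_def grad_def tip_diff[OF T_nonneg(1) P m(4)]
    using duality[OF A m(1,2) S' m(4) s(2)] sq_int_inner[OF G1_sq_int[OF s(1)] s(2)] sq_int_inner[OF s(3,2)]
    by (simp add: inner_add_left del: transpose_matrix_vector)
  then show ?thesis using cost_expansion[OF xi u S S', of c] by simp
qed

end

section \<open>Lagrange multipliers and the optimality system\<close>

text \<open>A separation argument on the real line. Processes carry no vector space type here, so
  convexity of D is replaced by a point that lies below the chord in J and exactly on it in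
  c.\<close>

lemma multiplier_exists:
  fixes J c :: "'d \<Rightarrow> real"
  assumes conv: "\<And>x y t. x \<in> D \<Longrightarrow> y \<in> D \<Longrightarrow> 0 \<le> t \<Longrightarrow> t \<le> 1 \<Longrightarrow>
      \<exists>z\<in>D. J z \<le> (1 - t) * J x + t * J y \<and> c z = (1 - t) * c x + t * c y"
    and slater: "x0 \<in> D" "c x0 < 0"
    and bound: "\<And>x. x \<in> D \<Longrightarrow> c x \<le> 0 \<Longrightarrow> m \<le> J x"
  obtains l where "0 \<le> l" "\<And>x. x \<in> D \<Longrightarrow> m \<le> J x + l * c x"
proof -
  have slope: "(m - J x) / c x \<le> (J y - m) / - c y" if xy: "x \<in> D" "y \<in> D" "0 < c x" "c y < 0" for x y
  proof -
    \<comment> \<open>The weight at which the chord from x to y crosses c = 0; the point found there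
      satisfies the constraint.\<close>
    define t where "t = c x / (c x - c y)"
    have t: "0 \<le> t" "t \<le> 1" using xy by (auto simp: t_def field_simps)
    have t1: "1 - t = - c y / (c x - c y)" using xy by (simp add: t_def field_simps)
    obtain z where z: "z \<in> D" "J z \<le> (1 - t) * J x + t * J y" "c z = (1 - t) * c x + t * c y"
      using conv[OF xy(1,2) t] by blast
    have "c z = 0" unfolding z(3) t1 t_def using xy by (simp add: field_simps)
    then have "m \<le> (1 - t) * J x + t * J y" using bound[OF z(1)] z(2) by simp
    also have "\<dots> = (- c y * J x + c x * J y) / (c x - c y)" by (simp only: t1) (simp add: t_def add_divide_distrib diff_divide_distrib)
    finally have "m * (c x - c y) \<le> - c y * J x + c x * J y" using xy by (simp add: pos_le_divide_eq)
    then show ?thesis using xy by (simp add: field_simps)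
  qed
  \<comment> \<open>Inserting 0 makes the supremum nonnegative and the set nonempty. Its upper
    bounds come from points with strict slack, where m <= J y also covers the entry 0.\<close>
  define S where "S = insert 0 ((\<lambda>x. (m - J x) / c x) ` {x \<in> D. 0 < c x})"
  have ub: "s \<le> (J y - m) / - c y" if "s \<in> S" "y \<in> D" "c y < 0" for s y
    using that slope[of _ y] bound[of y] by (auto simp: S_def divide_nonneg_neg[of "J y - m" "c y"])
  have bdd: "bdd_above S" using ub[OF _ slater] by (auto simp: bdd_above_def)
  show thesis
  proof (rule that)
    show "0 \<le> Sup S" by (rule cSup_upper[OF _ bdd]) (simp add: S_def)
    fix x assume x: "x \<in> D"
    consider "0 < c x" | "c x = 0" | "c x < 0" by linarith
    then show "m \<le> J x + Sup S * c x"
    proof cases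
      case 1
      then have "(m - J x) / c x \<le> Sup S" using x by (intro cSup_upper[OF _ bdd]) (auto simp: S_def)
      then show ?thesis using 1 by (simp add: field_simps)
    next
      case 3
      have "Sup S \<le> (J x - m) / - c x" by (rule cSup_least) (use ub[OF _ x 3] in \<open>auto simp: S_def\<close>)
      then show ?thesis using 3 by (simp add: field_simps)
    qed (use bound[OF x] in simp)
  qed
qed

lemma nonneg_of_small_slopes:
  fixes a Q :: real
  assumes "\<And>t. 0 < t \<Longrightarrow> t \<le> 1 \<Longrightarrow> 0 \<le> t * a + t\<^sup>2 * Q"
  shows "0 \<le> a"
proof (rule ccontr)
  assume "\<not> 0 \<le> a"
  \<comment> \<open>Small enough that t |Q| <= - a / 2, so the quadratic term cannot compensate a
    negative slope; the 1 in the denominator covers Q = 0.\<close>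
  define t where "t = min 1 (- a / (2 * (1 + \<bar>Q\<bar>)))"
  have "t \<le> - a / (2 * (1 + \<bar>Q\<bar>))" by (simp add: t_def)
  then have "t * (2 * (1 + \<bar>Q\<bar>)) \<le> - a" by (subst (asm) pos_le_divide_eq) auto
  moreover have "0 < - a / (2 * (1 + \<bar>Q\<bar>))" using \<open>\<not> 0 \<le> a\<close> by (intro divide_pos_pos) auto
  ultimately have t: "0 < t" "t \<le> 1" "t * (1 + \<bar>Q\<bar>) \<le> - a / 2"
    by (auto simp: t_def algebra_simps)
  have "0 \<le> t * (a + t * Q)" using assms[OF t(1,2)] by (simp add: power2_eq_square algebra_simps)
  then have "0 \<le> a + t * Q" using t by (simp add: zero_le_mult_iff)
  moreover have "t * Q \<le> t * (1 + \<bar>Q\<bar>)" using t by (intro mult_left_mono) auto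
  ultimately show False using t \<open>\<not> 0 \<le> a\<close> by linarith
qed

section \<open>Segments of terminal values and weak duality\<close>

context lq
begin

lemma K_props: "cK p \<noteq> {}" "closed (cK p)" "convex (cK p)"
  using standing by (auto simp: standing_assumptions_def)

lemma expectation_inner: "sq_int (pM p) \<xi> \<Longrightarrow> expectation (\<lambda>\<omega>. a \<bullet> \<xi> \<omega>) = a \<bullet> expectation \<xi>" for \<xi> :: "'a \<Rightarrow> real^'n"
  using sq_int_integrable_finite[OF finite_measure_axioms] by (intro integral_inner_right) blast

lemma admissible_iff: "\<xi> \<in> admissible_terminal p \<longleftrightarrow> \<xi> \<in> terminal_space p (cK p) \<and> cbeta p \<le> expectation (\<lambda>\<omega>. calpha p \<bullet> \<xi> \<omega>)"
  by (auto simp: admissible_terminal_def terminal_space_iff expectation_inner)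

lemma const_terminal: "k \<in> V \<Longrightarrow> (\<lambda>\<omega>. k) \<in> terminal_space p V"
  by (auto simp: terminal_space_iff intro: sq_int_const finite_measure_axioms)

lemma diff_terminal:
  assumes "\<xi> \<in> terminal_space p V" "\<xi>' \<in> terminal_space p V'"
  shows "(\<lambda>\<omega>. \<xi>' \<omega> - \<xi> \<omega>) \<in> terminal_space p UNIV"
  using assms by (auto simp: terminal_space_iff intro!: sq_int_diff borel_measurable_diff)

lemma segment_terminal:
  assumes x: "\<xi> \<in> terminal_space p (cK p)" "\<xi>' \<in> terminal_space p (cK p)" and t: "0 \<le> t" "t \<le> 1"
  shows "(\<lambda>\<omega>. \<xi> \<omega> + t *\<^sub>R (\<xi>' \<omega> - \<xi> \<omega>)) \<in> terminal_space p (cK p)"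
  unfolding terminal_space_iff
proof (intro conjI)
  have "AE \<omega> in pM p. \<xi> \<omega> \<in> cK p" "AE \<omega> in pM p. \<xi>' \<omega> \<in> cK p" using x by (auto simp: terminal_space_iff)
  then show "AE \<omega> in pM p. \<xi> \<omega> + t *\<^sub>R (\<xi>' \<omega> - \<xi> \<omega>) \<in> cK p"
  proof eventually_elim
    case (elim \<omega>)
    have "\<xi> \<omega> + t *\<^sub>R (\<xi>' \<omega> - \<xi> \<omega>) = (1 - t) *\<^sub>R \<xi> \<omega> + t *\<^sub>R \<xi>' \<omega>" by (simp add: algebra_simps)
    then show ?case using convexD_alt[OF K_props(3) elim t] by simp
  qed
qed (use x in \<open>auto simp: terminal_space_iff intro!: sq_int_add sq_int_scaleR sq_int_diff borel_measurable_add borel_measurable_scaleR borel_measurable_diff\<close>)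

lemma expectation_segment:
  assumes x: "\<xi> \<in> terminal_space p V" "\<xi>' \<in> terminal_space p V'"
  shows "expectation (\<lambda>\<omega>. a \<bullet> (\<xi> \<omega> + t *\<^sub>R (\<xi>' \<omega> - \<xi> \<omega>))) = (1 - t) * expectation (\<lambda>\<omega>. a \<bullet> \<xi> \<omega>) + t * expectation (\<lambda>\<omega>. a \<bullet> \<xi>' \<omega>)"
proof -
  have i: "integrable (pM p) \<xi>" "integrable (pM p) \<xi>'" using x by (auto simp: terminal_space_iff intro: sq_int_integrable_finite finite_measure_axioms)
  show ?thesis using i by (simp add: inner_add_right inner_diff_right algebra_simps)
qed

lemma cost_quadratic:
  assumes "\<xi> \<in> terminal_space p UNIV" "\<eta> \<in> terminal_space p UNIV" "u \<in> control_space p" "v \<in> control_space p"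
  obtains G where "\<And>c. cost p (\<lambda>\<omega>. \<xi> \<omega> + c *\<^sub>R \<eta> \<omega>) (\<lambda>s \<omega>. u s \<omega> + c *\<^sub>R v s \<omega>) = cost p \<xi> u + c * G + c\<^sup>2 * cost p \<eta> v"
proof -
  obtain Y X Z where S: "state_solution p \<xi> u Y X Z" using state_solution_exists[OF assms(1,3)] by blast
  obtain Y' X' Z' where S': "state_solution p \<eta> v Y' X' Z'" using state_solution_exists[OF assms(2,4)] by blast
  show thesis by (rule that) (rule cost_expansion[OF assms S S'])
qed

lemma weak_duality:
  assumes "0 \<le> l" shows "dual_function p l \<le> optimal_value p"
  unfolding optimal_value_def
proof (rule INF_greatest, clarify)
  fix \<xi> u assume x: "\<xi> \<in> admissible_terminal p" "u \<in> control_space p"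
  have "dual_function p l \<le> ereal (lagrangian p l \<xi> u)"
    unfolding dual_function_def by (rule INF_lower2[of "(\<xi>, u)"]) (use x in \<open>auto simp: admissible_iff\<close>)
  also have "lagrangian p l \<xi> u \<le> cost p \<xi> u"
    using x mult_nonneg_nonpos[OF assms, of "cbeta p - expectation (\<lambda>\<omega>. calpha p \<bullet> \<xi> \<omega>)"] by (simp add: lagrangian_def admissible_iff)
  finally show "dual_function p l \<le> ereal (cost p \<xi> u)" by simp
qed

end

section \<open>Nonnegative second variation and existence of the multiplier\<close>

locale convex_lq = lq p for p :: "('a, 'n::finite, 'm1::finite, 'm2::finite) lq_problem" +
  assumes slater: "ereal (cbeta p) < support_fun (cK p) (calpha p)"
    and convex_problem: "problem_convex p"
    and finite_problem: "problem_finite p"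
begin

lemma slater_point:
  obtains k where "k \<in> cK p" "cbeta p < calpha p \<bullet> k"
  using slater unfolding support_fun_def less_SUP_iff by auto

text \<open>Convexity is only assumed on the admissible set; shrinking towards the Slater point
  moves any two points of the larger set into the admissible one.\<close>

lemma cost_diff_nonneg:
  assumes x: "\<xi> \<in> terminal_space p (cK p)" "\<xi>' \<in> terminal_space p (cK p)" and u: "u \<in> control_space p" "u' \<in> control_space p"
  shows "0 \<le> cost p (\<lambda>\<omega>. \<xi>' \<omega> - \<xi> \<omega>) (\<lambda>s \<omega>. u' s \<omega> - u s \<omega>)"
proof -
  obtain k where k: "k \<in> cK p" "cbeta p < calpha p \<bullet> k" by (rule slater_point)
  have kt: "(\<lambda>\<omega>. k) \<in> terminal_space p (cK p)" by (rule const_terminal[OF k(1)])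
  define \<delta> where "\<delta> = calpha p \<bullet> k - cbeta p"
  define a where "a \<zeta> = \<bar>expectation (\<lambda>\<omega>. calpha p \<bullet> \<zeta> \<omega>) - calpha p \<bullet> k\<bar>" for \<zeta>
  \<comment> \<open>The Slater point has slack \<open>\<delta>\<close>; moving from it towards
    either point by this fraction loses at most \<open>\<delta>\<close>, so both shrunk points
    remain admissible.\<close>
  define \<epsilon> where "\<epsilon> = \<delta> / (\<delta> + a \<xi> + a \<xi>')"
  have d: "0 < \<delta>" "0 \<le> a \<xi>" "0 \<le> a \<xi>'" using k by (auto simp: \<delta>_def a_def)
  have e: "0 < \<epsilon>" "\<epsilon> \<le> 1" using d by (auto simp: \<epsilon>_def field_simps)
  have e2: "\<epsilon> * a \<xi> \<le> \<delta>" "\<epsilon> * a \<xi>' \<le> \<delta>"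
  proof -
    have "\<delta> * a \<xi> \<le> \<delta> * (\<delta> + a \<xi> + a \<xi>')" "\<delta> * a \<xi>' \<le> \<delta> * (\<delta> + a \<xi> + a \<xi>')" using d by (intro mult_left_mono; simp)+
    then show "\<epsilon> * a \<xi> \<le> \<delta>" "\<epsilon> * a \<xi>' \<le> \<delta>" using d by (auto simp: \<epsilon>_def field_simps)
  qed
  have adm: "(\<lambda>\<omega>. k + \<epsilon> *\<^sub>R (\<zeta> \<omega> - k)) \<in> admissible_terminal p" if z: "\<zeta> \<in> terminal_space p (cK p)" "\<epsilon> * a \<zeta> \<le> \<delta>" for \<zeta>
  proof -
    have "- (\<epsilon> * a \<zeta>) \<le> \<epsilon> * (expectation (\<lambda>\<omega>. calpha p \<bullet> \<zeta> \<omega>) - calpha p \<bullet> k)"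
      using e mult_left_mono[of "- a \<zeta>" "expectation (\<lambda>\<omega>. calpha p \<bullet> \<zeta> \<omega>) - calpha p \<bullet> k" \<epsilon>] by (simp add: a_def)
    then have "cbeta p \<le> (1 - \<epsilon>) * (calpha p \<bullet> k) + \<epsilon> * expectation (\<lambda>\<omega>. calpha p \<bullet> \<zeta> \<omega>)"
      using z(2) by (simp add: \<delta>_def algebra_simps)
    then show ?thesis using segment_terminal[OF kt z(1)] e expectation_segment[OF kt z(1), of "calpha p" \<epsilon>]
      by (simp add: admissible_iff prob_space)
  qed
  let ?x = "\<lambda>\<omega>. k + \<epsilon> *\<^sub>R (\<xi> \<omega> - k)" and ?x' = "\<lambda>\<omega>. k + \<epsilon> *\<^sub>R (\<xi>' \<omega> - k)"
  let ?d = "\<lambda>\<omega>. \<xi>' \<omega> - \<xi> \<omega>" and ?v = "\<lambda>s \<omega>. u' s \<omega> - u s \<omega>"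
  have v: "?v \<in> control_space p" using u by (simp add: control_space_def L2_proc_diff[OF T_nonneg(1)])
  have ut: "(\<lambda>s \<omega>. u s \<omega> + \<epsilon> *\<^sub>R ?v s \<omega>) \<in> control_space p"
    using u(1) v by (simp only: control_space_def L2_proc_add_scaleR[OF T_nonneg(1)])
  have "?x \<in> terminal_space p UNIV" using adm[OF x(1) e2(1)] terminal_UNIV by (auto simp: admissible_iff)
  then obtain G where G: "\<And>c. cost p (\<lambda>\<omega>. ?x \<omega> + c *\<^sub>R ?d \<omega>) (\<lambda>s \<omega>. u s \<omega> + c *\<^sub>R ?v s \<omega>) = cost p ?x u + c * G + c\<^sup>2 * cost p ?d ?v"
    using cost_quadratic[OF _ diff_terminal[OF x] u(1) v] by blast
  \<comment> \<open>Midpoint convexity between the shrunk points, with controls u and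
    \<open>u + \<epsilon> v\<close>. Their difference is \<open>\<epsilon>\<close> times the
    original one, in the terminal value and in the control.\<close>
  have "cost p (\<lambda>\<omega>. (1/2) *\<^sub>R ?x' \<omega> + (1 - 1/2) *\<^sub>R ?x \<omega>) (\<lambda>s \<omega>. (1/2) *\<^sub>R (u s \<omega> + \<epsilon> *\<^sub>R ?v s \<omega>) + (1 - 1/2) *\<^sub>R u s \<omega>)
      \<le> 1/2 * cost p ?x' (\<lambda>s \<omega>. u s \<omega> + \<epsilon> *\<^sub>R ?v s \<omega>) + (1 - 1/2) * cost p ?x u"
    using convex_problem adm[OF x(1) e2(1)] adm[OF x(2) e2(2)] u(1) ut unfolding problem_convex_def
    by (elim ballE[where x = "1/2::real"] ballE[where x = ?x] ballE[where x = ?x'] ballE[where x = u] ballE[where x = "\<lambda>s \<omega>. u s \<omega> + \<epsilon> *\<^sub>R ?v s \<omega>"]) auto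
  moreover have "(\<lambda>\<omega>. (1/2) *\<^sub>R ?x' \<omega> + (1 - 1/2) *\<^sub>R ?x \<omega>) = (\<lambda>\<omega>. ?x \<omega> + (\<epsilon>/2) *\<^sub>R ?d \<omega>)"
    by (rule ext) (simp add: vec_eq_iff field_simps)
  moreover have "(\<lambda>s \<omega>. (1/2) *\<^sub>R (u s \<omega> + \<epsilon> *\<^sub>R ?v s \<omega>) + (1 - 1/2) *\<^sub>R u s \<omega>) = (\<lambda>s \<omega>. u s \<omega> + (\<epsilon>/2) *\<^sub>R ?v s \<omega>)"
    by (intro ext) (simp add: vec_eq_iff field_simps)
  moreover have "?x' = (\<lambda>\<omega>. ?x \<omega> + \<epsilon> *\<^sub>R ?d \<omega>)" by (rule ext) (simp add: algebra_simps)
  ultimately have "cost p ?x u + \<epsilon>/2 * G + (\<epsilon>/2)\<^sup>2 * cost p ?d ?v \<le> 1/2 * (cost p ?x u + \<epsilon> * G + \<epsilon>\<^sup>2 * cost p ?d ?v) + 1/2 * cost p ?x u"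
    by (simp only: G) simp
  \<comment> \<open>The linear terms cancel, and comparing the quadratic ones, 1/4 against 1/2,
    leaves the sign.\<close>
  then have "0 \<le> \<epsilon>\<^sup>2 * cost p ?d ?v" by (simp add: power_divide field_simps)
  then show ?thesis using e by (simp add: zero_le_mult_iff)
qed

lemma kt_coefficient_exists: obtains l where "kt_coefficient p l"
proof -
  obtain k where k: "k \<in> cK p" "cbeta p < calpha p \<bullet> k" by (rule slater_point)
  have zero: "(\<lambda>s \<omega>. 0) \<in> control_space p" by (simp add: control_space_def PL2_intros)
  have kt: "(\<lambda>\<omega>. k) \<in> terminal_space p (cK p)" by (rule const_terminal[OF k(1)])
  have "(\<lambda>\<omega>. k) \<in> admissible_terminal p" using k kt by (simp add: admissible_iff prob_space)
  then have "optimal_value p \<le> ereal (cost p (\<lambda>\<omega>. k) (\<lambda>s \<omega>. 0))"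
    unfolding optimal_value_def using zero by (intro INF_lower2[of "(\<lambda>\<omega>. k, \<lambda>s \<omega>. 0)"]) auto
  \<comment> \<open>Bounded below by finiteness of the problem and above by the cost of the Slater
    point with control 0, the value is a real number.\<close>
  then obtain m where m: "optimal_value p = ereal m"
    using finite_problem unfolding problem_finite_def by (cases "optimal_value p") auto
  let ?c = "\<lambda>(\<xi>, u::real \<Rightarrow> 'a \<Rightarrow> real^'m1). cbeta p - expectation (\<lambda>\<omega>. calpha p \<bullet> \<xi> \<omega>)"
  let ?D = "terminal_space p (cK p) \<times> control_space p"
  obtain l where l: "0 \<le> l" "\<And>x. x \<in> ?D \<Longrightarrow> m \<le> (case x of (\<xi>, u) \<Rightarrow> cost p \<xi> u) + l * ?c x"
  proof (rule multiplier_exists[of ?D "\<lambda>(\<xi>, u). cost p \<xi> u" ?c "(\<lambda>\<omega>. k, \<lambda>s \<omega>. 0)" m])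
    show "(\<lambda>\<omega>. k, \<lambda>s \<omega>. 0) \<in> ?D" using kt zero by simp
    show "?c (\<lambda>\<omega>. k, \<lambda>s \<omega>. 0) < 0" using k by (simp add: prob_space)
    fix x assume "x \<in> ?D" "?c x \<le> 0"
    then obtain \<xi> u where x: "x = (\<xi>, u)" "\<xi> \<in> admissible_terminal p" "u \<in> control_space p" by (auto simp: admissible_iff)
    have "optimal_value p \<le> ereal (cost p \<xi> u)"
      unfolding optimal_value_def using x by (intro INF_lower2[of "(\<xi>, u)"]) auto
    then show "m \<le> (case x of (\<xi>, u) \<Rightarrow> cost p \<xi> u)" by (simp add: x m)
  next
    fix x y and t :: real assume "x \<in> ?D" "y \<in> ?D" and t: "0 \<le> t" "t \<le> 1"
    then obtain \<xi> u \<xi>' u' where x: "x = (\<xi>, u)" "\<xi> \<in> terminal_space p (cK p)" "u \<in> control_space p"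
      and y: "y = (\<xi>', u')" "\<xi>' \<in> terminal_space p (cK p)" "u' \<in> control_space p" by auto
    let ?d = "\<lambda>\<omega>. \<xi>' \<omega> - \<xi> \<omega>" and ?v = "\<lambda>s \<omega>. u' s \<omega> - u s \<omega>"
    have v: "?v \<in> control_space p" using x y by (simp add: control_space_def L2_proc_diff[OF T_nonneg(1)])
    obtain G where G: "\<And>c. cost p (\<lambda>\<omega>. \<xi> \<omega> + c *\<^sub>R ?d \<omega>) (\<lambda>s \<omega>. u s \<omega> + c *\<^sub>R ?v s \<omega>) = cost p \<xi> u + c * G + c\<^sup>2 * cost p ?d ?v"
      using cost_quadratic[OF terminal_UNIV[OF x(2)] diff_terminal[OF x(2) y(2)] x(3) v] by blast
    have Q: "0 \<le> cost p ?d ?v" by (rule cost_diff_nonneg[OF x(2) y(2) x(3) y(3)])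
    \<comment> \<open>On [0,1] a quadratic with nonnegative leading coefficient lies below its chord
      because t^2 <= t.\<close>
    have "t\<^sup>2 * cost p ?d ?v \<le> t * cost p ?d ?v" using Q t by (intro mult_right_mono) (simp_all add: power2_eq_square mult_left_le)
    then have J: "cost p (\<lambda>\<omega>. \<xi> \<omega> + t *\<^sub>R ?d \<omega>) (\<lambda>s \<omega>. u s \<omega> + t *\<^sub>R ?v s \<omega>) \<le> (1 - t) * cost p \<xi> u + t * cost p \<xi>' u'"
      using G[of t] G[of 1] by (simp add: algebra_simps)
    have "(\<lambda>s \<omega>. u s \<omega> + t *\<^sub>R ?v s \<omega>) \<in> control_space p"
      using x(3) v by (simp only: control_space_def L2_proc_add_scaleR[OF T_nonneg(1)])
    then show "\<exists>z\<in>?D. (case z of (\<xi>, u) \<Rightarrow> cost p \<xi> u) \<le> (1 - t) * (case x of (\<xi>, u) \<Rightarrow> cost p \<xi> u) + t * (case y of (\<xi>, u) \<Rightarrow> cost p \<xi> u)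
        \<and> ?c z = (1 - t) * ?c x + t * ?c y"
      using segment_terminal[OF x(2) y(2) t] J expectation_segment[OF x(2) y(2), of "calpha p" t]
      by (intro bexI[of _ "(\<lambda>\<omega>. \<xi> \<omega> + t *\<^sub>R ?d \<omega>, \<lambda>s \<omega>. u s \<omega> + t *\<^sub>R ?v s \<omega>)"]) (auto simp: x(1) y(1) algebra_simps)
  qed blast
  have "optimal_value p \<le> dual_function p l"
    unfolding dual_function_def m by (rule INF_greatest) (use l(2) in \<open>auto simp: lagrangian_def\<close>)
  then have "kt_coefficient p l"
    using weak_duality[OF l(1)] l(1) m by (auto simp: kt_coefficient_def)
  then show thesis by (rule that)
qed

end

section \<open>Necessary conditions\<close>

context lq
begin

text \<open>Measurable selection is avoided by testing with one constant at a time and letting it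
  run through a countable dense subset of \<open>K\<close>.\<close>

lemma pointwise_variational_inequality:
  assumes xi: "\<xi> \<in> terminal_space p (cK p)" and wm: "w \<in> borel_measurable (pF p TT)" and w: "sq_int (pM p) w"
    and opt: "\<And>\<xi>'. \<xi>' \<in> terminal_space p (cK p) \<Longrightarrow> 0 \<le> expectation (\<lambda>\<omega>. w \<omega> \<bullet> (\<xi>' \<omega> - \<xi> \<omega>))"
  shows "AE \<omega> in pM p. \<forall>k\<in>cK p. 0 \<le> w \<omega> \<bullet> (k - \<xi> \<omega>)"
proof -
  have x: "\<xi> \<in> borel_measurable (pF p TT)" "AE \<omega> in pM p. \<xi> \<omega> \<in> cK p" "sq_int (pM p) \<xi>" using xi by (auto simp: terminal_space_iff)
  have one: "AE \<omega> in pM p. 0 \<le> w \<omega> \<bullet> (k - \<xi> \<omega>)" if k: "k \<in> cK p" for k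
  proof -
    \<comment> \<open>The competitor switches to k exactly where the inequality fails. Its pairing
      with w is nowhere positive yet has nonnegative mean, so it vanishes almost surely.\<close>
    define \<xi>' where "\<xi>' \<omega> = (if w \<omega> \<bullet> (k - \<xi> \<omega>) < 0 then k else \<xi> \<omega>)" for \<omega>
    have m: "\<xi>' \<in> borel_measurable (pF p TT)"
    proof -
      note [measurable] = x(1) wm
      show ?thesis unfolding \<xi>'_def[abs_def] by measurable
    qed
    have d: "sq_int (pM p) (\<lambda>\<omega>. \<xi>' \<omega> - \<xi> \<omega>)"
    proof (rule sq_int_bound[where c = 1])
      show "sq_int (pM p) (\<lambda>\<omega>. k - \<xi> \<omega>)" by (intro sq_int_diff sq_int_const finite_measure_axioms x)
      show "(\<lambda>\<omega>. \<xi>' \<omega> - \<xi> \<omega>) \<in> borel_measurable (pM p)"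
        by (rule borel_measurable_diff[OF measurable_F_M[OF m] measurable_F_M[OF x(1)]])
    qed (simp add: \<xi>'_def)
    have s: "sq_int (pM p) \<xi>'" using sq_int_add[OF d x(3)] by simp
    have "\<xi>' \<in> terminal_space p (cK p)" unfolding terminal_space_iff
      using m s x(2) k by (auto simp: \<xi>'_def)
    then have "0 \<le> expectation (\<lambda>\<omega>. w \<omega> \<bullet> (\<xi>' \<omega> - \<xi> \<omega>))" by (rule opt)
    moreover have i: "integrable (pM p) (\<lambda>\<omega>. w \<omega> \<bullet> (\<xi>' \<omega> - \<xi> \<omega>))" by (rule sq_int_inner[OF w d])
    moreover have np: "w \<omega> \<bullet> (\<xi>' \<omega> - \<xi> \<omega>) \<le> 0" for \<omega> by (simp add: \<xi>'_def)
    ultimately have "expectation (\<lambda>\<omega>. - (w \<omega> \<bullet> (\<xi>' \<omega> - \<xi> \<omega>))) = 0"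
      using Bochner_Integration.integral_nonneg[of "pM p" "\<lambda>\<omega>. - (w \<omega> \<bullet> (\<xi>' \<omega> - \<xi> \<omega>))"] by simp
    then have "AE \<omega> in pM p. - (w \<omega> \<bullet> (\<xi>' \<omega> - \<xi> \<omega>)) = 0"
      using integral_nonneg_eq_0_iff_AE[of "pM p" "\<lambda>\<omega>. - (w \<omega> \<bullet> (\<xi>' \<omega> - \<xi> \<omega>))"] i np by simp
    then show ?thesis by eventually_elim (auto simp: \<xi>'_def split: if_splits)
  qed
  obtain D where D: "countable D" "D \<subseteq> cK p" "cK p \<subseteq> closure D" using separable by blast
  have "AE \<omega> in pM p. \<forall>k\<in>D. 0 \<le> w \<omega> \<bullet> (k - \<xi> \<omega>)" using one D by (subst AE_ball_countable) auto
  then show ?thesis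
  proof eventually_elim
    case (elim \<omega>)
    have "closed {k. 0 \<le> w \<omega> \<bullet> (k - \<xi> \<omega>)}" by (intro closed_Collect_le continuous_intros)
    then have "closure D \<subseteq> {k. 0 \<le> w \<omega> \<bullet> (k - \<xi> \<omega>)}" using elim by (intro closure_minimal) auto
    then show ?case using D(3) by blast
  qed
qed

text \<open>The vector in the inequality is the derivative of the Lagrangian in the terminal value,
  so the projection formula is the pointwise first-order condition over K.\<close>

lemma candidate_terminal_iff:
  "AE \<omega> in pM p. y \<omega> = candidate_terminal p l g \<omega>
    \<longleftrightarrow> y \<omega> \<in> cK p \<and> (\<forall>k\<in>cK p. 0 \<le> (cG1 p \<omega> *v y \<omega> + g TT \<omega> - l *\<^sub>R calpha p) \<bullet> (k - y \<omega>))"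
  using G1_posdef
proof eventually_elim
  case (elim \<omega>)
  have e: "cG1 p \<omega> *v y \<omega> - (- g TT \<omega> + l *\<^sub>R calpha p) = cG1 p \<omega> *v y \<omega> + g TT \<omega> - l *\<^sub>R calpha p" by simp
  show ?case unfolding candidate_terminal_def
    using weighted_proj_iff[of "cG1 p \<omega>" "cK p" "y \<omega>" "- g TT \<omega> + l *\<^sub>R calpha p"] elim K_props unfolding e by blast
qed

lemma R11_invertible: "AE z in time_prob (pM p) TT. invertible (cR11 p (fst z) (snd z))"
  using standing by (simp add: standing_assumptions_def split_beta')

lemma candidate_control_PL2: "g \<in> cont_space p \<Longrightarrow> candidate_control p g \<in> PL2"
  using R11_inv_PL2[OF mult_transpose_PL2(3)[OF cont_PL2]] by (simp add: candidate_control_def[abs_def])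

lemma candidate_drift:
  "(cB1 p s \<omega> ** matrix_inv (cR11 p s \<omega>) ** transpose (cB1 p s \<omega>)) *v g s \<omega> = cB1 p s \<omega> *v candidate_control p g s \<omega>"
  by (simp add: candidate_control_def matrix_vector_mul_assoc matrix_mul_assoc del: transpose_matrix_vector)

lemma grad_multiplier:
  assumes "sq_int (pM p) \<xi>" "sq_int (pM p) (g TT)" "sq_int (pM p) \<eta>"
  shows "grad \<xi> u g \<eta> v - l * expectation (\<lambda>\<omega>. calpha p \<bullet> \<eta> \<omega>)
    = expectation (\<lambda>\<omega>. (cG1 p \<omega> *v \<xi> \<omega> + g TT \<omega> - l *\<^sub>R calpha p) \<bullet> \<eta> \<omega>)
      + tip TT (\<lambda>s \<omega>. cR11 p s \<omega> *v u s \<omega> - transpose (cB1 p s \<omega>) *v g s \<omega>) v"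
proof -
  have "integrable (pM p) (\<lambda>\<omega>. (cG1 p \<omega> *v \<xi> \<omega> + g TT \<omega>) \<bullet> \<eta> \<omega>)" "integrable (pM p) (\<lambda>\<omega>. calpha p \<bullet> \<eta> \<omega>)"
    by (intro sq_int_inner sq_int_add G1_sq_int sq_int_const finite_measure_axioms assms)+
  then have "expectation (\<lambda>\<omega>. (cG1 p \<omega> *v \<xi> \<omega> + g TT \<omega>) \<bullet> \<eta> \<omega> - l * (calpha p \<bullet> \<eta> \<omega>))
    = expectation (\<lambda>\<omega>. (cG1 p \<omega> *v \<xi> \<omega> + g TT \<omega>) \<bullet> \<eta> \<omega>) - l * expectation (\<lambda>\<omega>. calpha p \<bullet> \<eta> \<omega>)"
    by simp
  then show ?thesis by (simp add: grad_def inner_diff_left)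
qed

text \<open>Any KT coefficient can serve as the multiplier of the system: the optimal pair minimises
  the Lagrangian over the larger set without the expectation constraint, and there terminal value
  and control vary independently.\<close>

lemma optimal_pair_necessary:
  assumes kt: "kt_coefficient p l" and opt: "optimal_pair p \<xi> u"
  obtains Y g X Z h q where "optimality_system p l Y g X Z h q" "kkt_conditions p l g"
    "AE \<omega> in pM p. \<xi> \<omega> = candidate_terminal p l g \<omega>"
    "AE (s, \<omega>) in time_prob (pM p) TT. u s \<omega> = candidate_control p g s \<omega>"
proof -
  note T = T_nonneg(1)
  have l: "0 \<le> l" "dual_function p l = ereal (cost p \<xi> u)" using kt opt by (auto simp: kt_coefficient_def optimal_pair_def)
  have adm: "\<xi> \<in> terminal_space p (cK p)" "cbeta p \<le> expectation (\<lambda>\<omega>. calpha p \<bullet> \<xi> \<omega>)" and u: "u \<in> control_space p"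
    using opt by (auto simp: optimal_pair_def admissible_iff)
  have lag: "cost p \<xi> u \<le> lagrangian p l \<xi>' u'" if "\<xi>' \<in> terminal_space p (cK p)" "u' \<in> control_space p" for \<xi>' u'
  proof -
    have "dual_function p l \<le> ereal (lagrangian p l \<xi>' u')"
      unfolding dual_function_def by (rule INF_lower2[of "(\<xi>', u')"]) (use that in auto)
    then show ?thesis by (simp add: l(2))
  qed
  \<comment> \<open>The optimal cost equals the infimum of the Lagrangian, while the Lagrangian at
    the optimal pair exceeds this cost by the present term; hence the term is also
    nonnegative.\<close>
  have "l * (cbeta p - expectation (\<lambda>\<omega>. calpha p \<bullet> \<xi> \<omega>)) \<le> 0" using adm(2) l(1) by (intro mult_nonneg_nonpos) auto
  then have slack: "l * (cbeta p - expectation (\<lambda>\<omega>. calpha p \<bullet> \<xi> \<omega>)) = 0" using lag[OF adm(1) u] by (simp add: lagrangian_def)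
  have xi: "\<xi> \<in> terminal_space p UNIV" by (rule terminal_UNIV[OF adm(1)])
  obtain Y X Z where S: "state_solution p \<xi> u Y X Z" using state_solution_exists[OF xi u] by blast
  note s = S[unfolded state_solution_def]
  obtain g h q where A: "adjoint X Z g h q" by (rule adjoint_exists[of X Z]) (use s in auto)
  note a = A[unfolded adjoint_def]
  have g: "g \<in> cont_space p" and sg: "sq_int (pM p) (g TT)" using a cont_sq_int T_nonneg by auto
  have sx: "sq_int (pM p) \<xi>" using adm by (simp add: terminal_space_iff)
  define w where "w \<omega> = cG1 p \<omega> *v \<xi> \<omega> + g TT \<omega> - l *\<^sub>R calpha p" for \<omega>
  define r where "r s \<omega> = cR11 p s \<omega> *v u s \<omega> - transpose (cB1 p s \<omega>) *v g s \<omega>" for s \<omega>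
  have r: "r \<in> PL2" using u unfolding r_def[abs_def] control_space_def by (intro PL2_intros cont_PL2 g)
  \<comment> \<open>The terminal value varies along segments inside the convex set, the control
    along arbitrary directions; the quadratic remainder disappears for small steps.\<close>
  have first_order: "0 \<le> expectation (\<lambda>\<omega>. w \<omega> \<bullet> (\<xi>' \<omega> - \<xi> \<omega>)) + tip TT r v"
    if x': "\<xi>' \<in> terminal_space p (cK p)" and v: "v \<in> PL2" for \<xi>' v
  proof -
    let ?\<eta> = "\<lambda>\<omega>. \<xi>' \<omega> - \<xi> \<omega>"
    have eta: "?\<eta> \<in> terminal_space p UNIV" by (rule diff_terminal[OF adm(1) x'])
    have vc: "v \<in> control_space p" using v by (simp add: control_space_def)
    have "0 \<le> grad \<xi> u g ?\<eta> v - l * expectation (\<lambda>\<omega>. calpha p \<bullet> ?\<eta> \<omega>)"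
    proof (rule nonneg_of_small_slopes)
      fix t :: real assume t: "0 < t" "t \<le> 1"
      have ut: "(\<lambda>s \<omega>. u s \<omega> + t *\<^sub>R v s \<omega>) \<in> control_space p"
        using u v by (simp only: control_space_def L2_proc_add_scaleR[OF T])
      have "integrable (pM p) \<xi>" "integrable (pM p) \<xi>'" using x' sx by (auto simp: terminal_space_iff intro: sq_int_integrable_finite finite_measure_axioms)
      then have E: "expectation (\<lambda>\<omega>. calpha p \<bullet> ?\<eta> \<omega>) = expectation (\<lambda>\<omega>. calpha p \<bullet> \<xi>' \<omega>) - expectation (\<lambda>\<omega>. calpha p \<bullet> \<xi> \<omega>)"
        by (simp add: inner_diff_right)
      have "cost p \<xi> u \<le> lagrangian p l (\<lambda>\<omega>. \<xi> \<omega> + t *\<^sub>R ?\<eta> \<omega>) (\<lambda>s \<omega>. u s \<omega> + t *\<^sub>R v s \<omega>)"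
        using t by (intro lag segment_terminal[OF adm(1) x'] ut) auto
      also have "\<dots> = cost p \<xi> u + t * grad \<xi> u g ?\<eta> v + t\<^sup>2 * cost p ?\<eta> v
          + (l * (cbeta p - expectation (\<lambda>\<omega>. calpha p \<bullet> \<xi> \<omega>)) - l * t * expectation (\<lambda>\<omega>. calpha p \<bullet> ?\<eta> \<omega>))"
        unfolding lagrangian_def cost_variation[OF xi eta u vc S A] expectation_segment[OF adm(1) x'] E by (simp add: algebra_simps)
      finally show "0 \<le> t * (grad \<xi> u g ?\<eta> v - l * expectation (\<lambda>\<omega>. calpha p \<bullet> ?\<eta> \<omega>)) + t\<^sup>2 * cost p ?\<eta> v"
        unfolding slack by (simp add: algebra_simps)
    qed
    then show ?thesis using eta by (simp only: grad_multiplier[where g = g, OF sx sg] w_def r_def[abs_def] terminal_space_iff)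
  qed
  have r0: "AE z in time_prob (pM p) TT. case_prod r z = 0"
  proof (rule sq_int_integral_zero_AE[OF L2_proc_sq_int[OF r T]])
    \<comment> \<open>The direction v = - r with unchanged terminal value.\<close>
    have "tip TT r r \<le> 0" using first_order[OF adm(1) L2_proc_minus[OF T r]] by (simp add: tip_minus)
    then show "(\<integral>z. (norm (case_prod r z))\<^sup>2 \<partial>time_prob (pM p) TT) = 0"
      by (intro antisym Bochner_Integration.integral_nonneg) (simp_all add: tip_def power2_norm_eq_inner)
  qed
  have control: "AE z in time_prob (pM p) TT. u (fst z) (snd z) = candidate_control p g (fst z) (snd z)"
    using r0 R11_invertible
  proof eventually_elim
    case (elim z)
    then have "transpose (cB1 p (fst z) (snd z)) *v g (fst z) (snd z) = cR11 p (fst z) (snd z) *v u (fst z) (snd z)"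
      by (simp add: r_def split_beta' del: transpose_matrix_vector)
    then show ?case unfolding candidate_control_def using matrix_inv_mult_vec(2)[OF elim(2)] by metis
  qed
  have wm: "w \<in> borel_measurable (pF p TT)"
  proof -
    have "cG1 p \<in> borel_measurable (pF p TT)" using standing by (auto simp: standing_assumptions_def Linf_rv_def)
    moreover have "\<xi> \<in> borel_measurable (pF p TT)" using adm by (simp add: terminal_space_iff)
    moreover have "g TT \<in> borel_measurable (pF p TT)" using g T_nonneg by (auto simp: cont_space_def L2_cont_def)
    ultimately show ?thesis unfolding w_def[abs_def]
      by (intro borel_measurable_diff borel_measurable_add matrix_vector_mult_measurable) auto
  qed
  have ws: "sq_int (pM p) w" unfolding w_def[abs_def]
    by (intro sq_int_diff sq_int_add G1_sq_int sx sg sq_int_const finite_measure_axioms)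
  have "AE \<omega> in pM p. \<forall>k\<in>cK p. 0 \<le> w \<omega> \<bullet> (k - \<xi> \<omega>)"
  proof (rule pointwise_variational_inequality[OF adm(1) wm ws])
    fix \<xi>' assume "\<xi>' \<in> terminal_space p (cK p)"
    from first_order[OF this L2_proc_zero[OF T]] show "0 \<le> expectation (\<lambda>\<omega>. w \<omega> \<bullet> (\<xi>' \<omega> - \<xi> \<omega>))"
      by (simp add: tip_def split_beta')
  qed
  moreover have "AE \<omega> in pM p. \<xi> \<omega> \<in> cK p" using adm by (simp add: terminal_space_iff)
  ultimately have terminal: "AE \<omega> in pM p. \<xi> \<omega> = candidate_terminal p l g \<omega>"
    using candidate_terminal_iff[of \<xi> l g] by eventually_elim (simp add: w_def)
  \<comment> \<open>The control and its formula agree only almost everywhere, so the drift of X is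
    replaced by an almost everywhere equal one.\<close>
  have "sde p X
       (\<lambda>s \<omega>. cA p s \<omega> *v X s \<omega> + (cB1 p s \<omega> ** matrix_inv (cR11 p s \<omega>) ** transpose (cB1 p s \<omega>)) *v g s \<omega>
          + feedback_matrix p s \<omega> *v Y s \<omega> + cC p s \<omega> *v Z s \<omega>) Z"
    unfolding sde_def candidate_drift
  proof (rule ito_process_drift_AE_eq[OF _ T])
    show "ito_process (pM p) (pF p) (pW p) TT X
       (\<lambda>s \<omega>. cA p s \<omega> *v X s \<omega> + cB1 p s \<omega> *v u s \<omega> + feedback_matrix p s \<omega> *v Y s \<omega> + cC p s \<omega> *v Z s \<omega>) Z"
      using s by (simp add: sde_def)
    have m: "X \<in> PL2" "Y \<in> PL2" "Z \<in> PL2" "u \<in> PL2" using s u cont_PL2 by (auto simp: control_space_def)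
    have "(\<lambda>s \<omega>. cA p s \<omega> *v X s \<omega> + cB1 p s \<omega> *v u s \<omega> + feedback_matrix p s \<omega> *v Y s \<omega> + cC p s \<omega> *v Z s \<omega>) \<in> PL2"
      "(\<lambda>s \<omega>. cA p s \<omega> *v X s \<omega> + cB1 p s \<omega> *v candidate_control p g s \<omega> + feedback_matrix p s \<omega> *v Y s \<omega> + cC p s \<omega> *v Z s \<omega>) \<in> PL2"
      by (intro PL2_intros m candidate_control_PL2 g)+
    then show "progressive (pF p) TT (\<lambda>s \<omega>. cA p s \<omega> *v X s \<omega> + cB1 p s \<omega> *v u s \<omega> + feedback_matrix p s \<omega> *v Y s \<omega> + cC p s \<omega> *v Z s \<omega>)"
      "progressive (pF p) TT (\<lambda>s \<omega>. cA p s \<omega> *v X s \<omega> + cB1 p s \<omega> *v candidate_control p g s \<omega> + feedback_matrix p s \<omega> *v Y s \<omega> + cC p s \<omega> *v Z s \<omega>)"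
      by (simp_all only: L2_proc_def mem_Collect_eq)
  qed (use control in \<open>eventually_elim; simp\<close>)
  moreover have "AE \<omega> in pM p. X TT \<omega> = candidate_terminal p l g \<omega>"
  proof -
    have "AE \<omega> in pM p. X TT \<omega> = \<xi> \<omega>" using s by simp
    then show ?thesis using terminal by eventually_elim simp
  qed
  ultimately have sys: "optimality_system p l Y g X Z h q" using s a by (simp only: optimality_system_def simp_thms)
  \<comment> \<open>The projection formula contains choice terms; its measurability is inherited
    from xi through completeness.\<close>
  have "(\<lambda>\<omega>. candidate_terminal p l g \<omega>) \<in> borel_measurable (pM p)"
    using measurable_M_AE[OF sq_int_measurable[OF sx] terminal] .
  then have "expectation (\<lambda>\<omega>. calpha p \<bullet> candidate_terminal p l g \<omega>) = expectation (\<lambda>\<omega>. calpha p \<bullet> \<xi> \<omega>)"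
    by (intro integral_cong_AE borel_measurable_inner borel_measurable_const sq_int_measurable[OF sx]) (use terminal in \<open>auto elim: eventually_mono\<close>)
  then have "kkt_conditions p l g" using slack l(1) adm(2) by (simp add: kkt_conditions_def)
  with sys terminal control show thesis by (intro that) (simp_all add: split_beta')
qed

end

section \<open>Sufficiency of the optimality system\<close>

context convex_lq
begin

lemma optimality_system_sufficient:
  assumes sys: "optimality_system p l Y g X Z h q" and kkt: "kkt_conditions p l g"
  shows "kt_coefficient p l \<and> optimal_pair p (candidate_terminal p l g) (candidate_control p g)"
proof -
  note T = T_nonneg(1)
  let ?\<xi> = "candidate_terminal p l g" and ?u = "candidate_control p g"
  note o = sys[unfolded optimality_system_def]
  have g: "g \<in> cont_space p" and X: "X \<in> cont_space p" and XT: "AE \<omega> in pM p. X TT \<omega> = ?\<xi> \<omega>" using o by auto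
  have A: "adjoint X Z g h q" using o by (simp only: adjoint_def simp_thms)
  have S: "state_solution p ?\<xi> ?u Y X Z" using o by (simp only: state_solution_def candidate_drift simp_thms)
  have u: "?u \<in> control_space p" using candidate_control_PL2[OF g] by (simp add: control_space_def)
  have char: "AE \<omega> in pM p. ?\<xi> \<omega> \<in> cK p \<and> (\<forall>k\<in>cK p. 0 \<le> (cG1 p \<omega> *v ?\<xi> \<omega> + g TT \<omega> - l *\<^sub>R calpha p) \<bullet> (k - ?\<xi> \<omega>))"
    using candidate_terminal_iff[of ?\<xi> l g] by eventually_elim blast
  have xi: "?\<xi> \<in> terminal_space p (cK p)" unfolding terminal_space_iff
  proof (intro conjI)
    have "X TT \<in> borel_measurable (pF p TT)" using X T_nonneg by (auto simp: cont_space_def L2_cont_def)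
    then show m: "?\<xi> \<in> borel_measurable (pF p TT)" by (rule measurable_F_AE[OF _ XT])
    show "AE \<omega> in pM p. ?\<xi> \<omega> \<in> cK p" using char by eventually_elim blast
    show "sq_int (pM p) ?\<xi>"
      by (rule sq_int_bound[OF cont_sq_int[OF X T_nonneg(3)] measurable_F_M[OF m], where c = 1])
        (use XT in \<open>eventually_elim; simp\<close>)
  qed
  have sx: "sq_int (pM p) ?\<xi>" and sg: "sq_int (pM p) (g TT)" using xi cont_sq_int[OF g T_nonneg(3)] by (auto simp: terminal_space_iff)
  \<comment> \<open>With this control the derivative in u vanishes identically, since
    \<open>cR11\<close> is invertible almost everywhere.\<close>
  have r0: "tip TT (\<lambda>s \<omega>. cR11 p s \<omega> *v ?u s \<omega> - transpose (cB1 p s \<omega>) *v g s \<omega>) v = 0" if v: "v \<in> PL2" for v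
  proof -
    have "tip TT (\<lambda>s \<omega>. cR11 p s \<omega> *v ?u s \<omega> - transpose (cB1 p s \<omega>) *v g s \<omega>) v = tip TT (\<lambda>s \<omega>. 0) v"
    proof (rule tip_cong_AE[OF T])
      show "AE z in time_prob (pM p) TT. (case z of (s, \<omega>) \<Rightarrow> cR11 p s \<omega> *v ?u s \<omega> - transpose (cB1 p s \<omega>) *v g s \<omega>) = (case z of (s, \<omega>) \<Rightarrow> 0)"
        using R11_invertible by eventually_elim (simp add: candidate_control_def split_beta' matrix_inv_mult_vec del: transpose_matrix_vector)
      show "(\<lambda>s \<omega>. cR11 p s \<omega> *v ?u s \<omega> - transpose (cB1 p s \<omega>) *v g s \<omega>) \<in> PL2"
        by (intro PL2_intros cont_PL2 g candidate_control_PL2)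
    qed (simp_all add: v L2_proc_zero[OF T])
    then show ?thesis by (simp add: tip_def split_beta')
  qed
  have slack: "l * (cbeta p - expectation (\<lambda>\<omega>. calpha p \<bullet> ?\<xi> \<omega>)) = 0" and l: "0 \<le> l" and feas: "cbeta p \<le> expectation (\<lambda>\<omega>. calpha p \<bullet> ?\<xi> \<omega>)"
    using kkt by (auto simp: kkt_conditions_def)
  have lag: "cost p ?\<xi> ?u \<le> lagrangian p l \<xi>' u'" if x': "\<xi>' \<in> terminal_space p (cK p)" and u': "u' \<in> control_space p" for \<xi>' u'
  proof -
    let ?\<eta> = "\<lambda>\<omega>. \<xi>' \<omega> - ?\<xi> \<omega>" and ?v = "\<lambda>s \<omega>. u' s \<omega> - ?u s \<omega>"
    have eta: "?\<eta> \<in> terminal_space p UNIV" by (rule diff_terminal[OF xi x'])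
    have se: "sq_int (pM p) ?\<eta>" using eta by (simp add: terminal_space_iff)
    have v: "?v \<in> PL2" using u u' L2_proc_diff[OF T] by (simp add: control_space_def)
    have vc: "?v \<in> control_space p" using v by (simp add: control_space_def)
    have "AE \<omega> in pM p. 0 \<le> (cG1 p \<omega> *v ?\<xi> \<omega> + g TT \<omega> - l *\<^sub>R calpha p) \<bullet> ?\<eta> \<omega>"
    proof -
      have "AE \<omega> in pM p. \<xi>' \<omega> \<in> cK p" using x' by (simp add: terminal_space_iff)
      then show ?thesis using char by eventually_elim blast
    qed
    then have "0 \<le> expectation (\<lambda>\<omega>. (cG1 p \<omega> *v ?\<xi> \<omega> + g TT \<omega> - l *\<^sub>R calpha p) \<bullet> ?\<eta> \<omega>)" by (rule integral_nonneg_AE)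
    then have G: "0 \<le> grad ?\<xi> ?u g ?\<eta> ?v - l * expectation (\<lambda>\<omega>. calpha p \<bullet> ?\<eta> \<omega>)"
      unfolding grad_multiplier[where g = g, OF sx sg se] r0[OF v] by simp
    have "integrable (pM p) ?\<xi>" "integrable (pM p) \<xi>'" using x' sx by (auto simp: terminal_space_iff intro: sq_int_integrable_finite finite_measure_axioms)
    then have E: "expectation (\<lambda>\<omega>. calpha p \<bullet> ?\<eta> \<omega>) = expectation (\<lambda>\<omega>. calpha p \<bullet> \<xi>' \<omega>) - expectation (\<lambda>\<omega>. calpha p \<bullet> ?\<xi> \<omega>)"
      by (simp add: inner_diff_right)
    \<comment> \<open>The whole step from the candidate to the competitor is taken at once.\<close>
    have "cost p \<xi>' u' = cost p ?\<xi> ?u + grad ?\<xi> ?u g ?\<eta> ?v + cost p ?\<eta> ?v"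
      using cost_variation[OF terminal_UNIV[OF xi] eta u vc S A, of 1] by simp
    moreover have "0 \<le> cost p ?\<eta> ?v" by (rule cost_diff_nonneg[OF xi x' u u'])
    ultimately show ?thesis using G slack unfolding lagrangian_def E right_diff_distrib by linarith
  qed
  have adm: "?\<xi> \<in> admissible_terminal p" using xi feas by (simp add: admissible_iff)
  \<comment> \<open>Three inequalities close a cycle between the cost of the candidate, the dual
    value and the optimal value; all three are therefore equal, which yields the KT coefficient and
    optimality together.\<close>
  have "ereal (cost p ?\<xi> ?u) \<le> dual_function p l"
    unfolding dual_function_def by (rule INF_greatest) (use lag in auto)
  moreover have "dual_function p l \<le> optimal_value p" by (rule weak_duality[OF l])
  moreover have "optimal_value p \<le> ereal (cost p ?\<xi> ?u)"
    unfolding optimal_value_def using adm u by (intro INF_lower2[of "(?\<xi>, ?u)"]) auto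
  ultimately have "dual_function p l = ereal (cost p ?\<xi> ?u)" "optimal_value p = ereal (cost p ?\<xi> ?u)" by auto
  then show ?thesis using l adm u by (simp add: kt_coefficient_def optimal_pair_def)
qed

end

theorem theorem4p2:
  fixes p :: "('a, 'n::finite, 'm1::finite, 'm2::finite) lq_problem"
  assumes "standing_assumptions p"
    and "- support_fun (cK p) (- calpha p) < ereal (cbeta p)"
    and "ereal (cbeta p) < support_fun (cK p) (calpha p)"
    and "problem_convex p"
    and "problem_finite p"
  shows "kt_admissible p \<and>
    (problem_solvable p \<longleftrightarrow>
       (\<exists>l Y g X Z h q. optimality_system p l Y g X Z h q \<and> kkt_conditions p l g)) \<and>
    (\<forall>\<xi> u. optimal_pair p \<xi> u \<longrightarrow>
       (\<exists>l Y g X Z h q. optimality_system p l Y g X Z h q \<and> kkt_conditions p l g \<and>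
          (AE \<omega> in pM p. \<xi> \<omega> = candidate_terminal p l g \<omega>) \<and>
          (AE (s, \<omega>) in time_prob (pM p) (pT p). u s \<omega> = candidate_control p g s \<omega>))) \<and>
    (\<forall>l Y g X Z h q. optimality_system p l Y g X Z h q \<and> kkt_conditions p l g \<longrightarrow>
       kt_coefficient p l \<and>
       optimal_pair p (candidate_terminal p l g) (candidate_control p g))"
proof -
  interpret convex_lq p by unfold_locales (use assms in auto)
  obtain l where l: "kt_coefficient p l" by (rule kt_coefficient_exists)
  \<comment> \<open>A single KT coefficient, chosen beforehand, serves every optimal pair.\<close>
  have necessary: "\<exists>l Y g X Z h q. optimality_system p l Y g X Z h q \<and> kkt_conditions p l g \<and>
          (AE \<omega> in pM p. \<xi> \<omega> = candidate_terminal p l g \<omega>) \<and>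
          (AE (s, \<omega>) in time_prob (pM p) (pT p). u s \<omega> = candidate_control p g s \<omega>)"
    if opt: "optimal_pair p \<xi> u" for \<xi> u
    by (rule optimal_pair_necessary[OF l opt]) blast
  then have "problem_solvable p \<longleftrightarrow> (\<exists>l Y g X Z h q. optimality_system p l Y g X Z h q \<and> kkt_conditions p l g)"
    using optimality_system_sufficient unfolding problem_solvable_def by meson
  then show ?thesis using l necessary optimality_system_sufficient unfolding kt_admissible_def by blast
qed

end
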